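(* Let $\mathcal{G}$ be a connected metric graph satisfying the finite ball condition and let $V\in L^1_{\mathrm{loc}}(\mathcal{G})$ with $V\ge 0$ almost everywhere. Then for any integer $k\ge 1$, $$\mathcal{L}_k^D(\mathcal{G})\le \Sigma(\mathcal{G}),$$ where $\mathcal{L}_k^D(\mathcal{G})$ is the infimal energy over all $k$-partitions of $\mathcal{G}$ and $\Sigma(\mathcal{G})$ is the infimum of the essential spectrum of the Schrödinger operator $-\Delta+V$ on $\mathcal{G}$ (with standard vertex conditions).
   Context: **Graphs.** A metric graph $\mathcal{G}=(\mathcal{V},\mathcal{E})$ has a countable (possibly finite) vertex set $\mathcal{V}$ and a countable (possibly finite) edge set $\mathcal{E}$ (loops and multiple edges allowed), each edge $e$ being identified with a compact interval $[0,\ell_e]$ or a half-line $[0,\infty)$; $\mathcal{G}$ carries the canonical path metric $\mathrm{dist}_{\mathcal{G}}$ and the edgewise Lebesgue measure. Degree-two ("dummy") vertices may be inserted at will without changing $\mathcal{G}$. Finite ball condition: every ball of finite radius in $\mathcal{G}$ intersects only finitely many edges. $V\in L^1_{\mathrm{loc}}(\mathcal{G})$ means that $V$ is integrable on every ball of finite radius. **Subgraphs.** A subgraph $\mathcal{H}$ of $\mathcal{G}$ is a closed subset of $\mathcal{G}$ with finitely many connected components ($\mathcal{H}=\mathcal{G}$ allowed). $\partial\mathcal{H}$ denotes its topological boundary in the metric space $\mathcal{G}$; without loss of generality the points of $\partial\mathcal{H}$ are (possibly dummy) vertices. **Function spaces and operators.** Functions are real-valued. $H^1(\mathcal{G})$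 is the space of continuous, edgewise weakly differentiable $u\in L^2(\mathcal{G})$ with $\int_{\mathcal{G}}|u'|^2+V|u|^2\,dx<\infty$, and $H^1_0(\mathcal{H})=\{u\in H^1(\mathcal{G}):\operatorname{supp}u\subset\mathcal{H}\}$ (equivalently, $H^1$-functions on $\mathcal{H}$ vanishing on $\partial\mathcal{H}$, extended by zero). In particular $H^1_0(\mathcal{G})=H^1(\mathcal{G})$. $A_{\mathcal{H}}=-\Delta+V|_{\mathcal{H}}$ is the self-adjoint operator on $L^2(\mathcal{H})$ associated with the form $a_{\mathcal{H}}(f,g)=\int_{\mathcal{H}}f'g'+Vfg\,dx$, $f,g\in H^1_0(\mathcal{H})$, i.e. with Dirichlet conditions on $\partial\mathcal{H}$ and standard (continuity plus Kirchhoff) conditions at all other vertices. **Spectral quantities.** $\lambda(\mathcal{H})$ is the infimum of the spectrum of $A_{\mathcal{H}}$, equivalently the infimum of $a_{\mathcal{H}}(f,f)/\|f\|_{L^2}^2$ over $0\ne f\in H^1_0(\mathcal{H})$ (with $\inf\emptyset=+\infty$). $\Sigma(\mathcal{H})\in\mathbb{R}\cup\{\infty\}$ is the infimum of the essential spectrum of $A_{\mathcal{H}}$ ($=\infty$ if it is empty). **Partitions.** A $k$-partition of $\mathcal{G}$ is a collection $\mathcal{P}=(\mathcal{G}_1,\ldots,\mathcal{G}_k)$ of $k$ connected subgraphs with $\mathcal{G}_i\cap\mathcal{G}_j\subset\partial\mathcal{G}_i\cap\partial\mathcal{G}_j$ for all $i\neq j$. The $\mathcal{G}_i$ may be bounded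 or unbounded and need not cover $\mathcal{G}$. Its energy is $\Lambda_k(\mathcal{P})=\max\{\lambda(\mathcal{G}_1),\ldots,\lambda(\mathcal{G}_k)\}$, and $\mathcal{L}_k^D(\mathcal{G})=\inf\{\Lambda_k(\mathcal{P}):\mathcal{P}\text{ a }k\text{-partition of }\mathcal{G}\}$. *)

theory Defs
  imports "HOL-Analysis.Analysis"
begin

section \<open>Metric graphs\<close>

text \<open>
  An edge \<open>e\<close> is parametrised by \<open>[0, elen G e]\<close>, or by \<open>[0, \<infinity>)\<close> if \<open>elen G e = \<infinity>\<close>; the parameter
  \<open>0\<close> is glued to \<open>src G e\<close> and, for a finite edge only, the parameter \<open>elen G e\<close> to \<open>tgt G e\<close>
  (the value of \<open>tgt\<close> on a half-line is irrelevant). Loops and multiple edges are allowed.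
\<close>

record ('v, 'e) mgraph =
  verts :: "'v set"
  edges :: "'e set"
  elen :: "'e \<Rightarrow> ereal"
  src :: "'e \<Rightarrow> 'v"
  tgt :: "'e \<Rightarrow> 'v"

definition metric_graph :: "('v, 'e) mgraph \<Rightarrow> bool" where
  "metric_graph G \<longleftrightarrow> countable (verts G) \<and> countable (edges G) \<and>
     (\<forall>e\<in>edges G. 0 < elen G e \<and> src G e \<in> verts G \<and>
        (elen G e < \<infinity> \<longrightarrow> tgt G e \<in> verts G))"

text \<open>
  The quotient of the disjoint union of the edges is encoded by unique representatives:
  a point is a vertex, or an interior point of an edge given by its parameter.
\<close>

datatype ('v, 'e) gpoint = Vert 'v | EPt 'e real

definition edge_dom :: "('v, 'e) mgraph \<Rightarrow> 'e \<Rightarrow> real set" where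
  "edge_dom G e = {t. 0 \<le> t \<and> ereal t \<le> elen G e}"

definition edge_int :: "('v, 'e) mgraph \<Rightarrow> 'e \<Rightarrow> real set" where
  "edge_int G e = {t. 0 < t \<and> ereal t < elen G e}"

definition pt :: "('v, 'e) mgraph \<Rightarrow> 'e \<Rightarrow> real \<Rightarrow> ('v, 'e) gpoint" where
  "pt G e t = (if t = 0 then Vert (src G e)
               else if ereal t = elen G e then Vert (tgt G e) else EPt e t)"

definition points :: "('v, 'e) mgraph \<Rightarrow> ('v, 'e) gpoint set" where
  "points G = Vert ` verts G \<union> {EPt e t | e t. e \<in> edges G \<and> t \<in> edge_int G e}"

definition edge_set :: "('v, 'e) mgraph \<Rightarrow> 'e \<Rightarrow> ('v, 'e) gpoint set" where
  "edge_set G e = pt G e ` edge_dom G e"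

text \<open>\<open>walk G x y r\<close>: there is a path of length \<open>r\<close> from \<open>x\<close> to \<open>y\<close>, composed of finitely many
  segments each of which runs inside one edge.\<close>

inductive walk :: "('v, 'e) mgraph \<Rightarrow> ('v, 'e) gpoint \<Rightarrow> ('v, 'e) gpoint \<Rightarrow> real \<Rightarrow> bool"
  for G :: "('v, 'e) mgraph" where
  walk_refl: "x \<in> points G \<Longrightarrow> walk G x x 0"
| walk_step: "e \<in> edges G \<Longrightarrow> s \<in> edge_dom G e \<Longrightarrow> t \<in> edge_dom G e \<Longrightarrow> walk G (pt G e t) y r
    \<Longrightarrow> walk G (pt G e s) y (\<bar>s - t\<bar> + r)"

definition graph_connected :: "('v, 'e) mgraph \<Rightarrow> bool" where
  "graph_connected G \<longleftrightarrow> (\<forall>x\<in>points G. \<forall>y\<in>points G. \<exists>r. walk G x y r)"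

text \<open>The path metric of a connected \<open>G\<close>. The value \<open>0\<close> is for pairs outside \<open>points G\<close> only.\<close>

definition gdist :: "('v, 'e) mgraph \<Rightarrow> ('v, 'e) gpoint \<Rightarrow> ('v, 'e) gpoint \<Rightarrow> real" where
  "gdist G x y = (if \<exists>r. walk G x y r then Inf {r. walk G x y r} else 0)"

definition gball :: "('v, 'e) mgraph \<Rightarrow> ('v, 'e) gpoint \<Rightarrow> real \<Rightarrow> ('v, 'e) gpoint set" where
  "gball G x r = {y \<in> points G. gdist G x y < r}"

abbreviation gtop :: "('v, 'e) mgraph \<Rightarrow> ('v, 'e) gpoint topology" where
  "gtop G \<equiv> Metric_space.mtopology (points G) (gdist G)"

definition finite_ball_condition :: "('v, 'e) mgraph \<Rightarrow> bool" where
  "finite_ball_condition G \<longleftrightarrow>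
     (\<forall>x\<in>points G. \<forall>r. finite {e \<in> edges G. edge_set G e \<inter> gball G x r \<noteq> {}})"

text \<open>Edgewise Lebesgue measure; vertices are null sets.\<close>

definition graph_measure :: "('v, 'e) mgraph \<Rightarrow> ('v, 'e) gpoint measure" where
  "graph_measure G = measure_of (points G)
     {A. A \<subseteq> points G \<and> (\<forall>e\<in>edges G. {t \<in> edge_int G e. EPt e t \<in> A} \<in> sets lebesgue)}
     (\<lambda>A. \<integral>\<^sup>+ e. emeasure lebesgue {t \<in> edge_int G e. EPt e t \<in> A} \<partial>count_space (edges G))"

definition locally_L1 :: "('v, 'e) mgraph \<Rightarrow> (('v, 'e) gpoint \<Rightarrow> real) \<Rightarrow> bool" where
  "locally_L1 G V \<longleftrightarrow> (\<forall>x\<in>points G. \<forall>r. set_integrable (graph_measure G) (gball G x r) V)"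


section \<open>Linear operators on real L2 spaces\<close>

text \<open>
  Elements of \<open>L\<^sup>2(M)\<close> are represented by functions, two of them being identified if they agree
  almost everywhere. An operator is given by its graph, a set of pairs of representatives; all
  notions below are insensitive to the choice of representatives.
\<close>

type_synonym 'a operator = "(('a \<Rightarrow> real) \<times> ('a \<Rightarrow> real)) set"

definition L2 :: "'a measure \<Rightarrow> ('a \<Rightarrow> real) set" where
  "L2 M = {f \<in> borel_measurable M. integrable M (\<lambda>x. (f x)\<^sup>2)}"

definition L2_norm :: "'a measure \<Rightarrow> ('a \<Rightarrow> real) \<Rightarrow> real" where
  "L2_norm M f = sqrt (LINT x|M. (f x)\<^sup>2)"

text \<open>\<open>A - \<mu>\<close> is a bijection from its domain onto \<open>L\<^sup>2(M)\<close> with bounded inverse: it is onto, and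
  the estimate expresses both injectivity and boundedness of the inverse. For self-adjoint \<open>A\<close>
  the spectrum is real, so only real \<open>\<mu>\<close> are considered.\<close>

definition resolvent_set :: "'a measure \<Rightarrow> 'a operator \<Rightarrow> real set" where
  "resolvent_set M A = {\<mu>.
     (\<forall>g\<in>L2 M. \<exists>(f, h)\<in>A. AE x in M. h x - \<mu> * f x = g x) \<and>
     (\<exists>C. \<forall>(f, h)\<in>A. L2_norm M f \<le> C * L2_norm M (\<lambda>x. h x - \<mu> * f x))}"

definition spectrum_of :: "'a measure \<Rightarrow> 'a operator \<Rightarrow> real set" where
  "spectrum_of M A = - resolvent_set M A"

definition eigenspace :: "'a measure \<Rightarrow> 'a operator \<Rightarrow> real \<Rightarrow> ('a \<Rightarrow> real) set" where
  "eigenspace M A \<mu> = {f. \<exists>h. (f, h) \<in> A \<and> (AE x in M. h x = \<mu> * f x)}"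

definition is_eigenvalue :: "'a measure \<Rightarrow> 'a operator \<Rightarrow> real \<Rightarrow> bool" where
  "is_eigenvalue M A \<mu> \<longleftrightarrow> (\<exists>f\<in>eigenspace M A \<mu>. \<not> (AE x in M. f x = 0))"

definition finite_multiplicity :: "'a measure \<Rightarrow> 'a operator \<Rightarrow> real \<Rightarrow> bool" where
  "finite_multiplicity M A \<mu> \<longleftrightarrow>
     (\<exists>B. finite B \<and> B \<subseteq> eigenspace M A \<mu> \<and>
        (\<forall>f\<in>eigenspace M A \<mu>. \<exists>c. AE x in M. f x = (\<Sum>b\<in>B. c b * b x)))"

definition discrete_spectrum :: "'a measure \<Rightarrow> 'a operator \<Rightarrow> real set" where
  "discrete_spectrum M A =
     {\<mu>. \<mu> isolated_in spectrum_of M A \<and> is_eigenvalue M A \<mu> \<and> finite_multiplicity M A \<mu>}"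

definition essential_spectrum :: "'a measure \<Rightarrow> 'a operator \<Rightarrow> real set" where
  "essential_spectrum M A = spectrum_of M A - discrete_spectrum M A"


section \<open>Sobolev spaces and Schroedinger operators on metric graphs\<close>

definition test_function :: "('v, 'e) mgraph \<Rightarrow> 'e \<Rightarrow> (real \<Rightarrow> real) \<Rightarrow> bool" where
  "test_function G e \<phi> \<longleftrightarrow>
     (\<forall>n x. (deriv ^^ n) \<phi> field_differentiable (at x)) \<and>
     (\<exists>K. compact K \<and> K \<subseteq> edge_int G e \<and> (\<forall>t. t \<notin> K \<longrightarrow> \<phi> t = 0))"

text \<open>\<open>w\<close> is an edgewise weak derivative of \<open>u\<close>; its values at the vertices are arbitrary.\<close>

definition weak_deriv ::
  "('v, 'e) mgraph \<Rightarrow> (('v, 'e) gpoint \<Rightarrow> real) \<Rightarrow> (('v, 'e) gpoint \<Rightarrow> real) \<Rightarrow> bool" where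
  "weak_deriv G u w \<longleftrightarrow> (\<forall>e\<in>edges G.
     (\<forall>K. compact K \<and> K \<subseteq> edge_int G e \<longrightarrow>
        set_integrable lebesgue K (\<lambda>t. u (EPt e t)) \<and>
        set_integrable lebesgue K (\<lambda>t. w (EPt e t))) \<and>
     (\<forall>\<phi>. test_function G e \<phi> \<longrightarrow>
        (LINT t:edge_int G e|lebesgue. u (EPt e t) * deriv \<phi> t) =
        - (LINT t:edge_int G e|lebesgue. w (EPt e t) * \<phi> t)))"

definition gderiv :: "('v, 'e) mgraph \<Rightarrow> (('v, 'e) gpoint \<Rightarrow> real) \<Rightarrow> ('v, 'e) gpoint \<Rightarrow> real" where
  "gderiv G u = (SOME w. weak_deriv G u w)"

text \<open>As potentials are nonnegative, finiteness of the energy is integrability of its density.\<close>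

definition H1 ::
  "('v, 'e) mgraph \<Rightarrow> (('v, 'e) gpoint \<Rightarrow> real) \<Rightarrow> (('v, 'e) gpoint \<Rightarrow> real) set" where
  "H1 G V = {u. continuous_map (gtop G) euclideanreal u \<and> (\<exists>w. weak_deriv G u w) \<and>
     u \<in> L2 (graph_measure G) \<and>
     integrable (graph_measure G) (\<lambda>x. (gderiv G u x)\<^sup>2 + V x * (u x)\<^sup>2)}"

definition supp :: "('v, 'e) mgraph \<Rightarrow> (('v, 'e) gpoint \<Rightarrow> real) \<Rightarrow> ('v, 'e) gpoint set" where
  "supp G u = gtop G closure_of {x \<in> points G. u x \<noteq> 0}"

definition H10 :: "('v, 'e) mgraph \<Rightarrow> (('v, 'e) gpoint \<Rightarrow> real) \<Rightarrow> ('v, 'e) gpoint set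
    \<Rightarrow> (('v, 'e) gpoint \<Rightarrow> real) set" where
  "H10 G V H = {u \<in> H1 G V. supp G u \<subseteq> H}"

abbreviation measure_on :: "('v, 'e) mgraph \<Rightarrow> ('v, 'e) gpoint set \<Rightarrow> ('v, 'e) gpoint measure" where
  "measure_on G H \<equiv> restrict_space (graph_measure G) H"

definition form :: "('v, 'e) mgraph \<Rightarrow> (('v, 'e) gpoint \<Rightarrow> real) \<Rightarrow> ('v, 'e) gpoint set
    \<Rightarrow> (('v, 'e) gpoint \<Rightarrow> real) \<Rightarrow> (('v, 'e) gpoint \<Rightarrow> real) \<Rightarrow> real" where
  "form G V H f g = (LINT x|measure_on G H. gderiv G f x * gderiv G g x + V x * f x * g x)"

text \<open>The operator on \<open>L\<^sup>2(H)\<close> associated with the form \<open>form G V H\<close> with domain \<open>H10 G V H\<close>.\<close>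

definition schroedinger :: "('v, 'e) mgraph \<Rightarrow> (('v, 'e) gpoint \<Rightarrow> real) \<Rightarrow> ('v, 'e) gpoint set
    \<Rightarrow> ('v, 'e) gpoint operator" where
  "schroedinger G V H = {(f, h). f \<in> H10 G V H \<and> h \<in> L2 (measure_on G H) \<and>
     (\<forall>g\<in>H10 G V H. form G V H f g = (LINT x|measure_on G H. h x * g x))}"

definition spec_bottom :: "('v, 'e) mgraph \<Rightarrow> (('v, 'e) gpoint \<Rightarrow> real) \<Rightarrow> ('v, 'e) gpoint set
    \<Rightarrow> ereal" where
  "spec_bottom G V H = Inf (ereal ` spectrum_of (measure_on G H) (schroedinger G V H))"

definition ess_bottom :: "('v, 'e) mgraph \<Rightarrow> (('v, 'e) gpoint \<Rightarrow> real) \<Rightarrow> ('v, 'e) gpoint set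
    \<Rightarrow> ereal" where
  "ess_bottom G V H = Inf (ereal ` essential_spectrum (measure_on G H) (schroedinger G V H))"


section \<open>Partitions\<close>

definition subgraph :: "('v, 'e) mgraph \<Rightarrow> ('v, 'e) gpoint set \<Rightarrow> bool" where
  "subgraph G H \<longleftrightarrow>
     closedin (gtop G) H \<and> finite (connected_components_of (subtopology (gtop G) H))"

definition k_partition :: "('v, 'e) mgraph \<Rightarrow> nat \<Rightarrow> ('v, 'e) gpoint set list \<Rightarrow> bool" where
  "k_partition G k P \<longleftrightarrow> length P = k \<and>
     (\<forall>H\<in>set P. subgraph G H \<and> H \<noteq> {} \<and> connectedin (gtop G) H) \<and>
     (\<forall>i<k. \<forall>j<k. i \<noteq> j \<longrightarrow>
        P ! i \<inter> P ! j \<subseteq> (gtop G frontier_of (P ! i)) \<inter> (gtop G frontier_of (P ! j)))"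

definition energy :: "('v, 'e) mgraph \<Rightarrow> (('v, 'e) gpoint \<Rightarrow> real) \<Rightarrow> ('v, 'e) gpoint set list
    \<Rightarrow> ereal" where
  "energy G V P = Max (spec_bottom G V ` set P)"

definition min_energy :: "('v, 'e) mgraph \<Rightarrow> (('v, 'e) gpoint \<Rightarrow> real) \<Rightarrow> nat \<Rightarrow> ereal" where
  "min_energy G V k = Inf {energy G V P | P. k_partition G k P}"


section \<open>Well-definedness of the metric and the measure\<close>

lemma pt_in_points:
  "metric_graph G \<Longrightarrow> e \<in> edges G \<Longrightarrow> t \<in> edge_dom G e \<Longrightarrow> pt G e t \<in> points G"
  by (cases "elen G e") (auto simp: metric_graph_def edge_dom_def edge_int_def pt_def points_def)

lemma walk_nonneg: "walk G x y r \<Longrightarrow> 0 \<le> r"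
  by (induction rule: walk.induct) auto

lemma walk_trans: "walk G x y r \<Longrightarrow> walk G y z s \<Longrightarrow> walk G x z (r + s)"
  by (induction rule: walk.induct) (auto simp: add.assoc intro: walk_step)

lemma walk_sym: 
  assumes "metric_graph G" "walk G x y r" shows "walk G y x r"
  using assms(2)
proof (induction rule: walk.induct)
  case (walk_step e s t y r)
  have "walk G (pt G e t) (pt G e s) (\<bar>t - s\<bar> + 0)"
    using assms walk_step by (intro walk.walk_step walk_refl pt_in_points)
  from walk_trans[OF walk_step.IH this] show ?case
    by (simp add: abs_minus_commute add.commute)
qed (rule walk_refl)

lemma walk_lipschitz:
  fixes f :: "('v, 'e) gpoint \<Rightarrow> real"
  assumes "walk G x y r"
    and "\<And>e s t. e \<in> edges G \<Longrightarrow> s \<in> edge_dom G e \<Longrightarrow> t \<in> edge_dom G e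
           \<Longrightarrow> \<bar>f (pt G e s) - f (pt G e t)\<bar> \<le> \<bar>s - t\<bar>"
  shows "\<bar>f x - f y\<bar> \<le> r"
  using assms(1)
proof (induction rule: walk.induct)
  case (walk_step e s t y r)
  then show ?case using assms(2)[of e s t] by linarith
qed auto

lemma bdd_below_walk: "bdd_below {r. walk G x y r}"
  by (rule bdd_belowI[of _ 0]) (auto dest: walk_nonneg)

lemma gdist_le: "walk G x y r \<Longrightarrow> gdist G x y \<le> r"
  unfolding gdist_def by (auto intro!: cInf_lower bdd_below_walk)

lemma gdist_ge: "walk G x y r \<Longrightarrow> (\<And>r. walk G x y r \<Longrightarrow> c \<le> r) \<Longrightarrow> c \<le> gdist G x y"
  unfolding gdist_def by (auto intro!: cInf_greatest)

lemma gdist_nonneg: "0 \<le> gdist G x y"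
proof (cases "\<exists>r. walk G x y r")
  case True
  then show ?thesis by (auto intro: gdist_ge walk_nonneg)
qed (simp add: gdist_def)

lemma gdist_refl: "x \<in> points G \<Longrightarrow> gdist G x x = 0"
  using gdist_le[OF walk_refl, of x G] gdist_nonneg[of G x x] by simp

lemma gdist_pos:
  assumes G: "metric_graph G" "graph_connected G" "finite_ball_condition G"
    and x: "x \<in> points G" and y: "y \<in> points G" and "x \<noteq> y"
  shows "0 < gdist G x y"
proof -
  obtain r0 where r0: "walk G x y r0"
    using G(2) x y by (auto simp: graph_connected_def)
  have *: ?thesis if f: "\<And>e s t. e \<in> edges G \<Longrightarrow> s \<in> edge_dom G e \<Longrightarrow> t \<in> edge_dom G e
           \<Longrightarrow> \<bar>f (pt G e s) - f (pt G e t)\<bar> \<le> \<bar>s - t\<bar>" and "f x = 0" "f y > 0"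
       for f :: "('a, 'b) gpoint \<Rightarrow> real"
  proof -
    have "f y \<le> gdist G x y"
    proof (rule gdist_ge[OF r0])
      show "f y \<le> r" if "walk G x y r" for r
        using walk_lipschitz[OF that, of f] f \<open>f x = 0\<close> by force
    qed
    with \<open>f y > 0\<close> show ?thesis by simp
  qed
  show ?thesis
  proof (cases x)
    case (EPt e0 t0)
    have e0: "e0 \<in> edges G" "0 < t0" "ereal t0 < elen G e0"
      using x EPt by (auto simp: points_def edge_int_def)
    obtain d where d: "0 < d" "d \<le> t0" "ereal (t0 + d) \<le> elen G e0"
    proof (cases "elen G e0")
      case (real l)
      then show ?thesis using that[of "min t0 (l - t0)"] e0 by (auto simp: min_def split: if_splits)
    qed (use that[of t0] e0 in auto)
    define f where "f z = (case z of Vert v \<Rightarrow> d | EPt e t \<Rightarrow> if e = e0 then min d \<bar>t - t0\<bar> else d)"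
      for z :: "('a, 'b) gpoint"
    have fpt: "f (pt G e s) = (if e = e0 then min d \<bar>s - t0\<bar> else d)"
      if "e \<in> edges G" "s \<in> edge_dom G e" for e s
    proof -
      consider "s = 0" | "s \<noteq> 0" "ereal s = elen G e" | "s \<noteq> 0" "ereal s \<noteq> elen G e" by blast
      then show ?thesis
      proof cases
        case 2
        then have "s \<ge> t0 + d" if "e = e0" using d that by (metis ereal_less_eq(3))
        then show ?thesis using 2 d by (auto simp: pt_def f_def min_def)
      qed (use d in \<open>auto simp: pt_def f_def min_def\<close>)
    qed
    show ?thesis
    proof (rule *[of f])
      show "f x = 0" using EPt d by (simp add: f_def)
      show "f y > 0" using EPt d \<open>x \<noteq> y\<close> by (auto simp: f_def split: gpoint.split)
    qed (auto simp: fpt min_def)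
  next
    case (Vert v)
    define F where "F = {e \<in> edges G. edge_set G e \<inter> gball G x 1 \<noteq> {}}"
    have "finite F" using G(3) x by (auto simp: F_def finite_ball_condition_def)
    have inc: "e \<in> F" if "e \<in> edges G" "x \<in> edge_set G e" for e
      using that x gdist_refl[OF x] by (auto simp: F_def gball_def)
    have pos: "0 < elen G e" if "e \<in> edges G" for e using G(1) that by (auto simp: metric_graph_def)
    have ex: "\<exists>d>0. \<forall>e\<in>F. ereal d \<le> elen G e" if "finite F" "F \<subseteq> edges G" for F
      using that
    proof (induction F)
      case (insert e F)
      then obtain d where d: "d > 0" "\<forall>e\<in>F. ereal d \<le> elen G e" by auto
      obtain d' where d': "d' > 0" "ereal d' \<le> elen G e"
        using pos[of e] insert.prems by (cases "elen G e") (auto intro: that[of 1])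
      have "ereal (min d d') \<le> elen G a" if "a \<in> insert e F" for a
        using that d d' by (auto simp: min_def intro: order_trans[of _ "ereal d"] order_trans[of _ "ereal d'"])
      then show ?case using d d' by (intro exI[of _ "min d d'"]) auto
    qed (auto intro: exI[of _ 1])
    then obtain d where d: "d > 0" "\<forall>e\<in>F. ereal d \<le> elen G e"
      using ex[of F] \<open>finite F\<close> F_def by blast
    define g where "g e t = min d (min (if src G e = v then t else d)
      (if tgt G e = v \<and> elen G e < \<infinity> then real_of_ereal (elen G e) - t else d))" for e t
    define f where "f z = (case z of Vert w \<Rightarrow> if w = v then 0 else d | EPt e t \<Rightarrow> g e t)"
      for z :: "('a, 'b) gpoint"
    have fpt: "f (pt G e s) = g e s" if "e \<in> edges G" "s \<in> edge_dom G e" for e s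
    proof -
      have 0: "ereal d \<le> elen G e" if inc_v: "src G e = v \<or> (tgt G e = v \<and> elen G e < \<infinity>)"
      proof -
        have "x \<in> edge_set G e"
        proof (cases "src G e = v")
          case True
          then have "pt G e 0 = x" by (simp add: pt_def Vert)
          then show ?thesis using pos[OF \<open>e \<in> edges G\<close>]
            by (auto simp: edge_set_def edge_dom_def image_iff zero_ereal_def intro!: bexI[of _ 0])
        next
          case False
          then obtain l where l: "elen G e = ereal l" "l > 0" "tgt G e = v"
            using inc_v pos[OF \<open>e \<in> edges G\<close>] by (cases "elen G e") auto
          then have "pt G e l = x" "l \<in> edge_dom G e" by (simp_all add: pt_def Vert edge_dom_def)
          then show ?thesis unfolding edge_set_def by blast
        qed
        then show ?thesis using inc that \<open>e \<in> edges G\<close> d by auto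
      qed
      consider "s = 0" | "s \<noteq> 0" "ereal s = elen G e" | "s \<noteq> 0" "ereal s \<noteq> elen G e" by blast
      then show ?thesis
      proof cases
        case 1
        then show ?thesis using 0 d by (cases "elen G e") (auto simp: pt_def f_def g_def min_def)
      next
        case 2
        then have s: "elen G e = ereal s" by simp
        have "f (pt G e s) = (if tgt G e = v then 0 else d)" using 2 by (simp add: pt_def f_def)
        moreover have "d \<le> s" if "src G e = v \<or> tgt G e = v"
          using 0 that unfolding s by simp
        ultimately show ?thesis using d(1) unfolding g_def s by (auto simp: min_def)
      qed (simp add: pt_def f_def)
    qed
    show ?thesis
    proof (rule *[of f])
      show "f x = 0" using Vert by (simp add: f_def)
      show "f y > 0"
      proof (cases y)
        case (EPt e t)
        then have "e \<in> edges G" "0 < t" "ereal t < elen G e"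
          using y by (auto simp: points_def edge_int_def)
        then show ?thesis using EPt d by (cases "elen G e") (auto simp: f_def g_def)
      qed (use Vert \<open>x \<noteq> y\<close> d in \<open>auto simp: f_def\<close>)
    qed (auto simp: fpt g_def min_def)
  qed
qed

theorem Metric_space_graph:
  assumes G: "metric_graph G" "graph_connected G" "finite_ball_condition G"
  shows "Metric_space (points G) (gdist G)"
proof
  show "gdist G x y = gdist G y x" for x y
  proof -
    have "{r. walk G x y r} = {r. walk G y x r}" "(\<exists>r. walk G x y r) = (\<exists>r. walk G y x r)"
      using walk_sym[OF G(1)] by blast+
    then show ?thesis unfolding gdist_def by (simp only:)
  qed
  show "0 \<le> gdist G x y" for x y by (rule gdist_nonneg)
  show "gdist G x y = 0 \<longleftrightarrow> x = y" if "x \<in> points G" "y \<in> points G" for x y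
    using gdist_pos[OF G that] gdist_refl that by fastforce
  show "gdist G x z \<le> gdist G x y + gdist G y z"
    if "x \<in> points G" "y \<in> points G" "z \<in> points G" for x y z
  proof -
    obtain p q where pq: "walk G x y p" "walk G y z q"
      using G(2) \<open>x \<in> points G\<close> \<open>y \<in> points G\<close> \<open>z \<in> points G\<close> unfolding graph_connected_def by blast
    have "gdist G x z - gdist G y z \<le> gdist G x y"
    proof (rule gdist_ge[OF pq(1)])
      fix r assume r: "walk G x y r"
      have "gdist G x z - r \<le> gdist G y z"
      proof (rule gdist_ge[OF pq(2)])
        show "gdist G x z - r \<le> s" if "walk G y z s" for s
          using gdist_le[OF walk_trans[OF r that]] by simp
      qed
      then show "gdist G x z - gdist G y z \<le> r" by simp
    qed
    then show ?thesis by simp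
  qed
qed

lemma sigma_algebra_graph:
  "sigma_algebra (points G)
     {A. A \<subseteq> points G \<and> (\<forall>e\<in>edges G. {t \<in> edge_int G e. EPt e t \<in> A} \<in> sets lebesgue)}"
  (is "sigma_algebra _ ?S")
proof -
  have int: "edge_int G e \<in> sets lebesgue" for e
  proof -
    have "edge_int G e = {0<..} \<inter> (\<lambda>t. ereal t) -` {..<elen G e}" by (auto simp: edge_int_def)
    moreover have "open ((\<lambda>t. ereal t) -` {..<elen G e})"
      by (intro open_vimage continuous_intros open_lessThan)
    ultimately show ?thesis by (simp add: open_Int)
  qed
  have 1: "{t \<in> edge_int G e. EPt e t \<in> points G} = edge_int G e" if "e \<in> edges G" for e
    using that by (auto simp: points_def)
  have 2: "{t \<in> edge_int G e. EPt e t \<in> points G - A} = edge_int G e - {t \<in> edge_int G e. EPt e t \<in> A}"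
    if "e \<in> edges G" for e A using 1[OF that] by auto
  have 3: "{t \<in> edge_int G e. EPt e t \<in> (\<Union>i. A i)} = (\<Union>i. {t \<in> edge_int G e. EPt e t \<in> A i})"
    for e and A :: "nat \<Rightarrow> ('a, 'b) gpoint set" by auto
  show ?thesis
    unfolding sigma_algebra_iff2
  proof (intro conjI ballI allI impI)
    show "?S \<subseteq> Pow (points G)" "{} \<in> ?S" by auto
    show "points G - A \<in> ?S" if "A \<in> ?S" for A
    proof -
      have "{t \<in> edge_int G e. EPt e t \<in> points G - A} \<in> sets lebesgue" if "e \<in> edges G" for e
        unfolding 2[OF that] using \<open>A \<in> ?S\<close> that by (intro sets.Diff int) blast
      then show ?thesis by blast
    qed
    fix A :: "nat \<Rightarrow> ('a, 'b) gpoint set" assume A: "range A \<subseteq> ?S"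
    have "{t \<in> edge_int G e. EPt e t \<in> (\<Union>i. A i)} \<in> sets lebesgue" if "e \<in> edges G" for e
      unfolding 3 using A that by (intro sets.countable_UN) blast
    moreover have "(\<Union>i. A i) \<subseteq> points G" using A by blast
    ultimately show "(\<Union>i. A i) \<in> ?S" by blast
  qed
qed

theorem sets_graph_measure:
  "sets (graph_measure G) =
     {A. A \<subseteq> points G \<and> (\<forall>e\<in>edges G. {t \<in> edge_int G e. EPt e t \<in> A} \<in> sets lebesgue)}"
  unfolding graph_measure_def
  by (rule sigma_algebra.sets_measure_of_eq[OF sigma_algebra_graph])

theorem emeasure_graph_measure:
  assumes "A \<in> sets (graph_measure G)"
  shows "emeasure (graph_measure G) A =
    (\<integral>\<^sup>+ e. emeasure lebesgue {t \<in> edge_int G e. EPt e t \<in> A} \<partial>count_space (edges G))"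
  unfolding graph_measure_def
proof (rule emeasure_measure_of_sigma[OF sigma_algebra_graph])
  let ?S = "{A. A \<subseteq> points G \<and> (\<forall>e\<in>edges G. {t \<in> edge_int G e. EPt e t \<in> A} \<in> sets lebesgue)}"
  let ?m = "\<lambda>A. \<integral>\<^sup>+ e. emeasure lebesgue {t \<in> edge_int G e. EPt e t \<in> A} \<partial>count_space (edges G)"
  show "A \<in> ?S" using assms unfolding sets_graph_measure .
  show "positive ?S ?m" by (simp add: positive_def)
  show "countably_additive ?S ?m"
  proof (rule countably_additiveI)
    fix A :: "nat \<Rightarrow> ('a, 'b) gpoint set"
    assume A: "range A \<subseteq> ?S" "disjoint_family A"
    have "(\<Sum>i. ?m (A i)) =
        (\<integral>\<^sup>+ e. (\<Sum>i. emeasure lebesgue {t \<in> edge_int G e. EPt e t \<in> A i}) \<partial>count_space (edges G))"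
      by (rule nn_integral_suminf[symmetric]) simp
    also have "\<dots> = ?m (\<Union>i. A i)"
    proof (rule nn_integral_cong)
      fix e assume "e \<in> space (count_space (edges G))"
      then have e: "e \<in> edges G" by simp
      have "(\<Sum>i. emeasure lebesgue {t \<in> edge_int G e. EPt e t \<in> A i}) =
          emeasure lebesgue (\<Union>i. {t \<in> edge_int G e. EPt e t \<in> A i})"
      proof (rule suminf_emeasure)
        show "range (\<lambda>i. {t \<in> edge_int G e. EPt e t \<in> A i}) \<subseteq> sets lebesgue"
          using A(1) e by blast
        show "disjoint_family (\<lambda>i. {t \<in> edge_int G e. EPt e t \<in> A i})"
          using A(2) unfolding disjoint_family_on_def by blast
      qed
      also have "(\<Union>i. {t \<in> edge_int G e. EPt e t \<in> A i}) = {t \<in> edge_int G e. EPt e t \<in> (\<Union>i. A i)}"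
        by auto
      finally show "(\<Sum>i. emeasure lebesgue {t \<in> edge_int G e. EPt e t \<in> A i}) =
          emeasure lebesgue {t \<in> edge_int G e. EPt e t \<in> (\<Union>i. A i)}" .
    qed
    finally show "(\<Sum>i. ?m (A i)) = ?m (\<Union>i. A i)" .
  qed
qed

end

theory Submission
  imports Defs
begin

text \<open>
  Let \<open>\<mu>\<close> be in the essential spectrum and \<open>\<nu> > \<mu>\<close>. The idea is Persson's: the essential spectrum is
  only felt far out. For every bounded part of the graph there is a function of \<open>H\<^sup>1\<close> that vanishes
  there and has Rayleigh quotient below \<open>\<nu>\<close> (\<open>ground_energy_outside\<close>). Granting this, a cutoff far
  away makes the support of such a function bounded without losing the inequality
  (\<open>ground_energy_annulus\<close>). A bounded set meets finitely many edges, and if the support is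
  disconnected, the form and the squared norm split into those of its parts, so that one part still
  has a quotient below \<open>\<nu>\<close>; after finitely many splittings the support lies in a connected closed
  set (\<open>connected_support\<close>). Repeating this ever further out yields \<open>k\<close> pairwise disjoint connected sets.
  On each of them the bottom of the spectrum is at most \<open>\<nu>\<close>, since the infimum of the Rayleigh
  quotient belongs to the spectrum (\<open>spectrum_below_quotient\<close>). Hence the minimal energy is at most
  \<open>\<nu>\<close>, for all \<open>\<nu> > \<mu>\<close>.

  Persson's principle is proved by contradiction. If all functions that vanish on a bounded part
  have quotient at least \<open>\<nu>\<close>, then a cutoff, whose derivative lives on a bounded set, together with
  the Poincare inequality on finitely many short intervals covering this set, gives
  \<open>\<nu>0 \<parallel>u\<parallel>\<^sup>2 \<le> a(u, u) + K (u(x\<^sub>1)\<^sup>2 + \<dots> + u(x\<^sub>N)\<^sup>2)\<close> on \<open>H\<^sup>1\<close> with some \<open>\<nu>0 > \<mu>\<close>. The form on the right is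
  coercive, so by the Riesz representation theorem (\<open>H\<^sup>1\<close> is complete) the equation
  \<open>(A - \<lambda>) u = g\<close> for \<open>\<lambda> < \<nu>0\<close> reduces to a linear system for the \<open>N\<close> values \<open>u(x\<^sub>j)\<close>. Thus
  \<open>\<lambda>\<close> is in the resolvent set unless it is an eigenvalue (\<open>Fredholm_alternative\<close>), the eigenspaces
  are finite dimensional, and since the form is bounded below by \<open>\<nu>0\<close> on the functions vanishing at
  the \<open>x\<^sub>j\<close>, there are at most \<open>N\<close> eigenvalues below \<open>\<nu>0\<close> (\<open>finite_eigenvalues\<close>). So \<open>\<mu>\<close> would belong
  to the discrete spectrum.

  All cutoffs are smooth functions of a function \<open>height\<close> that is affine on every edge and equals the
  distance from a base point at the vertices, so that the region below a given height meets only
  finitely many edges, each in a bounded part. The product of such a cutoff with a test function on an edge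
  is again a test function, which makes the product rule for weak derivatives immediate.
\<close>

section \<open>Linear systems of equations\<close>

text \<open>
  Gaussian elimination: one equation removes one unknown, so that the surplus of unknowns
  survives the induction.
\<close>

lemma underdetermined_system:
  fixes L :: "nat \<Rightarrow> 'i \<Rightarrow> real"
  assumes "finite I" "N < card I"
  shows "\<exists>c. (\<exists>i\<in>I. c i \<noteq> 0) \<and> (\<forall>j<N. (\<Sum>i\<in>I. c i * L j i) = 0)"
  using assms
proof (induction N arbitrary: I L)
  case 0
  then have "I \<noteq> {}" by auto
  then show ?case by (intro exI[of _ "\<lambda>_. 1"]) auto
next
  case (Suc N)
  show ?case
  proof (cases "\<forall>i\<in>I. L N i = 0")
    case True
    obtain c where "\<exists>i\<in>I. c i \<noteq> 0" "\<forall>j<N. (\<Sum>i\<in>I. c i * L j i) = 0"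
      using Suc.IH[of I L] Suc.prems by auto
    moreover have "(\<Sum>i\<in>I. c i * L N i) = 0" using True by simp
    ultimately show ?thesis unfolding less_Suc_eq by blast
  next
    case False
    then obtain p where p: "p \<in> I" "L N p \<noteq> 0" by blast
    define I' where "I' = I - {p}"
    have I': "finite I'" "N < card I'" using Suc.prems p by (auto simp: I'_def)
    \<comment> \<open>Eliminate the unknown with index \<open>p\<close> by means of the last equation.\<close>
    obtain c where c: "\<exists>i\<in>I'. c i \<noteq> 0"
      "\<And>j. j < N \<Longrightarrow> (\<Sum>i\<in>I'. c i * (L j i - L j p * L N i / L N p)) = 0"
      using Suc.IH[OF I', of "\<lambda>j i. L j i - L j p * L N i / L N p"] by blast
    define s where "s = - (\<Sum>i\<in>I'. c i * L N i) / L N p"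
    define c' where "c' i = (if i = p then s else c i)" for i
    have split: "(\<Sum>i\<in>I. c' i * L j i) = s * L j p + (\<Sum>i\<in>I'. c i * L j i)" for j
    proof -
      have "(\<Sum>i\<in>I. c' i * L j i) = c' p * L j p + (\<Sum>i\<in>I'. c' i * L j i)"
        unfolding I'_def using Suc.prems p by (subst sum.remove[of _ p]) auto
      also have "(\<Sum>i\<in>I'. c' i * L j i) = (\<Sum>i\<in>I'. c i * L j i)"
        by (rule sum.cong) (auto simp: c'_def I'_def)
      finally show ?thesis by (simp add: c'_def)
    qed
    have "(\<Sum>i\<in>I. c' i * L j i) = 0" if "j < Suc N" for j
    proof (cases "j = N")
      case True
      then show ?thesis unfolding split using p by (simp add: s_def field_simps)
    next
      case False
      with that have "j < N" by simp
      have "(\<Sum>i\<in>I'. c i * (L j i - L j p * L N i / L N p))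
          = (\<Sum>i\<in>I'. c i * L j i) - L j p / L N p * (\<Sum>i\<in>I'. c i * L N i)"
        unfolding sum_distrib_left sum_subtractf[symmetric]
        by (rule sum.cong) (auto simp: right_diff_distrib)
      then show ?thesis using c(2)[OF \<open>j < N\<close>] unfolding split by (simp add: s_def)
    qed
    moreover have "\<exists>i\<in>I. c' i \<noteq> 0" using c(1) by (auto simp: c'_def I'_def)
    ultimately show ?thesis by blast
  qed
qed

lemma injective_system_solvable:
  fixes B :: "nat \<Rightarrow> nat \<Rightarrow> real"
  assumes inj: "\<And>c. (\<And>i. i < N \<Longrightarrow> (\<Sum>j<N. B i j * c j) = 0) \<Longrightarrow> (\<And>j. j < N \<Longrightarrow> c j = 0)"
  shows "\<exists>c. \<forall>i<N. (\<Sum>j<N. B i j * c j) = d i"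
proof -
  \<comment> \<open>The unknowns are the \<open>c j\<close> and one more, which multiplies the right-hand side.\<close>
  obtain c where c: "\<exists>j\<in>{..N}. c j \<noteq> 0"
    "\<And>i. i < N \<Longrightarrow> (\<Sum>j\<in>{..N}. c j * (if j = N then d i else B i j)) = 0"
    using underdetermined_system[of "{..N}" N "\<lambda>i j. if j = N then d i else B i j"] by auto
  have eq: "(\<Sum>j<N. B i j * c j) + c N * d i = 0" if "i < N" for i
  proof -
    have "(\<Sum>j\<in>{..N}. c j * (if j = N then d i else B i j))
        = (\<Sum>j<N. c j * (if j = N then d i else B i j)) + c N * d i"
      by (simp add: lessThan_Suc_atMost[symmetric])
    also have "(\<Sum>j<N. c j * (if j = N then d i else B i j)) = (\<Sum>j<N. B i j * c j)"
      by (rule sum.cong) auto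
    finally show ?thesis using c(2)[OF that] by simp
  qed
  have "c N \<noteq> 0"
  proof
    assume 0: "c N = 0"
    then have "c j = 0" if "j < N" for j using inj[of c j] eq that by simp
    with 0 c(1) show False by (auto simp: le_less)
  qed
  have "(\<Sum>j<N. B i j * (- c j / c N)) = d i" if "i < N" for i
  proof -
    have "(\<Sum>j<N. B i j * (- c j / c N)) = (- 1 / c N) * (\<Sum>j<N. B i j * c j)"
      unfolding sum_distrib_left by (rule sum.cong) auto
    moreover have "(\<Sum>j<N. B i j * c j) = - (c N * d i)" using eq[OF that] by linarith
    ultimately show ?thesis using \<open>c N \<noteq> 0\<close> by simp
  qed
  then show ?thesis by (intro exI[of _ "\<lambda>j. - c j / c N"]) blast
qed

text \<open>
  Solutions for the unit vectors combine linearly to a solution for any right-hand side, which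
  makes it bounded in terms of the right-hand side with a uniform constant.
\<close>

lemma injective_system_solvable_bounded:
  fixes B :: "nat \<Rightarrow> nat \<Rightarrow> real"
  assumes inj: "\<And>c. (\<And>i. i < N \<Longrightarrow> (\<Sum>j<N. B i j * c j) = 0) \<Longrightarrow> (\<And>j. j < N \<Longrightarrow> c j = 0)"
  shows "\<exists>K\<ge>0. \<forall>d. \<exists>c. (\<forall>i<N. (\<Sum>j<N. B i j * c j) = d i) \<and> (\<forall>j<N. \<bar>c j\<bar> \<le> K * (\<Sum>i<N. \<bar>d i\<bar>))"
proof -
  have "\<forall>k. \<exists>c. \<forall>i<N. (\<Sum>j<N. B i j * c j) = (if i = k then 1 else 0)"
  proof
    show "\<exists>c. \<forall>i<N. (\<Sum>j<N. B i j * c j) = (if i = k then 1 else 0)" for k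
      using inj by (rule injective_system_solvable)
  qed
  from choice[OF this] obtain E
    where E: "\<And>k i. i < N \<Longrightarrow> (\<Sum>j<N. B i j * E k j) = (if i = k then 1 else 0)"
    by blast
  define K where "K = (\<Sum>k<N. \<Sum>j<N. \<bar>E k j\<bar>)"
  have "\<exists>c. (\<forall>i<N. (\<Sum>j<N. B i j * c j) = d i) \<and> (\<forall>j<N. \<bar>c j\<bar> \<le> K * (\<Sum>i<N. \<bar>d i\<bar>))" for d
  proof (intro exI conjI allI impI)
    let ?c = "\<lambda>j. \<Sum>k<N. d k * E k j"
    show "(\<Sum>j<N. B i j * ?c j) = d i" if "i < N" for i
    proof -
      have "(\<Sum>j<N. B i j * ?c j) = (\<Sum>k<N. d k * (\<Sum>j<N. B i j * E k j))"
        unfolding sum_distrib_left by (subst sum.swap) (simp add: mult.left_commute)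
      also have "\<dots> = (\<Sum>k<N. d k * (if i = k then 1 else 0))"
        using that by (simp add: E)
      finally show ?thesis using that by (simp add: if_distrib cong: if_cong)
    qed
    show "\<bar>?c j\<bar> \<le> K * (\<Sum>i<N. \<bar>d i\<bar>)" if "j < N" for j
    proof -
      have "\<bar>E k j\<bar> \<le> K" if "k < N" for k
      proof -
        have "\<bar>E k j\<bar> \<le> (\<Sum>j<N. \<bar>E k j\<bar>)" using \<open>j < N\<close> by (intro member_le_sum) auto
        also have "\<dots> \<le> K" unfolding K_def using that
          by (intro member_le_sum[of k _ "\<lambda>k. \<Sum>j<N. \<bar>E k j\<bar>"]) (auto intro: sum_nonneg)
        finally show ?thesis .
      qed
      then have "\<bar>d k * E k j\<bar> \<le> K * \<bar>d k\<bar>" if "k < N" for k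
        using mult_left_mono[of "\<bar>E k j\<bar>" K "\<bar>d k\<bar>"] that by (simp add: abs_mult mult.commute)
      then have "(\<Sum>k<N. \<bar>d k * E k j\<bar>) \<le> (\<Sum>k<N. K * \<bar>d k\<bar>)"
        by (intro sum_mono) auto
      with sum_abs[of "\<lambda>k. d k * E k j" "{..<N}"] show ?thesis
        unfolding sum_distrib_left by (rule order_trans)
    qed
  qed
  moreover have "K \<ge> 0" by (auto simp: K_def intro!: sum_nonneg)
  ultimately show ?thesis by blast
qed

section \<open>Symmetric forms on spaces of functions\<close>

definition linear_on :: "('x \<Rightarrow> real) set \<Rightarrow> (('x \<Rightarrow> real) \<Rightarrow> real) \<Rightarrow> bool" where
  "linear_on D l \<longleftrightarrow> (\<forall>f\<in>D. \<forall>g\<in>D. \<forall>c d. l (\<lambda>x. c * f x + d * g x) = c * l f + d * l g)"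

lemma linear_onD:
  "linear_on D l \<Longrightarrow> f \<in> D \<Longrightarrow> g \<in> D \<Longrightarrow> l (\<lambda>x. c * f x + d * g x) = c * l f + d * l g"
  by (auto simp: linear_on_def)

locale function_space =
  fixes D :: "('x \<Rightarrow> real) set"
  assumes zero_mem: "(\<lambda>x. 0) \<in> D"
    and lin_mem: "\<And>f g c d. f \<in> D \<Longrightarrow> g \<in> D \<Longrightarrow> (\<lambda>x. c * f x + d * g x) \<in> D"
begin

lemma diff_mem: "f \<in> D \<Longrightarrow> g \<in> D \<Longrightarrow> (\<lambda>x. f x - g x) \<in> D"
  using lin_mem[of f g 1 "-1"] by simp

lemma linear_on_diff: "linear_on D l \<Longrightarrow> f \<in> D \<Longrightarrow> g \<in> D \<Longrightarrow> l (\<lambda>x. f x - g x) = l f - l g"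
  using linear_onD[of D l f g 1 "-1"] by simp

lemma linear_on_zero: "linear_on D l \<Longrightarrow> l (\<lambda>x. 0) = 0"
  using linear_onD[OF _ zero_mem zero_mem, of l 0 0] by simp

lemma sum_mem: "finite I \<Longrightarrow> (\<And>i. i \<in> I \<Longrightarrow> f i \<in> D) \<Longrightarrow> (\<lambda>x. \<Sum>i\<in>I. c i * f i x) \<in> D"
proof (induction I rule: finite_induct)
  case (insert i I)
  then show ?case using lin_mem[of "f i" "\<lambda>x. \<Sum>i\<in>I. c i * f i x" "c i" 1] by simp
qed (use zero_mem in auto)

lemma linear_on_sum:
  assumes "linear_on D l" "finite I" "\<And>i. i \<in> I \<Longrightarrow> f i \<in> D"
  shows "l (\<lambda>x. \<Sum>i\<in>I. c i * f i x) = (\<Sum>i\<in>I. c i * l (f i))"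
  using assms(2,3)
proof (induction I rule: finite_induct)
  case (insert i I)
  then show ?case
    using linear_onD[OF assms(1), of "f i" "\<lambda>x. \<Sum>i\<in>I. c i * f i x" "c i" 1] sum_mem[of I f c] by simp
qed (simp add: linear_on_zero assms)

end

locale symmetric_form = function_space D for D :: "('x \<Rightarrow> real) set" +
  fixes b :: "('x \<Rightarrow> real) \<Rightarrow> ('x \<Rightarrow> real) \<Rightarrow> real"
  assumes linear: "\<And>h. h \<in> D \<Longrightarrow> linear_on D (\<lambda>f. b f h)"
    and sym: "\<And>f g. f \<in> D \<Longrightarrow> g \<in> D \<Longrightarrow> b f g = b g f"
begin

lemma linear_right: "h \<in> D \<Longrightarrow> linear_on D (b h)"
  using linear[of h] unfolding linear_on_def by (simp add: sym lin_mem)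

lemma form_square:
  assumes "f \<in> D" "g \<in> D"
  shows "b (\<lambda>x. c * f x + d * g x) (\<lambda>x. c * f x + d * g x)
    = c\<^sup>2 * b f f + 2 * c * d * b f g + d\<^sup>2 * b g g"
proof -
  let ?h = "\<lambda>x. c * f x + d * g x"
  have h: "?h \<in> D" by (intro lin_mem assms)
  have "b ?h ?h = c * b f ?h + d * b g ?h" by (rule linear_onD[OF linear[OF h] assms])
  also have "b f ?h = c * b f f + d * b f g" by (rule linear_onD[OF linear_right[OF assms(1)] assms])
  also have "b g ?h = c * b g f + d * b g g" by (rule linear_onD[OF linear_right[OF assms(2)] assms])
  finally show ?thesis using sym[OF assms] by (simp add: power2_eq_square algebra_simps)
qed

lemma form_diff:
  assumes "f \<in> D" "g \<in> D"
  shows "b (\<lambda>x. f x - g x) (\<lambda>x. f x - g x) = b f f - 2 * b f g + b g g"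
  using form_square[OF assms, of 1 "-1"] by simp

end

locale nonneg_form = symmetric_form D b for D :: "('x \<Rightarrow> real) set" and b +
  assumes nonneg: "\<And>f. f \<in> D \<Longrightarrow> 0 \<le> b f f"
begin

lemma Cauchy_Schwarz:
  assumes "f \<in> D" "g \<in> D"
  shows "(b f g)\<^sup>2 \<le> b f f * b g g"
proof -
  have pos: "0 \<le> c\<^sup>2 * b f f + 2 * c * d * b f g + d\<^sup>2 * b g g" for c d
    using nonneg[OF lin_mem[OF assms, of c d]] by (simp add: form_square assms)
  show ?thesis
  proof (cases "b g g = 0")
    case True
    have "b f g = 0"
    proof (rule ccontr)
      assume "b f g \<noteq> 0"
      then have "2 * (- (b f f + 1) / (2 * b f g)) * b f g = - (b f f + 1)" by simp
      then show False
        using pos[of 1 "- (b f f + 1) / (2 * b f g)"] True by simp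
    qed
    then show ?thesis using True by simp
  next
    case False
    then have "b g g > 0" using nonneg[OF assms(2)] by simp
    have "0 \<le> b f f - (b f g)\<^sup>2 / b g g"
      using pos[of 1 "- b f g / b g g"] False by (simp add: power2_eq_square)
    then show ?thesis using \<open>b g g > 0\<close> by (simp add: pos_divide_le_eq)
  qed
qed

end

text \<open>
  The form may vanish on nonzero functions (those that vanish almost everywhere), so limits
  need not be unique.
\<close>

definition complete_wrt :: "('x \<Rightarrow> real) set \<Rightarrow> (('x \<Rightarrow> real) \<Rightarrow> ('x \<Rightarrow> real) \<Rightarrow> real) \<Rightarrow> bool" where
  "complete_wrt D b \<longleftrightarrow> (\<forall>u. (\<forall>n. u n \<in> D) \<longrightarrow>
     (\<forall>\<epsilon>>0. \<exists>N. \<forall>i\<ge>N. \<forall>j\<ge>N. b (\<lambda>x. u i x - u j x) (\<lambda>x. u i x - u j x) < \<epsilon>) \<longrightarrow>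
     (\<exists>v\<in>D. (\<lambda>n. b (\<lambda>x. u n x - v x) (\<lambda>x. u n x - v x)) \<longlonglongrightarrow> 0))"

context nonneg_form begin

text \<open>
  The representative is the minimiser of \<open>J v = b v v - 2 \<phi> v\<close>. By the parallelogram identity
  a minimising sequence is Cauchy, and the variation of \<open>J\<close> at the limit vanishes, which is
  the equation.
\<close>

theorem Riesz_representation:
  assumes complete: "complete_wrt D b"
    and \<phi>: "linear_on D \<phi>" and "0 \<le> C" and bound: "\<And>v. v \<in> D \<Longrightarrow> (\<phi> v)\<^sup>2 \<le> C * b v v"
  shows "\<exists>u\<in>D. \<forall>v\<in>D. b u v = \<phi> v"
proof -
  define J where "J v = b v v - 2 * \<phi> v" for v
  have low: "- C \<le> J v" if "v \<in> D" for v
  proof -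
    have "0 \<le> b v v" by (rule nonneg[OF that])
    have "(2 * \<phi> v)\<^sup>2 \<le> 4 * (C * b v v)" using bound[OF that] by (simp add: power2_eq_square)
    also have "\<dots> \<le> (C + b v v)\<^sup>2"
      using zero_le_power2[of "C - b v v"] by (simp add: power2_eq_square algebra_simps)
    finally have *: "\<bar>2 * \<phi> v\<bar> \<le> \<bar>C + b v v\<bar>" by (simp add: abs_le_square_iff)
    then show ?thesis using \<open>0 \<le> b v v\<close> \<open>0 \<le> C\<close> by (simp add: J_def)
  qed
  define s where "s = Inf (J ` D)"
  have bdd: "bdd_below (J ` D)" using low by (intro bdd_belowI[of _ "-C"]) auto
  have s_le: "s \<le> J v" if "v \<in> D" for v
    unfolding s_def using bdd that by (intro cInf_lower) auto
  have "\<forall>n::nat. \<exists>v\<in>D. J v < s + 1 / (real n + 1)"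
  proof
    fix n :: nat
    have "Inf (J ` D) < s + 1 / (real n + 1)" by (simp add: s_def)
    then show "\<exists>v\<in>D. J v < s + 1 / (real n + 1)"
      using cInf_lessD[of "J ` D"] zero_mem by blast
  qed
  then obtain u where u: "\<And>n. u n \<in> D" "\<And>n. J (u n) < s + 1 / (real n + 1)" by metis
  have close: "b (\<lambda>x. u i x - u j x) (\<lambda>x. u i x - u j x) \<le> 2 / (real i + 1) + 2 / (real j + 1)" for i j
  proof -
    \<comment> \<open>Parallelogram identity at the midpoint.\<close>
    let ?m = "\<lambda>x. 1/2 * u i x + 1/2 * u j x"
    have "J ?m = 1/4 * b (u i) (u i) + 1/2 * b (u i) (u j) + 1/4 * b (u j) (u j) - \<phi> (u i) - \<phi> (u j)"
      unfolding J_def by (subst form_square[OF u(1) u(1)], subst linear_onD[OF \<phi> u(1) u(1)])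
        (simp add: power2_eq_square)
    moreover have "s \<le> J ?m" by (intro s_le lin_mem u)
    ultimately show ?thesis
      using u(2)[of i] u(2)[of j] unfolding form_diff[OF u(1) u(1)] J_def by simp
  qed
  have "\<forall>\<epsilon>>0. \<exists>N. \<forall>i\<ge>N. \<forall>j\<ge>N. b (\<lambda>x. u i x - u j x) (\<lambda>x. u i x - u j x) < \<epsilon>"
  proof (intro allI impI)
    fix \<epsilon> :: real assume "\<epsilon> > 0"
    then obtain N where N: "4 / \<epsilon> < real N" using reals_Archimedean2 by blast
    have small: "2 / (real i + 1) < \<epsilon> / 2" if "i \<ge> N" for i
    proof -
      have "4 / \<epsilon> < real i + 1" using N that by linarith
      then show ?thesis using \<open>\<epsilon> > 0\<close> by (simp add: field_simps)
    qed
    show "\<exists>N. \<forall>i\<ge>N. \<forall>j\<ge>N. b (\<lambda>x. u i x - u j x) (\<lambda>x. u i x - u j x) < \<epsilon>"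
    proof (intro exI[of _ N] allI impI)
      fix i j assume "i \<ge> N" "j \<ge> N"
      then show "b (\<lambda>x. u i x - u j x) (\<lambda>x. u i x - u j x) < \<epsilon>"
        using close[of i j] small[of i] small[of j] by linarith
    qed
  qed
  then obtain w where w: "w \<in> D" "(\<lambda>n. b (\<lambda>x. u n x - w x) (\<lambda>x. u n x - w x)) \<longlonglongrightarrow> 0"
    using complete u(1) unfolding complete_wrt_def by blast
  have "b w v = \<phi> v" if v: "v \<in> D" for v
  proof -
    have lim: "(\<lambda>n. b (u n) v) \<longlonglongrightarrow> b w v"
    proof -
      have "(\<lambda>n. (b (u n) v - b w v)\<^sup>2) \<longlonglongrightarrow> 0"
      proof (rule tendsto_sandwich[of "\<lambda>_. 0"])
        show "(\<lambda>n. b (\<lambda>x. u n x - w x) (\<lambda>x. u n x - w x) * b v v) \<longlonglongrightarrow> 0"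
          using tendsto_mult_left_zero[OF w(2), of "b v v"] .
        show "\<forall>\<^sub>F n in sequentially. (b (u n) v - b w v)\<^sup>2
            \<le> b (\<lambda>x. u n x - w x) (\<lambda>x. u n x - w x) * b v v"
          using Cauchy_Schwarz[OF diff_mem[OF u(1) w(1)] v]
          by (intro always_eventually allI) (simp add: linear_on_diff[OF linear[OF v] u(1) w(1)] del: power2_diff)
      qed auto
      then have "(\<lambda>n. sqrt ((b (u n) v - b w v)\<^sup>2)) \<longlonglongrightarrow> sqrt 0" by (rule tendsto_real_sqrt)
      then have "(\<lambda>n. b (u n) v - b w v) \<longlonglongrightarrow> 0" by (simp add: tendsto_rabs_zero_iff)
      then show ?thesis by (simp add: LIM_zero_iff)
    qed
    have quad: "0 \<le> 2 * t * (b w v - \<phi> v) + t\<^sup>2 * b v v" for t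
    proof -
      have "- (1 / (real n + 1)) \<le> 2 * t * (b (u n) v - \<phi> v) + t\<^sup>2 * b v v" for n
      proof -
        have "s \<le> J (\<lambda>x. 1 * u n x + t * v x)" by (intro s_le lin_mem u v)
        also have "\<dots> = J (u n) + 2 * t * (b (u n) v - \<phi> v) + t\<^sup>2 * b v v"
          unfolding J_def by (subst form_square[OF u(1) v], subst linear_onD[OF \<phi> u(1) v])
            (simp add: algebra_simps)
        finally show ?thesis using u(2)[of n] by linarith
      qed
      moreover have "(\<lambda>n. - (1 / (real n + 1))) \<longlonglongrightarrow> 0"
        using tendsto_minus[OF LIMSEQ_inverse_real_of_nat] by (simp add: inverse_eq_divide add.commute)
      moreover have "(\<lambda>n. 2 * t * (b (u n) v - \<phi> v) + t\<^sup>2 * b v v)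
          \<longlonglongrightarrow> 2 * t * (b w v - \<phi> v) + t\<^sup>2 * b v v"
        by (intro tendsto_intros lim)
      ultimately show ?thesis by (metis (mono_tags, lifting) LIMSEQ_le)
    qed
    show ?thesis
    proof (rule ccontr)
      define q where "q = b w v - \<phi> v"
      define p where "p = b v v + 1"
      assume "b w v \<noteq> \<phi> v"
      then have "q \<noteq> 0" by (simp add: q_def)
      have p: "p > 0" using nonneg[OF v] by (simp add: p_def)
      have "0 \<le> 2 * (- q / p) * q + (- q / p)\<^sup>2 * (p - 1)"
        using quad[of "- q / p"] by (simp add: q_def p_def)
      also have "\<dots> = (q / p)\<^sup>2 * (- p - 1)"
        using p by (simp add: power2_eq_square field_simps)
      also have "\<dots> < 0" using p \<open>q \<noteq> 0\<close> by (intro mult_pos_neg) auto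
      finally show False by simp
    qed
  qed
  then show ?thesis using w(1) by blast
qed

end

lemma symmetric_form_add:
  assumes "symmetric_form D b1" "symmetric_form D b2"
  shows "symmetric_form D (\<lambda>f g. b1 f g + s * b2 f g)"
proof -
  interpret b1: symmetric_form D b1 by fact
  interpret b2: symmetric_form D b2 by fact
  show ?thesis
  proof
    show "linear_on D (\<lambda>f. b1 f h + s * b2 f h)" if "h \<in> D" for h
      using b1.linear[OF that] b2.linear[OF that] by (simp add: linear_on_def algebra_simps)
    show "b1 f g + s * b2 f g = b1 g f + s * b2 g f" if "f \<in> D" "g \<in> D" for f g
      using b1.sym[OF that] b2.sym[OF that] by simp
  qed
qed

text \<open>
  Passing to an equivalent quadratic form changes neither Cauchy sequences nor limits. This
  transfers completeness from the norm of \<open>H\<^sup>1\<close> to the shifted forms.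
\<close>

lemma complete_wrt_equivalent:
  assumes "function_space D" "complete_wrt D b" "\<kappa> > 0"
    and equiv: "\<And>v. v \<in> D \<Longrightarrow> \<kappa> * b v v \<le> b' v v" "\<And>v. v \<in> D \<Longrightarrow> b' v v \<le> C * b v v"
    and nonneg: "\<And>v. v \<in> D \<Longrightarrow> 0 \<le> b v v"
  shows "complete_wrt D b'"
  unfolding complete_wrt_def
proof (intro allI impI)
  interpret function_space D by fact
  fix u :: "nat \<Rightarrow> 'a \<Rightarrow> real"
  let ?d = "\<lambda>i j x. u i x - u j x"
  assume u: "\<forall>n. u n \<in> D"
    and cauchy: "\<forall>\<epsilon>>0. \<exists>N. \<forall>i\<ge>N. \<forall>j\<ge>N. b' (?d i j) (?d i j) < \<epsilon>"
  have "\<forall>\<epsilon>>0. \<exists>N. \<forall>i\<ge>N. \<forall>j\<ge>N. b (?d i j) (?d i j) < \<epsilon>"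
  proof (intro allI impI)
    fix \<epsilon> :: real assume "\<epsilon> > 0"
    then obtain N where N: "\<And>i j. i \<ge> N \<Longrightarrow> j \<ge> N \<Longrightarrow> b' (?d i j) (?d i j) < \<kappa> * \<epsilon>"
      using cauchy \<open>\<kappa> > 0\<close> by (meson mult_pos_pos)
    have "b (?d i j) (?d i j) < \<epsilon>" if "i \<ge> N" "j \<ge> N" for i j
    proof -
      have "\<kappa> * b (?d i j) (?d i j) < \<kappa> * \<epsilon>"
        using N[OF that] equiv(1)[OF diff_mem, of "u i" "u j"] u by force
      then show ?thesis using \<open>\<kappa> > 0\<close> by simp
    qed
    then show "\<exists>N. \<forall>i\<ge>N. \<forall>j\<ge>N. b (?d i j) (?d i j) < \<epsilon>" by blast
  qed
  then obtain v where v: "v \<in> D" "(\<lambda>n. b (\<lambda>x. u n x - v x) (\<lambda>x. u n x - v x)) \<longlonglongrightarrow> 0"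
    using assms(2) u unfolding complete_wrt_def by blast
  have "(\<lambda>n. b' (\<lambda>x. u n x - v x) (\<lambda>x. u n x - v x)) \<longlonglongrightarrow> 0"
  proof (rule tendsto_sandwich[of "\<lambda>_. 0"])
    have mem: "(\<lambda>x. u n x - v x) \<in> D" for n using u v(1) by (intro diff_mem) auto
    show "(\<lambda>n. C * b (\<lambda>x. u n x - v x) (\<lambda>x. u n x - v x)) \<longlonglongrightarrow> 0"
      using tendsto_mult_right_zero[OF v(2)] .
    show "\<forall>\<^sub>F n in sequentially. b' (\<lambda>x. u n x - v x) (\<lambda>x. u n x - v x)
        \<le> C * b (\<lambda>x. u n x - v x) (\<lambda>x. u n x - v x)"
      using equiv(2)[OF mem] by simp
    have "0 \<le> b' (\<lambda>x. u n x - v x) (\<lambda>x. u n x - v x)" for n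
      using equiv(1)[OF mem[of n]] nonneg[OF mem[of n]] \<open>\<kappa> > 0\<close>
      by (meson mult_nonneg_nonneg order_trans less_imp_le)
    then show "\<forall>\<^sub>F n in sequentially. 0 \<le> b' (\<lambda>x. u n x - v x) (\<lambda>x. u n x - v x)"
      by simp
  qed simp
  with v(1) show "\<exists>v\<in>D. (\<lambda>n. b' (\<lambda>x. u n x - v x) (\<lambda>x. u n x - v x)) \<longlonglongrightarrow> 0" by blast
qed

text \<open>\<open>a\<close> plays the role of the energy and \<open>m\<close> of the inner product of \<open>L\<^sup>2\<close>.\<close>

locale form_pair = a: nonneg_form D a + m: nonneg_form D m
  for D :: "('x \<Rightarrow> real) set" and a m
begin

text \<open>
  The point \<open>\<nu>\<close> is the infimum of the quotients \<open>a f f / m f f\<close>. If the equation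
  \<open>a g - \<nu> m g = m f\<close> had solutions with a uniform bound, then testing with an almost
  minimising \<open>f\<close> and the inequality of Cauchy and Schwarz for the nonnegative form \<open>a - \<nu> m\<close>
  would give \<open>(m f f)\<^sup>2 \<le> (m g f) \<epsilon>\<close>, which is absurd for small \<open>\<epsilon>\<close>.
\<close>

theorem spectrum_below_quotient:
  assumes f0: "f0 \<in> D" "a f0 f0 < \<mu> * m f0 f0"
  shows "\<exists>\<nu><\<mu>. \<not> (\<exists>C. \<forall>f\<in>D. \<exists>g\<in>D. (\<forall>v\<in>D. a g v - \<nu> * m g v = m f v) \<and> m g g \<le> C * m f f)"
proof -
  have m0: "m f0 f0 > 0"
    using f0 a.nonneg[OF f0(1)] m.nonneg[OF f0(1)] by (cases "m f0 f0 = 0") auto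
  define S where "S = (\<lambda>f. a f f / m f f) ` {f \<in> D. m f f > 0}"
  define \<nu> where "\<nu> = Inf S"
  have bdd: "bdd_below S"
    unfolding S_def by (intro bdd_belowI[of _ 0]) (auto intro!: divide_nonneg_nonneg a.nonneg m.nonneg)
  have "\<nu> \<le> a f0 f0 / m f0 f0"
    unfolding \<nu>_def using bdd f0 m0 by (intro cInf_lower) (auto simp: S_def)
  also have "\<dots> < \<mu>" using f0(2) m0 by (simp add: pos_divide_less_eq)
  finally have "\<nu> < \<mu>" .
  define b where "b f g = a f g + (- \<nu>) * m f g" for f g
  have "symmetric_form D b"
    unfolding b_def[abs_def] by (intro symmetric_form_add a.symmetric_form_axioms m.symmetric_form_axioms)
  then interpret b: symmetric_form D b .
  interpret b: nonneg_form D b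
  proof
    show "0 \<le> b f f" if "f \<in> D" for f
    proof (cases "m f f = 0")
      case True
      then show ?thesis using a.nonneg[OF that] by (simp add: b_def)
    next
      case False
      then have "m f f > 0" using m.nonneg[OF that] by simp
      then have "\<nu> \<le> a f f / m f f"
        unfolding \<nu>_def using bdd that by (intro cInf_lower) (auto simp: S_def)
      then show ?thesis using \<open>m f f > 0\<close> by (simp add: b_def pos_le_divide_eq)
    qed
  qed
  have False if C: "\<forall>f\<in>D. \<exists>g\<in>D. (\<forall>v\<in>D. a g v - \<nu> * m g v = m f v) \<and> m g g \<le> C * m f f" for C
  proof -
    \<comment> \<open>A positive bound in place of \<open>C\<close>, about whose sign nothing is known.\<close>
    define K where "K = \<bar>C\<bar> + 1"
    have "Inf S < \<nu> + 1 / (2 * K)" by (simp add: \<nu>_def K_def)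
    then obtain f where f: "f \<in> D" "m f f > 0" "a f f / m f f < \<nu> + 1 / (2 * K)"
      using cInf_lessD[of S] f0(1) m0 unfolding S_def by blast
    have bf: "b f f < m f f / (2 * K)"
      using f(3) f(2) by (simp add: b_def pos_divide_less_eq algebra_simps)
    obtain g where g: "g \<in> D" "\<And>v. v \<in> D \<Longrightarrow> b g v = m f v" "m g g \<le> C * m f f"
      using C f(1) unfolding b_def by auto
    have gK: "m g g \<le> K * m f f"
      using g(3) f(2) by (smt (verit) K_def mult_right_mono)
    \<comment> \<open>Testing the equation for \<open>g\<close> with \<open>f\<close> bounds \<open>m f f\<close> by the small number \<open>b f f\<close>.\<close>
    have "(m f f)\<^sup>2 \<le> b g g * b f f"
      using b.Cauchy_Schwarz[OF g(1) f(1)] g(2)[OF f(1)] by simp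
    also have "\<dots> = m f g * b f f" using g by simp
    also have "m f g \<le> K * m f f"
    proof -
      have "(m f g)\<^sup>2 \<le> m f f * m g g" by (rule m.Cauchy_Schwarz[OF f(1) g(1)])
      also have "\<dots> \<le> m f f * (K * m f f)" using gK f(2) by (intro mult_left_mono) auto
      also have "\<dots> \<le> (K * m f f)\<^sup>2"
      proof -
        have "K * 1 \<le> K * K" unfolding K_def by (intro mult_left_mono) auto
        then have "K * (m f f)\<^sup>2 \<le> (K * K) * (m f f)\<^sup>2" by (intro mult_right_mono) auto
        then show ?thesis by (simp add: power2_eq_square mult_ac)
      qed
      finally show ?thesis using f(2) by (smt (verit) K_def mult_nonneg_nonneg power2_le_imp_le)
    qed
    then have "m f g * b f f \<le> (K * m f f) * (m f f / (2 * K))"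
      using bf b.nonneg[OF f(1)] f(2) by (intro mult_mono) (auto simp: K_def)
    also have "\<dots> = (m f f)\<^sup>2 / 2"
    proof -
      have "K \<noteq> 0" by (simp add: K_def)
      then show ?thesis by (simp add: power2_eq_square)
    qed
    finally show False using f(2) by simp
  qed
  then show ?thesis using \<open>\<nu> < \<mu>\<close> by blast
qed

end

section \<open>Forms that are coercive modulo finitely many functionals\<close>

text \<open>
  On the common kernel of the functionals \<open>l j\<close>, a subspace of codimension at most \<open>N\<close>, the
  form \<open>a\<close> is bounded below by \<open>M\<close>. All results concern spectral parameters below \<open>M\<close>.
\<close>

locale coercive_modulo = form_pair D a m
  for D :: "('x \<Rightarrow> real) set" and a m +
  fixes l :: "nat \<Rightarrow> ('x \<Rightarrow> real) \<Rightarrow> real" and N :: nat and L M :: real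
  assumes lin: "\<And>j. j < N \<Longrightarrow> linear_on D (l j)"
    and bounded: "\<And>j v. j < N \<Longrightarrow> v \<in> D \<Longrightarrow> (l j v)\<^sup>2 \<le> L * (a v v + m v v)"
    and coercive: "\<And>v. v \<in> D \<Longrightarrow> M * m v v \<le> a v v + (\<Sum>j<N. (l j v)\<^sup>2)"
    and complete: "complete_wrt D (\<lambda>f g. a f g + m f g)"
begin

text \<open>
  Adding the squares of the functionals turns \<open>a - \<nu> m\<close> into a coercive form; the difference
  of the two has finite rank.
\<close>

definition shifted :: "real \<Rightarrow> ('x \<Rightarrow> real) \<Rightarrow> ('x \<Rightarrow> real) \<Rightarrow> real" where
  "shifted \<nu> f g = a f g + (\<Sum>j<N. l j f * l j g) - \<nu> * m f g"

text \<open>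
  Coercivity controls only \<open>m\<close>. A small portion \<open>\<theta>\<close> of \<open>a\<close> is kept back to control \<open>a\<close> as
  well, at the cost of replacing \<open>M\<close> by \<open>(1 - \<theta>) M\<close>, which is still above \<open>\<nu>\<close>.
\<close>

lemma shifted_lower:
  assumes "\<nu> < M"
  shows "\<exists>\<kappa>>0. \<forall>v\<in>D. \<kappa> * (a v v + m v v) \<le> shifted \<nu> v v"
proof -
  \<comment> \<open>\<open>M\<close> may be negative or zero, hence the \<open>\<bar>M\<bar> + 1\<close>.\<close>
  define \<theta> where "\<theta> = min (1/2) ((M - \<nu>) / (2 * (\<bar>M\<bar> + 1)))"
  have \<theta>: "0 < \<theta>" "\<theta> \<le> 1/2"
    using assms unfolding \<theta>_def by (simp, intro min.cobounded1)
  have "\<theta> * \<bar>M\<bar> \<le> (M - \<nu>) / (2 * (\<bar>M\<bar> + 1)) * (\<bar>M\<bar> + 1)"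
    using assms by (intro mult_mono) (auto simp: \<theta>_def)
  also have "\<dots> = (M - \<nu>) / 2" by (simp add: field_simps)
  finally have M: "(1 - \<theta>) * M - \<nu> \<ge> (M - \<nu>) / 2"
    using mult_left_mono[OF abs_ge_self[of M] less_imp_le[OF \<theta>(1)]] by (simp add: left_diff_distrib)
  define \<kappa> where "\<kappa> = min \<theta> ((M - \<nu>) / 2)"
  have "\<kappa> > 0" using \<theta> assms by (simp add: \<kappa>_def)
  moreover have "\<kappa> * (a v v + m v v) \<le> shifted \<nu> v v" if v: "v \<in> D" for v
  proof -
    define q where "q = (\<Sum>j<N. (l j v)\<^sup>2)"
    have q: "0 \<le> q" "M * m v v \<le> a v v + q"
      using coercive[OF v] by (auto simp: q_def sum_nonneg)
    have "\<kappa> * a v v \<le> \<theta> * a v v"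
      using a.nonneg[OF v] by (intro mult_right_mono) (auto simp: \<kappa>_def)
    moreover have "\<kappa> * m v v \<le> ((1 - \<theta>) * M - \<nu>) * m v v"
      using m.nonneg[OF v] order_trans[OF min.cobounded2 M] unfolding \<kappa>_def by (intro mult_right_mono)
    moreover have "(1 - \<theta>) * (M * m v v) \<le> (1 - \<theta>) * (a v v + q)"
      using q \<theta> by (intro mult_left_mono) auto
    moreover have "0 \<le> \<theta> * q" using q \<theta> by simp
    ultimately show ?thesis
      unfolding shifted_def power2_eq_square[symmetric] q_def[symmetric] by (simp add: algebra_simps)
  qed
  ultimately show ?thesis by blast
qed

lemma shifted_upper: "\<exists>C. \<forall>v\<in>D. shifted \<nu> v v \<le> C * (a v v + m v v)"
proof (intro exI ballI)
  fix v assume v: "v \<in> D"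
  have "(\<Sum>j<N. (l j v)\<^sup>2) \<le> (\<Sum>j<N. L * (a v v + m v v))"
    using bounded v by (intro sum_mono) auto
  moreover have "- \<nu> * m v v \<le> \<bar>\<nu>\<bar> * m v v" using m.nonneg[OF v] by (intro mult_right_mono) auto
  moreover have "0 \<le> \<bar>\<nu>\<bar> * a v v" using a.nonneg[OF v] by simp
  ultimately show "shifted \<nu> v v \<le> (1 + real N * L + \<bar>\<nu>\<bar>) * (a v v + m v v)"
    using m.nonneg[OF v] unfolding shifted_def power2_eq_square[symmetric] by (simp add: algebra_simps)
qed

lemma symmetric_form_shifted: "symmetric_form D (shifted \<nu>)"
proof
  fix h assume h: "h \<in> D"
  show "linear_on D (\<lambda>f. shifted \<nu> f h)"
    unfolding linear_on_def
  proof (intro ballI allI)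
    fix f g c d assume fg: "f \<in> D" "g \<in> D"
    have "(\<Sum>j<N. l j (\<lambda>x. c * f x + d * g x) * l j h) = (\<Sum>j<N. c * (l j f * l j h) + d * (l j g * l j h))"
      using fg by (intro sum.cong) (auto simp: linear_onD[OF lin] algebra_simps)
    then show "shifted \<nu> (\<lambda>x. c * f x + d * g x) h = c * shifted \<nu> f h + d * shifted \<nu> g h"
      unfolding shifted_def linear_onD[OF a.linear[OF h] fg] linear_onD[OF m.linear[OF h] fg]
      by (simp add: sum.distrib sum_distrib_left algebra_simps)
  qed
next
  show "shifted \<nu> f g = shifted \<nu> g f" if "f \<in> D" "g \<in> D" for f g
    using that by (simp add: shifted_def a.sym m.sym mult.commute[of "l _ f"])
qed

lemma shifted_representation:
  assumes "\<nu> < M" "linear_on D \<phi>" "0 \<le> C" "\<And>v. v \<in> D \<Longrightarrow> (\<phi> v)\<^sup>2 \<le> C * (a v v + m v v)"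
  shows "\<exists>u\<in>D. \<forall>v\<in>D. shifted \<nu> u v = \<phi> v"
proof -
  obtain \<kappa> where \<kappa>: "\<kappa> > 0" "\<And>v. v \<in> D \<Longrightarrow> \<kappa> * (a v v + m v v) \<le> shifted \<nu> v v"
    using shifted_lower[OF assms(1)] by blast
  obtain C' where C': "\<And>v. v \<in> D \<Longrightarrow> shifted \<nu> v v \<le> C' * (a v v + m v v)"
    using shifted_upper by blast
  have X: "0 \<le> a v v + m v v" if "v \<in> D" for v using a.nonneg[OF that] m.nonneg[OF that] by simp
  interpret symmetric_form D "shifted \<nu>" by (rule symmetric_form_shifted)
  interpret nonneg_form D "shifted \<nu>"
  proof
    show "0 \<le> shifted \<nu> v v" if "v \<in> D" for v
      using \<kappa>(2)[OF that] X[OF that] \<kappa>(1) by (meson mult_nonneg_nonneg order_trans less_imp_le)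
  qed
  show ?thesis
  proof (rule Riesz_representation)
    show "complete_wrt D (shifted \<nu>)"
      using complete_wrt_equivalent[OF a.function_space_axioms complete \<kappa>(1)] \<kappa>(2) C' X by blast
    show "(\<phi> v)\<^sup>2 \<le> (C / \<kappa>) * shifted \<nu> v v" if "v \<in> D" for v
    proof -
      have "(\<phi> v)\<^sup>2 \<le> C * (a v v + m v v)" by (rule assms(4)[OF that])
      also have "\<dots> = (C / \<kappa>) * (\<kappa> * (a v v + m v v))" using \<kappa>(1) by simp
      also have "\<dots> \<le> (C / \<kappa>) * shifted \<nu> v v"
        using \<kappa> that assms(3) by (intro mult_left_mono) auto
      finally show ?thesis .
    qed
  qed (use assms \<kappa> in auto)
qed

lemma eigenfunction_null:
  assumes "\<nu> < M" "f \<in> D" "\<And>v. v \<in> D \<Longrightarrow> a f v = \<nu> * m f v" "\<And>j. j < N \<Longrightarrow> l j f = 0"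
  shows "m f f = 0"
proof -
  have "M * m f f \<le> \<nu> * m f f" using coercive[OF assms(2)] assms by simp
  then have "(M - \<nu>) * m f f \<le> 0" by (simp add: algebra_simps)
  then show ?thesis using assms(1) m.nonneg[OF assms(2)] by (simp add: mult_le_0_iff)
qed

text \<open>
  Represent the right-hand side \<open>\<phi>\<close> and the functionals \<open>l j\<close> with respect to the coercive
  form as \<open>p\<close> and \<open>r j\<close>. Then \<open>u\<close> solves the equation if and only if \<open>u = p + \<Sum>j. c j * r j\<close>
  with \<open>c j = l j u\<close>, and these conditions form a square linear system for \<open>c\<close>. A nontrivial
  solution of the homogeneous system is an eigenfunction, so that the system is uniquely
  solvable if there is none.
\<close>

theorem Fredholm_alternative:
  assumes "\<nu> < M"
    and no_eigenfunction: "\<And>f. f \<in> D \<Longrightarrow> (\<And>v. v \<in> D \<Longrightarrow> a f v = \<nu> * m f v) \<Longrightarrow> m f f = 0"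
  shows "\<exists>C. \<forall>\<phi> B. linear_on D \<phi> \<and> 0 \<le> B \<and> (\<forall>v\<in>D. (\<phi> v)\<^sup>2 \<le> B * m v v) \<longrightarrow>
    (\<exists>u\<in>D. (\<forall>v\<in>D. a u v - \<nu> * m u v = \<phi> v) \<and> m u u \<le> C * B)"
proof -
  obtain \<kappa> where \<kappa>: "\<kappa> > 0" "\<And>v. v \<in> D \<Longrightarrow> \<kappa> * (a v v + m v v) \<le> shifted \<nu> v v"
    using shifted_lower[OF assms(1)] by blast
  interpret sh: symmetric_form D "shifted \<nu>" by (rule symmetric_form_shifted)
  have X: "0 \<le> a v v" "0 \<le> m v v" if "v \<in> D" for v using a.nonneg[OF that] m.nonneg[OF that] by auto
  have "\<exists>r. \<forall>j. j < N \<longrightarrow> r j \<in> D \<and> (\<forall>v\<in>D. shifted \<nu> (r j) v = l j v)"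
  proof (rule choice, intro allI)
    show "\<exists>u. j < N \<longrightarrow> u \<in> D \<and> (\<forall>v\<in>D. shifted \<nu> u v = l j v)" for j
    proof (cases "j < N")
      case True
      have "(l j v)\<^sup>2 \<le> \<bar>L\<bar> * (a v v + m v v)" if "v \<in> D" for v
        using bounded[OF True that] X[OF that] by (smt (verit) mult_right_mono)
      then have "\<exists>u\<in>D. \<forall>v\<in>D. shifted \<nu> u v = l j v"
        by (intro shifted_representation[OF assms(1) lin[OF True], of "\<bar>L\<bar>"]) auto
      then show ?thesis by blast
    qed auto
  qed
  then obtain r where r: "\<And>j. j < N \<Longrightarrow> r j \<in> D" "\<And>j v. j < N \<Longrightarrow> v \<in> D \<Longrightarrow> shifted \<nu> (r j) v = l j v"
    by blast
  \<comment> \<open>If \<open>c\<close> are the values of the functionals at the solution \<open>u\<close>, then \<open>u\<close> is the sum of the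
    \<open>shifted\<close>-representative \<open>p\<close> of the right-hand side and the combination of the \<open>r j\<close>
    with coefficients \<open>c\<close>; this gives a linear system for \<open>c\<close>.\<close>
  define R where "R c = (\<lambda>x. \<Sum>j<N. c j * r j x)" for c
  have R: "R c \<in> D" for c unfolding R_def using r(1) by (intro a.sum_mem) auto
  have lR: "l i (R c) = (\<Sum>j<N. c j * l i (r j))" if "i < N" for i c
    unfolding R_def using r(1) that by (intro a.linear_on_sum lin) auto
  have shR: "shifted \<nu> (R c) v = (\<Sum>j<N. c j * l j v)" if "v \<in> D" for c v
  proof -
    have "shifted \<nu> (R c) v = (\<Sum>j<N. c j * shifted \<nu> (r j) v)"
      unfolding R_def using r(1) that by (intro a.linear_on_sum[where l = "\<lambda>f. shifted \<nu> f v"] sh.linear) auto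
    also have "\<dots> = (\<Sum>j<N. c j * l j v)" using r(2) that by (intro sum.cong) auto
    finally show ?thesis .
  qed
  \<comment> \<open>The matrix of the system: \<open>B c\<close> is the defect of \<open>l i (R c) = c i\<close>.\<close>
  define B where "B i j = (if i = j then 1 else 0) - l i (r j)" for i j
  have B: "(\<Sum>j<N. B i j * c j) = c i - l i (R c)" if "i < N" for i c
  proof -
    have "(\<Sum>j<N. B i j * c j) = (\<Sum>j<N. (if i = j then c j else 0)) - (\<Sum>j<N. c j * l i (r j))"
      unfolding B_def sum_subtractf[symmetric] by (intro sum.cong) (auto simp: algebra_simps)
    then show ?thesis using that by (simp add: lR)
  qed
  have inj: "c j = 0" if c: "\<And>i. i < N \<Longrightarrow> (\<Sum>j<N. B i j * c j) = 0" and j: "j < N" for c j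
  proof -
    have lc: "l i (R c) = c i" if "i < N" for i using c[OF that] B[OF that] by simp
    have eig: "a (R c) v = \<nu> * m (R c) v" if "v \<in> D" for v
    proof -
      have "(\<Sum>j<N. l j (R c) * l j v) = (\<Sum>j<N. c j * l j v)"
        by (intro sum.cong) (auto simp: lc)
      then show ?thesis using shR[OF that, of c] by (simp add: shifted_def)
    qed
    have m0: "m (R c) (R c) = 0" using no_eigenfunction[OF R] eig by blast
    then have "a (R c) (R c) = 0" using eig[OF R] by simp
    then have "(c j)\<^sup>2 \<le> 0" using bounded[OF j R, of c] m0 lc[OF j] by simp
    then show ?thesis by simp
  qed
  obtain K where K: "K \<ge> 0" "\<And>d. \<exists>c. (\<forall>i<N. (\<Sum>j<N. B i j * c j) = d i) \<and> (\<forall>j<N. \<bar>c j\<bar> \<le> K * (\<Sum>i<N. \<bar>d i\<bar>))"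
    using injective_system_solvable_bounded[of N B] inj by blast
  \<comment> \<open>The sum of the squares of the coefficients \<open>c\<close> will be at most \<open>K'\<close> times the bound on the right-hand side.\<close>
  define K' where "K' = real N * (K\<^sup>2 * (real N * (real N * (\<bar>L\<bar> / \<kappa>\<^sup>2))))"
  define C where "C = 2 / \<kappa> * (1 / (2 * \<kappa>) + K')"
  have "\<exists>u\<in>D. (\<forall>v\<in>D. a u v - \<nu> * m u v = \<phi> v) \<and> m u u \<le> C * E"
    if \<phi>: "linear_on D \<phi>" and E: "0 \<le> E" and bound: "\<And>v. v \<in> D \<Longrightarrow> (\<phi> v)\<^sup>2 \<le> E * m v v" for \<phi> E
  proof -
    have "(\<phi> v)\<^sup>2 \<le> E * (a v v + m v v)" if "v \<in> D" for v
      using bound[OF that] X[OF that] E by (smt (verit) mult_left_mono)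
    then obtain p where p: "p \<in> D" "\<And>v. v \<in> D \<Longrightarrow> shifted \<nu> p v = \<phi> v"
      using shifted_representation[OF assms(1) \<phi> E] by blast
    define Y where "Y v = a v v + m v v" for v
    have Y0: "0 \<le> Y v" if "v \<in> D" for v using X[OF that] by (simp add: Y_def)
    have \<phi>Y: "2 * \<bar>\<phi> v\<bar> \<le> \<kappa> * Y v + E / \<kappa>" if "v \<in> D" for v
    proof -
      have "(\<phi> v)\<^sup>2 \<le> E * Y v" using bound[OF that] X[OF that] E by (smt (verit) mult_left_mono Y_def)
      also have "E * Y v = (\<kappa> * Y v) * (E / \<kappa>)" using \<kappa>(1) by simp
      finally have "(2 * \<bar>\<phi> v\<bar>)\<^sup>2 \<le> 4 * ((\<kappa> * Y v) * (E / \<kappa>))" by (simp add: power_mult_distrib)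
      also have "4 * (P * Q) \<le> (P + Q)\<^sup>2" for P Q :: real
        using zero_le_power2[of "P - Q"] by (simp add: power2_eq_square algebra_simps)
      finally show ?thesis
        by (rule power2_le_imp_le) (use Y0[OF that] E \<kappa>(1) in auto)
    qed
    have "\<kappa> * Y p \<le> \<phi> p" using \<kappa>(2)[OF p(1)] p by (simp add: Y_def)
    then have "\<kappa> * Y p \<le> E / \<kappa>" using \<phi>Y[OF p(1)] by linarith
    then have Yp: "Y p \<le> E / \<kappa>\<^sup>2" using \<kappa>(1) by (simp add: power2_eq_square pos_le_divide_eq mult_ac)
    have lp: "(l i p)\<^sup>2 \<le> \<bar>L\<bar> / \<kappa>\<^sup>2 * E" if "i < N" for i
    proof -
      have "(l i p)\<^sup>2 \<le> L * Y p" using bounded[OF that p(1)] by (simp add: Y_def)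
      also have "\<dots> \<le> \<bar>L\<bar> * (E / \<kappa>\<^sup>2)" using Yp Y0[OF p(1)] by (intro mult_mono) auto
      finally show ?thesis by simp
    qed
    obtain c where c: "\<And>i. i < N \<Longrightarrow> (\<Sum>j<N. B i j * c j) = l i p"
      "\<And>j. j < N \<Longrightarrow> \<bar>c j\<bar> \<le> K * (\<Sum>i<N. \<bar>l i p\<bar>)"
      using K(2)[of "\<lambda>i. l i p"] by blast
    have csum: "(\<Sum>j<N. (c j)\<^sup>2) \<le> K' * E"
    proof -
      have "(\<Sum>i<N. \<bar>l i p\<bar>)\<^sup>2 \<le> real N * (\<Sum>i<N. (\<bar>l i p\<bar>)\<^sup>2)"
        using Cauchy_Schwarz_ineq_sum[of "\<lambda>_. 1" "\<lambda>i. \<bar>l i p\<bar>" "{..<N}"] by simp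
      also have "\<dots> \<le> real N * (\<Sum>i<N. \<bar>L\<bar> / \<kappa>\<^sup>2 * E)"
        using lp by (intro mult_left_mono sum_mono) auto
      finally have S: "(\<Sum>i<N. \<bar>l i p\<bar>)\<^sup>2 \<le> real N * (real N * (\<bar>L\<bar> / \<kappa>\<^sup>2)) * E" by (simp add: mult_ac)
      have "(\<Sum>j<N. (c j)\<^sup>2) \<le> (\<Sum>j<N. K\<^sup>2 * (\<Sum>i<N. \<bar>l i p\<bar>)\<^sup>2)"
      proof (rule sum_mono)
        fix j assume "j \<in> {..<N}"
        then have "(\<bar>c j\<bar>)\<^sup>2 \<le> (K * (\<Sum>i<N. \<bar>l i p\<bar>))\<^sup>2" using c(2) by (intro power_mono) auto
        then show "(c j)\<^sup>2 \<le> K\<^sup>2 * (\<Sum>i<N. \<bar>l i p\<bar>)\<^sup>2" by (simp add: power_mult_distrib)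
      qed
      also have "\<dots> = real N * (K\<^sup>2 * (\<Sum>i<N. \<bar>l i p\<bar>)\<^sup>2)" by simp
      also have "\<dots> \<le> real N * (K\<^sup>2 * (real N * (real N * (\<bar>L\<bar> / \<kappa>\<^sup>2)) * E))"
        using S by (intro mult_left_mono) auto
      also have "\<dots> = K' * E" by (simp add: K'_def mult_ac)
      finally show ?thesis .
    qed
    define u where "u = (\<lambda>x. 1 * p x + 1 * R c x)"
    have u: "u \<in> D" unfolding u_def using p(1) R by (intro a.lin_mem)
    have lu: "l i u = c i" if "i < N" for i
      using linear_onD[OF lin[OF that] p(1) R, of 1 1 c] c(1)[OF that] B[OF that, of c] by (simp add: u_def)
    have shu: "shifted \<nu> u v = \<phi> v + (\<Sum>j<N. c j * l j v)" if "v \<in> D" for v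
      using linear_onD[OF sh.linear[OF that] p(1) R, of 1 1 c] p(2)[OF that] shR[OF that, of c]
      by (simp add: u_def)
    have lsum: "(\<Sum>j<N. l j u * l j v) = (\<Sum>j<N. c j * l j v)" for v
      by (intro sum.cong) (auto simp: lu)
    have sol: "a u v - \<nu> * m u v = \<phi> v" if "v \<in> D" for v
      using shu[OF that] lsum[of v] by (simp add: shifted_def)
    have "\<kappa> * Y u \<le> \<phi> u + (\<Sum>j<N. c j * l j u)" using \<kappa>(2)[OF u] shu[OF u] by (simp add: Y_def)
    also have "(\<Sum>j<N. c j * l j u) = (\<Sum>j<N. (c j)\<^sup>2)"
      by (intro sum.cong) (auto simp: lu power2_eq_square)
    finally have "\<kappa> * Y u \<le> \<phi> u + K' * E" using csum by linarith
    then have "\<kappa> * Y u \<le> 2 * (1 / (2 * \<kappa>) + K') * E" using \<phi>Y[OF u] by (simp add: algebra_simps)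
    then have "Y u \<le> C * E" using \<kappa>(1) by (simp add: C_def field_simps)
    then have "m u u \<le> C * E" using X[OF u] by (simp add: Y_def)
    with u sol show ?thesis by blast
  qed
  then show ?thesis by blast
qed

text \<open>
  More than \<open>N\<close> eigenfunctions for different eigenvalues would have a nontrivial linear
  combination in the kernel of all functionals, where \<open>a \<ge> M m\<close>; but by orthogonality
  \<open>a < M m\<close> on the span of these eigenfunctions.
\<close>

theorem finite_eigenvalues:
  "finite {\<nu>. \<nu> < M \<and> (\<exists>f\<in>D. m f f \<noteq> 0 \<and> (\<forall>v\<in>D. a f v = \<nu> * m f v))}" (is "finite ?S")
proof (rule ccontr)
  assume "infinite ?S"
  then obtain I where I: "I \<subseteq> ?S" "finite I" "card I = Suc N"
    using infinite_arbitrarily_large by blast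
  have "\<forall>\<nu>. \<exists>f. \<nu> \<in> I \<longrightarrow> f \<in> D \<and> m f f \<noteq> 0 \<and> (\<forall>v\<in>D. a f v = \<nu> * m f v)"
    using I(1) by blast
  from choice[OF this] obtain f where f: "\<And>\<nu>. \<nu> \<in> I \<Longrightarrow> f \<nu> \<in> D" "\<And>\<nu>. \<nu> \<in> I \<Longrightarrow> m (f \<nu>) (f \<nu>) \<noteq> 0"
    "\<And>\<nu> v. \<nu> \<in> I \<Longrightarrow> v \<in> D \<Longrightarrow> a (f \<nu>) v = \<nu> * m (f \<nu>) v" by blast
  \<comment> \<open>Eigenfunctions for different eigenvalues are orthogonal with respect to both forms.\<close>
  have orth: "m (f \<nu>) (f \<nu>') = 0" if "\<nu> \<in> I" "\<nu>' \<in> I" "\<nu> \<noteq> \<nu>'" for \<nu> \<nu>'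
  proof -
    have "\<nu> * m (f \<nu>) (f \<nu>') = a (f \<nu>) (f \<nu>')" using f(3)[OF that(1) f(1)[OF that(2)]] by simp
    also have "\<dots> = a (f \<nu>') (f \<nu>)" by (rule a.sym[OF f(1)[OF that(1)] f(1)[OF that(2)]])
    also have "\<dots> = \<nu>' * m (f \<nu>') (f \<nu>)" by (rule f(3)[OF that(2) f(1)[OF that(1)]])
    also have "m (f \<nu>') (f \<nu>) = m (f \<nu>) (f \<nu>')" by (rule m.sym[OF f(1)[OF that(2)] f(1)[OF that(1)]])
    finally have "\<nu> * m (f \<nu>) (f \<nu>') = \<nu>' * m (f \<nu>) (f \<nu>')" .
    then show ?thesis using that(3) by simp
  qed
  obtain c where c: "\<exists>\<nu>\<in>I. c \<nu> \<noteq> 0" "\<And>j. j < N \<Longrightarrow> (\<Sum>\<nu>\<in>I. c \<nu> * l j (f \<nu>)) = 0"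
    using underdetermined_system[of I N "\<lambda>j \<nu>. l j (f \<nu>)"] I by auto
  define u where "u = (\<lambda>x. \<Sum>\<nu>\<in>I. c \<nu> * f \<nu> x)"
  have u: "u \<in> D" unfolding u_def using I f(1) by (intro a.sum_mem) auto
  have lu: "l j u = 0" if "j < N" for j
    unfolding u_def using a.linear_on_sum[OF lin[OF that] I(2), of f c] f(1) c(2)[OF that] by simp
  have mu: "m (f \<nu>) u = c \<nu> * m (f \<nu>) (f \<nu>)" if "\<nu> \<in> I" for \<nu>
  proof -
    have "m (f \<nu>) u = (\<Sum>\<nu>'\<in>I. c \<nu>' * m (f \<nu>) (f \<nu>'))"
      unfolding u_def using I f(1) that
      by (intro a.linear_on_sum[where l = "m (f \<nu>)"] m.linear_right) auto
    also have "\<dots> = (\<Sum>\<nu>'\<in>I. if \<nu>' = \<nu> then c \<nu> * m (f \<nu>) (f \<nu>) else 0)"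
      using orth[OF that] by (intro sum.cong) auto
    finally show ?thesis using I that by simp
  qed
  have auu: "a u u = (\<Sum>\<nu>\<in>I. \<nu> * ((c \<nu>)\<^sup>2 * m (f \<nu>) (f \<nu>)))"
  proof -
    have "a u u = (\<Sum>\<nu>\<in>I. c \<nu> * a (f \<nu>) u)"
      using a.linear_on_sum[OF a.linear[OF u] I(2), of f c] f(1) by (simp add: u_def)
    also have "\<dots> = (\<Sum>\<nu>\<in>I. \<nu> * ((c \<nu>)\<^sup>2 * m (f \<nu>) (f \<nu>)))"
      using f(3) u mu by (intro sum.cong) (auto simp: power2_eq_square)
    finally show ?thesis .
  qed
  have muu: "m u u = (\<Sum>\<nu>\<in>I. (c \<nu>)\<^sup>2 * m (f \<nu>) (f \<nu>))"
  proof -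
    have "m u u = (\<Sum>\<nu>\<in>I. c \<nu> * m (f \<nu>) u)"
      using a.linear_on_sum[OF m.linear[OF u] I(2), of f c] f(1) by (simp add: u_def)
    also have "\<dots> = (\<Sum>\<nu>\<in>I. (c \<nu>)\<^sup>2 * m (f \<nu>) (f \<nu>))"
      using mu by (intro sum.cong) (auto simp: power2_eq_square)
    finally show ?thesis .
  qed
  have pos: "0 < m (f \<nu>) (f \<nu>)" if "\<nu> \<in> I" for \<nu>
    using f(2)[OF that] m.nonneg[OF f(1)[OF that]] by simp
  have "a u u < (\<Sum>\<nu>\<in>I. M * ((c \<nu>)\<^sup>2 * m (f \<nu>) (f \<nu>)))"
    unfolding auu
  proof (rule sum_strict_mono_ex1)
    show "\<forall>\<nu>\<in>I. \<nu> * ((c \<nu>)\<^sup>2 * m (f \<nu>) (f \<nu>)) \<le> M * ((c \<nu>)\<^sup>2 * m (f \<nu>) (f \<nu>))"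
    proof (intro ballI mult_right_mono)
      fix \<nu> assume "\<nu> \<in> I"
      then show "\<nu> \<le> M" "0 \<le> (c \<nu>)\<^sup>2 * m (f \<nu>) (f \<nu>)"
        using I(1) pos[of \<nu>] by (auto intro: less_imp_le)
    qed
    obtain \<nu> where "\<nu> \<in> I" "c \<nu> \<noteq> 0" using c(1) by blast
    then show "\<exists>\<nu>\<in>I. \<nu> * ((c \<nu>)\<^sup>2 * m (f \<nu>) (f \<nu>)) < M * ((c \<nu>)\<^sup>2 * m (f \<nu>) (f \<nu>))"
      using I(1) pos[of \<nu>] by (intro bexI[of _ \<nu>] mult_strict_right_mono) auto
  qed (use I in auto)
  also have "\<dots> = M * m u u" by (simp add: muu sum_distrib_left)
  finally show False using coercive[OF u] lu by simp
qed

end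

text \<open>
  Induction on the number of functionals: a function on which the last functional does not
  vanish spans a complement of its kernel. Equality is relaxed to a predicate \<open>Z\<close>, which will
  be equality to zero almost everywhere.
\<close>

lemma finite_spanning_set:
  fixes l :: "nat \<Rightarrow> ('x \<Rightarrow> real) \<Rightarrow> real"
  assumes "function_space E" "\<And>j. j < N \<Longrightarrow> linear_on E (l j)"
    and null: "\<And>f. f \<in> E \<Longrightarrow> (\<And>j. j < N \<Longrightarrow> l j f = 0) \<Longrightarrow> Z f"
  shows "\<exists>B. finite B \<and> B \<subseteq> E \<and> (\<forall>f\<in>E. \<exists>c. Z (\<lambda>x. f x - (\<Sum>b\<in>B. c b * b x)))"
  using assms
proof (induction N arbitrary: E)
  case 0
  then show ?case by (intro exI[of _ "{}"]) auto
next
  case (Suc N)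
  interpret function_space E by fact
  define E' where "E' = {f \<in> E. l N f = 0}"
  have E': "function_space E'"
  proof
    show "(\<lambda>x. 0) \<in> E'" using zero_mem linear_on_zero[of "l N"] Suc.prems(2) by (simp add: E'_def)
    show "(\<lambda>x. c * f x + d * g x) \<in> E'" if "f \<in> E'" "g \<in> E'" for f g c d
      using that lin_mem linear_onD[of E "l N" f g c d] Suc.prems(2)[of N] by (auto simp: E'_def)
  qed
  have "\<exists>B. finite B \<and> B \<subseteq> E' \<and> (\<forall>f\<in>E'. \<exists>c. Z (\<lambda>x. f x - (\<Sum>b\<in>B. c b * b x)))"
  proof (rule Suc.IH[OF E'])
    show "linear_on E' (l j)" if "j < N" for j
      using Suc.prems(2)[of j] that by (auto simp: linear_on_def E'_def)
    show "Z f" if "f \<in> E'" "\<And>j. j < N \<Longrightarrow> l j f = 0" for f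
      using that by (intro Suc.prems(3)) (auto simp: E'_def less_Suc_eq)
  qed
  then obtain B where B: "finite B" "B \<subseteq> E'" "\<And>f. f \<in> E' \<Longrightarrow> \<exists>c. Z (\<lambda>x. f x - (\<Sum>b\<in>B. c b * b x))"
    by blast
  show ?case
  proof (cases "E' = E")
    case True
    then show ?thesis using B by blast
  next
    case False
    then obtain g where g: "g \<in> E" "l N g \<noteq> 0" by (auto simp: E'_def)
    then have gB: "g \<notin> B" using B(2) by (auto simp: E'_def)
    have "\<exists>c. Z (\<lambda>x. f x - (\<Sum>b\<in>insert g B. c b * b x))" if f: "f \<in> E" for f
    proof -
      define s where "s = l N f / l N g"
      have "l N (\<lambda>x. 1 * f x + (- s) * g x) = 0"
        using linear_onD[of E "l N" f g 1 "- s"] Suc.prems(2)[of N] f g by (simp add: s_def)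
      then have "(\<lambda>x. f x - s * g x) \<in> E'" using lin_mem[OF f g(1), of 1 "- s"] by (simp add: E'_def)
      then obtain c where c: "Z (\<lambda>x. (f x - s * g x) - (\<Sum>b\<in>B. c b * b x))" using B(3) by blast
      have "(\<Sum>b\<in>insert g B. (c(g := s)) b * b x) = s * g x + (\<Sum>b\<in>B. c b * b x)" for x
      proof -
        have "(\<Sum>b\<in>B. (c(g := s)) b * b x) = (\<Sum>b\<in>B. c b * b x)"
          using gB by (intro sum.cong) auto
        then show ?thesis using B(1) gB by simp
      qed
      then show ?thesis using c by (intro exI[of _ "c(g := s)"]) (simp add: diff_diff_eq)
    qed
    then show ?thesis using B g by (intro exI[of _ "insert g B"]) (auto simp: E'_def)
  qed
qed

section \<open>A smooth step function\<close>

text \<open>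
  \<open>n\<close>-fold differentiability, in a recursive form for which closure properties follow by
  induction from the rules for a single derivative.
\<close>

primrec Ck :: "nat \<Rightarrow> (real \<Rightarrow> real) \<Rightarrow> bool" where
  "Ck 0 f = True"
| "Ck (Suc n) f = ((\<forall>x. f field_differentiable (at x)) \<and> Ck n (deriv f))"

lemma Ck_SucI:
  assumes "\<And>x. (f has_field_derivative f' x) (at x)" "Ck n f'"
  shows "Ck (Suc n) f"
proof -
  have "deriv f = f'" using assms(1) by (auto intro!: DERIV_imp_deriv)
  then show ?thesis using assms by (auto simp: field_differentiable_def)
qed

lemma Ck_SucD: "Ck (Suc n) f \<Longrightarrow> Ck n f"
  by (induction n arbitrary: f) auto

lemma Ck_const: "Ck n (\<lambda>x. c)"
  by (induction n arbitrary: c) (auto intro!: Ck_SucI[where f' = "\<lambda>x. 0"] simp del: Ck.simps(2))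

lemma Ck_add: "Ck n f \<Longrightarrow> Ck n g \<Longrightarrow> Ck n (\<lambda>x. f x + g x)"
proof (induction n arbitrary: f g)
  case (Suc n)
  show ?case
  proof (rule Ck_SucI)
    show "((\<lambda>x. f x + g x) has_field_derivative deriv f x + deriv g x) (at x)" for x
      using Suc.prems by (intro DERIV_add field_differentiable_derivI) auto
  qed (use Suc in auto)
qed simp

lemma Ck_mult: "Ck n f \<Longrightarrow> Ck n g \<Longrightarrow> Ck n (\<lambda>x. f x * g x)"
proof (induction n arbitrary: f g)
  case (Suc n)
  show ?case
  proof (rule Ck_SucI)
    show "((\<lambda>x. f x * g x) has_field_derivative deriv f x * g x + deriv g x * f x) (at x)" for x
      using Suc.prems by (intro DERIV_mult field_differentiable_derivI) auto
    show "Ck n (\<lambda>x. deriv f x * g x + deriv g x * f x)"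
      using Suc.prems Suc.prems[THEN Ck_SucD] by (intro Ck_add Suc.IH) auto
  qed
qed simp

lemma Ck_cmult: "Ck n f \<Longrightarrow> Ck n (\<lambda>x. c * f x)"
  by (intro Ck_mult Ck_const)

lemma Ck_inverse: "Ck n f \<Longrightarrow> (\<And>x. f x \<noteq> 0) \<Longrightarrow> Ck n (\<lambda>x. inverse (f x))"
proof (induction n)
  case (Suc n)
  show ?case
  proof (rule Ck_SucI)
    show "((\<lambda>x. inverse (f x)) has_field_derivative - (inverse (f x) * deriv f x * inverse (f x))) (at x)" for x
      using Suc.prems by (intro DERIV_inverse' field_differentiable_derivI) auto
    have "Ck n (\<lambda>x. (- 1) * (inverse (f x) * deriv f x * inverse (f x)))"
      using Suc.prems Suc.prems(1)[THEN Ck_SucD] by (intro Ck_mult Ck_const Suc.IH) auto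
    then show "Ck n (\<lambda>x. - (inverse (f x) * deriv f x * inverse (f x)))" by simp
  qed
qed simp

lemma Ck_affine: "Ck n f \<Longrightarrow> Ck n (\<lambda>x. f (c + d * x))"
proof (induction n arbitrary: f)
  case (Suc n)
  show ?case
  proof (rule Ck_SucI)
    show "((\<lambda>x. f (c + d * x)) has_field_derivative deriv f (c + d * x) * d) (at x)" for x
    proof (rule DERIV_chain2[where f = f and g = "\<lambda>x. c + d * x"])
      show "(f has_real_derivative deriv f (c + d * x)) (at (c + d * x))"
        using Suc.prems by (intro field_differentiable_derivI) auto
      show "((\<lambda>x. c + d * x) has_real_derivative d) (at x)"
        by (auto intro!: derivative_eq_intros)
    qed
    show "Ck n (\<lambda>x. deriv f (c + d * x) * d)"
      using Suc by (intro Ck_mult Ck_const) auto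
  qed
qed simp

lemma Ck_iff: "Ck n f \<longleftrightarrow> (\<forall>m<n. \<forall>x. (deriv ^^ m) f field_differentiable (at x))"
proof (induction n arbitrary: f)
  case (Suc n)
  show ?case by (simp only: Ck.simps Suc.IH All_less_Suc2 funpow_Suc_right o_apply funpow.simps id_apply)
qed simp

definition smooth :: "(real \<Rightarrow> real) \<Rightarrow> bool" where
  "smooth f \<longleftrightarrow> (\<forall>n x. (deriv ^^ n) f field_differentiable (at x))"

lemma smooth_iff_Ck: "smooth f \<longleftrightarrow> (\<forall>n. Ck n f)"
  unfolding smooth_def Ck_iff by (meson lessI)

lemma smooth_add: "smooth f \<Longrightarrow> smooth g \<Longrightarrow> smooth (\<lambda>x. f x + g x)"
  and smooth_mult: "smooth f \<Longrightarrow> smooth g \<Longrightarrow> smooth (\<lambda>x. f x * g x)"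
  and smooth_cmult: "smooth f \<Longrightarrow> smooth (\<lambda>x. c * f x)"
  and smooth_const: "smooth (\<lambda>x. c)"
  and smooth_affine: "smooth f \<Longrightarrow> smooth (\<lambda>x. f (c + d * x))"
  and smooth_inverse: "smooth f \<Longrightarrow> (\<And>x. f x \<noteq> 0) \<Longrightarrow> smooth (\<lambda>x. inverse (f x))"
  by (auto simp: smooth_iff_Ck intro!: Ck_add Ck_mult Ck_const Ck_affine Ck_inverse)

lemma smooth_diff: "smooth f \<Longrightarrow> smooth g \<Longrightarrow> smooth (\<lambda>x. f x - g x)"
  using smooth_add[OF _ smooth_cmult[of g "-1"], of f] by simp

lemma smooth_deriv: "smooth f \<Longrightarrow> smooth (deriv f)"
  by (auto simp: smooth_iff_Ck dest: spec[of _ "Suc _"])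

lemma smooth_has_deriv: "smooth f \<Longrightarrow> (f has_field_derivative deriv f x) (at x)"
  unfolding smooth_def by (metis field_differentiable_derivI funpow_0)

lemma smooth_continuous_on: "smooth f \<Longrightarrow> continuous_on S f"
  by (meson DERIV_continuous continuous_at_imp_continuous_on smooth_has_deriv)

text \<open>
  The derivative of each of these functions is a linear combination of two others
  (\<open>flat_has_deriv\<close>), hence all of them are smooth, including at \<open>0\<close>, where they decay faster
  than any power.
\<close>

definition flat :: "nat \<Rightarrow> real \<Rightarrow> real" where
  "flat m x = (if 0 < x then exp (- 1 / x) / x ^ m else 0)"

lemma flat_tendsto_0: "(flat m \<longlongrightarrow> 0) (at 0)"
proof (rule filterlim_split_at)
  show "(flat m \<longlongrightarrow> 0) (at_left 0)"
    by (rule tendsto_eventually) (auto simp: flat_def eventually_at_filter)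
  have "((\<lambda>x. x ^ m / exp x) \<longlongrightarrow> 0) (at_top :: real filter)" by (rule tendsto_power_div_exp_0)
  then have "((\<lambda>x. inverse x ^ m / exp (inverse x)) \<longlongrightarrow> 0) (at_right (0::real))"
    by (rule filterlim_compose[OF _ filterlim_inverse_at_top_right])
  then show "(flat m \<longlongrightarrow> 0) (at_right 0)"
    by (rule Lim_transform_eventually)
      (auto simp: flat_def eventually_at_filter exp_minus field_simps)
qed

lemma flat_has_deriv: "(flat m has_field_derivative flat (m + 2) x - real m * flat (m + 1) x) (at x)"
proof -
  consider "x > 0" | "x < 0" | "x = 0" by linarith
  then show ?thesis
  proof cases
    case 1
    have "((\<lambda>x. exp (- 1 / x) / x ^ m) has_field_derivative flat (m + 2) x - real m * flat (m + 1) x) (at x)"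
    proof -
      have e: "((\<lambda>x. exp (- 1 / x)) has_field_derivative exp (- 1 / x) / x\<^sup>2) (at x)"
        using 1 by (auto intro!: derivative_eq_intros simp: power2_eq_square)
      have "((\<lambda>x. exp (- 1 / x) / x ^ m) has_field_derivative
          (exp (- 1 / x) / x\<^sup>2 * x ^ m - exp (- 1 / x) * (real m * x ^ (m - Suc 0))) / (x ^ m * x ^ m)) (at x)"
        using 1 by (intro DERIV_divide e DERIV_pow) auto
      also have "(exp (- 1 / x) / x\<^sup>2 * x ^ m - exp (- 1 / x) * (real m * x ^ (m - Suc 0))) / (x ^ m * x ^ m)
          = flat (m + 2) x - real m * flat (m + 1) x"
      proof (cases m)
        case (Suc k)
        have "(F / x\<^sup>2 * (x * y) - F * (r * y)) / ((x * y) * (x * y)) = F / (x * (x * (x * y))) - r * (F / (x * (x * y)))"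
          if "y \<noteq> 0" for F r y :: real
          using 1 that by (simp add: power2_eq_square field_simps)
        from this[of "x ^ k" "exp (- 1 / x)" "real m"] show ?thesis
          using 1 Suc by (simp add: flat_def)
      qed (use 1 in \<open>simp add: flat_def power2_eq_square\<close>)
      finally show ?thesis .
    qed
    then show ?thesis
      by (rule has_field_derivative_transform_within_open[of _ _ _ "{0<..}"]) (use 1 in \<open>auto simp: flat_def\<close>)
  next
    case 2
    have "((\<lambda>x. 0) has_field_derivative 0) (at x)" by simp
    then have "(flat m has_field_derivative 0) (at x)"
      by (rule has_field_derivative_transform_within_open[of _ _ _ "{..<0}"]) (use 2 in \<open>auto simp: flat_def\<close>)
    then show ?thesis using 2 by (simp add: flat_def)
  next
    case 3
    have "((\<lambda>y. (flat m y - flat m 0) / (y - 0)) \<longlongrightarrow> 0) (at 0)"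
      by (rule Lim_transform_eventually[OF flat_tendsto_0[of "m + 1"]])
        (auto simp: flat_def eventually_at_filter)
    then have "(flat m has_field_derivative 0) (at 0)" by (simp add: has_field_derivative_iff)
    then show ?thesis using 3 by (simp add: flat_def)
  qed
qed

lemma smooth_flat: "smooth (flat m)"
proof -
  have "Ck n (flat m)" for n
  proof (induction n arbitrary: m)
    case (Suc n)
    show ?case
    proof (rule Ck_SucI)
      show "(flat m has_field_derivative flat (m + 2) x + (- real m) * flat (m + 1) x) (at x)" for x
        using flat_has_deriv[of m x] by simp
      show "Ck n (\<lambda>x. flat (m + 2) x + (- real m) * flat (m + 1) x)"
        by (intro Ck_add Ck_cmult Suc.IH)
    qed
  qed simp
  then show ?thesis by (simp add: smooth_iff_Ck)
qed

definition step :: "real \<Rightarrow> real" where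
  "step x = flat 0 x * inverse (flat 0 x + flat 0 (1 + (- 1) * x))"

lemma flat_nonneg: "0 \<le> flat 0 x" and flat_pos: "0 < x \<Longrightarrow> 0 < flat 0 x"
  by (auto simp: flat_def)

lemma step_denominator: "0 < flat 0 x + flat 0 (1 + (- 1) * x)"
proof (cases "x > 0")
  case True
  then show ?thesis using flat_pos[of x] flat_nonneg[of "1 + (- 1) * x"] by linarith
next
  case False
  then show ?thesis using flat_pos[of "1 + (- 1) * x"] flat_nonneg[of x] by linarith
qed

lemma smooth_step: "smooth step"
  unfolding step_def[abs_def]
  using step_denominator by (intro smooth_mult smooth_inverse smooth_add smooth_affine smooth_flat) (metis less_irrefl)

lemma step_range: "0 \<le> step x" "step x \<le> 1"
  using step_denominator[of x] flat_nonneg[of x] flat_nonneg[of "1 + (- 1) * x"]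
  by (auto simp: step_def divide_inverse[symmetric])

lemma step_0: "x \<le> 0 \<Longrightarrow> step x = 0"
  by (simp add: step_def flat_def)

lemma step_1: "1 \<le> x \<Longrightarrow> step x = 1"
  using step_denominator[of x] by (simp add: step_def flat_def)

lemma deriv_step_0: "x < 0 \<or> 1 < x \<Longrightarrow> deriv step x = 0"
proof -
  have "deriv step x = 0" if "open S" "x \<in> S" "\<And>y. y \<in> S \<Longrightarrow> step y = c" for S c
  proof -
    have "((\<lambda>x. c) has_field_derivative 0) (at x)" by simp
    then have "(step has_field_derivative 0) (at x)"
      by (rule has_field_derivative_transform_within_open[of _ _ _ S]) (use that in auto)
    then show ?thesis by (rule DERIV_imp_deriv)
  qed
  from this[of "{..<0}" 0] this[of "{1<..}" 1] show "x < 0 \<or> 1 < x \<Longrightarrow> deriv step x = 0"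
    by (auto simp: step_0 step_1)
qed

lemma deriv_step_bounded: "\<exists>C>0. \<forall>x. \<bar>deriv step x\<bar> \<le> C"
proof -
  have "compact (deriv step ` {0..1})"
    by (intro compact_continuous_image smooth_continuous_on smooth_deriv smooth_step) auto
  then obtain B where B: "\<And>x. x \<in> {0..1} \<Longrightarrow> \<bar>deriv step x\<bar> \<le> B"
    by (force dest!: compact_imp_bounded simp: bounded_iff)
  have "\<bar>deriv step x\<bar> \<le> \<bar>B\<bar> + 1" for x
    using B[of x] deriv_step_0[of x] by (cases "x \<in> {0..1}") force+
  then show ?thesis by (intro exI[of _ "\<bar>B\<bar> + 1"]) auto
qed

section \<open>Weak derivatives on open sets of reals\<close>

lemma borel_measurable_indicator_lebesgue [measurable]:
  "A \<in> sets borel \<Longrightarrow> (indicator A :: real \<Rightarrow> real) \<in> borel_measurable lebesgue"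
  by (intro borel_measurable_indicator) simp

text \<open>The condition that \<open>weak_deriv\<close> imposes on a single edge.\<close>

definition weak_derivative_on :: "real set \<Rightarrow> (real \<Rightarrow> real) \<Rightarrow> (real \<Rightarrow> real) \<Rightarrow> bool" where
  "weak_derivative_on I u w \<longleftrightarrow>
     (\<forall>K. compact K \<and> K \<subseteq> I \<longrightarrow> set_integrable lebesgue K u \<and> set_integrable lebesgue K w) \<and>
     (\<forall>\<phi>. smooth \<phi> \<and> (\<exists>K. compact K \<and> K \<subseteq> I \<and> (\<forall>t. t \<notin> K \<longrightarrow> \<phi> t = 0)) \<longrightarrow>
        (LINT t:I|lebesgue. u t * deriv \<phi> t) = - (LINT t:I|lebesgue. w t * \<phi> t))"

lemma scaled_step_deriv:
  "((\<lambda>t. step (s * (t - c))) has_field_derivative s * deriv step (s * (t - c))) (at t)"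
proof -
  have "((\<lambda>t. step (s * (t - c))) has_field_derivative deriv step (s * (t - c)) * s) (at t)"
    by (rule DERIV_chain2[where f = step and g = "\<lambda>t. s * (t - c)", OF smooth_has_deriv[OF smooth_step]])
      (auto intro!: derivative_eq_intros)
  then show ?thesis by (simp add: mult.commute)
qed

lemma smooth_scaled_step: "smooth (\<lambda>t. step (s * (t - c)))"
  using smooth_affine[OF smooth_step, of "- s * c" s] by (simp add: algebra_simps)

lemma scaled_kernel_continuous: "continuous_on S (\<lambda>t. s * deriv step (s * (t - c)))"
proof -
  have "continuous_on S (\<lambda>t. s * deriv step (- s * c + s * t))"
    by (intro continuous_on_mult continuous_on_const smooth_continuous_on smooth_affine smooth_deriv smooth_step)
  then show ?thesis by (simp add: algebra_simps)
qed

lemma lebesgue_integral_continuous: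
  fixes f :: "real \<Rightarrow> real"
  assumes "continuous_on {a..b} f"
  shows "set_integrable lebesgue {a..b} f" "(LINT t:{a..b}|lebesgue. f t) = integral {a..b} f"
proof -
  show 1: "set_integrable lebesgue {a..b} f" by (rule absolutely_integrable_continuous_real[OF assms])
  then show "(LINT t:{a..b}|lebesgue. f t) = integral {a..b} f"
    by (rule set_lebesgue_integral_eq_integral)
qed

text \<open>
  The kernels are supported in \<open>[c, c + 1/n]\<close>, have integral \<open>1\<close> and absolute value at most a
  multiple of \<open>n\<close>; so the integral of \<open>u - u c\<close> against them is bounded by a multiple of the
  oscillation of \<open>u\<close> near \<open>c\<close>.
\<close>

lemma approximate_identity:
  fixes u :: "real \<Rightarrow> real"
  assumes u: "continuous_on {c..c+\<delta>} u" and "\<delta> > 0"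
  shows "(\<lambda>n. LINT t:{c..c+\<delta>}|lebesgue. u t * (real (Suc n) * deriv step (real (Suc n) * (t - c)))) \<longlonglongrightarrow> u c"
proof (rule LIMSEQ_I)
  fix \<epsilon> :: real assume "\<epsilon> > 0"
  obtain C where C: "C > 0" "\<And>x. \<bar>deriv step x\<bar> \<le> C" using deriv_step_bounded by blast
  define \<eta> where "\<eta> = \<epsilon> / (2 * C)"
  have "\<eta> > 0" using C \<open>\<epsilon> > 0\<close> by (simp add: \<eta>_def)
  then obtain d where d: "d > 0" "\<And>t. t \<in> {c..c+\<delta>} \<Longrightarrow> dist t c < d \<Longrightarrow> dist (u t) (u c) < \<eta>"
    using u[unfolded continuous_on_iff, rule_format, of c \<eta>] \<open>\<delta> > 0\<close> by auto
  obtain N where N: "1 / min d \<delta> < real N" using reals_Archimedean2 by blast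
  show "\<exists>N. \<forall>n\<ge>N. norm ((LINT t:{c..c+\<delta>}|lebesgue. u t * (real (Suc n) * deriv step (real (Suc n) * (t - c)))) - u c) < \<epsilon>"
  proof (intro exI[of _ N] allI impI)
    fix n assume "n \<ge> N"
    define s where "s = real (Suc n)"
    have "s > 0" "min d \<delta> > 0" using d(1) \<open>\<delta> > 0\<close> by (auto simp: s_def)
    moreover have "1 / min d \<delta> < s" using N \<open>n \<ge> N\<close> by (simp add: s_def)
    ultimately have "1 / s < min d \<delta>" by (simp only: pos_divide_less_eq mult.commute)
    with \<open>s > 0\<close> have s: "s > 0" "1 / s < d" "1 / s < \<delta>" by auto
    define g where "g t = s * deriv step (s * (t - c))" for t
    have g_cont: "continuous_on S g" for S
      unfolding g_def[abs_def] by (rule scaled_kernel_continuous)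
    have ug_cont: "continuous_on {c..c+\<delta>} (\<lambda>t. u t * g t)" by (intro continuous_on_mult u g_cont)
    have g0: "g t = 0" if "t \<ge> c + 1 / s" "t \<noteq> c + 1 / s" for t
      using that s(1) deriv_step_0[of "s * (t - c)"] by (simp add: g_def field_simps)
    have g_int: "(g has_integral 1) {c..c + 1 / s}"
    proof -
      have "(g has_integral step (s * (c + 1 / s - c)) - step (s * (c - c))) {c..c + 1 / s}"
        unfolding g_def[abs_def] using s(1) scaled_step_deriv
        by (intro fundamental_theorem_of_calculus)
          (auto intro: has_field_derivative_at_within simp: has_real_derivative_iff_has_vector_derivative[symmetric])
      then show ?thesis using s(1) by (simp add: step_0 step_1)
    qed
    have "(LINT t:{c..c+\<delta>}|lebesgue. u t * g t) = integral {c..c+\<delta>} (\<lambda>t. u t * g t)"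
      by (rule lebesgue_integral_continuous[OF ug_cont])
    also have "\<dots> = integral {c..c + 1 / s} (\<lambda>t. u t * g t) + integral {c + 1 / s..c+\<delta>} (\<lambda>t. u t * g t)"
      using s by (intro Henstock_Kurzweil_Integration.integral_combine[symmetric] integrable_continuous_interval ug_cont) auto
    also have "integral {c + 1 / s..c+\<delta>} (\<lambda>t. u t * g t) = 0"
    proof (rule integral_unique, rule has_integral_spike_finite[of "{c + 1 / s}"])
      show "((\<lambda>t. 0) has_integral 0) {c + 1 / s..c+\<delta>}" by simp
    qed (use g0 in auto)
    finally have L: "(LINT t:{c..c+\<delta>}|lebesgue. u t * g t) = integral {c..c + 1 / s} (\<lambda>t. u t * g t)" by simp
    have cont': "continuous_on {c..c + 1 / s} (\<lambda>t. (u t - u c) * g t)"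
      using s by (intro continuous_intros g_cont continuous_on_subset[OF u]) auto
    have "u c = integral {c..c + 1 / s} (\<lambda>t. u c * g t)"
      using integral_unique[OF g_int] by simp
    then have "(LINT t:{c..c+\<delta>}|lebesgue. u t * g t) - u c
      = integral {c..c + 1 / s} (\<lambda>t. u t * g t) - integral {c..c + 1 / s} (\<lambda>t. u c * g t)"
      using L by simp
    also have "\<dots> = integral {c..c + 1 / s} (\<lambda>t. (u t - u c) * g t)"
      unfolding left_diff_distrib using s
      by (intro Henstock_Kurzweil_Integration.integral_diff[symmetric] integrable_continuous_interval
          continuous_intros g_cont continuous_on_subset[OF u]) auto
    also have "norm \<dots> \<le> (\<eta> * (s * C)) * (c + 1 / s - c)"
    proof (rule integral_bound[OF _ cont'])
      show "norm ((u t - u c) * g t) \<le> \<eta> * (s * C)" if t: "t \<in> {c..c + 1 / s}" for t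
      proof -
        have "dist (u t) (u c) < \<eta>" using t s by (intro d) (auto simp: dist_real_def)
        moreover have "\<bar>g t\<bar> \<le> s * C" using C(2) s(1) by (simp add: g_def abs_mult mult_left_mono)
        ultimately show ?thesis
          using s(1) C(1) by (auto simp: abs_mult dist_real_def intro!: mult_mono)
      qed
    qed (use s in auto)
    also have "\<dots> = \<epsilon> / 2" using s(1) C(1) by (simp add: \<eta>_def)
    finally show "norm ((LINT t:{c..c+\<delta>}|lebesgue. u t * (real (Suc n) * deriv step (real (Suc n) * (t - c)))) - u c) < \<epsilon>"
      using \<open>\<epsilon> > 0\<close> unfolding g_def s_def by linarith
  qed
qed

lemma set_integral_eq_on_subset:
  fixes f g :: "real \<Rightarrow> real"
  assumes "K \<subseteq> S" "\<And>t. t \<in> K \<Longrightarrow> f t = g t" "\<And>t. t \<in> S \<Longrightarrow> t \<notin> K \<Longrightarrow> f t = 0"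
  shows "(LINT t:S|M. f t) = (LINT t:K|M. g t)"
  unfolding set_lebesgue_integral_def
  using assms by (intro Bochner_Integration.integral_cong) (auto simp: indicator_def)

lemma set_integrable_times_continuous:
  fixes f g :: "real \<Rightarrow> real"
  assumes K: "compact K" and f: "set_integrable lebesgue K f" and g: "continuous_on K g"
  shows "set_integrable lebesgue K (\<lambda>t. f t * g t)"
proof -
  obtain B where B: "\<And>t. t \<in> K \<Longrightarrow> \<bar>g t\<bar> \<le> B"
    using compact_continuous_image[OF g K] by (force dest!: compact_imp_bounded simp: bounded_iff)
  have fm: "(\<lambda>t. indicator K t * f t) \<in> borel_measurable lebesgue"
    using f unfolding set_integrable_def by (simp add: borel_measurable_integrable)
  have "(\<lambda>t. indicator K t *\<^sub>R g t) \<in> borel_measurable borel"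
    using K g by (intro borel_measurable_continuous_on_indicator) (auto simp: borel_compact)
  then have gm: "(\<lambda>t. indicator K t * g t) \<in> borel_measurable lebesgue"
    by (intro measurable_completion) simp
  have "integrable lebesgue (\<lambda>t. B * (indicator K t * f t))"
    using f unfolding set_integrable_def by simp
  then have "integrable lebesgue (\<lambda>t. (indicator K t * f t) * (indicator K t * g t))"
  proof (rule Bochner_Integration.integrable_bound)
    show "AE t in lebesgue. norm ((indicator K t * f t) * (indicator K t * g t))
        \<le> norm (B * (indicator K t * f t))"
    proof (intro AE_I2)
      fix t
      have "\<bar>f t\<bar> * \<bar>g t\<bar> \<le> \<bar>B\<bar> * \<bar>f t\<bar>" if "t \<in> K"
        using mult_left_mono[OF order_trans[OF B[OF that] abs_ge_self[of B]] abs_ge_zero[of "f t"]]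
        by (simp add: mult.commute)
      then show "norm ((indicator K t * f t) * (indicator K t * g t))
        \<le> norm (B * (indicator K t * f t))"
        by (auto simp: indicator_def abs_mult)
    qed
  qed (intro borel_measurable_times fm gm)
  then show ?thesis unfolding set_integrable_def
    by (rule Bochner_Integration.integrable_cong[THEN iffD1, rotated 2]) (auto simp: indicator_def)
qed

text \<open>
  The test functions \<open>\<phi> n\<close>, differences of two steps, approximate the indicator of \<open>(a, b]\<close>,
  while their derivatives approximate the difference of the point masses at \<open>a\<close> and \<open>b\<close>.
\<close>

theorem weak_derivative_FTC:
  assumes I: "open I" and uw: "weak_derivative_on I u w" and ab: "{a..b} \<subseteq> I" "a \<le> b"
    and u: "continuous_on I u"
  shows "u b - u a = (LINT t:{a..b}|lebesgue. w t)"
proof -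
  obtain e where e: "e > 0" "cball b e \<subseteq> I"
    using I ab by (force simp: open_contains_cball)
  \<comment> \<open>The supports of the test functions reach slightly beyond \<open>b\<close>.\<close>
  define K where "K = {a..b + e}"
  have K: "K \<subseteq> I"
  proof
    fix t assume t: "t \<in> K"
    then show "t \<in> I" using ab e(2) by (cases "t \<le> b") (auto simp: K_def cball_def dist_real_def)
  qed
  have w_int: "set_integrable lebesgue K w"
    using uw K unfolding weak_derivative_on_def K_def by (meson compact_Icc)
  define s where "s n = real (Suc n)" for n
  define k where "k n c t = s n * deriv step (s n * (t - c))" for n c t
  define \<phi> where "\<phi> n t = step (s n * (t - a)) - step (s n * (t - b))" for n t
  have \<phi>_deriv: "deriv (\<phi> n) t = k n a t - k n b t" for n t
    unfolding \<phi>_def[abs_def] k_def by (intro DERIV_imp_deriv DERIV_diff scaled_step_deriv)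
  have s_pos: "s n > 0" for n by (simp add: s_def)
  have uK: "continuous_on K u" by (rule continuous_on_subset[OF u K])
  have k_cont: "continuous_on S (k n c)" for S n c
    unfolding k_def[abs_def] by (rule scaled_kernel_continuous)
  have k0: "k n c t = 0" if "t < c" for n c t
    using that s_pos[of n] deriv_step_0[of "s n * (t - c)"] by (simp add: k_def mult_pos_neg)
  obtain N where N: "1 / e < real N" using reals_Archimedean2 by blast
  have large: "1 < s n * e" if "n \<ge> N" for n
  proof -
    have "1 / e < s n" using N that by (simp add: s_def)
    then show ?thesis using e(1) by (simp add: field_simps)
  qed
  have outside: "1 < s n * (t - b)" "1 < s n * (t - a)" if "n \<ge> N" "t > b + e" for n t
  proof -
    have "s n * e \<le> s n * (t - b)" "s n * (t - b) \<le> s n * (t - a)"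
      using that ab s_pos[of n] by (auto intro!: mult_left_mono)
    then show "1 < s n * (t - b)" "1 < s n * (t - a)" using large[OF that(1)] by linarith+
  qed
  have \<phi>_out: "\<phi> n t = 0" if "n \<ge> N" "t \<notin> K" for n t
  proof (cases "t < a")
    case True
    then have "s n * (t - a) \<le> 0" "s n * (t - b) \<le> 0"
      using s_pos[of n] ab by (auto intro!: mult_nonneg_nonpos)
    then show ?thesis by (simp add: \<phi>_def step_0)
  next
    case False
    then show ?thesis using that outside[of n t] by (auto simp: \<phi>_def step_1 K_def)
  qed
  have eq: "(LINT t:K|lebesgue. u t * k n a t) - (LINT t:{b..b+e}|lebesgue. u t * k n b t)
      = - (LINT t:K|lebesgue. w t * \<phi> n t)" if n: "n \<ge> N" for n
  proof -
    have "smooth (\<phi> n)" unfolding \<phi>_def[abs_def] by (intro smooth_diff smooth_scaled_step)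
    then have "(LINT t:I|lebesgue. u t * deriv (\<phi> n) t) = - (LINT t:I|lebesgue. w t * \<phi> n t)"
      using uw K \<phi>_out[OF n] unfolding weak_derivative_on_def K_def by (meson compact_Icc)
    moreover have "(LINT t:I|lebesgue. w t * \<phi> n t) = (LINT t:K|lebesgue. w t * \<phi> n t)"
      using K \<phi>_out[OF n] by (intro set_integral_eq_on_subset) auto
    moreover have "(LINT t:I|lebesgue. u t * deriv (\<phi> n) t) = (LINT t:K|lebesgue. u t * k n a t - u t * k n b t)"
    proof (rule set_integral_eq_on_subset[OF K])
      show "u t * deriv (\<phi> n) t = 0" if "t \<notin> K" for t
      proof (cases "t < a")
        case True
        then show ?thesis using k0[of t a n] k0[of t b n] ab by (simp add: \<phi>_deriv)
      next
        case False
        then show ?thesis using outside[OF n, of t] that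
          by (auto simp: \<phi>_deriv k_def K_def deriv_step_0)
      qed
    qed (auto simp: \<phi>_deriv algebra_simps)
    moreover have "\<dots> = (LINT t:K|lebesgue. u t * k n a t) - (LINT t:K|lebesgue. u t * k n b t)"
      using uK k_cont unfolding K_def
      by (intro set_integral_diff lebesgue_integral_continuous continuous_on_mult) auto
    moreover have "(LINT t:K|lebesgue. u t * k n b t) = (LINT t:{b..b+e}|lebesgue. u t * k n b t)"
      using ab k0[of _ b n] by (intro set_integral_eq_on_subset) (auto simp: K_def)
    ultimately show ?thesis by linarith
  qed
  have "(\<lambda>n. LINT t:{a..a + (b + e - a)}|lebesgue. u t * (real (Suc n) * deriv step (real (Suc n) * (t - a)))) \<longlonglongrightarrow> u a"
    using uK e(1) ab by (intro approximate_identity) (auto simp: K_def)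
  moreover have "(\<lambda>n. LINT t:{b..b+e}|lebesgue. u t * (real (Suc n) * deriv step (real (Suc n) * (t - b)))) \<longlonglongrightarrow> u b"
    using e(1) ab by (intro approximate_identity continuous_on_subset[OF uK]) (auto simp: K_def)
  ultimately have lim1: "(\<lambda>n. (LINT t:K|lebesgue. u t * k n a t) - (LINT t:{b..b+e}|lebesgue. u t * k n b t)) \<longlonglongrightarrow> u a - u b"
    unfolding k_def s_def K_def by (intro tendsto_diff) auto
  have \<phi>_lim: "(\<lambda>n. \<phi> n t) \<longlonglongrightarrow> indicator {a<..b} t" for t
  proof -
    have st: "(\<lambda>n. step (s n * (t - c))) \<longlonglongrightarrow> indicator {c<..} t" for c
    proof (cases "t > c")
      case True
      obtain N where N: "1 / (t - c) < real N" using reals_Archimedean2 by blast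
      have "step (s n * (t - c)) = 1" if "n \<ge> N" for n
      proof -
        have "1 / (t - c) < s n" using N that by (simp add: s_def)
        then have "1 < s n * (t - c)" using True by (simp add: field_simps)
        then show ?thesis by (simp add: step_1)
      qed
      then have "\<forall>\<^sub>F n in sequentially. step (s n * (t - c)) = 1" by (auto simp: eventually_sequentially)
      then show ?thesis using True by (simp add: tendsto_eventually)
    next
      case False
      then have "step (s n * (t - c)) = 0" for n using s_pos[of n] by (intro step_0 mult_nonneg_nonpos) auto
      then show ?thesis using False by simp
    qed
    have "(\<lambda>n. \<phi> n t) \<longlonglongrightarrow> indicator {a<..} t - indicator {b<..} t"
      unfolding \<phi>_def by (intro tendsto_diff st)
    also have "indicator {a<..} t - indicator {b<..} t = (indicator {a<..b} t :: real)"
      using ab by (auto simp: indicator_def)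
    finally show ?thesis .
  qed
  have lim2: "(\<lambda>n. LINT t:K|lebesgue. w t * \<phi> n t) \<longlonglongrightarrow> (LINT t:K|lebesgue. w t * indicator {a<..b} t)"
    unfolding set_lebesgue_integral_def real_scaleR_def
  proof (rule integral_dominated_convergence[where w = "\<lambda>t. \<bar>indicator K t * w t\<bar>"])
    have wm: "(\<lambda>t. indicator K t * w t) \<in> borel_measurable lebesgue"
      using w_int unfolding set_integrable_def by (simp add: borel_measurable_integrable)
    have \<phi>_cont: "continuous_on UNIV (\<phi> n)" for n
      unfolding \<phi>_def[abs_def] by (intro smooth_continuous_on smooth_diff smooth_scaled_step)
    have \<phi>m: "\<phi> n \<in> borel_measurable lebesgue" for n
      by (intro measurable_completion) (simp add: borel_measurable_continuous_onI[OF \<phi>_cont[of n]])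
    have im: "(\<lambda>t. indicator {a<..b} t :: real) \<in> borel_measurable lebesgue"
      using borel_measurable_indicator_lebesgue[of "{a<..b}"] by simp
    show "(\<lambda>t. indicator K t * (w t * indicator {a<..b} t)) \<in> borel_measurable lebesgue"
      using borel_measurable_times[OF wm im] by (simp add: mult.assoc)
    show "(\<lambda>t. indicator K t * (w t * \<phi> n t)) \<in> borel_measurable lebesgue" for n
      using borel_measurable_times[OF wm \<phi>m] by (simp add: mult.assoc)
    show "integrable lebesgue (\<lambda>t. \<bar>indicator K t * w t\<bar>)"
      using w_int unfolding set_integrable_def by (simp add: integrable_abs)
    show "AE t in lebesgue. (\<lambda>n. indicator K t * (w t * \<phi> n t)) \<longlonglongrightarrow> indicator K t * (w t * indicator {a<..b} t)"
      by (intro AE_I2 tendsto_intros \<phi>_lim)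
    show "AE t in lebesgue. norm (indicator K t * (w t * \<phi> n t)) \<le> \<bar>indicator K t * w t\<bar>" for n
    proof (intro AE_I2)
      fix t
      have "\<bar>\<phi> n t\<bar> \<le> 1"
        using step_range[of "s n * (t - a)"] step_range[of "s n * (t - b)"] by (auto simp: \<phi>_def)
      then have "\<bar>indicator K t * w t\<bar> * \<bar>\<phi> n t\<bar> \<le> \<bar>indicator K t * w t\<bar> * 1"
        by (intro mult_left_mono) auto
      then show "norm (indicator K t * (w t * \<phi> n t)) \<le> \<bar>indicator K t * w t\<bar>"
        by (simp add: abs_mult mult.assoc)
    qed
  qed
  have "(LINT t:K|lebesgue. w t * indicator {a<..b} t) = (LINT t:{a<..b}|lebesgue. w t)"
    using e ab by (intro set_integral_eq_on_subset) (auto simp: K_def indicator_def)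
  also have "\<dots> = (LINT t:{a..b}|lebesgue. w t)"
    unfolding set_lebesgue_integral_def
  proof (rule integral_cong_AE)
    have *: "set_integrable lebesgue A w" if "A \<subseteq> K" "A \<in> sets lebesgue" for A
      using set_integrable_subset[OF w_int] that by blast
    show "(\<lambda>t. indicator {a<..b} t *\<^sub>R w t) \<in> borel_measurable lebesgue"
      "(\<lambda>t. indicator {a..b} t *\<^sub>R w t) \<in> borel_measurable lebesgue"
    proof -
      have "{a<..b} \<subseteq> K" "{a..b} \<subseteq> K" using e(1) by (auto simp: K_def)
      then show "(\<lambda>t. indicator {a<..b} t *\<^sub>R w t) \<in> borel_measurable lebesgue"
        "(\<lambda>t. indicator {a..b} t *\<^sub>R w t) \<in> borel_measurable lebesgue"
        using *[of "{a<..b}"] *[of "{a..b}"] unfolding set_integrable_def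
        by (auto intro: borel_measurable_integrable)
    qed
    have "AE t in lebesgue. t \<noteq> a" by (rule AE_not_in[of "{a}", simplified]) auto
    then show "AE t in lebesgue. indicator {a<..b} t *\<^sub>R w t = indicator {a..b} t *\<^sub>R w t"
      by eventually_elim (auto simp: indicator_def)
  qed
  finally have "(\<lambda>n. - (LINT t:K|lebesgue. w t * \<phi> n t)) \<longlonglongrightarrow> - (LINT t:{a..b}|lebesgue. w t)"
    using lim2 by (intro tendsto_minus) simp
  then have "(\<lambda>n. (LINT t:K|lebesgue. u t * k n a t) - (LINT t:{b..b+e}|lebesgue. u t * k n b t))
      \<longlonglongrightarrow> - (LINT t:{a..b}|lebesgue. w t)"
    by (rule Lim_transform_eventually)
      (unfold eventually_sequentially, intro exI[of _ N] allI impI, rule eq[symmetric])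
  from LIMSEQ_unique[OF this lim1] show ?thesis by simp
qed

text \<open>
  The positive and the negative part of \<open>f\<close> are densities of two finite measures that agree on
  all half-lines, hence everywhere.
\<close>

lemma AE_zero_if_tail_integrals_zero:
  fixes f :: "real \<Rightarrow> real"
  assumes f: "integrable lebesgue f" and zero: "\<And>x. (LINT t:{x<..}|lebesgue. f t) = 0"
  shows "AE t in lebesgue. f t = 0"
proof -
  obtain g where g: "g \<in> borel_measurable lborel" "AE t in lborel. f t = g t"
    using completion_ex_borel_measurable_real[OF borel_measurable_integrable[OF f]] by auto
  have [measurable]: "g \<in> borel_measurable borel" using g(1) by simp
  have g_ae: "AE t in lebesgue. f t = g t" using g(2) by (rule AE_completion)
  have gi: "integrable lborel g"
  proof -
    have "integrable lebesgue g"
      using f g_ae g(1) borel_measurable_integrable[OF f] measurable_completion[OF g(1)]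
      by (subst integrable_cong_AE[of _ _ f]) auto
    then show ?thesis using g(1) by (simp add: integrable_completion)
  qed
  have gz: "(LINT t:{x<..}|lborel. g t) = 0" for x
  proof -
    have "(LINT t:{x<..}|lborel. g t) = (LINT t:{x<..}|lebesgue. g t)"
      unfolding set_lebesgue_integral_def by (rule integral_completion[symmetric]) simp
    also have "\<dots> = (LINT t:{x<..}|lebesgue. f t)"
      unfolding set_lebesgue_integral_def
      using g_ae borel_measurable_integrable[OF f] measurable_completion[OF g(1)]
      by (intro integral_cong_AE borel_measurable_scaleR borel_measurable_indicator_lebesgue) auto
    finally show ?thesis using zero by simp
  qed
  define P where "P = density lborel (\<lambda>t. ennreal (max 0 (g t)))"
  define Q where "Q = density lborel (\<lambda>t. ennreal (max 0 (- g t)))"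
  have int: "integrable lborel (\<lambda>t. indicator {x<..} t * max 0 (g t))"
    "integrable lborel (\<lambda>t. indicator {x<..} t * max 0 (- g t))" for x
    using gi by (auto intro!: integrable_real_mult_indicator simp: mult.commute[of "indicator _ _"])
  have P: "emeasure P {x<..} = ennreal (LINT t|lborel. indicator {x<..} t * max 0 (g t))" for x
  proof -
    have "emeasure P {x<..} = (\<integral>\<^sup>+t. ennreal (indicator {x<..} t * max 0 (g t)) \<partial>lborel)"
      unfolding P_def by (subst emeasure_density) (auto intro!: nn_integral_cong simp: indicator_def)
    also have "\<dots> = ennreal (LINT t|lborel. indicator {x<..} t * max 0 (g t))"
      by (rule nn_integral_eq_integral[OF int(1)]) auto
    finally show ?thesis .
  qed
  have Q: "emeasure Q {x<..} = ennreal (LINT t|lborel. indicator {x<..} t * max 0 (- g t))" for x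
  proof -
    have "emeasure Q {x<..} = (\<integral>\<^sup>+t. ennreal (indicator {x<..} t * max 0 (- g t)) \<partial>lborel)"
      unfolding Q_def by (subst emeasure_density) (auto intro!: nn_integral_cong simp: indicator_def)
    also have "\<dots> = ennreal (LINT t|lborel. indicator {x<..} t * max 0 (- g t))"
      by (rule nn_integral_eq_integral[OF int(2)]) auto
    finally show ?thesis .
  qed
  have "(LINT t|lborel. indicator {x<..} t * max 0 (g t)) = (LINT t|lborel. indicator {x<..} t * max 0 (- g t))" for x
  proof -
    have "(LINT t|lborel. indicator {x<..} t * max 0 (g t)) - (LINT t|lborel. indicator {x<..} t * max 0 (- g t))
        = (LINT t|lborel. indicator {x<..} t * max 0 (g t) - indicator {x<..} t * max 0 (- g t))"
      by (rule Bochner_Integration.integral_diff[symmetric, OF int])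
    also have "\<dots> = (LINT t:{x<..}|lborel. g t)"
      unfolding set_lebesgue_integral_def by (intro Bochner_Integration.integral_cong) (auto simp: max_def)
    finally show ?thesis using gz by simp
  qed
  then have "P = Q" by (intro measure_eqI_lessThan) (auto simp: P Q, auto simp: P_def Q_def)
  then have "AE t in lborel. ennreal (max 0 (g t)) = ennreal (max 0 (- g t))"
    unfolding P_def Q_def
    by (rule sigma_finite_measure.density_unique[OF sigma_finite_lborel, rotated 2]) auto
  then have "AE t in lborel. g t = 0"
    by eventually_elim (auto simp: max_def split: if_splits)
  then have "AE t in lebesgue. g t = 0" by (rule AE_completion)
  with g_ae show ?thesis by eventually_elim simp
qed

lemma open_rational_cover:
  fixes I :: "real set"
  assumes "open I"
  shows "\<exists>R. countable R \<and> (\<forall>K\<in>R. \<exists>p q. p \<le> q \<and> K = {p..q}) \<and> I = \<Union>R"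
proof (intro exI conjI)
  define R where "R = (\<lambda>(p, q). {p..q}) ` {(p, q). p \<in> \<rat> \<and> q \<in> \<rat> \<and> p \<le> q \<and> {p..q} \<subseteq> I}"
  have "countable {(p, q). p \<in> \<rat> \<and> q \<in> \<rat> \<and> p \<le> q \<and> {p..q} \<subseteq> I}"
    by (rule countable_subset[of _ "\<rat> \<times> \<rat>"]) (auto simp: countable_rat)
  then show "countable R" by (simp add: R_def)
  show "\<forall>K\<in>R. \<exists>p q. p \<le> q \<and> K = {p..q}" by (auto simp: R_def)
  show "I = \<Union>R"
  proof
    show "I \<subseteq> \<Union>R"
    proof
      fix t assume "t \<in> I"
      then obtain e where e: "e > 0" "ball t e \<subseteq> I" using assms open_contains_ball by blast
      obtain p where p: "p \<in> \<rat>" "t - e < p" "p < t" using Rats_dense_in_real[of "t - e" t] e by auto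
      obtain q where q: "q \<in> \<rat>" "t < q" "q < t + e" using Rats_dense_in_real[of t "t + e"] e by auto
      have "{p..q} \<subseteq> ball t e" using p q by (auto simp: dist_real_def)
      then have "(p, q) \<in> {(p, q). p \<in> \<rat> \<and> q \<in> \<rat> \<and> p \<le> q \<and> {p..q} \<subseteq> I}" "t \<in> {p..q}"
        using p q e(2) by auto
      then have "{p..q} \<in> R" "t \<in> {p..q}" unfolding R_def by force+
      then show "t \<in> \<Union>R" by blast
    qed
  qed (auto simp: R_def)
qed

lemma AE_zero_if_interval_integrals_zero:
  fixes f :: "real \<Rightarrow> real"
  assumes I: "open I"
    and int: "\<And>a b. a \<le> b \<Longrightarrow> {a..b} \<subseteq> I \<Longrightarrow> set_integrable lebesgue {a..b} f"
    and zero: "\<And>a b. a \<le> b \<Longrightarrow> {a..b} \<subseteq> I \<Longrightarrow> (LINT t:{a..b}|lebesgue. f t) = 0"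
  shows "AE t in lebesgue. t \<in> I \<longrightarrow> f t = 0"
proof -
  have local: "AE t in lebesgue. t \<in> {a..b} \<longrightarrow> f t = 0" if ab: "a \<le> b" "{a..b} \<subseteq> I" for a b
  proof -
    define g where "g t = indicator {a..b} t * f t" for t
    have "AE t in lebesgue. g t = 0"
    proof (rule AE_zero_if_tail_integrals_zero)
      show gi: "integrable lebesgue g" using int[OF ab] by (simp add: set_integrable_def g_def[abs_def])
      show "(LINT t:{x<..}|lebesgue. g t) = 0" for x
      proof (cases "b \<le> x")
        case True
        then have "indicator {x<..} t *\<^sub>R g t = 0" for t by (auto simp: g_def indicator_def)
        then show ?thesis by (simp only: set_lebesgue_integral_def) simp
      next
        case False
        define c where "c = max a x"
        have c: "c \<le> b" "{c..b} \<subseteq> I" using False ab by (auto simp: c_def)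
        have "(LINT t:{x<..}|lebesgue. g t) = (LINT t:{c..b}|lebesgue. f t)"
          unfolding set_lebesgue_integral_def
        proof (rule integral_cong_AE)
          show "(\<lambda>t. indicator {x<..} t *\<^sub>R g t) \<in> borel_measurable lebesgue"
            using borel_measurable_integrable[OF gi]
            by (intro borel_measurable_scaleR borel_measurable_indicator_lebesgue) auto
          show "(\<lambda>t. indicator {c..b} t *\<^sub>R f t) \<in> borel_measurable lebesgue"
            using int[OF c] unfolding set_integrable_def by (rule borel_measurable_integrable)
          have "AE t in lebesgue. t \<noteq> x" by (rule AE_not_in[of "{x}", simplified]) auto
          then show "AE t in lebesgue. indicator {x<..} t *\<^sub>R g t = indicator {c..b} t *\<^sub>R f t"
            by eventually_elim (auto simp: g_def c_def indicator_def)
        qed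
        then show ?thesis using zero[OF c] by simp
      qed
    qed
    then show ?thesis by eventually_elim (auto simp: g_def)
  qed
  obtain R where R: "countable R" "\<And>J. J \<in> R \<Longrightarrow> \<exists>p q. p \<le> q \<and> J = {p..q}" "I = \<Union>R"
    using open_rational_cover[OF I] by blast
  have "AE t in lebesgue. t \<in> J \<longrightarrow> f t = 0" if J: "J \<in> R" for J
  proof -
    obtain p q where "p \<le> q" "J = {p..q}" using R(2)[OF J] by blast
    then show ?thesis using local[of p q] R(3) J by auto
  qed
  then have "AE t in lebesgue. \<forall>J\<in>R. t \<in> J \<longrightarrow> f t = 0"
    using R(1) by (intro AE_ball_countable')
  then show ?thesis by eventually_elim (use R(3) in blast)
qed

theorem weak_derivative_unique:
  assumes I: "open I" and u: "continuous_on I u"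
    and w: "weak_derivative_on I u w" and w': "weak_derivative_on I u w'"
  shows "AE t in lebesgue. t \<in> I \<longrightarrow> w t = w' t"
proof -
  have int: "set_integrable lebesgue {a..b} w" "set_integrable lebesgue {a..b} w'" if "{a..b} \<subseteq> I" for a b
    using w w' that unfolding weak_derivative_on_def by (meson compact_Icc)+
  have "AE t in lebesgue. t \<in> I \<longrightarrow> w t - w' t = 0"
  proof (rule AE_zero_if_interval_integrals_zero[OF I])
    fix a b :: real assume ab: "a \<le> b" "{a..b} \<subseteq> I"
    show "set_integrable lebesgue {a..b} (\<lambda>t. w t - w' t)" using int[OF ab(2)] by (rule set_integral_diff)
    have "(LINT t:{a..b}|lebesgue. w t - w' t) = (LINT t:{a..b}|lebesgue. w t) - (LINT t:{a..b}|lebesgue. w' t)"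
      using int[OF ab(2)] by (rule set_integral_diff)
    then show "(LINT t:{a..b}|lebesgue. w t - w' t) = 0"
      using weak_derivative_FTC[OF I w ab(2,1) u] weak_derivative_FTC[OF I w' ab(2,1) u] by simp
  qed
  then show ?thesis by simp
qed

lemma Cauchy_Schwarz_interval:
  fixes w :: "real \<Rightarrow> real"
  assumes "a < b" and w: "set_integrable lebesgue {a..b} w"
    and w2: "set_integrable lebesgue {a..b} (\<lambda>t. (w t)\<^sup>2)"
  shows "(LINT t:{a..b}|lebesgue. w t)\<^sup>2 \<le> (b - a) * (LINT t:{a..b}|lebesgue. (w t)\<^sup>2)"
proof -
  define S where "S = (LINT t:{a..b}|lebesgue. w t)"
  define Q where "Q = (LINT t:{a..b}|lebesgue. (w t)\<^sup>2)"
  define c where "c = S / (b - a)"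
  have const: "set_integrable lebesgue {a..b} (\<lambda>t. c\<^sup>2)"
    "(LINT t:{a..b}|lebesgue. c\<^sup>2) = c\<^sup>2 * (b - a)"
    using lebesgue_integral_continuous[of a b "\<lambda>t. c\<^sup>2"] \<open>a < b\<close> by auto
  have cw: "set_integrable lebesgue {a..b} (\<lambda>t. (2 * c) * w t)" using w by simp
  have "0 \<le> (LINT t:{a..b}|lebesgue. (w t - c)\<^sup>2)"
    unfolding set_lebesgue_integral_def by (intro Bochner_Integration.integral_nonneg) auto
  also have "\<dots> = (LINT t:{a..b}|lebesgue. ((w t)\<^sup>2 - (2 * c) * w t) + c\<^sup>2)"
    by (simp add: power2_diff algebra_simps)
  also have "\<dots> = (LINT t:{a..b}|lebesgue. (w t)\<^sup>2 - (2 * c) * w t) + c\<^sup>2 * (b - a)"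
    using set_integral_add(2)[OF set_integral_diff(1)[OF w2 cw] const(1)] const(2) by simp
  also have "\<dots> = Q - 2 * c * S + c\<^sup>2 * (b - a)"
    using set_integral_diff(2)[OF w2 cw] by (simp add: Q_def S_def)
  also have "\<dots> = Q - S\<^sup>2 / (b - a)"
    using \<open>a < b\<close> by (simp add: c_def power2_eq_square)
  finally show ?thesis using \<open>a < b\<close> unfolding S_def[symmetric] Q_def[symmetric]
    by (simp add: pos_divide_le_eq mult.commute)
qed

lemma set_integral_mono_set_nonneg:
  fixes f :: "real \<Rightarrow> real"
  assumes "set_integrable lebesgue B f" "A \<in> sets lebesgue" "A \<subseteq> B" "\<And>t. 0 \<le> f t"
  shows "(LINT t:A|lebesgue. f t) \<le> (LINT t:B|lebesgue. f t)"
  unfolding set_lebesgue_integral_def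
  using assms set_integrable_subset[OF assms(1-3)]
  by (intro integral_mono) (auto simp: set_integrable_def indicator_def)

text \<open>
  The closed interval may have end points outside \<open>I\<close>, where only the continuity of \<open>u\<close> is at
  hand: this is the situation at the vertices of an edge.
\<close>

locale weak_derivative_interval =
  fixes I :: "real set" and u w :: "real \<Rightarrow> real" and a b :: real
  assumes I: "open I" and uw: "weak_derivative_on I u w"
    and u_cont: "continuous_on I u" and u_cont_closed: "continuous_on {a..b} u"
    and ab: "a < b" "{a<..<b} \<subseteq> I"
    and w2: "set_integrable lebesgue {a<..<b} (\<lambda>t. (w t)\<^sup>2)"
begin

abbreviation W :: real where "W \<equiv> (LINT t:{a<..<b}|lebesgue. (w t)\<^sup>2)"

lemma W_nonneg: "0 \<le> W"
  unfolding set_lebesgue_integral_def by (intro Bochner_Integration.integral_nonneg) auto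

lemma Hoelder_interior:
  assumes "x \<in> {a<..<b}" "y \<in> {a<..<b}"
  shows "(u x - u y)\<^sup>2 \<le> (b - a) * W"
proof -
  have *: "(u y - u x)\<^sup>2 \<le> (b - a) * W" if "x < y" "a < x" "y < b" for x y
  proof -
    have sub: "{x..y} \<subseteq> {a<..<b}" "{x..y} \<subseteq> I" using that ab by auto
    have "set_integrable lebesgue {x..y} w"
      using uw sub(2) unfolding weak_derivative_on_def by (meson compact_Icc)
    moreover have "set_integrable lebesgue {x..y} (\<lambda>t. (w t)\<^sup>2)"
      using set_integrable_subset[OF w2 _ sub(1)] by auto
    ultimately have "(LINT t:{x..y}|lebesgue. w t)\<^sup>2 \<le> (y - x) * (LINT t:{x..y}|lebesgue. (w t)\<^sup>2)"
      using that(1) by (intro Cauchy_Schwarz_interval)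
    also have "\<dots> \<le> (b - a) * W"
    proof (intro mult_mono set_integral_mono_set_nonneg[OF w2])
      show "0 \<le> (LINT t:{x..y}|lebesgue. (w t)\<^sup>2)"
        unfolding set_lebesgue_integral_def by (intro Bochner_Integration.integral_nonneg) auto
    qed (use that sub in auto)
    finally show ?thesis using weak_derivative_FTC[OF I uw sub(2) _ u_cont] that(1) by simp
  qed
  consider "x < y" | "y < x" | "x = y" by linarith
  then show ?thesis
  proof cases
    case 1
    then show ?thesis using *[of x y] assms by (simp add: power2_commute)
  next
    case 3
    then show ?thesis using ab W_nonneg by simp
  qed (use *[of y x] assms in auto)
qed

text \<open>
  The estimate extends from the open interval to its closure by continuity of \<open>u\<close>, one
  variable at a time.
\<close>

lemma Hoelder:
  assumes "x \<in> {a..b}" "y \<in> {a..b}"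
  shows "(u x - u y)\<^sup>2 \<le> (b - a) * W"
proof -
  have cl: "closure {a<..<b} = {a..b}" using ab by simp
  have cont: "continuous_on (closure {a<..<b}) (\<lambda>x. (u x - u z)\<^sup>2)" for z
    unfolding cl by (intro continuous_intros u_cont_closed)
  have 1: "(u x - u z)\<^sup>2 \<le> (b - a) * W" if "z \<in> {a<..<b}" for z
  proof (rule continuous_le_on_closure[OF cont])
    show "x \<in> closure {a<..<b}" using assms(1) by (simp only: cl)
    show "(u t - u z)\<^sup>2 \<le> (b - a) * W" if "t \<in> {a<..<b}" for t
      using that \<open>z \<in> {a<..<b}\<close> by (rule Hoelder_interior)
  qed
  have "(u y - u x)\<^sup>2 \<le> (b - a) * W"
  proof (rule continuous_le_on_closure[OF cont])
    show "y \<in> closure {a<..<b}" using assms(2) by (simp only: cl)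
    show "(u t - u x)\<^sup>2 \<le> (b - a) * W" if "t \<in> {a<..<b}" for t
      using 1[OF that] by (subst power2_commute)
  qed
  then show ?thesis by (simp add: power2_commute)
qed

lemma u2_integrable: "set_integrable lebesgue {a<..<b} (\<lambda>t. (u t)\<^sup>2)"
proof -
  have "set_integrable lebesgue {a..b} (\<lambda>t. (u t)\<^sup>2)"
    by (intro lebesgue_integral_continuous continuous_intros u_cont_closed)
  then show ?thesis by (rule set_integrable_subset) auto
qed

lemma integral_const_interior: "(LINT t:{a<..<b}|lebesgue. c) = c * (b - a)"
  "set_integrable lebesgue {a<..<b} (\<lambda>t. c :: real)"
proof -
  have "set_integrable lebesgue {a..b} (\<lambda>t. c :: real)" by (intro lebesgue_integral_continuous continuous_intros)
  then show "set_integrable lebesgue {a<..<b} (\<lambda>t. c :: real)" by (rule set_integrable_subset) auto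
  show "(LINT t:{a<..<b}|lebesgue. c) = c * (b - a)"
    using ab by (simp add: set_lebesgue_integral_def)
qed

lemma pointwise_square:
  assumes "x \<in> {a..b}" "y \<in> {a..b}"
  shows "(u x)\<^sup>2 \<le> 2 * (u y)\<^sup>2 + 2 * ((b - a) * W)"
proof -
  have "(u x)\<^sup>2 \<le> 2 * (u y)\<^sup>2 + 2 * (u x - u y)\<^sup>2"
    using zero_le_power2[of "u x - 2 * u y"] by (simp add: power2_eq_square algebra_simps)
  then show ?thesis using Hoelder[OF assms] by linarith
qed

text \<open>Averaging over \<open>y\<close> the estimate of \<open>u x\<close> by \<open>u y\<close> and the oscillation.\<close>

theorem sup_estimate:
  assumes "x \<in> {a..b}"
  shows "(u x)\<^sup>2 \<le> 2 / (b - a) * (LINT t:{a<..<b}|lebesgue. (u t)\<^sup>2) + 2 * (b - a) * W"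
proof -
  have u2: "set_integrable lebesgue {a<..<b} (\<lambda>t. 2 * (u t)\<^sup>2)"
    by (rule set_integrable_mult_right[OF u2_integrable])
  have "(LINT t:{a<..<b}|lebesgue. (u x)\<^sup>2) \<le> (LINT t:{a<..<b}|lebesgue. 2 * (u t)\<^sup>2 + 2 * ((b - a) * W))"
  proof (rule set_integral_mono[OF integral_const_interior(2) set_integral_add(1)[OF u2 integral_const_interior(2)]])
    show "(u x)\<^sup>2 \<le> 2 * (u t)\<^sup>2 + 2 * ((b - a) * W)" if "t \<in> {a<..<b}" for t
      using that by (intro pointwise_square[OF assms]) auto
  qed
  also have "\<dots> = (LINT t:{a<..<b}|lebesgue. 2 * (u t)\<^sup>2) + 2 * ((b - a) * W) * (b - a)"
    by (simp only: set_integral_add(2)[OF u2 integral_const_interior(2)] integral_const_interior(1))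
  also have "(LINT t:{a<..<b}|lebesgue. 2 * (u t)\<^sup>2) = 2 * (LINT t:{a<..<b}|lebesgue. (u t)\<^sup>2)"
    by (rule set_integral_mult_right)
  finally have "(u x)\<^sup>2 * (b - a) \<le> 2 * (LINT t:{a<..<b}|lebesgue. (u t)\<^sup>2) + 2 * ((b - a) * W) * (b - a)"
    by (simp only: integral_const_interior(1))
  then show ?thesis using ab(1) by (simp add: field_simps)
qed

text \<open>
  A Poincare inequality in which the value at any point of the interval replaces the mean.
  Unlike the mean, a point value is a bounded functional on \<open>H\<^sup>1\<close> only, which is where the
  functionals of \<open>Fredholm_alternative\<close> have to be bounded.
\<close>

theorem Poincare_estimate:
  assumes "x \<in> {a..b}"
  shows "(LINT t:{a<..<b}|lebesgue. (u t)\<^sup>2) \<le> 2 * (b - a) * (u x)\<^sup>2 + 2 * (b - a)\<^sup>2 * W"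
proof -
  have "(LINT t:{a<..<b}|lebesgue. (u t)\<^sup>2) \<le> (LINT t:{a<..<b}|lebesgue. 2 * (u x)\<^sup>2 + 2 * ((b - a) * W))"
  proof (rule set_integral_mono[OF u2_integrable integral_const_interior(2)])
    show "(u t)\<^sup>2 \<le> 2 * (u x)\<^sup>2 + 2 * ((b - a) * W)" if "t \<in> {a<..<b}" for t
      using that by (intro pointwise_square[OF _ assms]) auto
  qed
  then show ?thesis by (simp only: integral_const_interior(1)) (simp add: power2_eq_square algebra_simps)
qed

end

section \<open>The edgewise Lebesgue measure\<close>

lemma open_edge_int: "open (edge_int G e)"
proof -
  have "edge_int G e = {0<..} \<inter> (\<lambda>t. ereal t) -` {..<elen G e}" by (auto simp: edge_int_def)
  moreover have "open ((\<lambda>t. ereal t) -` {..<elen G e})"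
    by (intro open_vimage continuous_intros open_lessThan)
  ultimately show ?thesis by (simp add: open_Int)
qed

lemma edge_int_lebesgue [measurable]: "edge_int G e \<in> sets lebesgue"
  using open_edge_int[of G e] by simp

lemma space_graph_measure [simp]: "space (graph_measure G) = points G"
  by (simp add: graph_measure_def space_measure_of_conv)

lemma EPt_in_points: "e \<in> edges G \<Longrightarrow> t \<in> edge_int G e \<Longrightarrow> EPt e t \<in> points G"
  by (auto simp: points_def)

lemma measurable_EPt:
  assumes "e \<in> edges G"
  shows "EPt e \<in> measurable (restrict_space lebesgue (edge_int G e)) (graph_measure G)"
proof (rule measurableI)
  show "EPt e t \<in> space (graph_measure G)" if "t \<in> space (restrict_space lebesgue (edge_int G e))" for t
    using that assms by (auto simp: space_restrict_space intro: EPt_in_points)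
  fix A assume A: "A \<in> sets (graph_measure G)"
  have "EPt e -` A \<inter> space (restrict_space lebesgue (edge_int G e)) = {t \<in> edge_int G e. EPt e t \<in> A}"
    by (auto simp: space_restrict_space)
  moreover have "{t \<in> edge_int G e. EPt e t \<in> A} \<in> sets lebesgue"
    using A assms by (simp add: sets_graph_measure)
  ultimately show "EPt e -` A \<inter> space (restrict_space lebesgue (edge_int G e))
      \<in> sets (restrict_space lebesgue (edge_int G e))"
    by (subst sets_restrict_space_iff) auto
qed

lemma EPt_image_sets:
  assumes "e \<in> edges G" "J \<in> sets lebesgue" "J \<subseteq> edge_int G e"
  shows "EPt e ` J \<in> sets (graph_measure G)"
proof -
  have *: "{t \<in> edge_int G e'. EPt e' t \<in> EPt e ` J} = (if e' = e then J else {})" for e'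
    using assms(3) by auto
  have "{t \<in> edge_int G e'. EPt e' t \<in> EPt e ` J} \<in> sets lebesgue" for e'
    unfolding * using assms by simp
  moreover have "EPt e ` J \<subseteq> points G" using assms by (auto intro: EPt_in_points)
  ultimately show ?thesis unfolding sets_graph_measure by blast
qed

lemma emeasure_edge_part:
  assumes "e \<in> edges G" "A \<in> sets (graph_measure G)"
  shows "emeasure (graph_measure G) (EPt e ` edge_int G e \<inter> A) = emeasure lebesgue {t \<in> edge_int G e. EPt e t \<in> A}"
proof -
  let ?c = "emeasure lebesgue {t \<in> edge_int G e. EPt e t \<in> A}"
  have "EPt e ` edge_int G e \<inter> A \<in> sets (graph_measure G)"
    using assms by (intro sets.Int EPt_image_sets) auto
  then have "emeasure (graph_measure G) (EPt e ` edge_int G e \<inter> A)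
      = (\<integral>\<^sup>+ e'. emeasure lebesgue {t \<in> edge_int G e'. EPt e' t \<in> EPt e ` edge_int G e \<inter> A} \<partial>count_space (edges G))"
    by (rule emeasure_graph_measure)
  also have "\<dots> = (\<integral>\<^sup>+ e'. ?c * indicator {e} e' \<partial>count_space (edges G))"
  proof (rule nn_integral_cong)
    fix e'
    have "{t \<in> edge_int G e'. EPt e' t \<in> EPt e ` edge_int G e \<inter> A}
        = (if e' = e then {t \<in> edge_int G e. EPt e t \<in> A} else {})" by auto
    then show "emeasure lebesgue {t \<in> edge_int G e'. EPt e' t \<in> EPt e ` edge_int G e \<inter> A} = ?c * indicator {e} e'"
      by auto
  qed
  also have "\<dots> = ?c * emeasure (count_space (edges G)) {e}"
    using assms(1) by (intro nn_integral_cmult_indicator) auto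
  finally show ?thesis using assms(1) by simp
qed

text \<open>Transports integration along an edge to integration over the graph and back.\<close>

lemma distr_EPt:
  assumes e: "e \<in> edges G"
  shows "distr (restrict_space lebesgue (edge_int G e)) (graph_measure G) (EPt e)
    = density (graph_measure G) (indicator (EPt e ` edge_int G e))"
proof (rule measure_eqI)
  fix A assume "A \<in> sets (distr (restrict_space lebesgue (edge_int G e)) (graph_measure G) (EPt e))"
  then have A: "A \<in> sets (graph_measure G)" by simp
  have E: "EPt e ` edge_int G e \<in> sets (graph_measure G)" using e by (intro EPt_image_sets) auto
  have "EPt e -` A \<inter> space (restrict_space lebesgue (edge_int G e)) = {t \<in> edge_int G e. EPt e t \<in> A}"
    by (auto simp: space_restrict_space)
  then have "emeasure (distr (restrict_space lebesgue (edge_int G e)) (graph_measure G) (EPt e)) A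
      = emeasure (restrict_space lebesgue (edge_int G e)) {t \<in> edge_int G e. EPt e t \<in> A}"
    by (simp add: emeasure_distr[OF measurable_EPt[OF e] A])
  also have "\<dots> = emeasure lebesgue {t \<in> edge_int G e. EPt e t \<in> A}"
    by (rule emeasure_restrict_space) auto
  also have "\<dots> = emeasure (graph_measure G) (EPt e ` edge_int G e \<inter> A)"
    by (rule emeasure_edge_part[OF e A, symmetric])
  also have "\<dots> = (\<integral>\<^sup>+x. indicator (EPt e ` edge_int G e) x * indicator A x \<partial>graph_measure G)"
  proof -
    have "emeasure (graph_measure G) (EPt e ` edge_int G e \<inter> A)
        = (\<integral>\<^sup>+x. indicator (EPt e ` edge_int G e \<inter> A) x \<partial>graph_measure G)"
      using E A by (intro nn_integral_indicator[symmetric]) auto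
    then show ?thesis by (simp only: indicator_inter_arith)
  qed
  also have "\<dots> = emeasure (density (graph_measure G) (indicator (EPt e ` edge_int G e))) A"
    using E A by (intro emeasure_density[symmetric]) auto
  finally show "emeasure (distr (restrict_space lebesgue (edge_int G e)) (graph_measure G) (EPt e)) A
    = emeasure (density (graph_measure G) (indicator (EPt e ` edge_int G e))) A" .
qed simp

theorem integral_edge_part:
  fixes f :: "('v, 'e) gpoint \<Rightarrow> real"
  assumes e: "e \<in> edges G" and J: "J \<in> sets lebesgue" "J \<subseteq> edge_int G e"
    and f: "f \<in> borel_measurable (graph_measure G)"
  shows "set_integrable (graph_measure G) (EPt e ` J) f \<longleftrightarrow> set_integrable lebesgue J (\<lambda>t. f (EPt e t))"
    and "(LINT x:EPt e ` J|graph_measure G. f x) = (LINT t:J|lebesgue. f (EPt e t))"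
proof -
  let ?M = "graph_measure G" and ?I = "edge_int G e"
  let ?N = "restrict_space lebesgue ?I"
  define g where "g x = indicator (EPt e ` J) x * f x" for x
  have [measurable]: "EPt e ` J \<in> sets ?M" "EPt e ` ?I \<in> sets ?M"
    using e J by (auto intro!: EPt_image_sets)
  have g [measurable]: "g \<in> borel_measurable ?M" unfolding g_def[abs_def] using f by measurable
  have ind: "indicator ?I t *\<^sub>R g (EPt e t) = indicator J t *\<^sub>R f (EPt e t)" for t
    using J by (auto simp: g_def indicator_def)
  have dens: "density ?M (indicator (EPt e ` ?I)) = density ?M (\<lambda>x. ennreal (indicator (EPt e ` ?I) x))"
    by (intro density_cong) (auto simp: indicator_def)
  have gi: "indicator (EPt e ` ?I) x * g x = g x" for x
    using J by (auto simp: g_def indicator_def)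
  have "set_integrable ?M (EPt e ` J) f \<longleftrightarrow> integrable ?M g"
    by (simp add: set_integrable_def g_def[abs_def])
  also have "\<dots> \<longleftrightarrow> integrable (density ?M (indicator (EPt e ` ?I))) g"
    unfolding dens by (subst integrable_density) (auto simp: gi)
  also have "\<dots> \<longleftrightarrow> integrable ?N (\<lambda>t. g (EPt e t))"
    unfolding distr_EPt[OF e, symmetric] by (rule integrable_distr_eq[OF measurable_EPt[OF e] g])
  also have "\<dots> \<longleftrightarrow> integrable lebesgue (\<lambda>t. indicator ?I t *\<^sub>R g (EPt e t))"
    by (rule integrable_restrict_space) simp
  finally show "set_integrable ?M (EPt e ` J) f \<longleftrightarrow> set_integrable lebesgue J (\<lambda>t. f (EPt e t))"
    by (simp only: ind set_integrable_def)
  have "(LINT x:EPt e ` J|?M. f x) = (LINT x|?M. g x)"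
    by (simp add: set_lebesgue_integral_def g_def)
  also have "\<dots> = (LINT x|density ?M (indicator (EPt e ` ?I)). g x)"
    unfolding dens by (subst integral_density) (auto simp: gi)
  also have "\<dots> = (LINT t|?N. g (EPt e t))"
    unfolding distr_EPt[OF e, symmetric] by (rule integral_distr[OF measurable_EPt[OF e] g])
  also have "\<dots> = (LINT t|lebesgue. indicator ?I t *\<^sub>R g (EPt e t))"
    by (rule integral_restrict_space) simp
  finally show "(LINT x:EPt e ` J|?M. f x) = (LINT t:J|lebesgue. f (EPt e t))"
    by (simp only: ind set_lebesgue_integral_def)
qed

text \<open>
  Vertices carry no mass, so that null sets can be recognised on the edges one at a time.
\<close>

theorem AE_graph_measure_iff:
  "(AE x in graph_measure G. P x) \<longleftrightarrow> (\<forall>e\<in>edges G. AE t in lebesgue. t \<in> edge_int G e \<longrightarrow> P (EPt e t))"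
proof
  assume "AE x in graph_measure G. P x"
  then obtain N where N: "{x \<in> points G. \<not> P x} \<subseteq> N" "N \<in> null_sets (graph_measure G)"
    by (auto elim!: AE_E3 simp: eventually_ae_filter)
  show "\<forall>e\<in>edges G. AE t in lebesgue. t \<in> edge_int G e \<longrightarrow> P (EPt e t)"
  proof
    fix e assume e: "e \<in> edges G"
    have sets: "N \<in> sets (graph_measure G)" using N(2) by auto
    have "emeasure lebesgue {t \<in> edge_int G e. EPt e t \<in> N} = emeasure (graph_measure G) (EPt e ` edge_int G e \<inter> N)"
      by (rule emeasure_edge_part[OF e sets, symmetric])
    also have "\<dots> \<le> emeasure (graph_measure G) N" by (intro emeasure_mono sets) auto
    finally have "{t \<in> edge_int G e. EPt e t \<in> N} \<in> null_sets lebesgue"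
      using N(2) sets e by (auto simp: null_sets_def sets_graph_measure)
    then show "AE t in lebesgue. t \<in> edge_int G e \<longrightarrow> P (EPt e t)"
      by (rule AE_I') (use N(1) e in \<open>auto intro: EPt_in_points\<close>)
  qed
next
  assume "\<forall>e\<in>edges G. AE t in lebesgue. t \<in> edge_int G e \<longrightarrow> P (EPt e t)"
  then have "\<forall>e\<in>edges G. \<exists>N. N \<in> null_sets lebesgue \<and> {t. \<not> (t \<in> edge_int G e \<longrightarrow> P (EPt e t))} \<subseteq> N"
    by (auto simp: eventually_ae_filter)
  from bchoice[OF this] obtain N where N: "\<And>e. e \<in> edges G \<Longrightarrow> N e \<in> null_sets lebesgue"
    "\<And>e t. e \<in> edges G \<Longrightarrow> t \<in> edge_int G e \<Longrightarrow> \<not> P (EPt e t) \<Longrightarrow> t \<in> N e" by blast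
  define Z where "Z = Vert ` verts G \<union> {EPt e t |e t. e \<in> edges G \<and> t \<in> edge_int G e \<and> t \<in> N e}"
  have Z: "{t \<in> edge_int G e. EPt e t \<in> Z} = edge_int G e \<inter> N e" if "e \<in> edges G" for e
    using that by (auto simp: Z_def)
  have null: "edge_int G e \<inter> N e \<in> null_sets lebesgue" if "e \<in> edges G" for e
    using N(1)[OF that] by (intro null_set_Int1) auto
  have sets: "Z \<in> sets (graph_measure G)"
    using null by (auto simp: sets_graph_measure Z) (auto simp: Z_def points_def)
  have "emeasure (graph_measure G) Z = (\<integral>\<^sup>+ e. 0 \<partial>count_space (edges G))"
    unfolding emeasure_graph_measure[OF sets] using null by (intro nn_integral_cong) (auto simp: Z)
  then have "Z \<in> null_sets (graph_measure G)" using sets by (simp add: null_sets_def)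
  then show "AE x in graph_measure G. P x"
    by (rule AE_I') (use N(2) in \<open>auto simp: Z_def points_def\<close>)
qed

lemma borel_measurable_graph_measure_iff:
  fixes f :: "('v, 'e) gpoint \<Rightarrow> real"
  shows "f \<in> borel_measurable (graph_measure G) \<longleftrightarrow>
    (\<forall>e\<in>edges G. (\<lambda>t. f (EPt e t)) \<in> borel_measurable (restrict_space lebesgue (edge_int G e)))"
proof
  assume "f \<in> borel_measurable (graph_measure G)"
  then show "\<forall>e\<in>edges G. (\<lambda>t. f (EPt e t)) \<in> borel_measurable (restrict_space lebesgue (edge_int G e))"
    by (intro ballI measurable_compose[OF measurable_EPt])
next
  assume *: "\<forall>e\<in>edges G. (\<lambda>t. f (EPt e t)) \<in> borel_measurable (restrict_space lebesgue (edge_int G e))"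
  show "f \<in> borel_measurable (graph_measure G)"
  proof (rule measurableI)
    fix A :: "real set" assume A: "A \<in> sets borel"
    have "{t \<in> edge_int G e. EPt e t \<in> f -` A \<inter> points G} \<in> sets lebesgue" if e: "e \<in> edges G" for e
    proof -
      have "(\<lambda>t. f (EPt e t)) -` A \<inter> space (restrict_space lebesgue (edge_int G e))
          \<in> sets (restrict_space lebesgue (edge_int G e))"
        using * e A by (intro measurable_sets) auto
      moreover have "(\<lambda>t. f (EPt e t)) -` A \<inter> space (restrict_space lebesgue (edge_int G e))
          = {t \<in> edge_int G e. EPt e t \<in> f -` A \<inter> points G}"
        using e by (auto simp: space_restrict_space intro: EPt_in_points)
      ultimately show ?thesis by (simp add: sets_restrict_space_iff)
    qed
    then show "f -` A \<inter> space (graph_measure G) \<in> sets (graph_measure G)"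
      by (auto simp: sets_graph_measure)
  qed auto
qed

lemma weak_derivative_on_measurable:
  assumes I: "open I" and uw: "weak_derivative_on I u w"
  shows "w \<in> borel_measurable (restrict_space lebesgue I)"
proof -
  obtain R where R: "countable R" "\<And>K. K \<in> R \<Longrightarrow> \<exists>p q. p \<le> q \<and> K = {p..q}" "I = \<Union>R"
    using open_rational_cover[OF I] by blast
  have sets: "K \<in> sets lebesgue" if "K \<in> R" for K using R(2)[OF that] by auto
  show ?thesis
  proof (rule measurable_piecewise_restrict[OF R(1)])
    show "K \<inter> space (restrict_space lebesgue I) \<in> sets (restrict_space lebesgue I)" if "K \<in> R" for K
      using sets[OF that] R(3) that I by (subst sets_restrict_space_iff) (auto simp: space_restrict_space)
    show "space (restrict_space lebesgue I) \<subseteq> \<Union>R" using R(3) by (simp add: space_restrict_space)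
    show "w \<in> borel_measurable (restrict_space (restrict_space lebesgue I) K)" if K: "K \<in> R" for K
    proof -
      have "compact K" "K \<subseteq> I" using R(2)[OF K] R(3) K by auto
      then have "set_integrable lebesgue K w" using uw by (auto simp: weak_derivative_on_def)
      then have "w \<in> borel_measurable (restrict_space lebesgue K)"
        using sets[OF K] unfolding set_integrable_def
        by (subst borel_measurable_restrict_space_iff) (auto simp: borel_measurable_integrable)
      moreover have "restrict_space (restrict_space lebesgue I) K = restrict_space lebesgue K"
        using sets[OF K] I \<open>K \<subseteq> I\<close> by (subst restrict_restrict_space) (auto simp: Int_absorb1)
      ultimately show ?thesis by simp
    qed
  qed
qed

lemma weak_deriv_iff:
  "weak_deriv G u w \<longleftrightarrow>
    (\<forall>e\<in>edges G. weak_derivative_on (edge_int G e) (\<lambda>t. u (EPt e t)) (\<lambda>t. w (EPt e t)))"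
  unfolding weak_deriv_def weak_derivative_on_def test_function_def smooth_def by blast

lemma weak_deriv_measurable:
  "weak_deriv G u w \<Longrightarrow> w \<in> borel_measurable (graph_measure G)"
  by (auto simp: borel_measurable_graph_measure_iff weak_deriv_iff
      intro: weak_derivative_on_measurable[OF open_edge_int])

locale connected_metric_graph =
  fixes G :: "('v, 'e) mgraph"
  assumes metric: "metric_graph G" and connected: "graph_connected G"
    and finite_balls: "finite_ball_condition G"
begin

sublocale dist: Metric_space "points G" "gdist G"
  using metric connected finite_balls by (rule Metric_space_graph)

lemma gdist_pt_le:
  assumes "e \<in> edges G" "s \<in> edge_dom G e" "t \<in> edge_dom G e"
  shows "gdist G (pt G e s) (pt G e t) \<le> \<bar>s - t\<bar>"
proof -
  have "walk G (pt G e s) (pt G e t) (\<bar>s - t\<bar> + 0)"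
    using assms metric by (intro walk_step walk_refl pt_in_points)
  then show ?thesis using gdist_le by fastforce
qed

lemma pt_interior: "t \<in> edge_int G e \<Longrightarrow> pt G e t = EPt e t"
  by (auto simp: pt_def edge_int_def)

lemma edge_int_subset_dom: "edge_int G e \<subseteq> edge_dom G e"
  by (auto simp: edge_int_def edge_dom_def)

lemma continuous_map_iff:
  "continuous_map (gtop G) euclideanreal u \<longleftrightarrow>
    (\<forall>x\<in>points G. \<forall>\<epsilon>>0. \<exists>\<delta>>0. \<forall>y\<in>points G. gdist G x y < \<delta> \<longrightarrow> \<bar>u x - u y\<bar> < \<epsilon>)"
  using dist.metric_continuous_map[OF Met_TC.Metric_space_axioms, of u]
  by (simp add: dist_real_def mtopology_is_euclidean Ball_def imp_conjL)

lemma continuous_pt: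
  assumes "e \<in> edges G" "continuous_map (gtop G) euclideanreal u"
  shows "continuous_on (edge_dom G e) (\<lambda>t. u (pt G e t))"
  unfolding continuous_on_iff
proof (intro ballI allI impI)
  fix s \<epsilon> :: real assume s: "s \<in> edge_dom G e" and "\<epsilon> > 0"
  then obtain \<delta> where \<delta>: "\<delta> > 0" "\<And>y. y \<in> points G \<Longrightarrow> gdist G (pt G e s) y < \<delta> \<Longrightarrow> \<bar>u (pt G e s) - u y\<bar> < \<epsilon>"
    using assms pt_in_points[OF metric] unfolding continuous_map_iff by meson
  show "\<exists>d>0. \<forall>t\<in>edge_dom G e. dist t s < d \<longrightarrow> dist (u (pt G e t)) (u (pt G e s)) < \<epsilon>"
  proof (intro exI[of _ \<delta>] conjI ballI impI)
    fix t assume t: "t \<in> edge_dom G e" "dist t s < \<delta>"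
    then have "gdist G (pt G e s) (pt G e t) < \<delta>"
      using gdist_pt_le[OF assms(1) s t(1)] by (auto simp: dist_real_def abs_minus_commute)
    then have "\<bar>u (pt G e s) - u (pt G e t)\<bar> < \<epsilon>"
      by (intro \<delta>(2) pt_in_points[OF metric assms(1) t(1)])
    then show "dist (u (pt G e t)) (u (pt G e s)) < \<epsilon>" by (simp add: dist_real_def abs_minus_commute)
  qed (use \<delta> in auto)
qed

lemma continuous_EPt:
  assumes "e \<in> edges G" "continuous_map (gtop G) euclideanreal u"
  shows "continuous_on (edge_int G e) (\<lambda>t. u (EPt e t))"
  using continuous_on_subset[OF continuous_pt[OF assms] edge_int_subset_dom]
  by (rule continuous_on_eq) (simp add: pt_interior)

lemma continuous_measurable:
  assumes "continuous_map (gtop G) euclideanreal u"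
  shows "u \<in> borel_measurable (graph_measure G)"
  unfolding borel_measurable_graph_measure_iff
proof
  fix e assume "e \<in> edges G"
  then have "(\<lambda>t. u (EPt e t)) \<in> borel_measurable (restrict_space borel (edge_int G e))"
    using continuous_EPt[OF _ assms] by (intro borel_measurable_continuous_on_restrict)
  then have "(\<lambda>t. indicator (edge_int G e) t *\<^sub>R u (EPt e t)) \<in> borel_measurable borel"
    using open_edge_int[of G e] by (subst (asm) borel_measurable_restrict_space_iff) auto
  then have "(\<lambda>t. indicator (edge_int G e) t *\<^sub>R u (EPt e t)) \<in> borel_measurable lebesgue"
    by (intro measurable_completion) simp
  then show "(\<lambda>t. u (EPt e t)) \<in> borel_measurable (restrict_space lebesgue (edge_int G e))"
    by (subst borel_measurable_restrict_space_iff) auto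
qed

end

section \<open>Square-integrable functions and their weak derivatives\<close>

lemma integrable_mult_of_squares:
  fixes f g :: "'a \<Rightarrow> real"
  assumes [measurable]: "f \<in> borel_measurable M" "g \<in> borel_measurable M"
    and "integrable M (\<lambda>x. (f x)\<^sup>2)" "integrable M (\<lambda>x. (g x)\<^sup>2)"
  shows "integrable M (\<lambda>x. f x * g x)"
proof (rule Bochner_Integration.integrable_bound)
  show "integrable M (\<lambda>x. (f x)\<^sup>2 + (g x)\<^sup>2)" using assms by simp
  have "\<bar>p * q\<bar> \<le> p\<^sup>2 + q\<^sup>2" for p q :: real
  proof -
    have "2 * (\<bar>p\<bar> * \<bar>q\<bar>) \<le> p\<^sup>2 + q\<^sup>2"
      using zero_le_power2[of "\<bar>p\<bar> - \<bar>q\<bar>"] by (simp add: power2_diff)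
    moreover have "0 \<le> \<bar>p\<bar> * \<bar>q\<bar>" by simp
    ultimately show ?thesis unfolding abs_mult by linarith
  qed
  then show "AE x in M. norm (f x * g x) \<le> norm ((f x)\<^sup>2 + (g x)\<^sup>2)" by (intro AE_I2) simp
qed simp

lemma Cauchy_Schwarz_integral:
  fixes f g :: "'a \<Rightarrow> real"
  assumes "f \<in> borel_measurable M" "g \<in> borel_measurable M"
    and "integrable M (\<lambda>x. (f x)\<^sup>2)" "integrable M (\<lambda>x. (g x)\<^sup>2)"
  shows "(LINT x|M. f x * g x)\<^sup>2 \<le> (LINT x|M. (f x)\<^sup>2) * (LINT x|M. (g x)\<^sup>2)"
proof -
  define D where "D = {f \<in> borel_measurable M. integrable M (\<lambda>x. (f x :: real)\<^sup>2)}"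
  interpret nonneg_form D "\<lambda>f g. LINT x|M. f x * g x"
  proof
    show "(\<lambda>x. 0) \<in> D" by (simp add: D_def)
    show "(\<lambda>x. c * f x + d * g x) \<in> D" if "f \<in> D" "g \<in> D" for f g c d
    proof -
      have "integrable M (\<lambda>x. c\<^sup>2 * (f x)\<^sup>2 + 2 * c * d * (f x * g x) + d\<^sup>2 * (g x)\<^sup>2)"
        using that integrable_mult_of_squares[of f M g] by (simp add: D_def)
      then show ?thesis using that by (auto simp: D_def power2_eq_square algebra_simps)
    qed
    show "linear_on D (\<lambda>f. LINT x|M. f x * h x)" if h: "h \<in> D" for h
      unfolding linear_on_def
    proof (intro ballI allI)
      fix f g c d assume fg: "f \<in> D" "g \<in> D"
      have "integrable M (\<lambda>x. f x * h x)" "integrable M (\<lambda>x. g x * h x)"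
        using fg h by (auto simp: D_def intro!: integrable_mult_of_squares)
      then show "(LINT x|M. (c * f x + d * g x) * h x) = c * (LINT x|M. f x * h x) + d * (LINT x|M. g x * h x)"
        by (simp add: distrib_right mult.assoc)
    qed
    show "(LINT x|M. f x * g x) = (LINT x|M. g x * f x)" if "f \<in> D" "g \<in> D" for f g by (simp add: mult.commute)
    show "0 \<le> (LINT x|M. f x * f x)" if "f \<in> D" for f by (intro Bochner_Integration.integral_nonneg) auto
  qed
  show ?thesis using Cauchy_Schwarz[of f g] assms by (simp add: D_def power2_eq_square)
qed

lemma Fatou_integral:
  fixes h :: "nat \<Rightarrow> 'a \<Rightarrow> real"
  assumes [measurable]: "\<And>k. h k \<in> borel_measurable M" "g \<in> borel_measurable M"
    and "\<And>k. AE x in M. 0 \<le> h k x" "\<And>k. integrable M (h k)" "\<And>k. (LINT x|M. h k x) \<le> C"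
    and lim: "AE x in M. (\<lambda>k. h k x) \<longlonglongrightarrow> g x"
  shows "integrable M g" "(LINT x|M. g x) \<le> C"
proof -
  have "0 \<le> (LINT x|M. h 0 x)" using assms(3) by (intro integral_nonneg_AE)
  then have C: "0 \<le> C" using assms(5)[of 0] by linarith
  have "AE x in M. \<forall>k. 0 \<le> h k x" using assms(3) by (simp add: AE_all_countable)
  then have g0: "AE x in M. 0 \<le> g x" using lim
    by eventually_elim (auto intro: LIMSEQ_le_const)
  have "(\<integral>\<^sup>+x. ennreal (g x) \<partial>M) = (\<integral>\<^sup>+x. liminf (\<lambda>k. ennreal (h k x)) \<partial>M)"
    using lim by (intro nn_integral_cong_AE, eventually_elim)
      (metis lim_imp_Liminf tendsto_ennrealI trivial_limit_sequentially)
  also have "\<dots> \<le> liminf (\<lambda>k. \<integral>\<^sup>+x. ennreal (h k x) \<partial>M)" by (rule nn_integral_liminf) simp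
  also have "\<dots> \<le> ennreal C"
  proof (rule Liminf_le)
    show "\<forall>\<^sub>F k in sequentially. (\<integral>\<^sup>+x. ennreal (h k x) \<partial>M) \<le> ennreal C"
      using assms(3-5) by (intro always_eventually allI) (simp add: nn_integral_eq_integral ennreal_leI)
  qed simp
  finally have fin: "(\<integral>\<^sup>+x. ennreal (g x) \<partial>M) \<le> ennreal C" .
  then have "(\<integral>\<^sup>+x. ennreal (g x) \<partial>M) < \<infinity>" by (rule order_le_less_trans) simp
  then show int: "integrable M g" using g0 by (intro integrableI_nonneg) auto
  show "(LINT x|M. g x) \<le> C"
    using fin nn_integral_eq_integral[OF int g0] C by (simp add: ennreal_le_iff)
qed

text \<open>
  Along a subsequence the squared distances of consecutive terms are at most \<open>8\<^sup>-\<^sup>k\<close>. Then the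
  series of \<open>4\<^sup>k\<close> times the squared differences is integrable, hence finite almost everywhere,
  where the differences are eventually below \<open>2\<^sup>-\<^sup>k\<close>. Weighting the series in this way avoids
  the triangle inequality in \<open>L\<^sup>2\<close>.
\<close>

lemma L2_Cauchy_subsequence:
  fixes f :: "nat \<Rightarrow> 'a \<Rightarrow> real"
  assumes [measurable]: "\<And>n. f n \<in> borel_measurable M"
    and int: "\<And>i j. integrable M (\<lambda>x. (f i x - f j x)\<^sup>2)"
    and cauchy: "\<And>\<epsilon>. \<epsilon> > 0 \<Longrightarrow> \<exists>N. \<forall>i\<ge>N. \<forall>j\<ge>N. (LINT x|M. (f i x - f j x)\<^sup>2) < \<epsilon>"
  shows "\<exists>r. strict_mono r \<and> (AE x in M. convergent (\<lambda>k. f (r k) x))"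
proof -
  have "\<forall>k. \<exists>N. \<forall>i\<ge>N. \<forall>j\<ge>N. (LINT x|M. (f i x - f j x)\<^sup>2) < (1/8)^k"
    using cauchy by simp
  then obtain N where N: "\<And>k i j. i \<ge> N k \<Longrightarrow> j \<ge> N k \<Longrightarrow> (LINT x|M. (f i x - f j x)\<^sup>2) < (1/8)^k"
    by metis
  \<comment> \<open>A strictly increasing sequence above \<open>N\<close>.\<close>
  define r where "r k = (\<Sum>i\<le>k. N i) + k" for k
  have r: "strict_mono r" by (auto simp: strict_mono_Suc_iff r_def)
  have "N k \<le> (\<Sum>i\<le>k. N i)" for k by (rule member_le_sum) auto
  then have rN: "N k \<le> r k" "N k \<le> r (Suc k)" for k
    unfolding r_def by (auto simp: trans_le_add1 le_SucI)
  define d where "d k x = (f (r (Suc k)) x - f (r k) x)\<^sup>2" for k x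
  have [measurable]: "d k \<in> borel_measurable M" for k unfolding d_def by simp
  have d_int: "(\<integral>\<^sup>+x. ennreal (4^k * d k x) \<partial>M) \<le> ennreal ((1/2)^k)" for k
  proof -
    have "(\<integral>\<^sup>+x. ennreal (4^k * d k x) \<partial>M) = ennreal (LINT x|M. 4^k * d k x)"
      unfolding d_def using int by (intro nn_integral_eq_integral) auto
    also have "(LINT x|M. 4^k * d k x) \<le> 4^k * (1/8)^k"
      using N[OF rN(2,1), of k] by (simp add: d_def)
    also have "4^k * (1/8)^k = (1/2 :: real)^k" by (simp flip: power_mult_distrib)
    finally show ?thesis by (simp add: ennreal_leI)
  qed
  have "(\<integral>\<^sup>+x. (\<Sum>k. ennreal (4^k * d k x)) \<partial>M) = (\<Sum>k. \<integral>\<^sup>+x. ennreal (4^k * d k x) \<partial>M)"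
    by (rule nn_integral_suminf) simp
  also have "\<dots> \<le> (\<Sum>k. ennreal ((1/2)^k))" by (intro suminf_le d_int) auto
  also have "\<dots> < \<infinity>"
    using summable_geometric[of "1/2 :: real"] by (subst suminf_ennreal2) auto
  finally have "AE x in M. (\<Sum>k. ennreal (4^k * d k x)) \<noteq> \<infinity>"
    by (intro nn_integral_PInf_AE) auto
  then have "AE x in M. convergent (\<lambda>k. f (r k) x)"
  proof eventually_elim
    case (elim x)
    have "summable (\<lambda>k. 4^k * d k x)" using elim by (intro summable_suminf_not_top) (auto simp: d_def)
    then have "(\<lambda>k. 4^k * d k x) \<longlonglongrightarrow> 0" by (rule summable_LIMSEQ_zero)
    then have "\<forall>\<^sub>F k in sequentially. 4^k * d k x < 1" by (rule order_tendstoD) simp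
    then obtain K where K: "\<And>k. k \<ge> K \<Longrightarrow> 4^k * d k x < 1" by (auto simp: eventually_sequentially)
    have geo: "norm (f (r (Suc k)) x - f (r k) x) \<le> (1/2)^k" if "k \<ge> K" for k
    proof -
      have "4^k * ((1/2)^k)\<^sup>2 = (1 :: real)" by (simp add: power2_eq_square flip: power_mult_distrib)
      then have "4^k * d k x < 4^k * ((1/2)^k)\<^sup>2" using K[OF that] by simp
      then have "d k x \<le> ((1/2)^k)\<^sup>2" by simp
      then have "\<bar>f (r (Suc k)) x - f (r k) x\<bar> \<le> \<bar>(1/2)^k\<bar>" unfolding d_def by (simp only: abs_le_square_iff)
      then show ?thesis by simp
    qed
    have "summable (\<lambda>k. (1/2 :: real)^k)" by (rule summable_geometric) simp
    then have "summable (\<lambda>k. f (r (Suc k)) x - f (r k) x)"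
      using geo by (rule summable_comparison_test')
    then have "convergent (\<lambda>n. \<Sum>k<n. f (r (Suc k)) x - f (r k) x)" by (simp add: summable_iff_convergent)
    then have "convergent (\<lambda>n. f (r n) x - f (r 0) x)" by (simp add: sum_lessThan_telescope[of "\<lambda>k. f (r k) x"])
    then have "convergent (\<lambda>n. (f (r n) x - f (r 0) x) + f (r 0) x)" by (intro convergent_add convergent_const)
    then show ?case by simp
  qed
  with r show ?thesis by blast
qed

lemma set_integrable_extend:
  fixes f :: "real \<Rightarrow> real"
  assumes "set_integrable lebesgue K f" "K \<subseteq> I" "\<And>t. t \<notin> K \<Longrightarrow> f t = 0"
  shows "set_integrable lebesgue I f"
proof -
  have "indicator K t *\<^sub>R f t = indicator I t *\<^sub>R f t" for t
    using assms(2,3) by (auto simp: indicator_def)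
  then show ?thesis using assms(1) by (simp only: set_integrable_def)
qed

lemma deriv_zero_outside:
  fixes \<phi> :: "real \<Rightarrow> real"
  assumes "closed K" "\<And>t. t \<notin> K \<Longrightarrow> \<phi> t = 0" "t \<notin> K"
  shows "deriv \<phi> t = 0"
proof -
  have "((\<lambda>x. 0) has_field_derivative 0) (at t)" by simp
  then have "(\<phi> has_field_derivative 0) (at t)"
    by (rule has_field_derivative_transform_within_open[of _ _ _ "- K"]) (use assms in auto)
  then show ?thesis by (rule DERIV_imp_deriv)
qed

definition test_on :: "real set \<Rightarrow> (real \<Rightarrow> real) \<Rightarrow> bool" where
  "test_on I \<phi> \<longleftrightarrow> smooth \<phi> \<and> (\<exists>K. compact K \<and> K \<subseteq> I \<and> (\<forall>t. t \<notin> K \<longrightarrow> \<phi> t = 0))"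

lemma integrable_times_test:
  assumes loc: "\<And>K. compact K \<Longrightarrow> K \<subseteq> I \<Longrightarrow> set_integrable lebesgue K f" and \<phi>: "test_on I \<phi>"
    and g: "continuous_on UNIV g"
  shows "set_integrable lebesgue I (\<lambda>t. f t * (g t * \<phi> t))"
    and "set_integrable lebesgue I (\<lambda>t. f t * (g t * deriv \<phi> t))"
proof -
  obtain K where K: "compact K" "K \<subseteq> I" "\<And>t. t \<notin> K \<Longrightarrow> \<phi> t = 0" and sm: "smooth \<phi>"
    using \<phi> by (auto simp: test_on_def)
  have K': "deriv \<phi> t = 0" if "t \<notin> K" for t
    using deriv_zero_outside[OF compact_imp_closed[OF K(1)] K(3) that] .
  have "continuous_on K g" "continuous_on K \<phi>" "continuous_on K (deriv \<phi>)"
    using continuous_on_subset[OF g] smooth_continuous_on[OF sm] smooth_continuous_on[OF smooth_deriv[OF sm]] by auto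
  then have "continuous_on K (\<lambda>t. g t * \<phi> t)" "continuous_on K (\<lambda>t. g t * deriv \<phi> t)"
    by (auto intro!: continuous_on_mult)
  then show "set_integrable lebesgue I (\<lambda>t. f t * (g t * \<phi> t))"
    "set_integrable lebesgue I (\<lambda>t. f t * (g t * deriv \<phi> t))"
    using set_integrable_extend[OF set_integrable_times_continuous[OF K(1) loc[OF K(1,2)]] K(2)] K(3) K' by auto
qed

lemma weak_derivative_onD:
  assumes "weak_derivative_on I u w"
  shows "\<And>K. compact K \<Longrightarrow> K \<subseteq> I \<Longrightarrow> set_integrable lebesgue K u"
    and "\<And>K. compact K \<Longrightarrow> K \<subseteq> I \<Longrightarrow> set_integrable lebesgue K w"
    and "\<And>\<phi>. test_on I \<phi> \<Longrightarrow> (LINT t:I|lebesgue. u t * deriv \<phi> t) = - (LINT t:I|lebesgue. w t * \<phi> t)"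
  using assms unfolding weak_derivative_on_def test_on_def by blast+

lemma weak_derivative_onI:
  assumes "\<And>K. compact K \<Longrightarrow> K \<subseteq> I \<Longrightarrow> set_integrable lebesgue K u"
    and "\<And>K. compact K \<Longrightarrow> K \<subseteq> I \<Longrightarrow> set_integrable lebesgue K w"
    and "\<And>\<phi>. test_on I \<phi> \<Longrightarrow> (LINT t:I|lebesgue. u t * deriv \<phi> t) = - (LINT t:I|lebesgue. w t * \<phi> t)"
  shows "weak_derivative_on I u w"
  using assms unfolding weak_derivative_on_def test_on_def by blast

lemma weak_derivative_on_test_integrable:
  assumes "weak_derivative_on I u w" "test_on I \<phi>" "continuous_on UNIV g"
  shows "set_integrable lebesgue I (\<lambda>t. u t * (g t * \<phi> t))"
    "set_integrable lebesgue I (\<lambda>t. u t * (g t * deriv \<phi> t))"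
    "set_integrable lebesgue I (\<lambda>t. w t * (g t * \<phi> t))"
  using weak_derivative_onD(1,2)[OF assms(1)] by (auto intro!: integrable_times_test[OF _ assms(2,3)])

lemma weak_derivative_on_cong:
  assumes "\<And>t. t \<in> I \<Longrightarrow> u t = u' t" "\<And>t. t \<in> I \<Longrightarrow> w t = w' t"
  shows "weak_derivative_on I u w \<longleftrightarrow> weak_derivative_on I u' w'"
proof -
  have "weak_derivative_on I u' w'" if uw: "weak_derivative_on I u w"
    and eq: "\<And>t. t \<in> I \<Longrightarrow> u t = u' t" "\<And>t. t \<in> I \<Longrightarrow> w t = w' t" for u w u' w'
  proof (rule weak_derivative_onI)
    have *: "set_integrable lebesgue K f \<longleftrightarrow> set_integrable lebesgue K g"
      if "\<And>t. t \<in> I \<Longrightarrow> f t = g t" "K \<subseteq> I" for f g :: "real \<Rightarrow> real" and K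
      unfolding set_integrable_def using that
      by (intro Bochner_Integration.integrable_cong) (auto simp: indicator_def)
    show "set_integrable lebesgue K u'" "set_integrable lebesgue K w'" if "compact K" "K \<subseteq> I" for K
      using weak_derivative_onD(1,2)[OF uw that] *[OF eq(1) that(2)] *[OF eq(2) that(2)] by auto
    have **: "(LINT t:I|lebesgue. f t * \<phi> t) = (LINT t:I|lebesgue. g t * \<phi> t)"
      if "\<And>t. t \<in> I \<Longrightarrow> f t = g t" for f g \<phi> :: "real \<Rightarrow> real"
      unfolding set_lebesgue_integral_def using that
      by (intro Bochner_Integration.integral_cong) (auto simp: indicator_def)
    show "(LINT t:I|lebesgue. u' t * deriv \<phi> t) = - (LINT t:I|lebesgue. w' t * \<phi> t)" if "test_on I \<phi>" for \<phi>
      using weak_derivative_onD(3)[OF uw that] **[of u u' "deriv \<phi>", OF eq(1)] **[of w w' \<phi>, OF eq(2)] by simp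
  qed
  from this[of u w u' w'] this[of u' w' u w] show ?thesis using assms by auto
qed

lemma weak_derivative_on_lin:
  assumes 1: "weak_derivative_on I u1 w1" and 2: "weak_derivative_on I u2 w2"
  shows "weak_derivative_on I (\<lambda>t. c * u1 t + d * u2 t) (\<lambda>t. c * w1 t + d * w2 t)"
proof (rule weak_derivative_onI)
  show "set_integrable lebesgue K (\<lambda>t. c * u1 t + d * u2 t)" "set_integrable lebesgue K (\<lambda>t. c * w1 t + d * w2 t)"
    if "compact K" "K \<subseteq> I" for K
    using weak_derivative_onD(1,2)[OF 1 that] weak_derivative_onD(1,2)[OF 2 that]
    by (auto intro!: set_integral_add set_integrable_mult_right)
  fix \<phi> assume \<phi>: "test_on I \<phi>"
  have lin: "(LINT t:I|lebesgue. (c * f t + d * g t) * h t)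
      = c * (LINT t:I|lebesgue. f t * h t) + d * (LINT t:I|lebesgue. g t * h t)"
    if "set_integrable lebesgue I (\<lambda>t. f t * h t)" "set_integrable lebesgue I (\<lambda>t. g t * h t)" for f g h :: "real \<Rightarrow> real"
  proof -
    have "(LINT t:I|lebesgue. (c * f t + d * g t) * h t) = (LINT t:I|lebesgue. c * (f t * h t) + d * (g t * h t))"
      by (simp add: algebra_simps)
    also have "\<dots> = (LINT t:I|lebesgue. c * (f t * h t)) + (LINT t:I|lebesgue. d * (g t * h t))"
      using that by (intro set_integral_add set_integrable_mult_right)
    finally show ?thesis by simp
  qed
  note int = weak_derivative_on_test_integrable[OF 1 \<phi> continuous_on_const[of _ 1], unfolded mult_1]
    weak_derivative_on_test_integrable[OF 2 \<phi> continuous_on_const[of _ 1], unfolded mult_1]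
  show "(LINT t:I|lebesgue. (c * u1 t + d * u2 t) * deriv \<phi> t) = - (LINT t:I|lebesgue. (c * w1 t + d * w2 t) * \<phi> t)"
    using weak_derivative_onD(3)[OF 1 \<phi>] weak_derivative_onD(3)[OF 2 \<phi>]
    by (simp add: lin[OF int(2) int(5)] lin[OF int(3) int(6)])
qed

text \<open>
  \<open>\<theta> * \<phi>\<close> is a test function if \<open>\<phi>\<close> is one, so the product rule is the defining equation for
  \<open>\<theta> * \<phi>\<close> rearranged.
\<close>

lemma weak_derivative_on_times_smooth:
  assumes uw: "weak_derivative_on I u w" and \<theta>: "smooth \<theta>"
  shows "weak_derivative_on I (\<lambda>t. \<theta> t * u t) (\<lambda>t. \<theta> t * w t + deriv \<theta> t * u t)"
proof (rule weak_derivative_onI)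
  have \<theta>c: "continuous_on S \<theta>" "continuous_on S (deriv \<theta>)" for S
    using \<theta> by (auto intro: smooth_continuous_on smooth_deriv)
  show "set_integrable lebesgue K (\<lambda>t. \<theta> t * u t)" "set_integrable lebesgue K (\<lambda>t. \<theta> t * w t + deriv \<theta> t * u t)"
    if "compact K" "K \<subseteq> I" for K
    using set_integrable_times_continuous[OF that(1) weak_derivative_onD(1)[OF uw that] \<theta>c(1)]
      set_integrable_times_continuous[OF that(1) weak_derivative_onD(1)[OF uw that] \<theta>c(2)]
      set_integrable_times_continuous[OF that(1) weak_derivative_onD(2)[OF uw that] \<theta>c(1)]
    by (auto intro!: set_integral_add simp: mult.commute)
  fix \<phi> assume \<phi>: "test_on I \<phi>"
  then have sm: "smooth \<phi>" by (simp add: test_on_def)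
  have \<theta>\<phi>: "test_on I (\<lambda>t. \<theta> t * \<phi> t)"
    using \<phi> \<theta> by (auto simp: test_on_def intro!: smooth_mult) 
  have deriv: "deriv (\<lambda>t. \<theta> t * \<phi> t) t = deriv \<theta> t * \<phi> t + \<theta> t * deriv \<phi> t" for t
    using DERIV_mult[OF smooth_has_deriv[OF \<theta>] smooth_has_deriv[OF sm], of t]
    by (intro DERIV_imp_deriv) (simp add: mult.commute)
  note iu = weak_derivative_on_test_integrable(1,2)[OF uw \<phi>]
  note iw = weak_derivative_on_test_integrable(3)[OF uw \<phi>]
  have "(LINT t:I|lebesgue. u t * (deriv \<theta> t * \<phi> t)) + (LINT t:I|lebesgue. u t * (\<theta> t * deriv \<phi> t))
      = (LINT t:I|lebesgue. u t * (deriv \<theta> t * \<phi> t) + u t * (\<theta> t * deriv \<phi> t))"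
    using iu(1)[OF \<theta>c(2)] iu(2)[OF \<theta>c(1)] by (rule set_integral_add(2)[symmetric])
  also have "\<dots> = (LINT t:I|lebesgue. u t * deriv (\<lambda>t. \<theta> t * \<phi> t) t)"
    by (simp add: deriv distrib_left)
  also have "\<dots> = - (LINT t:I|lebesgue. w t * (\<theta> t * \<phi> t))"
    by (rule weak_derivative_onD(3)[OF uw \<theta>\<phi>])
  finally have eq: "(LINT t:I|lebesgue. u t * (\<theta> t * deriv \<phi> t))
      = - ((LINT t:I|lebesgue. w t * (\<theta> t * \<phi> t)) + (LINT t:I|lebesgue. u t * (deriv \<theta> t * \<phi> t)))" by linarith
  also have "(LINT t:I|lebesgue. w t * (\<theta> t * \<phi> t)) + (LINT t:I|lebesgue. u t * (deriv \<theta> t * \<phi> t))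
      = (LINT t:I|lebesgue. w t * (\<theta> t * \<phi> t) + u t * (deriv \<theta> t * \<phi> t))"
    using iw[OF \<theta>c(1)] iu(1)[OF \<theta>c(2)] by (rule set_integral_add(2)[symmetric])
  finally show "(LINT t:I|lebesgue. \<theta> t * u t * deriv \<phi> t) = - (LINT t:I|lebesgue. (\<theta> t * w t + deriv \<theta> t * u t) * \<phi> t)"
    by (simp add: algebra_simps)
qed

lemma set_Cauchy_Schwarz:
  fixes f g :: "real \<Rightarrow> real"
  assumes m: "(\<lambda>t. indicator I t * f t) \<in> borel_measurable lebesgue" "(\<lambda>t. indicator I t * g t) \<in> borel_measurable lebesgue"
    and "set_integrable lebesgue I (\<lambda>t. (f t)\<^sup>2)" "set_integrable lebesgue I (\<lambda>t. (g t)\<^sup>2)"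
  shows "(LINT t:I|lebesgue. f t * g t)\<^sup>2 \<le> (LINT t:I|lebesgue. (f t)\<^sup>2) * (LINT t:I|lebesgue. (g t)\<^sup>2)"
    and "set_integrable lebesgue I (\<lambda>t. f t * g t)"
proof -
  have sq: "indicator I t *\<^sub>R (h t)\<^sup>2 = (indicator I t * h t)\<^sup>2" "indicator I t *\<^sub>R (f t * g t) = (indicator I t * f t) * (indicator I t * g t)"
    for h :: "real \<Rightarrow> real" and t by (auto simp: indicator_def)
  show "(LINT t:I|lebesgue. f t * g t)\<^sup>2 \<le> (LINT t:I|lebesgue. (f t)\<^sup>2) * (LINT t:I|lebesgue. (g t)\<^sup>2)"
    using assms Cauchy_Schwarz_integral[OF m] by (simp only: set_integrable_def set_lebesgue_integral_def sq)
  show "set_integrable lebesgue I (\<lambda>t. f t * g t)"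
    using assms integrable_mult_of_squares[OF m] by (simp only: set_integrable_def sq)
qed

text \<open>
  The defining equation is continuous with respect to convergence in \<open>L\<^sup>2\<close>, because test
  functions and their derivatives are square-integrable.
\<close>

lemma weak_derivative_on_limit:
  assumes I: "I \<in> sets lebesgue" and uw: "\<And>n. weak_derivative_on I (u n) (w n)"
    and mu: "\<And>n. (\<lambda>t. indicator I t * (u n t - v t)) \<in> borel_measurable lebesgue"
    and mw: "\<And>n. (\<lambda>t. indicator I t * (w n t - z t)) \<in> borel_measurable lebesgue"
    and iu: "\<And>n. set_integrable lebesgue I (\<lambda>t. (u n t - v t)\<^sup>2)"
    and iw: "\<And>n. set_integrable lebesgue I (\<lambda>t. (w n t - z t)\<^sup>2)"
    and lu: "(\<lambda>n. LINT t:I|lebesgue. (u n t - v t)\<^sup>2) \<longlonglongrightarrow> 0"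
    and lw: "(\<lambda>n. LINT t:I|lebesgue. (w n t - z t)\<^sup>2) \<longlonglongrightarrow> 0"
  shows "weak_derivative_on I v z"
proof (rule weak_derivative_onI)
  have loc: "set_integrable lebesgue K g"
    if K: "compact K" "K \<subseteq> I" and f: "set_integrable lebesgue K f"
      and m: "(\<lambda>t. indicator I t * (f t - g t)) \<in> borel_measurable lebesgue"
      and i: "set_integrable lebesgue I (\<lambda>t. (f t - g t)\<^sup>2)" for K and f g :: "real \<Rightarrow> real"
  proof -
    have KL: "K \<in> sets lebesgue" using K(1) by (auto simp: borel_compact)
    have "(\<lambda>t. indicator K t * (indicator I t * (f t - g t))) \<in> borel_measurable lebesgue"
      by (rule borel_measurable_times[OF borel_measurable_indicator[OF KL] m])
    moreover have "indicator K t * (indicator I t * (f t - g t)) = indicator K t * (f t - g t)" for t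
      using K(2) by (auto simp: indicator_def)
    ultimately have m': "(\<lambda>t. indicator K t * (f t - g t)) \<in> borel_measurable lebesgue" by simp
    have one: "(\<lambda>t. indicator K t * (1::real)) \<in> borel_measurable lebesgue" using KL by simp
    have "set_integrable lebesgue K (\<lambda>t. (1::real)\<^sup>2)"
      using lmeasurable_compact[OF K(1)] by (simp add: set_integrable_def fmeasurableD2 lmeasurable_iff_integrable)
    then have "set_integrable lebesgue K (\<lambda>t. (f t - g t) * 1)"
      using set_integrable_subset[OF i KL K(2)] by (intro set_Cauchy_Schwarz(2) m' one)
    from set_integral_diff(1)[OF f this] show ?thesis by simp
  qed
  show "set_integrable lebesgue K v" "set_integrable lebesgue K z" if "compact K" "K \<subseteq> I" for K
    using loc[OF that weak_derivative_onD(1)[OF uw that] mu iu]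
      loc[OF that weak_derivative_onD(2)[OF uw that] mw iw] by auto
  note locv = this
  have lim: "(\<lambda>n. LINT t:I|lebesgue. f n t * g t) \<longlonglongrightarrow> (LINT t:I|lebesgue. h t * g t)"
    if m: "\<And>n. (\<lambda>t. indicator I t * (f n t - h t)) \<in> borel_measurable lebesgue"
      and i: "\<And>n. set_integrable lebesgue I (\<lambda>t. (f n t - h t)\<^sup>2)"
      and l: "(\<lambda>n. LINT t:I|lebesgue. (f n t - h t)\<^sup>2) \<longlonglongrightarrow> 0"
      and g: "(\<lambda>t. indicator I t * g t) \<in> borel_measurable lebesgue" "set_integrable lebesgue I (\<lambda>t. (g t)\<^sup>2)"
      and fg: "\<And>n. set_integrable lebesgue I (\<lambda>t. f n t * g t)" "set_integrable lebesgue I (\<lambda>t. h t * g t)"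
    for f :: "nat \<Rightarrow> real \<Rightarrow> real" and h g :: "real \<Rightarrow> real"
  proof -
    have "(\<lambda>n. ((LINT t:I|lebesgue. f n t * g t) - (LINT t:I|lebesgue. h t * g t))\<^sup>2) \<longlonglongrightarrow> 0"
    proof (rule tendsto_sandwich[of "\<lambda>_. 0"])
      show "(\<lambda>n. (LINT t:I|lebesgue. (f n t - h t)\<^sup>2) * (LINT t:I|lebesgue. (g t)\<^sup>2)) \<longlonglongrightarrow> 0"
        by (rule tendsto_mult_left_zero[OF l])
      show "\<forall>\<^sub>F n in sequentially. ((LINT t:I|lebesgue. f n t * g t) - (LINT t:I|lebesgue. h t * g t))\<^sup>2
          \<le> (LINT t:I|lebesgue. (f n t - h t)\<^sup>2) * (LINT t:I|lebesgue. (g t)\<^sup>2)"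
      proof (intro always_eventually allI)
        fix n
        have "(LINT t:I|lebesgue. f n t * g t) - (LINT t:I|lebesgue. h t * g t) = (LINT t:I|lebesgue. (f n t - h t) * g t)"
          by (simp add: set_integral_diff(2)[OF fg, symmetric] left_diff_distrib)
        then show "((LINT t:I|lebesgue. f n t * g t) - (LINT t:I|lebesgue. h t * g t))\<^sup>2
          \<le> (LINT t:I|lebesgue. (f n t - h t)\<^sup>2) * (LINT t:I|lebesgue. (g t)\<^sup>2)"
          using set_Cauchy_Schwarz(1)[OF m g(1) i g(2)] by simp
      qed
    qed auto
    then have "(\<lambda>n. sqrt (((LINT t:I|lebesgue. f n t * g t) - (LINT t:I|lebesgue. h t * g t))\<^sup>2)) \<longlonglongrightarrow> sqrt 0"
      by (rule tendsto_real_sqrt)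
    then show ?thesis by (simp add: tendsto_rabs_zero_iff LIM_zero_iff)
  qed
  fix \<phi> assume \<phi>: "test_on I \<phi>"
  have int: "set_integrable lebesgue I (\<lambda>t. f t * \<phi> t)" "set_integrable lebesgue I (\<lambda>t. f t * deriv \<phi> t)"
    if "\<And>K. compact K \<Longrightarrow> K \<subseteq> I \<Longrightarrow> set_integrable lebesgue K f" for f
    using integrable_times_test[OF that \<phi> continuous_on_const[of _ 1]] by simp_all
  have sm: "smooth \<phi>" using \<phi> by (simp add: test_on_def)
  obtain K where K: "compact K" "K \<subseteq> I" "\<And>t. t \<notin> K \<Longrightarrow> \<phi> t = 0" using \<phi> by (auto simp: test_on_def)
  have K': "deriv \<phi> t = 0" if "t \<notin> K" for t
    using deriv_zero_outside[OF compact_imp_closed[OF K(1)] K(3) that] .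
  have reg: "(\<lambda>t. indicator I t * g t) \<in> borel_measurable lebesgue \<and> set_integrable lebesgue I (\<lambda>t. (g t)\<^sup>2)"
    if g: "smooth g" "\<And>t. t \<notin> K \<Longrightarrow> g t = 0" for g
  proof
    have "g \<in> borel_measurable lebesgue"
      using smooth_continuous_on[OF g(1), of UNIV] by (intro measurable_completion) (simp add: borel_measurable_continuous_onI)
    then show "(\<lambda>t. indicator I t * g t) \<in> borel_measurable lebesgue" using I by (intro borel_measurable_times) auto
    have "set_integrable lebesgue K (\<lambda>t. (1::real) * (g t)\<^sup>2)"
      using lmeasurable_compact[OF K(1)]
      by (intro set_integrable_times_continuous[OF K(1)] continuous_intros smooth_continuous_on[OF g(1)])
        (simp add: set_integrable_def lmeasurable_iff_integrable)
    then show "set_integrable lebesgue I (\<lambda>t. (g t)\<^sup>2)"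
      using K(2) g(2) by (intro set_integrable_extend[of K _ I]) auto
  qed
  have 1: "(\<lambda>n. LINT t:I|lebesgue. u n t * deriv \<phi> t) \<longlonglongrightarrow> (LINT t:I|lebesgue. v t * deriv \<phi> t)"
    using reg[OF smooth_deriv[OF sm] K'] int weak_derivative_onD(1)[OF uw] locv(1)
    by (intro lim mu iu lu) auto
  have 2: "(\<lambda>n. LINT t:I|lebesgue. w n t * \<phi> t) \<longlonglongrightarrow> (LINT t:I|lebesgue. z t * \<phi> t)"
    using reg[OF sm K(3)] int weak_derivative_onD(2)[OF uw] locv(2)
    by (intro lim mw iw lw) auto
  have "(\<lambda>n. LINT t:I|lebesgue. u n t * deriv \<phi> t) \<longlonglongrightarrow> - (LINT t:I|lebesgue. z t * \<phi> t)"
    using tendsto_minus[OF 2] weak_derivative_onD(3)[OF uw \<phi>] by simp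
  from LIMSEQ_unique[OF 1 this]
  show "(LINT t:I|lebesgue. v t * deriv \<phi> t) = - (LINT t:I|lebesgue. z t * \<phi> t)" .
qed

section \<open>The space H1 and its forms\<close>

definition L2_inner :: "('v, 'e) mgraph \<Rightarrow> ('v, 'e) gpoint set \<Rightarrow> (('v, 'e) gpoint \<Rightarrow> real) \<Rightarrow> (('v, 'e) gpoint \<Rightarrow> real) \<Rightarrow> real" where
  "L2_inner G H f g = (LINT x|measure_on G H. f x * g x)"

lemma restrict_graph_measure_points: "measure_on G (points G) = graph_measure G"
proof (rule measure_eqI)
  have p: "points G \<in> sets (graph_measure G)" using sets.top[of "graph_measure G"] by simp
  have "A \<in> sets (measure_on G (points G)) \<longleftrightarrow> A \<in> sets (graph_measure G)" for A
    using p sets.sets_into_space[of A "graph_measure G"] by (auto simp: sets_restrict_space_iff)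
  then show "sets (measure_on G (points G)) = sets (graph_measure G)" by blast
  show "emeasure (measure_on G (points G)) A = emeasure (graph_measure G) A"
    if "A \<in> sets (measure_on G (points G))" for A
    using that p by (intro emeasure_restrict_space) (auto simp: sets_restrict_space_iff)
qed

lemma form_eq_set_integral:
  "H \<in> sets (graph_measure G) \<Longrightarrow>
    form G V H f g = (LINT x:H|graph_measure G. gderiv G f x * gderiv G g x + V x * f x * g x)"
  unfolding form_def set_lebesgue_integral_def by (rule integral_restrict_space) (simp only: sets.Int_space_eq2)

lemma L2_inner_eq_set_integral:
  "H \<in> sets (graph_measure G) \<Longrightarrow> L2_inner G H f g = (LINT x:H|graph_measure G. f x * g x)"
  unfolding L2_inner_def set_lebesgue_integral_def by (rule integral_restrict_space) (simp only: sets.Int_space_eq2)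

lemma weak_deriv_lin:
  assumes "weak_deriv G f w" "weak_deriv G g z"
  shows "weak_deriv G (\<lambda>x. c * f x + d * g x) (\<lambda>x. c * w x + d * z x)"
  using assms by (auto simp: weak_deriv_iff intro: weak_derivative_on_lin)

lemma integrable_square_lin:
  fixes f g :: "'a \<Rightarrow> real"
  assumes [measurable]: "f \<in> borel_measurable M" "g \<in> borel_measurable M" "W \<in> borel_measurable M"
    and W: "AE x in M. 0 \<le> W x"
    and "integrable M (\<lambda>x. W x * (f x)\<^sup>2)" "integrable M (\<lambda>x. W x * (g x)\<^sup>2)"
  shows "integrable M (\<lambda>x. W x * (c * f x + d * g x)\<^sup>2)"
proof (rule Bochner_Integration.integrable_bound)
  show "integrable M (\<lambda>x. 2 * c\<^sup>2 * (W x * (f x)\<^sup>2) + 2 * d\<^sup>2 * (W x * (g x)\<^sup>2))" using assms by simp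
  have "(c * p + d * q)\<^sup>2 \<le> 2 * c\<^sup>2 * p\<^sup>2 + 2 * d\<^sup>2 * q\<^sup>2" for p q :: real
    using zero_le_power2[of "c * p - d * q"] by (simp add: power2_eq_square algebra_simps)
  from mult_left_mono[OF this]
  have *: "w * (c * p + d * q)\<^sup>2 \<le> 2 * c\<^sup>2 * (w * p\<^sup>2) + 2 * d\<^sup>2 * (w * q\<^sup>2)" if "0 \<le> w" for w p q :: real
    using that by (simp only: distrib_left mult.left_commute)
  show "AE x in M. norm (W x * (c * f x + d * g x)\<^sup>2) \<le> norm (2 * c\<^sup>2 * (W x * (f x)\<^sup>2) + 2 * d\<^sup>2 * (W x * (g x)\<^sup>2))"
    using W
  proof eventually_elim
    case (elim x)
    have "norm (W x * (c * f x + d * g x)\<^sup>2) = W x * (c * f x + d * g x)\<^sup>2" using elim by simp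
    also have "\<dots> \<le> 2 * c\<^sup>2 * (W x * (f x)\<^sup>2) + 2 * d\<^sup>2 * (W x * (g x)\<^sup>2)" by (rule *[OF elim])
    also have "\<dots> \<le> norm \<dots>" by simp
    finally show ?case .
  qed
qed simp

locale schroedinger_graph = connected_metric_graph G for G :: "('v, 'e) mgraph" +
  fixes V :: "('v, 'e) gpoint \<Rightarrow> real"
  assumes V_measurable [measurable]: "V \<in> borel_measurable (graph_measure G)"
    and V_nonneg: "AE x in graph_measure G. 0 \<le> V x"
begin

abbreviation "M \<equiv> graph_measure G"

text \<open>
  \<open>gderiv\<close> is chosen among all weak derivatives, which agree almost everywhere. This is what
  makes the form independent of the choice.
\<close>

lemma gderiv_AE:
  assumes u: "continuous_map (gtop G) euclideanreal u" and w: "weak_deriv G u w"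
  shows "AE x in M. gderiv G u x = w x"
  unfolding AE_graph_measure_iff
proof
  fix e assume e: "e \<in> edges G"
  have "weak_deriv G u (gderiv G u)" unfolding gderiv_def using w by (rule someI[of "weak_deriv G u"])
  then show "AE t in lebesgue. t \<in> edge_int G e \<longrightarrow> gderiv G u (EPt e t) = w (EPt e t)"
    using w e continuous_EPt[OF e u] by (intro weak_derivative_unique[OF open_edge_int]) (auto simp: weak_deriv_iff)
qed

lemma H1_I:
  assumes u: "continuous_map (gtop G) euclideanreal u" and w: "weak_deriv G u w"
    and int: "integrable M (\<lambda>x. (u x)\<^sup>2)" "integrable M (\<lambda>x. (w x)\<^sup>2)" "integrable M (\<lambda>x. V x * (u x)\<^sup>2)"
  shows "u \<in> H1 G V"
proof -
  have wd: "weak_deriv G u (gderiv G u)" unfolding gderiv_def using w by (rule someI[of "weak_deriv G u"])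
  have [measurable]: "u \<in> borel_measurable M" "w \<in> borel_measurable M" "gderiv G u \<in> borel_measurable M"
    using continuous_measurable[OF u] weak_deriv_measurable[OF w] weak_deriv_measurable[OF wd] by auto
  have "integrable M (\<lambda>x. (w x)\<^sup>2 + V x * (u x)\<^sup>2)" using int by simp
  moreover have "AE x in M. (gderiv G u x)\<^sup>2 + V x * (u x)\<^sup>2 = (w x)\<^sup>2 + V x * (u x)\<^sup>2"
    using gderiv_AE[OF u w] by eventually_elim simp
  ultimately have "integrable M (\<lambda>x. (gderiv G u x)\<^sup>2 + V x * (u x)\<^sup>2)"
    by (subst integrable_cong_AE[where g = "\<lambda>x. (w x)\<^sup>2 + V x * (u x)\<^sup>2"]) auto
  then show ?thesis using u w int by (auto simp: H1_def L2_def)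
qed

lemma H1_D:
  assumes "u \<in> H1 G V"
  shows "continuous_map (gtop G) euclideanreal u" "weak_deriv G u (gderiv G u)"
    and "u \<in> borel_measurable M" "gderiv G u \<in> borel_measurable M"
    and "integrable M (\<lambda>x. (u x)\<^sup>2)" "integrable M (\<lambda>x. (gderiv G u x)\<^sup>2)" "integrable M (\<lambda>x. V x * (u x)\<^sup>2)"
proof -
  obtain w where "weak_deriv G u w" using assms by (auto simp: H1_def)
  then show wd: "weak_deriv G u (gderiv G u)" unfolding gderiv_def by (rule someI[of "weak_deriv G u"])
  show "continuous_map (gtop G) euclideanreal u" and um [measurable]: "u \<in> borel_measurable M"
    and "integrable M (\<lambda>x. (u x)\<^sup>2)"
    using assms by (auto simp: H1_def L2_def)
  show gm [measurable]: "gderiv G u \<in> borel_measurable M" by (rule weak_deriv_measurable[OF wd])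
  have int: "integrable M (\<lambda>x. (gderiv G u x)\<^sup>2 + V x * (u x)\<^sup>2)" using assms by (simp add: H1_def)
  show "integrable M (\<lambda>x. (gderiv G u x)\<^sup>2)"
    by (rule Bochner_Integration.integrable_bound[OF int]) (use V_nonneg in auto)
  show "integrable M (\<lambda>x. V x * (u x)\<^sup>2)"
    by (rule Bochner_Integration.integrable_bound[OF int]) (use V_nonneg in auto)
qed

lemma H1_lin:
  assumes "f \<in> H1 G V" "g \<in> H1 G V"
  shows "(\<lambda>x. c * f x + d * g x) \<in> H1 G V"
proof (rule H1_I)
  note f = H1_D[OF assms(1)] and g = H1_D[OF assms(2)]
  show "continuous_map (gtop G) euclideanreal (\<lambda>x. c * f x + d * g x)"
    by (intro continuous_map_add continuous_map_real_mult_left f g)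
  show "weak_deriv G (\<lambda>x. c * f x + d * g x) (\<lambda>x. c * gderiv G f x + d * gderiv G g x)"
    by (intro weak_deriv_lin f g)
  show "integrable M (\<lambda>x. (c * f x + d * g x)\<^sup>2)" "integrable M (\<lambda>x. (c * gderiv G f x + d * gderiv G g x)\<^sup>2)"
    using integrable_square_lin[of f M g "\<lambda>_. 1" c d] f g
      integrable_square_lin[of "gderiv G f" M "gderiv G g" "\<lambda>_. 1" c d] by auto
  show "integrable M (\<lambda>x. V x * (c * f x + d * g x)\<^sup>2)"
    using integrable_square_lin[of f M g V c d] f g V_nonneg by auto
qed

lemma gderiv_lin_AE:
  assumes "f \<in> H1 G V" "g \<in> H1 G V"
  shows "AE x in M. gderiv G (\<lambda>x. c * f x + d * g x) x = c * gderiv G f x + d * gderiv G g x"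
  using H1_D[OF H1_lin[OF assms, of c d]] H1_D[OF assms(1)] H1_D[OF assms(2)]
  by (intro gderiv_AE weak_deriv_lin)

lemma zero_H1: "(\<lambda>x. 0) \<in> H1 G V"
proof (rule H1_I)
  show "weak_deriv G (\<lambda>x. 0) (\<lambda>x. 0)"
    by (auto simp: weak_deriv_iff weak_derivative_on_def set_integrable_def)
qed auto

lemma H10_function_space: "function_space (H10 G V H)"
proof
  show "(\<lambda>x. 0) \<in> H10 G V H" using zero_H1 by (simp add: H10_def supp_def)
  fix f g :: "('v, 'e) gpoint \<Rightarrow> real" and c d :: real
  assume fg: "f \<in> H10 G V H" "g \<in> H10 G V H"
  have "{x \<in> points G. c * f x + d * g x \<noteq> 0} \<subseteq> {x \<in> points G. f x \<noteq> 0} \<union> {x \<in> points G. g x \<noteq> 0}" by auto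
  from closure_of_mono[OF this, of "gtop G"]
  have "supp G (\<lambda>x. c * f x + d * g x) \<subseteq> supp G f \<union> supp G g"
    by (simp add: supp_def closure_of_Un)
  then show "(\<lambda>x. c * f x + d * g x) \<in> H10 G V H" using fg H1_lin[of f g c d] by (auto simp: H10_def)
qed

lemma H10_points: "H10 G V (points G) = H1 G V"
  by (auto simp: H10_def supp_def dest!: subsetD[OF closure_of_subset_topspace])

lemma integrable_products:
  assumes "f \<in> H1 G V" "g \<in> H1 G V"
  shows "integrable M (\<lambda>x. f x * g x)" "integrable M (\<lambda>x. gderiv G f x * gderiv G g x + V x * f x * g x)"
proof -
  note f = H1_D[OF assms(1)] and g = H1_D[OF assms(2)]
  show "integrable M (\<lambda>x. f x * g x)" using f g by (intro integrable_mult_of_squares)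
  have "integrable M (\<lambda>x. gderiv G f x * gderiv G g x)" using f g by (intro integrable_mult_of_squares)
  moreover have "integrable M (\<lambda>x. V x * f x * g x)"
  proof -
    have [measurable]: "f \<in> borel_measurable M" "g \<in> borel_measurable M" using f g by auto
    have eq: "2 * (V x * f x * g x) = V x * (1 * f x + 1 * g x)\<^sup>2 - V x * (f x)\<^sup>2 - V x * (g x)\<^sup>2" for x
      by (simp add: power2_eq_square algebra_simps)
    have "integrable M (\<lambda>x. 2 * (V x * f x * g x))"
      unfolding eq using integrable_square_lin[of f M g V 1 1] f g V_nonneg by auto
    then show ?thesis by simp
  qed
  ultimately show "integrable M (\<lambda>x. gderiv G f x * gderiv G g x + V x * f x * g x)" by simp
qed

lemma H10_subset: "f \<in> H10 G V H \<Longrightarrow> f \<in> H1 G V" by (simp add: H10_def)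

theorem form_pair_H10:
  assumes H: "H \<in> sets M"
  shows "form_pair (H10 G V H) (form G V H) (L2_inner G H)"
proof -
  have set_int: "set_integrable M H h" if "integrable M h" for h :: "('v, 'e) gpoint \<Rightarrow> real"
    using that H integrable_mult_indicator[OF H that] by (simp add: set_integrable_def)
  interpret function_space "H10 G V H" by (rule H10_function_space)
  show ?thesis
  proof (intro form_pair.intro nonneg_form.intro symmetric_form.intro function_space_axioms
      symmetric_form_axioms.intro nonneg_form_axioms.intro)
    fix h assume h: "h \<in> H10 G V H"
    show "linear_on (H10 G V H) (\<lambda>f. form G V H f h)"
      unfolding linear_on_def form_eq_set_integral[OF H]
    proof (intro ballI allI)
      fix f g c d assume fg: "f \<in> H10 G V H" "g \<in> H10 G V H"
      note fgh = fg[THEN H10_subset] H10_subset[OF h]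
      let ?q = "\<lambda>f x. gderiv G f x * gderiv G h x + V x * f x * h x"
      have lin: "(\<lambda>x. c * f x + d * g x) \<in> H1 G V" by (rule H1_lin[OF fgh(1,2)])
      have "(LINT x:H|M. ?q (\<lambda>x. c * f x + d * g x) x) = (LINT x:H|M. c * ?q f x + d * ?q g x)"
        unfolding set_lebesgue_integral_def
      proof (rule integral_cong_AE)
        have [measurable]: "H \<in> sets M" "h \<in> borel_measurable M" "gderiv G h \<in> borel_measurable M"
          "f \<in> borel_measurable M" "gderiv G f \<in> borel_measurable M"
          "g \<in> borel_measurable M" "gderiv G g \<in> borel_measurable M"
          "gderiv G (\<lambda>x. c * f x + d * g x) \<in> borel_measurable M"
          using H H1_D[OF fgh(1)] H1_D[OF fgh(2)] H1_D[OF fgh(3)] H1_D[OF lin] by auto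
        show "(\<lambda>x. indicator H x *\<^sub>R ?q (\<lambda>x. c * f x + d * g x) x) \<in> borel_measurable M" by measurable
        show "(\<lambda>x. indicator H x *\<^sub>R (c * ?q f x + d * ?q g x)) \<in> borel_measurable M" by measurable
        show "AE x in M. indicator H x *\<^sub>R ?q (\<lambda>x. c * f x + d * g x) x = indicator H x *\<^sub>R (c * ?q f x + d * ?q g x)"
          using gderiv_lin_AE[OF fgh(1,2), of c d] by eventually_elim (simp add: algebra_simps)
      qed
      also have "\<dots> = (LINT x:H|M. c * ?q f x) + (LINT x:H|M. d * ?q g x)"
        by (intro set_integral_add set_integrable_mult_right set_int integrable_products fgh)
      finally show "(LINT x:H|M. ?q (\<lambda>x. c * f x + d * g x) x) = c * (LINT x:H|M. ?q f x) + d * (LINT x:H|M. ?q g x)"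
        by simp
    qed
    show "linear_on (H10 G V H) (\<lambda>f. L2_inner G H f h)"
      unfolding linear_on_def L2_inner_eq_set_integral[OF H]
    proof (intro ballI allI)
      fix f g c d assume fg: "f \<in> H10 G V H" "g \<in> H10 G V H"
      note fgh = fg[THEN H10_subset] H10_subset[OF h]
      have "(LINT x:H|M. (c * f x + d * g x) * h x) = (LINT x:H|M. c * (f x * h x) + d * (g x * h x))"
        by (simp add: algebra_simps)
      also have "\<dots> = (LINT x:H|M. c * (f x * h x)) + (LINT x:H|M. d * (g x * h x))"
        by (intro set_integral_add set_integrable_mult_right set_int integrable_products fgh)
      finally show "(LINT x:H|M. (c * f x + d * g x) * h x) = c * (LINT x:H|M. f x * h x) + d * (LINT x:H|M. g x * h x)"
        by simp
    qed
  next
    show "form G V H f g = form G V H g f" if "f \<in> H10 G V H" "g \<in> H10 G V H" for f g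
      by (simp add: form_def mult.commute mult.left_commute)
    show "L2_inner G H f g = L2_inner G H g f" if "f \<in> H10 G V H" "g \<in> H10 G V H" for f g
      by (simp add: L2_inner_def mult.commute)
    show "0 \<le> form G V H f f" if "f \<in> H10 G V H" for f
      unfolding form_eq_set_integral[OF H] set_lebesgue_integral_def
      using V_nonneg by (intro integral_nonneg_AE) (auto elim!: eventually_mono simp: mult.assoc)
    show "0 \<le> L2_inner G H f f" if "f \<in> H10 G V H" for f
      unfolding L2_inner_def by (intro Bochner_Integration.integral_nonneg) simp
  qed
qed

lemma form_points: "form G V (points G) f g = (LINT x|M. gderiv G f x * gderiv G g x + V x * f x * g x)"
  by (simp add: form_def restrict_graph_measure_points)

lemma L2_inner_points: "L2_inner G (points G) f g = (LINT x|M. f x * g x)"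
  by (simp add: L2_inner_def restrict_graph_measure_points)

sublocale full: form_pair "H1 G V" "form G V (points G)" "L2_inner G (points G)"
  using form_pair_H10[of "points G"] sets.top[of M] by (simp add: H10_points)

text \<open>
  Connects the estimates on an interval with integrals over the graph; \<open>pt\<close> instead of \<open>EPt\<close>
  gives the values at the end points of the edge.
\<close>

lemma edge_interval:
  assumes f: "f \<in> H1 G V" and e: "e \<in> edges G" and ab: "a < b" "{a..b} \<subseteq> edge_dom G e"
  shows "weak_derivative_interval (edge_int G e) (\<lambda>t. f (pt G e t)) (\<lambda>t. gderiv G f (EPt e t)) a b"
    and "(LINT t:{a<..<b}|lebesgue. (f (pt G e t))\<^sup>2) = (LINT x:EPt e ` {a<..<b}|M. (f x)\<^sup>2)"
    and "(LINT t:{a<..<b}|lebesgue. (gderiv G f (EPt e t))\<^sup>2) = (LINT x:EPt e ` {a<..<b}|M. (gderiv G f x)\<^sup>2)"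
    and "EPt e ` {a<..<b} \<in> sets M"
proof -
  note D = H1_D[OF f]
  have sub: "{a<..<b} \<subseteq> edge_int G e"
  proof
    fix t assume t: "t \<in> {a<..<b}"
    have "a \<in> edge_dom G e" "b \<in> edge_dom G e" using ab by auto
    then have "0 \<le> a" "ereal b \<le> elen G e" by (auto simp: edge_dom_def)
    moreover have "ereal t < elen G e"
      using less_le_trans[OF _ \<open>ereal b \<le> elen G e\<close>, of "ereal t"] t by simp
    ultimately show "t \<in> edge_int G e" using t by (auto simp: edge_int_def)
  qed
  have [measurable]: "f \<in> borel_measurable M" "gderiv G f \<in> borel_measurable M" using D by auto
  have J: "{a<..<b} \<in> sets lebesgue" by simp
  show sets: "EPt e ` {a<..<b} \<in> sets M" by (rule EPt_image_sets[OF e J sub])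
  have "integrable M (\<lambda>x. indicator (EPt e ` {a<..<b}) x *\<^sub>R (gderiv G f x)\<^sup>2)"
    by (rule integrable_mult_indicator[OF sets D(6)])
  then have w2: "set_integrable lebesgue {a<..<b} (\<lambda>t. (gderiv G f (EPt e t))\<^sup>2)"
    using integral_edge_part(1)[OF e J sub, of "\<lambda>x. (gderiv G f x)\<^sup>2"] by (simp add: set_integrable_def)
  show "weak_derivative_interval (edge_int G e) (\<lambda>t. f (pt G e t)) (\<lambda>t. gderiv G f (EPt e t)) a b"
  proof
    show "open (edge_int G e)" by (rule open_edge_int)
    have "weak_derivative_on (edge_int G e) (\<lambda>t. f (EPt e t)) (\<lambda>t. gderiv G f (EPt e t))"
      using D(2) e by (simp add: weak_deriv_iff)
    then show "weak_derivative_on (edge_int G e) (\<lambda>t. f (pt G e t)) (\<lambda>t. gderiv G f (EPt e t))"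
      by (rule weak_derivative_on_cong[THEN iffD1, rotated 2]) (auto simp: pt_interior)
    show "continuous_on (edge_int G e) (\<lambda>t. f (pt G e t))"
      by (rule continuous_on_subset[OF continuous_pt[OF e D(1)] edge_int_subset_dom])
    show "continuous_on {a..b} (\<lambda>t. f (pt G e t))"
      by (rule continuous_on_subset[OF continuous_pt[OF e D(1)] ab(2)])
  qed (use ab sub w2 in auto)
  have "(LINT t:{a<..<b}|lebesgue. (f (pt G e t))\<^sup>2) = (LINT t:{a<..<b}|lebesgue. (f (EPt e t))\<^sup>2)"
    unfolding set_lebesgue_integral_def using sub
    by (intro Bochner_Integration.integral_cong) (auto simp: indicator_def pt_interior subset_iff)
  then show "(LINT t:{a<..<b}|lebesgue. (f (pt G e t))\<^sup>2) = (LINT x:EPt e ` {a<..<b}|M. (f x)\<^sup>2)"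
    by (subst integral_edge_part(2)[OF e J sub]) auto
  show "(LINT t:{a<..<b}|lebesgue. (gderiv G f (EPt e t))\<^sup>2) = (LINT x:EPt e ` {a<..<b}|M. (gderiv G f x)\<^sup>2)"
    by (subst integral_edge_part(2)[OF e J sub]) auto
qed

lemma set_integral_le_integral:
  fixes h :: "('v, 'e) gpoint \<Rightarrow> real"
  assumes "A \<in> sets M" "integrable M h" "\<And>x. 0 \<le> h x"
  shows "(LINT x:A|M. h x) \<le> (LINT x|M. h x)"
  unfolding set_lebesgue_integral_def
  using assms integrable_mult_indicator[OF assms(1,2)] by (intro integral_mono) (auto simp: indicator_def)

lemma form_diag:
  assumes "f \<in> H1 G V"
  shows "form G V (points G) f f = (LINT x|M. (gderiv G f x)\<^sup>2) + (LINT x|M. V x * (f x)\<^sup>2)"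
    and "L2_inner G (points G) f f = (LINT x|M. (f x)\<^sup>2)"
    and "0 \<le> (LINT x|M. (gderiv G f x)\<^sup>2)" "0 \<le> (LINT x|M. V x * (f x)\<^sup>2)" "0 \<le> (LINT x|M. (f x)\<^sup>2)"
  using H1_D[OF assms] V_nonneg
  by (auto simp: form_points L2_inner_points power2_eq_square mult.assoc intro!: integral_nonneg_AE)

text \<open>
  Each point of the edge lies in a subinterval whose length depends on the edge only, to which
  the estimate of the supremum applies. Thus point evaluations are bounded functionals on
  \<open>H\<^sup>1\<close>, uniformly on the edge.
\<close>

theorem edge_sup_bound:
  assumes e: "e \<in> edges G"
  shows "\<exists>C>0. \<forall>f\<in>H1 G V. \<forall>t\<in>edge_dom G e.
    (f (pt G e t))\<^sup>2 \<le> C * (form G V (points G) f f + L2_inner G (points G) f f)"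
proof -
  have pos: "0 < elen G e" using metric e by (auto simp: metric_graph_def)
  obtain L where L: "L > 0" "\<And>t. t \<in> edge_dom G e \<Longrightarrow> \<exists>a. t \<in> {a..a + L} \<and> {a..a + L} \<subseteq> edge_dom G e"
  proof (cases "elen G e")
    case (real l)
    show ?thesis
    proof (rule that[of l])
      show "\<exists>a. t \<in> {a..a + l} \<and> {a..a + l} \<subseteq> edge_dom G e" if "t \<in> edge_dom G e" for t
        using that real by (intro exI[of _ 0]) (auto simp: edge_dom_def)
    qed (use pos real in auto)
  next
    case PInf
    show ?thesis
    proof (rule that[of 1])
      show "\<exists>a. t \<in> {a..a + 1} \<and> {a..a + 1} \<subseteq> edge_dom G e" if "t \<in> edge_dom G e" for t
        using that PInf by (intro exI[of _ t]) (auto simp: edge_dom_def)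
    qed auto
  qed (use pos in auto)
  have "(f (pt G e t))\<^sup>2 \<le> (2 / L + 2 * L) * (form G V (points G) f f + L2_inner G (points G) f f)"
    if f: "f \<in> H1 G V" and t: "t \<in> edge_dom G e" for f t
  proof -
    obtain a where a: "t \<in> {a..a + L}" "{a..a + L} \<subseteq> edge_dom G e" using L(2)[OF t] by blast
    note D = H1_D[OF f] and int = edge_interval[OF f e _ a(2)]
    interpret weak_derivative_interval "edge_int G e" "\<lambda>t. f (pt G e t)" "\<lambda>t. gderiv G f (EPt e t)" a "a + L"
      using int(1) L(1) by simp
    have "(f (pt G e t))\<^sup>2 \<le> 2 / L * (LINT x:EPt e ` {a<..<a + L}|M. (f x)\<^sup>2)
        + 2 * L * (LINT x:EPt e ` {a<..<a + L}|M. (gderiv G f x)\<^sup>2)"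
      using sup_estimate[OF a(1)] int(2,3) L(1) by simp
    also have "\<dots> \<le> 2 / L * (LINT x|M. (f x)\<^sup>2) + 2 * L * (LINT x|M. (gderiv G f x)\<^sup>2)"
      using L(1) D int(4) by (intro add_mono mult_left_mono set_integral_le_integral) auto
    also have "\<dots> \<le> (2 / L + 2 * L) * (form G V (points G) f f + L2_inner G (points G) f f)"
    proof -
      have "2 / L * (LINT x|M. (f x)\<^sup>2) \<le> 2 / L * (form G V (points G) f f + L2_inner G (points G) f f)"
        "2 * L * (LINT x|M. (gderiv G f x)\<^sup>2) \<le> 2 * L * (form G V (points G) f f + L2_inner G (points G) f f)"
        using form_diag[OF f] L(1) by (intro mult_left_mono; simp)+
      then show ?thesis by (simp add: distrib_right)
    qed
    finally show ?thesis .
  qed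
  moreover have "2 / L + 2 * L > 0" using L(1) by (simp add: add_pos_pos)
  ultimately show ?thesis by blast
qed

end

section \<open>Completeness of H1\<close>

context connected_metric_graph begin

lemma edge_int_nonempty: "e \<in> edges G \<Longrightarrow> \<exists>t. t \<in> edge_int G e"
proof -
  assume "e \<in> edges G"
  then have "0 < elen G e" using metric by (simp add: metric_graph_def)
  then obtain z where "0 < z" "z < elen G e" using dense by blast
  then show ?thesis by (cases z) (auto simp: edge_int_def)
qed

text \<open>
  In a connected graph with edges no vertex is isolated. An isolated vertex would be invisible
  to the measure, and a Cauchy sequence in \<open>H\<^sup>1\<close> need not converge there.
\<close>

lemma point_on_edge:
  assumes "edges G \<noteq> {}" "x \<in> points G"
  shows "\<exists>e\<in>edges G. \<exists>t\<in>edge_dom G e. x = pt G e t"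
proof (cases x)
  case (EPt e t)
  then have "e \<in> edges G" "t \<in> edge_int G e" using assms(2) by (auto simp: points_def)
  then show ?thesis using EPt pt_interior edge_int_subset_dom[of e] by (metis subsetD)
next
  case (Vert v)
  obtain e t where "e \<in> edges G" "t \<in> edge_int G e" using assms(1) edge_int_nonempty by blast
  then have "EPt e t \<in> points G" by (rule EPt_in_points)
  then obtain r where "walk G x (EPt e t) r" using connected assms(2) by (auto simp: graph_connected_def)
  then show ?thesis
  proof cases
    case (walk_step e' s t' r')
    then show ?thesis by blast
  qed (use Vert in simp)
qed

end

context schroedinger_graph begin

abbreviation "energy_form f g \<equiv> form G V (points G) f g + L2_inner G (points G) f g"

lemma H1_diff: "f \<in> H1 G V \<Longrightarrow> g \<in> H1 G V \<Longrightarrow> (\<lambda>x. f x - g x) \<in> H1 G V"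
  using H1_lin[of f g 1 "-1"] by simp

lemma gderiv_diff_AE:
  "f \<in> H1 G V \<Longrightarrow> g \<in> H1 G V \<Longrightarrow> AE x in M. gderiv G (\<lambda>x. f x - g x) x = gderiv G f x - gderiv G g x"
  using gderiv_lin_AE[of f g 1 "-1"] by simp

lemma energy_diag:
  assumes "f \<in> H1 G V" and w: "w \<in> borel_measurable M" "AE x in M. gderiv G f x = w x"
  shows "integrable M (\<lambda>x. (w x)\<^sup>2 + V x * (f x)\<^sup>2 + (f x)\<^sup>2)"
    and "energy_form f f = (LINT x|M. (w x)\<^sup>2 + V x * (f x)\<^sup>2 + (f x)\<^sup>2)"
    and "integrable M (\<lambda>x. (w x)\<^sup>2)"
proof -
  note D = H1_D[OF assms(1)]
  have [measurable]: "f \<in> borel_measurable M" "gderiv G f \<in> borel_measurable M" using D by auto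
  note [measurable] = w(1)
  have eq: "AE x in M. (gderiv G f x)\<^sup>2 = (w x)\<^sup>2" using w(2) by eventually_elim simp
  show wi: "integrable M (\<lambda>x. (w x)\<^sup>2)" using D(6) integrable_cong_AE[OF _ _ eq] by simp
  then show "integrable M (\<lambda>x. (w x)\<^sup>2 + V x * (f x)\<^sup>2 + (f x)\<^sup>2)" using D by simp
  have "(LINT x|M. (gderiv G f x)\<^sup>2) = (LINT x|M. (w x)\<^sup>2)" by (rule integral_cong_AE[OF _ _ eq]) auto
  then show "energy_form f f = (LINT x|M. (w x)\<^sup>2 + V x * (f x)\<^sup>2 + (f x)\<^sup>2)"
    using D wi by (simp add: form_diag[OF assms(1)])
qed

text \<open>
  By the finite ball condition a ball meets finitely many edges, so uniform convergence on
  each edge is uniform convergence on the ball.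
\<close>

lemma uniform_Cauchy_limit_continuous:
  fixes u :: "nat \<Rightarrow> ('v, 'e) gpoint \<Rightarrow> real"
  assumes ne: "edges G \<noteq> {}" and u: "\<And>n. continuous_map (gtop G) euclideanreal (u n)"
    and unif: "\<And>e \<epsilon>. e \<in> edges G \<Longrightarrow> \<epsilon> > 0 \<Longrightarrow> \<exists>N. \<forall>n\<ge>N. \<forall>t\<in>edge_dom G e. \<bar>u n (pt G e t) - v (pt G e t)\<bar> < \<epsilon>"
  shows "continuous_map (gtop G) euclideanreal v"
  unfolding continuous_map_iff
proof (intro ballI allI impI)
  fix x \<epsilon> assume x: "x \<in> points G" and \<epsilon>: "\<epsilon> > (0::real)"
  define F where "F = {e \<in> edges G. edge_set G e \<inter> gball G x 1 \<noteq> {}}"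
  have F: "finite F" "F \<subseteq> edges G" using finite_balls x by (auto simp: F_def finite_ball_condition_def)
  have "\<forall>e\<in>F. \<exists>N. \<forall>n\<ge>N. \<forall>t\<in>edge_dom G e. \<bar>u n (pt G e t) - v (pt G e t)\<bar> < \<epsilon> / 3"
    using unif[of _ "\<epsilon> / 3"] F(2) \<epsilon> by auto
  from bchoice[OF this] obtain N
    where N': "\<forall>e\<in>F. \<forall>n\<ge>N e. \<forall>t\<in>edge_dom G e. \<bar>u n (pt G e t) - v (pt G e t)\<bar> < \<epsilon> / 3" ..
  have N: "\<bar>u n (pt G e t) - v (pt G e t)\<bar> < \<epsilon> / 3" if "e \<in> F" "n \<ge> N e" "t \<in> edge_dom G e" for e n t
    using N' that by simp
  \<comment> \<open>The sum is an index beyond all \<open>N e\<close>.\<close>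
  define n where "n = (\<Sum>e\<in>F. N e)"
  have n: "n \<ge> N e" if "e \<in> F" for e unfolding n_def using that F by (intro member_le_sum) auto
  have close: "\<bar>u n y - v y\<bar> < \<epsilon> / 3" if y: "y \<in> points G" "gdist G x y < 1" for y
  proof -
    obtain e t where e: "e \<in> edges G" "t \<in> edge_dom G e" "y = pt G e t" using point_on_edge[OF ne y(1)] by blast
    then have "y \<in> edge_set G e \<inter> gball G x 1" using y by (auto simp: edge_set_def gball_def)
    then have "e \<in> F" using e by (auto simp: F_def)
    then show ?thesis using N[OF _ n e(2)] e(3) by simp
  qed
  obtain \<delta> where \<delta>: "\<delta> > 0" "\<And>y. y \<in> points G \<Longrightarrow> gdist G x y < \<delta> \<Longrightarrow> \<bar>u n x - u n y\<bar> < \<epsilon> / 3"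
    using u[of n] x \<epsilon> unfolding continuous_map_iff by (metis divide_pos_pos zero_less_numeral)
  show "\<exists>\<delta>>0. \<forall>y\<in>points G. gdist G x y < \<delta> \<longrightarrow> \<bar>v x - v y\<bar> < \<epsilon>"
  proof (intro exI[of _ "min \<delta> 1"] conjI ballI impI)
    fix y assume y: "y \<in> points G" "gdist G x y < min \<delta> 1"
    then have "\<bar>u n x - u n y\<bar> < \<epsilon> / 3" "\<bar>u n y - v y\<bar> < \<epsilon> / 3" "\<bar>u n x - v x\<bar> < \<epsilon> / 3"
      using \<delta>(2) close[of y] close[OF x] gdist_refl[OF x] by auto
    then show "\<bar>v x - v y\<bar> < \<epsilon>" by linarith
  qed (use \<delta> in auto)
qed

text \<open>
  Functions converge uniformly on each edge, which gives a continuous limit \<open>v\<close>; their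
  derivatives converge almost everywhere along a subsequence to some \<open>w\<close>. Fatou's lemma,
  applied to the density of the energy of \<open>u n - u (r k)\<close> as \<open>k\<close> grows, turns this into
  convergence of all three parts of the energy, and then \<open>w\<close> is the weak derivative of \<open>v\<close>.
\<close>

lemma H1_complete_with_edges:
  assumes ne: "edges G \<noteq> {}" and u: "\<And>n. u n \<in> H1 G V"
    and cauchy: "\<And>\<epsilon>. \<epsilon> > 0 \<Longrightarrow>
      \<exists>N. \<forall>i\<ge>N. \<forall>j\<ge>N. energy_form (\<lambda>x. u i x - u j x) (\<lambda>x. u i x - u j x) < \<epsilon>"
  shows "\<exists>v\<in>H1 G V. (\<lambda>n. energy_form (\<lambda>x. u n x - v x) (\<lambda>x. u n x - v x)) \<longlonglongrightarrow> 0"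
proof -
  define d where "d i j = (\<lambda>x. u i x - u j x)" for i j
  define Du where "Du n = gderiv G (u n)" for n
  have d: "d i j \<in> H1 G V" for i j unfolding d_def by (intro H1_diff u)
  note uD = H1_D[OF u]
  have [measurable]: "u n \<in> borel_measurable M" "Du n \<in> borel_measurable M" for n
    using uD by (auto simp: Du_def)
  have dD: "AE x in M. gderiv G (d i j) x = Du i x - Du j x" for i j
    unfolding d_def Du_def by (intro gderiv_diff_AE u)
  have Dd_meas: "(\<lambda>x. Du i x - Du j x) \<in> borel_measurable M" for i j by measurable
  note dE = energy_diag[OF d Dd_meas dD]
  have cauchy': "\<exists>N. \<forall>i\<ge>N. \<forall>j\<ge>N. energy_form (d i j) (d i j) < \<epsilon>" if "\<epsilon> > 0" for \<epsilon>
    using cauchy[OF that] by (simp add: d_def)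
  \<comment> \<open>The derivatives converge almost everywhere along a subsequence.\<close>
  have "\<exists>r. strict_mono r \<and> (AE x in M. convergent (\<lambda>k. Du (r k) x))"
  proof (rule L2_Cauchy_subsequence)
    show "integrable M (\<lambda>x. (Du i x - Du j x)\<^sup>2)" for i j by (rule dE(3))
    fix \<epsilon> :: real assume "\<epsilon> > 0"
    then obtain N where N: "\<And>i j. i \<ge> N \<Longrightarrow> j \<ge> N \<Longrightarrow> energy_form (d i j) (d i j) < \<epsilon>" using cauchy' by blast
    have "(LINT x|M. (Du i x - Du j x)\<^sup>2) \<le> energy_form (d i j) (d i j)" for i j
      unfolding dE(2) using V_nonneg dE(1,3) by (intro integral_mono_AE) (auto elim!: eventually_mono)
    then show "\<exists>N. \<forall>i\<ge>N. \<forall>j\<ge>N. (LINT x|M. (Du i x - Du j x)\<^sup>2) < \<epsilon>"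
      using N by (meson order_le_less_trans)
  qed simp
  then obtain r where r: "strict_mono r" "AE x in M. convergent (\<lambda>k. Du (r k) x)" by blast
  define w where "w x = lim (\<lambda>k. Du (r k) x)" for x
  have [measurable]: "w \<in> borel_measurable M" unfolding w_def[abs_def] by measurable
  have w: "AE x in M. (\<lambda>k. Du (r k) x) \<longlonglongrightarrow> w x"
    using r(2) by eventually_elim (simp add: w_def convergent_LIMSEQ_iff)
  \<comment> \<open>The functions themselves converge uniformly on each edge.\<close>
  have "\<forall>e\<in>edges G. \<exists>C>0. \<forall>f\<in>H1 G V. \<forall>t\<in>edge_dom G e. (f (pt G e t))\<^sup>2 \<le> C * energy_form f f"
    using edge_sup_bound by blast
  from bchoice[OF this] obtain C where C: "\<And>e. e \<in> edges G \<Longrightarrow> C e > 0"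
    "\<And>e f t. e \<in> edges G \<Longrightarrow> f \<in> H1 G V \<Longrightarrow> t \<in> edge_dom G e \<Longrightarrow> (f (pt G e t))\<^sup>2 \<le> C e * energy_form f f"
    by blast
  have unif: "\<exists>N. \<forall>i\<ge>N. \<forall>j\<ge>N. \<forall>t\<in>edge_dom G e. \<bar>u i (pt G e t) - u j (pt G e t)\<bar> < \<epsilon>"
    if e: "e \<in> edges G" and "\<epsilon> > 0" for e \<epsilon>
  proof -
    have "\<epsilon>\<^sup>2 / C e > 0" using C(1)[OF e] \<open>\<epsilon> > 0\<close> by simp
    then obtain N where N: "\<And>i j. i \<ge> N \<Longrightarrow> j \<ge> N \<Longrightarrow> energy_form (d i j) (d i j) < \<epsilon>\<^sup>2 / C e" using cauchy' by blast
    have "\<bar>u i (pt G e t) - u j (pt G e t)\<bar> < \<epsilon>" if "i \<ge> N" "j \<ge> N" "t \<in> edge_dom G e" for i j t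
    proof -
      have "(d i j (pt G e t))\<^sup>2 \<le> C e * energy_form (d i j) (d i j)" by (rule C(2)[OF e d that(3)])
      also have "\<dots> < C e * (\<epsilon>\<^sup>2 / C e)" using N[OF that(1,2)] C(1)[OF e] by (rule mult_strict_left_mono)
      also have "\<dots> = \<epsilon>\<^sup>2" using C(1)[OF e] by simp
      finally have "\<bar>d i j (pt G e t)\<bar>\<^sup>2 < \<epsilon>\<^sup>2" by simp
      then show ?thesis using \<open>\<epsilon> > 0\<close> unfolding d_def by (meson less_imp_le power2_less_imp_less)
    qed
    then show ?thesis by blast
  qed
  define v where "v x = lim (\<lambda>n. u n x)" for x
  have v: "(\<lambda>n. u n x) \<longlonglongrightarrow> v x" if x: "x \<in> points G" for x
  proof -
    obtain e t where e: "e \<in> edges G" "t \<in> edge_dom G e" "x = pt G e t" using point_on_edge[OF ne x] by blast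
    have "Cauchy (\<lambda>n. u n x)"
      unfolding Cauchy_iff
    proof (intro allI impI)
      fix \<epsilon> :: real assume "\<epsilon> > 0"
      then show "\<exists>N. \<forall>m\<ge>N. \<forall>n\<ge>N. norm (u m x - u n x) < \<epsilon>" using unif[OF e(1)] e(2,3) by force
    qed
    then show ?thesis by (simp add: v_def Cauchy_convergent_iff convergent_LIMSEQ_iff)
  qed
  have v_cont: "continuous_map (gtop G) euclideanreal v"
  proof (rule uniform_Cauchy_limit_continuous[OF ne uD(1)])
    fix e and \<epsilon> :: real assume e: "e \<in> edges G" and "\<epsilon> > 0"
    obtain N where N: "\<And>i j t. i \<ge> N \<Longrightarrow> j \<ge> N \<Longrightarrow> t \<in> edge_dom G e \<Longrightarrow> \<bar>u i (pt G e t) - u j (pt G e t)\<bar> < \<epsilon> / 2"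
      using unif[OF e, of "\<epsilon> / 2"] \<open>\<epsilon> > 0\<close> by auto
    have "\<bar>u n (pt G e t) - v (pt G e t)\<bar> < \<epsilon>" if n: "n \<ge> N" and t: "t \<in> edge_dom G e" for n t
    proof -
      have "(\<lambda>j. \<bar>u n (pt G e t) - u j (pt G e t)\<bar>) \<longlonglongrightarrow> \<bar>u n (pt G e t) - v (pt G e t)\<bar>"
        using v[OF pt_in_points[OF metric e t]] by (intro tendsto_intros)
      then have "\<bar>u n (pt G e t) - v (pt G e t)\<bar> \<le> \<epsilon> / 2"
        by (rule LIMSEQ_le_const2) (use N[OF n _ t] in \<open>auto intro!: exI[of _ N] less_imp_le\<close>)
      then show ?thesis using \<open>\<epsilon> > 0\<close> by linarith
    qed
    then show "\<exists>N. \<forall>n\<ge>N. \<forall>t\<in>edge_dom G e. \<bar>u n (pt G e t) - v (pt G e t)\<bar> < \<epsilon>" by blast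
  qed
  have [measurable]: "v \<in> borel_measurable M" by (rule continuous_measurable[OF v_cont])
  define g where "g n x = (Du n x - w x)\<^sup>2 + V x * (u n x - v x)\<^sup>2 + (u n x - v x)\<^sup>2" for n x
  have g_bound: "integrable M (g n)" "(LINT x|M. g n x) \<le> \<epsilon>"
    if N: "\<And>i j. i \<ge> N \<Longrightarrow> j \<ge> N \<Longrightarrow> energy_form (d i j) (d i j) < \<epsilon>" and n: "n \<ge> N" for n N \<epsilon>
  proof -
    \<comment> \<open>The index \<open>k + N\<close> keeps \<open>r (k + N)\<close> beyond \<open>N\<close> for all \<open>k\<close>.\<close>
    define h where "h k x = (Du n x - Du (r (k + N)) x)\<^sup>2 + V x * (u n x - u (r (k + N)) x)\<^sup>2 + (u n x - u (r (k + N)) x)\<^sup>2" for k x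
    have rN: "r (k + N) \<ge> N" for k using seq_suble[OF r(1), of "k + N"] by linarith
    have h_meas: "h k \<in> borel_measurable M" for k unfolding h_def[abs_def] by measurable
    have g_meas: "g n \<in> borel_measurable M" unfolding g_def[abs_def] by measurable
    have h_nonneg: "AE x in M. 0 \<le> h k x" for k
      using V_nonneg by eventually_elim (auto simp: h_def intro!: add_nonneg_nonneg)
    have h_int: "integrable M (h k)" for k
      using dE(1)[of n "r (k + N)"] by (simp add: h_def[abs_def] d_def)
    have h_le: "(LINT x|M. h k x) \<le> \<epsilon>" for k
      using dE(2)[of n "r (k + N)"] N[OF n rN, of k] by (simp add: h_def d_def)
    have h_lim: "AE x in M. (\<lambda>k. h k x) \<longlonglongrightarrow> g n x"
      using w AE_space
    proof eventually_elim
      case (elim x)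
      have "(\<lambda>k. Du (r (k + N)) x) \<longlonglongrightarrow> w x" using elim(1) by (rule LIMSEQ_ignore_initial_segment)
      moreover have "(\<lambda>k. u (r (k + N)) x) \<longlonglongrightarrow> v x"
        using LIMSEQ_ignore_initial_segment[OF LIMSEQ_subseq_LIMSEQ[OF v r(1)], of x N] elim(2) by (simp add: o_def)
      ultimately show ?case unfolding h_def g_def by (intro tendsto_intros)
    qed
    show "integrable M (g n)" "(LINT x|M. g n x) \<le> \<epsilon>"
      using Fatou_integral[OF h_meas g_meas h_nonneg h_int h_le h_lim] by auto
  qed
  obtain N1 where N1: "\<And>i j. i \<ge> N1 \<Longrightarrow> j \<ge> N1 \<Longrightarrow> energy_form (d i j) (d i j) < 1"
    using cauchy'[of 1] by auto
  have g_int: "integrable M (g n)" if "n \<ge> N1" for n using g_bound(1)[OF N1 that] .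
  have g_nonneg: "AE x in M. 0 \<le> g n x" for n
    using V_nonneg by eventually_elim (auto simp: g_def intro!: add_nonneg_nonneg)
  have g_lim: "(\<lambda>n. LINT x|M. g n x) \<longlonglongrightarrow> 0"
  proof (rule LIMSEQ_I)
    fix \<epsilon> :: real assume "\<epsilon> > 0"
    then obtain N where N: "\<And>i j. i \<ge> N \<Longrightarrow> j \<ge> N \<Longrightarrow> energy_form (d i j) (d i j) < \<epsilon> / 2"
      using cauchy'[of "\<epsilon> / 2"] by auto
    have "norm ((LINT x|M. g n x) - 0) < \<epsilon>" if "n \<ge> N" for n
      using g_bound(2)[OF N that] integral_nonneg_AE[OF g_nonneg[of n]] \<open>\<epsilon> > 0\<close> by simp
    then show "\<exists>N. \<forall>n\<ge>N. norm ((LINT x|M. g n x) - 0) < \<epsilon>" by blast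
  qed
  have parts: "integrable M (\<lambda>x. (Du n x - w x)\<^sup>2)" "integrable M (\<lambda>x. V x * (u n x - v x)\<^sup>2)"
    "integrable M (\<lambda>x. (u n x - v x)\<^sup>2)" if n: "n \<ge> N1" for n
    by (rule Bochner_Integration.integrable_bound[OF g_int[OF n]];
      use V_nonneg in \<open>auto simp: g_def elim!: eventually_mono\<close>)+
  have wv: "weak_deriv G v w"
    unfolding weak_deriv_iff
  proof
    fix e assume e: "e \<in> edges G"
    define J :: "('v, 'e) gpoint set" where "J = EPt e ` edge_int G e"
    have J: "J \<in> sets M" unfolding J_def using e by (intro EPt_image_sets) auto
    have edge: "set_integrable lebesgue (edge_int G e) (\<lambda>t. p (EPt e t))"
      "(LINT t:edge_int G e|lebesgue. p (EPt e t)) = (LINT x:J|M. p x)"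
      if "integrable M p" for p :: "('v, 'e) gpoint \<Rightarrow> real"
      using integral_edge_part[OF e _ order_refl, of p] integrable_mult_indicator[OF J that]
        borel_measurable_integrable[OF that] by (auto simp: J_def set_integrable_def)
    have meas: "(\<lambda>t. indicator (edge_int G e) t * p (EPt e t)) \<in> borel_measurable lebesgue"
      if "p \<in> borel_measurable M" for p :: "('v, 'e) gpoint \<Rightarrow> real"
    proof -
      have "(\<lambda>t. p (EPt e t)) \<in> borel_measurable (restrict_space lebesgue (edge_int G e))"
        using that e by (simp add: borel_measurable_graph_measure_iff)
      then show ?thesis by (subst (asm) borel_measurable_restrict_space_iff) auto
    qed
    have lim0: "(\<lambda>n. LINT t:edge_int G e|lebesgue. p (n + N1) (EPt e t)) \<longlonglongrightarrow> 0"
      if p: "\<And>n. n \<ge> N1 \<Longrightarrow> integrable M (p n)" "\<And>n x. 0 \<le> p n x" "\<And>n. AE x in M. p n x \<le> g n x" for p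
    proof (rule tendsto_sandwich[of "\<lambda>_. 0"])
      have "(LINT x:J|M. p (n + N1) x) \<le> (LINT x|M. g (n + N1) x)" for n
      proof -
        have "(LINT x:J|M. p (n + N1) x) \<le> (LINT x|M. p (n + N1) x)"
          by (rule set_integral_le_integral[OF J p(1) p(2)]) simp
        also have "\<dots> \<le> (LINT x|M. g (n + N1) x)" by (rule integral_mono_AE[OF p(1) g_int p(3)]) simp_all
        finally show ?thesis .
      qed
      then show "\<forall>\<^sub>F n in sequentially. (LINT t:edge_int G e|lebesgue. p (n + N1) (EPt e t)) \<le> (LINT x|M. g (n + N1) x)"
        using edge(2)[OF p(1)] by simp
      show "\<forall>\<^sub>F n in sequentially. 0 \<le> (LINT t:edge_int G e|lebesgue. p (n + N1) (EPt e t))"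
        unfolding set_lebesgue_integral_def using p(2)
        by (intro always_eventually allI Bochner_Integration.integral_nonneg) auto
      show "(\<lambda>n. LINT x|M. g (n + N1) x) \<longlonglongrightarrow> 0" by (rule LIMSEQ_ignore_initial_segment[OF g_lim])
    qed simp
    show "weak_derivative_on (edge_int G e) (\<lambda>t. v (EPt e t)) (\<lambda>t. w (EPt e t))"
    proof (rule weak_derivative_on_limit[where u = "\<lambda>n t. u (n + N1) (EPt e t)" and w = "\<lambda>n t. Du (n + N1) (EPt e t)"])
      show "weak_derivative_on (edge_int G e) (\<lambda>t. u (n + N1) (EPt e t)) (\<lambda>t. Du (n + N1) (EPt e t))" for n
        using uD(2)[of "n + N1"] e by (simp add: weak_deriv_iff Du_def)
      show "(\<lambda>t. indicator (edge_int G e) t * (u (n + N1) (EPt e t) - v (EPt e t))) \<in> borel_measurable lebesgue"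
        "(\<lambda>t. indicator (edge_int G e) t * (Du (n + N1) (EPt e t) - w (EPt e t))) \<in> borel_measurable lebesgue" for n
      proof -
        have "(\<lambda>x. u (n + N1) x - v x) \<in> borel_measurable M" "(\<lambda>x. Du (n + N1) x - w x) \<in> borel_measurable M"
          by measurable
        from this[THEN meas] show "(\<lambda>t. indicator (edge_int G e) t * (u (n + N1) (EPt e t) - v (EPt e t))) \<in> borel_measurable lebesgue"
          "(\<lambda>t. indicator (edge_int G e) t * (Du (n + N1) (EPt e t) - w (EPt e t))) \<in> borel_measurable lebesgue" .
      qed
      show "set_integrable lebesgue (edge_int G e) (\<lambda>t. (u (n + N1) (EPt e t) - v (EPt e t))\<^sup>2)"
        "set_integrable lebesgue (edge_int G e) (\<lambda>t. (Du (n + N1) (EPt e t) - w (EPt e t))\<^sup>2)" for n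
        using edge(1)[OF parts(3), of "n + N1"] edge(1)[OF parts(1), of "n + N1"] by simp_all
      show "(\<lambda>n. LINT t:edge_int G e|lebesgue. (u (n + N1) (EPt e t) - v (EPt e t))\<^sup>2) \<longlonglongrightarrow> 0"
        using V_nonneg by (intro lim0[of "\<lambda>n x. (u n x - v x)\<^sup>2"] parts) (auto simp: g_def elim!: eventually_mono)
      show "(\<lambda>n. LINT t:edge_int G e|lebesgue. (Du (n + N1) (EPt e t) - w (EPt e t))\<^sup>2) \<longlonglongrightarrow> 0"
        using V_nonneg by (intro lim0[of "\<lambda>n x. (Du n x - w x)\<^sup>2"] parts) (auto simp: g_def elim!: eventually_mono)
    qed simp
  qed
  have v_H1: "v \<in> H1 G V"
  proof (rule H1_I[OF v_cont wv])
    let ?u = "u N1" and ?D = "Du N1"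
    have "integrable M (\<lambda>x. 1 * (1 * ?u x + (-1) * (?u x - v x))\<^sup>2)"
      using uD(5)[of N1] parts(3)[of N1] by (intro integrable_square_lin) auto
    then show "integrable M (\<lambda>x. (v x)\<^sup>2)" by simp
    have "integrable M (\<lambda>x. 1 * (1 * ?D x + (-1) * (?D x - w x))\<^sup>2)"
      using uD(6)[of N1, folded Du_def] parts(1)[of N1] by (intro integrable_square_lin) auto
    then show "integrable M (\<lambda>x. (w x)\<^sup>2)" by simp
    have "integrable M (\<lambda>x. V x * (1 * ?u x + (-1) * (?u x - v x))\<^sup>2)"
      using uD(7)[of N1] parts(2)[of N1] V_nonneg by (intro integrable_square_lin) auto
    then show "integrable M (\<lambda>x. V x * (v x)\<^sup>2)" by simp
  qed
  have "energy_form (\<lambda>x. u n x - v x) (\<lambda>x. u n x - v x) = (LINT x|M. g n x)" for n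
  proof -
    have "AE x in M. gderiv G (\<lambda>x. u n x - v x) x = Du n x - w x"
      using gderiv_diff_AE[OF u[of n] v_H1] gderiv_AE[OF v_cont wv] by eventually_elim (simp add: Du_def)
    moreover have "(\<lambda>x. Du n x - w x) \<in> borel_measurable M" by measurable
    ultimately show ?thesis using energy_diag(2)[OF H1_diff[OF u v_H1]] by (simp add: g_def)
  qed
  then show ?thesis using g_lim v_H1 by (intro bexI[of _ v]) auto
qed

text \<open>If there are no edges, the measure is zero and every function is a limit.\<close>

theorem H1_complete: "complete_wrt (H1 G V) energy_form"
  unfolding complete_wrt_def
proof (intro allI impI)
  fix u :: "nat \<Rightarrow> ('v, 'e) gpoint \<Rightarrow> real"
  assume u: "\<forall>n. u n \<in> H1 G V"
    and cauchy: "\<forall>\<epsilon>>0. \<exists>N. \<forall>i\<ge>N. \<forall>j\<ge>N. energy_form (\<lambda>x. u i x - u j x) (\<lambda>x. u i x - u j x) < \<epsilon>"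
  show "\<exists>v\<in>H1 G V. (\<lambda>n. energy_form (\<lambda>x. u n x - v x) (\<lambda>x. u n x - v x)) \<longlonglongrightarrow> 0"
  proof (cases "edges G = {}")
    case True
    then have "AE x in M. P x" for P by (simp add: AE_graph_measure_iff)
    then have "(LINT x|M. p x) = 0" for p :: "('v, 'e) gpoint \<Rightarrow> real" by (intro integral_eq_zero_AE) blast
    then have "energy_form f f = 0" for f by (simp add: form_points L2_inner_points)
    then show ?thesis using zero_H1 by (intro bexI[of _ "\<lambda>x. 0"]) auto
  next
    case False
    then show ?thesis using H1_complete_with_edges[OF False] u cauchy by blast
  qed
qed

section \<open>Rayleigh quotients and the spectrum\<close>

lemma L2_H10:
  assumes H: "H \<in> sets M" and f: "f \<in> H10 G V H"
  shows "f \<in> L2 (measure_on G H)"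
proof -
  note D = H1_D[OF H10_subset[OF f]]
  have "integrable M (\<lambda>x. indicator H x *\<^sub>R (f x)\<^sup>2)" by (rule integrable_mult_indicator[OF H D(5)])
  then have "integrable (measure_on G H) (\<lambda>x. (f x)\<^sup>2)"
    using H by (subst integrable_restrict_space) (simp_all only: sets.Int_space_eq2)
  then show ?thesis using D(3) by (simp add: L2_def measurable_restrict_space1)
qed

text \<open>
  If \<open>\<nu>\<close> is in the resolvent set, then the equation with right-hand side \<open>f\<close> is solvable with
  a uniform bound, which is impossible for some \<open>\<nu> < \<mu>\<close>.
\<close>

theorem spec_bottom_le:
  assumes H: "H \<in> sets M" and f0: "f0 \<in> H10 G V H" "form G V H f0 f0 < \<mu> * L2_inner G H f0 f0"
  shows "spec_bottom G V H \<le> ereal \<mu>"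
proof -
  let ?N = "measure_on G H" and ?A = "schroedinger G V H"
  interpret form_pair "H10 G V H" "form G V H" "L2_inner G H" by (rule form_pair_H10[OF H])
  obtain \<nu> where \<nu>: "\<nu> < \<mu>" and no: "\<not> (\<exists>C. \<forall>f\<in>H10 G V H. \<exists>g\<in>H10 G V H.
      (\<forall>v\<in>H10 G V H. form G V H g v - \<nu> * L2_inner G H g v = L2_inner G H f v) \<and> L2_inner G H g g \<le> C * L2_inner G H f f)"
    using spectrum_below_quotient[OF f0] by blast
  have "\<nu> \<notin> resolvent_set ?N ?A"
  proof
    assume "\<nu> \<in> resolvent_set ?N ?A"
    then obtain C where surj: "\<And>g. g \<in> L2 ?N \<Longrightarrow> \<exists>(f, h)\<in>?A. AE x in ?N. h x - \<nu> * f x = g x"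
      and bound: "\<And>f h. (f, h) \<in> ?A \<Longrightarrow> L2_norm ?N f \<le> C * L2_norm ?N (\<lambda>x. h x - \<nu> * f x)"
      unfolding resolvent_set_def by blast
    have "\<exists>g\<in>H10 G V H. (\<forall>v\<in>H10 G V H. form G V H g v - \<nu> * L2_inner G H g v = L2_inner G H f v)
        \<and> L2_inner G H g g \<le> C\<^sup>2 * L2_inner G H f f" if f: "f \<in> H10 G V H" for f
    proof -
      have fL: "f \<in> L2 ?N" by (rule L2_H10[OF H f])
      obtain g h where gh: "(g, h) \<in> ?A" "AE x in ?N. h x - \<nu> * g x = f x" using surj[OF fL] by blast
      then have g: "g \<in> H10 G V H" and h: "h \<in> L2 ?N"
        and eq: "\<And>v. v \<in> H10 G V H \<Longrightarrow> form G V H g v = (LINT x|?N. h x * v x)"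
        by (auto simp: schroedinger_def)
      have gL: "g \<in> L2 ?N" by (rule L2_H10[OF H g])
      have [measurable]: "f \<in> borel_measurable ?N" "g \<in> borel_measurable ?N" "h \<in> borel_measurable ?N"
        using fL gL h by (auto simp: L2_def)
      have "form G V H g v - \<nu> * L2_inner G H g v = L2_inner G H f v" if v: "v \<in> H10 G V H" for v
      proof -
        have vL: "v \<in> L2 ?N" by (rule L2_H10[OF H v])
        then have [measurable]: "v \<in> borel_measurable ?N" by (simp add: L2_def)
        have "integrable ?N (\<lambda>x. h x * v x)" "integrable ?N (\<lambda>x. g x * v x)"
          using h gL vL by (auto simp: L2_def intro!: integrable_mult_of_squares)
        then have "form G V H g v - \<nu> * L2_inner G H g v = (LINT x|?N. h x * v x - \<nu> * (g x * v x))"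
          by (simp add: eq[OF v] L2_inner_def)
        also have "\<dots> = (LINT x|?N. f x * v x)"
          using gh(2) by (intro integral_cong_AE) (auto elim!: eventually_mono simp: algebra_simps)
        finally show ?thesis by (simp add: L2_inner_def)
      qed
      moreover have "L2_inner G H g g \<le> C\<^sup>2 * L2_inner G H f f"
      proof -
        have "L2_norm ?N (\<lambda>x. h x - \<nu> * g x) = L2_norm ?N f"
          unfolding L2_norm_def using gh(2)
          by (intro arg_cong[where f = sqrt] integral_cong_AE) (auto elim!: eventually_mono)
        then have "L2_norm ?N g \<le> C * L2_norm ?N f" using bound[OF gh(1)] by simp
        moreover have "0 \<le> L2_norm ?N g" by (simp add: L2_norm_def)
        ultimately have "(L2_norm ?N g)\<^sup>2 \<le> (C * L2_norm ?N f)\<^sup>2" by (intro power_mono)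
        moreover have "(L2_norm ?N p)\<^sup>2 = L2_inner G H p p" for p
          by (simp add: L2_norm_def L2_inner_def power2_eq_square[symmetric])
        ultimately show ?thesis by (simp add: power_mult_distrib)
      qed
      ultimately show ?thesis using g by blast
    qed
    with no show False by blast
  qed
  then have "spec_bottom G V H \<le> ereal \<nu>"
    unfolding spec_bottom_def by (intro Inf_lower) (auto simp: spectrum_of_def)
  then show ?thesis using \<nu> by (meson ereal_less_eq(3) less_imp_le order_trans)
qed

lemma L2_inner_zero_AE:
  assumes "f \<in> H1 G V" "L2_inner G (points G) f f = 0"
  shows "AE x in M. f x = 0"
proof -
  have "(LINT x|M. (f x)\<^sup>2) = 0" using assms form_diag(2) by simp
  then show ?thesis using H1_D(5)[OF assms(1)] by (simp add: integral_nonneg_eq_0_iff_AE)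
qed

lemma L2_inner_AE_zero:
  assumes "AE x in M. f x = 0"
  shows "L2_inner G (points G) f f = 0"
  unfolding L2_inner_points using assms by (intro integral_eq_zero_AE) (auto elim!: eventually_mono)

lemma schroedinger_points:
  "(f, h) \<in> schroedinger G V (points G) \<longleftrightarrow> f \<in> H1 G V \<and> h \<in> L2 M \<and>
    (\<forall>g\<in>H1 G V. form G V (points G) f g = (LINT x|M. h x * g x))"
  by (simp add: schroedinger_def H10_points restrict_graph_measure_points)

definition eigenfunctions :: "real \<Rightarrow> (('v, 'e) gpoint \<Rightarrow> real) set" where
  "eigenfunctions \<nu> = {f \<in> H1 G V. \<forall>v\<in>H1 G V. form G V (points G) f v = \<nu> * L2_inner G (points G) f v}"

lemma eigenspace_eq: "eigenspace M (schroedinger G V (points G)) \<nu> = eigenfunctions \<nu>"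
proof (intro set_eqI iffI)
  fix f assume "f \<in> eigenspace M (schroedinger G V (points G)) \<nu>"
  then obtain h where h: "f \<in> H1 G V" "h \<in> L2 M" "AE x in M. h x = \<nu> * f x"
    "\<And>g. g \<in> H1 G V \<Longrightarrow> form G V (points G) f g = (LINT x|M. h x * g x)"
    by (auto simp: eigenspace_def schroedinger_points)
  have [measurable]: "f \<in> borel_measurable M" "h \<in> borel_measurable M" using h H1_D(3) by (auto simp: L2_def)
  have "form G V (points G) f g = \<nu> * L2_inner G (points G) f g" if g: "g \<in> H1 G V" for g
  proof -
    have [measurable]: "g \<in> borel_measurable M" using g H1_D(3) by auto
    have "(LINT x|M. h x * g x) = (LINT x|M. \<nu> * (f x * g x))"
      using h(3) by (intro integral_cong_AE) (auto elim!: eventually_mono)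
    then show ?thesis by (simp add: h(4)[OF g] L2_inner_points)
  qed
  then show "f \<in> eigenfunctions \<nu>" using h(1) by (simp add: eigenfunctions_def)
next
  fix f assume "f \<in> eigenfunctions \<nu>"
  then have f: "f \<in> H1 G V" "\<And>g. g \<in> H1 G V \<Longrightarrow> form G V (points G) f g = \<nu> * L2_inner G (points G) f g"
    by (auto simp: eigenfunctions_def)
  have "(f, \<lambda>x. \<nu> * f x) \<in> schroedinger G V (points G)"
    using f H1_D[OF f(1)] by (simp add: schroedinger_points L2_def L2_inner_points power_mult_distrib mult.assoc)
  then show "f \<in> eigenspace M (schroedinger G V (points G)) \<nu>" by (auto simp: eigenspace_def)
qed

lemma eigenfunctions_function_space: "function_space (eigenfunctions \<nu>)"
proof
  show "(\<lambda>x. 0) \<in> eigenfunctions \<nu>"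
    using zero_H1 full.a.linear_on_zero[OF full.a.linear] full.a.linear_on_zero[OF full.m.linear]
    by (auto simp: eigenfunctions_def)
  show "(\<lambda>x. c * f x + d * g x) \<in> eigenfunctions \<nu>" if "f \<in> eigenfunctions \<nu>" "g \<in> eigenfunctions \<nu>" for f g c d
    using that H1_lin[of f g c d] linear_onD[OF full.a.linear, of _ f g c d] linear_onD[OF full.m.linear, of _ f g c d]
    by (auto simp: eigenfunctions_def algebra_simps)
qed

text \<open>
  The functionals are the evaluations at the points of \<open>X\<close>, scaled to absorb the constant \<open>K\<close>.
  Below \<open>\<nu>0\<close> the spectrum then consists of finitely many eigenvalues of finite multiplicity,
  all of which are discrete.
\<close>

theorem not_essential_if_coercive_modulo_points:
  fixes X :: "('v, 'e) gpoint list"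
  assumes X: "\<And>x. x \<in> set X \<Longrightarrow> \<exists>e\<in>edges G. \<exists>t\<in>edge_dom G e. x = pt G e t"
    and "0 \<le> K"
    and coercive: "\<And>f. f \<in> H1 G V \<Longrightarrow>
      \<nu>0 * L2_inner G (points G) f f \<le> form G V (points G) f f + K * (\<Sum>j<length X. (f (X ! j))\<^sup>2)"
    and \<mu>: "\<mu> < \<nu>0"
  shows "\<mu> \<notin> essential_spectrum (measure_on G (points G)) (schroedinger G V (points G))"
proof -
  let ?A = "schroedinger G V (points G)"
  define l where "l j f = sqrt K * f (X ! j)" for j and f :: "('v, 'e) gpoint \<Rightarrow> real"
  have "\<forall>j. \<exists>C>0. j < length X \<longrightarrow> (\<forall>f\<in>H1 G V. (f (X ! j))\<^sup>2 \<le> C * energy_form f f)"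
  proof
    fix j
    show "\<exists>C>0. j < length X \<longrightarrow> (\<forall>f\<in>H1 G V. (f (X ! j))\<^sup>2 \<le> C * energy_form f f)"
    proof (cases "j < length X")
      case True
      then obtain e t where e: "e \<in> edges G" "t \<in> edge_dom G e" "X ! j = pt G e t" using X[of "X ! j"] by auto
      then show ?thesis using edge_sup_bound[OF e(1)] by auto
    qed (auto intro: exI[of _ 1])
  qed
  from choice[OF this] obtain C where C: "\<And>j. C j > 0"
    "\<And>j f. j < length X \<Longrightarrow> f \<in> H1 G V \<Longrightarrow> (f (X ! j))\<^sup>2 \<le> C j * energy_form f f" by blast
  define L where "L = (\<Sum>j<length X. K * C j)"
  interpret coercive_modulo "H1 G V" "form G V (points G)" "L2_inner G (points G)" l "length X" L \<nu>0
  proof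
    show "linear_on (H1 G V) (l j)" for j by (simp add: linear_on_def l_def algebra_simps)
    show "(l j f)\<^sup>2 \<le> L * energy_form f f" if j: "j < length X" and f: "f \<in> H1 G V" for j f
    proof -
      have e: "0 \<le> energy_form f f" using full.a.nonneg[OF f] full.m.nonneg[OF f] by simp
      have "K * C j \<le> L" unfolding L_def using j \<open>0 \<le> K\<close> C(1)
        by (intro member_le_sum[of j _ "\<lambda>j. K * C j"]) (auto intro: mult_nonneg_nonneg less_imp_le)
      then have "K * C j * energy_form f f \<le> L * energy_form f f" using e by (rule mult_right_mono)
      moreover have "(l j f)\<^sup>2 \<le> K * (C j * energy_form f f)"
        using mult_left_mono[OF C(2)[OF j f] \<open>0 \<le> K\<close>] \<open>0 \<le> K\<close> by (simp add: l_def power_mult_distrib)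
      ultimately show ?thesis by simp
    qed
    show "\<nu>0 * L2_inner G (points G) f f \<le> form G V (points G) f f + (\<Sum>j<length X. (l j f)\<^sup>2)" if "f \<in> H1 G V" for f
      using coercive[OF that] \<open>0 \<le> K\<close> by (simp add: l_def power_mult_distrib sum_distrib_left)
    show "complete_wrt (H1 G V) (\<lambda>f g. energy_form f g)" by (rule H1_complete)
  qed
  define S where "S = {\<nu>. \<nu> < \<nu>0 \<and> (\<exists>f\<in>H1 G V. L2_inner G (points G) f f \<noteq> 0 \<and>
      (\<forall>v\<in>H1 G V. form G V (points G) f v = \<nu> * L2_inner G (points G) f v))}"
  have "finite S" unfolding S_def by (rule finite_eigenvalues)
  have spec: "\<nu> \<in> S" if \<nu>: "\<nu> \<in> spectrum_of M ?A" "\<nu> < \<nu>0" for \<nu>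
  proof (rule ccontr)
    assume "\<nu> \<notin> S"
    then have none: "L2_inner G (points G) f f = 0"
      if "f \<in> H1 G V" "\<And>v. v \<in> H1 G V \<Longrightarrow> form G V (points G) f v = \<nu> * L2_inner G (points G) f v" for f
      using that \<nu>(2) by (auto simp: S_def)
    obtain C where C: "\<And>\<phi> B. linear_on (H1 G V) \<phi> \<Longrightarrow> 0 \<le> B \<Longrightarrow>
        (\<And>v. v \<in> H1 G V \<Longrightarrow> (\<phi> v)\<^sup>2 \<le> B * L2_inner G (points G) v v) \<Longrightarrow>
        \<exists>u\<in>H1 G V. (\<forall>v\<in>H1 G V. form G V (points G) u v - \<nu> * L2_inner G (points G) u v = \<phi> v) \<and>
          L2_inner G (points G) u u \<le> C * B"
      using Fredholm_alternative[OF \<nu>(2) none] by blast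
    have solve: "\<exists>u\<in>H1 G V. (\<forall>v\<in>H1 G V. form G V (points G) u v - \<nu> * L2_inner G (points G) u v = (LINT x|M. g x * v x)) \<and>
          L2_inner G (points G) u u \<le> C * (LINT x|M. (g x)\<^sup>2)" if g: "g \<in> L2 M" for g
    proof (rule C)
      have int: "integrable M (\<lambda>x. g x * v x)" if "v \<in> H1 G V" for v
        using g H1_D[OF that] by (intro integrable_mult_of_squares) (auto simp: L2_def)
      show "linear_on (H1 G V) (\<lambda>v. LINT x|M. g x * v x)"
        unfolding linear_on_def
      proof (intro ballI allI)
        fix f h c d assume fh: "f \<in> H1 G V" "h \<in> H1 G V"
        have "(LINT x|M. g x * (c * f x + d * h x)) = (LINT x|M. c * (g x * f x) + d * (g x * h x))"
          by (simp add: algebra_simps)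
        then show "(LINT x|M. g x * (c * f x + d * h x)) = c * (LINT x|M. g x * f x) + d * (LINT x|M. g x * h x)"
          using int[OF fh(1)] int[OF fh(2)] by simp
      qed
      show "(LINT x|M. g x * v x)\<^sup>2 \<le> (LINT x|M. (g x)\<^sup>2) * L2_inner G (points G) v v" if v: "v \<in> H1 G V" for v
        unfolding form_diag(2)[OF v] using g H1_D[OF v]
        by (intro Cauchy_Schwarz_integral) (auto simp: L2_def)
    qed (intro Bochner_Integration.integral_nonneg, simp)
    have "\<nu> \<in> resolvent_set M ?A"
      unfolding resolvent_set_def
    proof (intro CollectI conjI ballI exI[of _ "sqrt \<bar>C\<bar>"])
      fix g assume g: "g \<in> L2 M"
      then obtain u where u: "u \<in> H1 G V"
        "\<And>v. v \<in> H1 G V \<Longrightarrow> form G V (points G) u v - \<nu> * L2_inner G (points G) u v = (LINT x|M. g x * v x)"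
        using solve by blast
      note uD = H1_D[OF u(1)]
      have gi: "g \<in> borel_measurable M" "integrable M (\<lambda>x. (g x)\<^sup>2)" using g by (auto simp: L2_def)
      have "(u, \<lambda>x. g x + \<nu> * u x) \<in> ?A"
        unfolding schroedinger_points
      proof (intro conjI ballI)
        have "integrable M (\<lambda>x. 1 * (1 * g x + \<nu> * u x)\<^sup>2)"
          using uD gi by (intro integrable_square_lin) auto
        then show "(\<lambda>x. g x + \<nu> * u x) \<in> L2 M" using gi uD by (simp add: L2_def)
        fix v assume v: "v \<in> H1 G V"
        have "integrable M (\<lambda>x. g x * v x)" "integrable M (\<lambda>x. u x * v x)"
          using gi uD H1_D[OF v] by (auto intro!: integrable_mult_of_squares)
        then have "(LINT x|M. g x * v x + \<nu> * (u x * v x)) = (LINT x|M. g x * v x) + \<nu> * (LINT x|M. u x * v x)"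
          by simp
        then show "form G V (points G) u v = (LINT x|M. (g x + \<nu> * u x) * v x)"
          using u(2)[OF v] by (simp add: L2_inner_points distrib_right mult.assoc)
      qed (rule u)
      then show "\<exists>(f, h)\<in>?A. AE x in M. h x - \<nu> * f x = g x"
        by (intro bexI[of _ "(u, \<lambda>x. g x + \<nu> * u x)"]) auto
    next
      fix p assume "p \<in> ?A"
      then obtain f h where p: "p = (f, h)" and f: "f \<in> H1 G V" and h: "h \<in> L2 M"
        and fh: "\<And>v. v \<in> H1 G V \<Longrightarrow> form G V (points G) f v = (LINT x|M. h x * v x)"
        by (cases p) (auto simp: schroedinger_points)
      define g where "g = (\<lambda>x. h x - \<nu> * f x)"
      note fD = H1_D[OF f]
      have hi: "h \<in> borel_measurable M" "integrable M (\<lambda>x. (h x)\<^sup>2)" using h by (auto simp: L2_def)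
      have "integrable M (\<lambda>x. 1 * (1 * h x + (- \<nu>) * f x)\<^sup>2)"
        using fD hi by (intro integrable_square_lin) auto
      then have g: "g \<in> L2 M" using hi fD by (simp add: L2_def g_def)
      obtain u where u: "u \<in> H1 G V"
        "\<And>v. v \<in> H1 G V \<Longrightarrow> form G V (points G) u v - \<nu> * L2_inner G (points G) u v = (LINT x|M. g x * v x)"
        "L2_inner G (points G) u u \<le> C * (LINT x|M. (g x)\<^sup>2)"
        using solve[OF g] by blast
      define w where "w = (\<lambda>x. f x - u x)"
      have w: "w \<in> H1 G V" unfolding w_def by (rule H1_diff[OF f u(1)])
      have "form G V (points G) w v = \<nu> * L2_inner G (points G) w v" if v: "v \<in> H1 G V" for v
      proof -
        have "integrable M (\<lambda>x. h x * v x)" "integrable M (\<lambda>x. f x * v x)"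
          using hi fD H1_D[OF v] by (auto intro!: integrable_mult_of_squares)
        then have "(LINT x|M. h x * v x - \<nu> * (f x * v x)) = (LINT x|M. h x * v x) - \<nu> * (LINT x|M. f x * v x)"
          by simp
        then have "(LINT x|M. g x * v x) = form G V (points G) f v - \<nu> * L2_inner G (points G) f v"
          by (simp add: fh[OF v] L2_inner_points g_def left_diff_distrib mult.assoc)
        then show ?thesis
          using u(2)[OF v] full.a.linear_on_diff[OF full.a.linear[OF v] f u(1)]
            full.a.linear_on_diff[OF full.m.linear[OF v] f u(1)]
          by (simp add: w_def right_diff_distrib)
      qed
      then have "AE x in M. w x = 0" using none[OF w] L2_inner_zero_AE[OF w] by blast
      then have "(LINT x|M. (f x)\<^sup>2) = (LINT x|M. (u x)\<^sup>2)"
        using fD H1_D[OF u(1)] by (intro integral_cong_AE) (auto elim!: eventually_mono simp: w_def)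
      also have "\<dots> \<le> C * (LINT x|M. (g x)\<^sup>2)" using u(3) by (simp add: form_diag(2)[OF u(1)])
      also have "\<dots> \<le> \<bar>C\<bar> * (LINT x|M. (g x)\<^sup>2)" by (intro mult_right_mono) auto
      finally have "L2_norm M f \<le> sqrt \<bar>C\<bar> * L2_norm M g"
        unfolding L2_norm_def by (simp flip: real_sqrt_mult)
      then show "case p of (f, h) \<Rightarrow> L2_norm M f \<le> sqrt \<bar>C\<bar> * L2_norm M (\<lambda>x. h x - \<nu> * f x)"
        by (simp add: p g_def)
    qed
    with \<nu>(1) show False by (simp add: spectrum_of_def)
  qed
  have "\<mu> \<in> discrete_spectrum M ?A" if \<mu>s: "\<mu> \<in> spectrum_of M ?A"
    unfolding discrete_spectrum_def
  proof (intro CollectI conjI)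
    \<comment> \<open>A finite part of the spectrum below \<open>\<nu>0\<close> isolates each of its points.\<close>
    have "open ({..<\<nu>0} - (S - {\<mu>}))" using \<open>finite S\<close> by (intro open_Diff finite_imp_closed) auto
    moreover have "({..<\<nu>0} - (S - {\<mu>})) \<inter> spectrum_of M ?A = {\<mu>}" using spec \<mu> \<mu>s by auto
    ultimately show "\<mu> isolated_in spectrum_of M ?A" using \<mu>s unfolding isolated_in_def by blast
    obtain f where f: "f \<in> eigenfunctions \<mu>" "L2_inner G (points G) f f \<noteq> 0"
      using spec[OF \<mu>s \<mu>] by (auto simp: S_def eigenfunctions_def)
    then show "is_eigenvalue M ?A \<mu>"
      using L2_inner_AE_zero unfolding is_eigenvalue_def eigenspace_eq by blast
    have "\<exists>B. finite B \<and> B \<subseteq> eigenfunctions \<mu> \<and>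
      (\<forall>f\<in>eigenfunctions \<mu>. \<exists>c. AE x in M. f x - (\<Sum>b\<in>B. c b * b x) = 0)"
    proof (rule finite_spanning_set[OF eigenfunctions_function_space, where l = l and N = "length X"])
      show "linear_on (eigenfunctions \<mu>) (l j)" for j by (simp add: linear_on_def l_def algebra_simps)
      show "AE x in M. f x = 0" if "f \<in> eigenfunctions \<mu>" "\<And>j. j < length X \<Longrightarrow> l j f = 0" for f
        using that eigenfunction_null[OF \<mu>, of f] L2_inner_zero_AE[of f] by (auto simp: eigenfunctions_def)
    qed
    then show "finite_multiplicity M ?A \<mu>" unfolding finite_multiplicity_def eigenspace_eq by simp
  qed
  then show ?thesis by (auto simp: essential_spectrum_def restrict_graph_measure_points)
qed

end

section \<open>Edgewise affine height functions and cutoffs\<close>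

context connected_metric_graph begin

definition slope :: "('v, 'e) gpoint \<Rightarrow> 'e \<Rightarrow> real" where
  "slope x0 e = (if elen G e = \<infinity> then 1
     else (gdist G x0 (Vert (tgt G e)) - gdist G x0 (Vert (src G e))) / real_of_ereal (elen G e))"

text \<open>
  Agrees with the distance from \<open>x0\<close> at the vertices and is affine on each edge. The distance
  itself is only piecewise affine on edges, so that smooth functions of it need not be smooth.
\<close>

definition height :: "('v, 'e) gpoint \<Rightarrow> ('v, 'e) gpoint \<Rightarrow> real" where
  "height x0 z = (case z of Vert v \<Rightarrow> gdist G x0 (Vert v)
     | EPt e t \<Rightarrow> gdist G x0 (Vert (src G e)) + slope x0 e * t)"

lemma elen_cases:
  assumes "e \<in> edges G"
  obtains (finite) l where "elen G e = ereal l" "0 < l" | (infinite) "elen G e = \<infinity>"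
  using assms metric by (cases "elen G e") (auto simp: metric_graph_def)

lemma pt_0: "pt G e 0 = Vert (src G e)"
  by (simp add: pt_def)

lemma pt_end: "elen G e = ereal l \<Longrightarrow> 0 < l \<Longrightarrow> pt G e l = Vert (tgt G e)"
  by (simp add: pt_def)

lemma zero_in_dom: "e \<in> edges G \<Longrightarrow> 0 \<in> edge_dom G e"
  using metric unfolding metric_graph_def edge_dom_def zero_ereal_def by (auto intro: less_imp_le)

lemma end_in_dom: "elen G e = ereal l \<Longrightarrow> 0 < l \<Longrightarrow> l \<in> edge_dom G e"
  by (simp add: edge_dom_def)

lemma src_in_points: "e \<in> edges G \<Longrightarrow> Vert (src G e) \<in> points G"
  using pt_in_points[OF metric _ zero_in_dom, of e] by (simp add: pt_0)

lemma height_pt: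
  assumes e: "e \<in> edges G" and t: "t \<in> edge_dom G e"
  shows "height x0 (pt G e t) = gdist G x0 (Vert (src G e)) + slope x0 e * t"
  using e
proof (cases rule: elen_cases)
  case (finite l)
  then show ?thesis using t by (auto simp: pt_def height_def slope_def)
next
  case infinite
  then show ?thesis using t by (auto simp: pt_def height_def)
qed

lemma slope_le_1:
  assumes x0: "x0 \<in> points G" and e: "e \<in> edges G"
  shows "\<bar>slope x0 e\<bar> \<le> 1"
  using e
proof (cases rule: elen_cases)
  case (finite l)
  have v: "Vert (src G e) \<in> points G" "Vert (tgt G e) \<in> points G"
    using src_in_points[OF e] pt_in_points[OF metric e end_in_dom[OF finite]] by (auto simp: pt_end[OF finite])
  have "gdist G (Vert (src G e)) (Vert (tgt G e)) \<le> l"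
    using gdist_pt_le[OF e zero_in_dom[OF e] end_in_dom[OF finite]] finite by (simp add: pt_0 pt_end[OF finite])
  then have "\<bar>gdist G x0 (Vert (tgt G e)) - gdist G x0 (Vert (src G e))\<bar> \<le> l"
    using dist.triangle[OF x0 v] dist.triangle[OF x0 v(2,1)] dist.commute[of "Vert (src G e)" "Vert (tgt G e)"] by linarith
  then show ?thesis using finite by (simp add: slope_def)
qed (simp add: slope_def)

lemma height_Lipschitz:
  assumes x0: "x0 \<in> points G" and x: "x \<in> points G" "y \<in> points G"
  shows "\<bar>height x0 x - height x0 y\<bar> \<le> gdist G x y"
proof -
  obtain r where r: "walk G x y r" using connected x by (auto simp: graph_connected_def)
  show ?thesis
  proof (rule gdist_ge[OF r])
    fix r assume "walk G x y r"
    then show "\<bar>height x0 x - height x0 y\<bar> \<le> r"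
    proof (rule walk_lipschitz)
      fix e s t assume e: "e \<in> edges G" "s \<in> edge_dom G e" "t \<in> edge_dom G e"
      have "\<bar>slope x0 e * (s - t)\<bar> \<le> 1 * \<bar>s - t\<bar>"
        unfolding abs_mult by (intro mult_right_mono slope_le_1[OF x0 e(1)]) auto
      then show "\<bar>height x0 (pt G e s) - height x0 (pt G e t)\<bar> \<le> \<bar>s - t\<bar>"
        by (simp add: height_pt[OF e(1,2)] height_pt[OF e(1,3)] right_diff_distrib)
    qed
  qed
qed

lemma height_continuous: "x0 \<in> points G \<Longrightarrow> continuous_map (gtop G) euclideanreal (height x0)"
  unfolding continuous_map_iff
proof (intro ballI allI impI)
  fix x and \<epsilon> :: real assume "x0 \<in> points G" "x \<in> points G" "\<epsilon> > 0"
  then show "\<exists>\<delta>>0. \<forall>y\<in>points G. gdist G x y < \<delta> \<longrightarrow> \<bar>height x0 x - height x0 y\<bar> < \<epsilon>"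
    using height_Lipschitz by (intro exI[of _ \<epsilon>]) (meson order_le_less_trans)
qed

text \<open>
  If the height is at most \<open>R\<close> at some point of an edge, then by affinity an end point of the
  edge has distance at most \<open>R\<close> from \<open>x0\<close>.
\<close>

lemma finite_low_edges:
  assumes x0: "x0 \<in> points G"
  shows "finite {e \<in> edges G. \<exists>t\<in>edge_dom G e. height x0 (pt G e t) \<le> R}"
proof (rule finite_subset)
  show "finite {e \<in> edges G. edge_set G e \<inter> gball G x0 (R + 1) \<noteq> {}}"
    using finite_balls x0 by (auto simp: finite_ball_condition_def)
  show "{e \<in> edges G. \<exists>t\<in>edge_dom G e. height x0 (pt G e t) \<le> R}
      \<subseteq> {e \<in> edges G. edge_set G e \<inter> gball G x0 (R + 1) \<noteq> {}}"
  proof clarify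
    fix e t assume e: "e \<in> edges G" and t: "t \<in> edge_dom G e" "height x0 (pt G e t) \<le> R"
      and empty: "edge_set G e \<inter> gball G x0 (R + 1) = {}"
    have far: "R + 1 \<le> gdist G x0 (pt G e s)" if "s \<in> edge_dom G e" for s
      using empty that pt_in_points[OF metric e that] by (force simp: edge_set_def gball_def)
    have R: "gdist G x0 (Vert (src G e)) + slope x0 e * t \<le> R" using t by (simp add: height_pt[OF e])
    have s: "R + 1 \<le> gdist G x0 (Vert (src G e))" using far[OF zero_in_dom[OF e]] by (simp add: pt_0)
    from e show False
    proof (cases rule: elen_cases)
      case (finite l)
      have tl: "0 \<le> t" "t \<le> l" using t(1) finite by (auto simp: edge_dom_def)
      have e': "R + 1 \<le> gdist G x0 (Vert (tgt G e))"
        using far[OF end_in_dom[OF finite]] by (simp add: pt_end[OF finite])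
      define p q where "p = gdist G x0 (Vert (src G e))" and "q = gdist G x0 (Vert (tgt G e))"
      have "l * R \<ge> l * (p + (q - p) / l * t)"
        using R finite by (intro mult_left_mono) (auto simp: slope_def p_def q_def)
      also have "l * (p + (q - p) / l * t) = (l - t) * p + t * q"
        using finite by (simp add: field_simps)
      finally have "(l - t) * p + t * q \<le> l * R" .
      moreover have "(l - t) * (R + 1) \<le> (l - t) * p" "t * (R + 1) \<le> t * q"
        using tl s e' by (auto intro!: mult_left_mono simp: p_def q_def)
      ultimately have "l * (R + 1) \<le> l * R" by (simp add: algebra_simps)
      then show False using finite by simp
    next
      case infinite
      then show False using R s t(1) by (auto simp: slope_def edge_dom_def)
    qed
  qed
qed

lemma low_part_bounded:
  assumes e: "e \<in> edges G"
  shows "\<exists>T>0. {0..T} \<subseteq> edge_dom G e \<and> (\<forall>t\<in>edge_dom G e. height x0 (pt G e t) \<le> R \<longrightarrow> t \<le> T)"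
  using e
proof (cases rule: elen_cases)
  case (finite l)
  then show ?thesis by (intro exI[of _ l]) (auto simp: edge_dom_def)
next
  case infinite
  moreover have "t \<le> max 1 R" if "gdist G x0 (Vert (src G e)) + t \<le> R" for t
    using that gdist_nonneg[of G x0 "Vert (src G e)"] by linarith
  ultimately show ?thesis
    by (intro exI[of _ "max 1 R"]) (auto simp: edge_dom_def height_pt[OF e] slope_def simp del: max.bounded_iff le_max_iff_disj)
qed

text \<open>
  The derivative of the height along the edges, with the default value \<open>0\<close> at the vertices, a
  null set.
\<close>

definition edge_slope :: "('v, 'e) gpoint \<Rightarrow> ('v, 'e) gpoint \<Rightarrow> real" where
  "edge_slope x0 z = (case z of Vert v \<Rightarrow> 0 | EPt e t \<Rightarrow> slope x0 e)"

end

context schroedinger_graph begin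

lemma form_eq_weak:
  assumes "f \<in> H1 G V" and z: "z \<in> borel_measurable M" "AE x in M. gderiv G f x = z x"
  shows "form G V (points G) f f = (LINT x|M. (z x)\<^sup>2 + V x * (f x)\<^sup>2)"
    and "integrable M (\<lambda>x. (z x)\<^sup>2 + V x * (f x)\<^sup>2)"
proof -
  note D = H1_D[OF assms(1)]
  have [measurable]: "f \<in> borel_measurable M" "gderiv G f \<in> borel_measurable M" using D by auto
  note [measurable] = z(1)
  have "form G V (points G) f f = (LINT x|M. (gderiv G f x)\<^sup>2 + V x * (f x)\<^sup>2)"
    by (simp add: form_points power2_eq_square mult.assoc)
  also have "\<dots> = (LINT x|M. (z x)\<^sup>2 + V x * (f x)\<^sup>2)"
    using z(2) by (intro integral_cong_AE) (auto elim!: eventually_mono)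
  finally show "form G V (points G) f f = (LINT x|M. (z x)\<^sup>2 + V x * (f x)\<^sup>2)" .
  show "integrable M (\<lambda>x. (z x)\<^sup>2 + V x * (f x)\<^sup>2)"
    using energy_diag(3)[OF assms] D(7) by simp
qed

text \<open>
  The weak derivative \<open>z\<close> is made explicit because its two parts are estimated separately.
\<close>

theorem cutoff_H1:
  assumes x0: "x0 \<in> points G" and u: "u \<in> H1 G V" and \<theta>: "smooth \<theta>"
    and bound: "\<And>h. 0 \<le> \<theta> h" "\<And>h. \<theta> h \<le> 1" "\<And>h. \<bar>deriv \<theta> h\<bar> \<le> C"
  defines "z \<equiv> \<lambda>x. \<theta> (height x0 x) * gderiv G u x + deriv \<theta> (height x0 x) * edge_slope x0 x * u x"
  shows "(\<lambda>x. \<theta> (height x0 x) * u x) \<in> H1 G V"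
    and "z \<in> borel_measurable M"
    and "AE x in M. gderiv G (\<lambda>x. \<theta> (height x0 x) * u x) x = z x"
    and "AE x in M. (deriv \<theta> (height x0 x) * edge_slope x0 x * u x)\<^sup>2 \<le> C\<^sup>2 * (u x)\<^sup>2"
    and "AE x in M. (z x)\<^sup>2 \<le> 2 * (gderiv G u x)\<^sup>2 + 2 * (C\<^sup>2 * (u x)\<^sup>2)"
    and "(\<lambda>x. \<theta> (height x0 x)) \<in> borel_measurable M"
proof -
  note D = H1_D[OF u]
  have cont: "continuous_map (gtop G) euclideanreal (\<lambda>x. \<theta> (height x0 x))"
    using continuous_map_compose[OF height_continuous[OF x0], of euclideanreal \<theta>] smooth_continuous_on[OF \<theta>, of UNIV]
    by (simp add: o_def)
  then have cont_u: "continuous_map (gtop G) euclideanreal (\<lambda>x. \<theta> (height x0 x) * u x)"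
    using D(1) by (rule continuous_map_real_mult)
  show [measurable]: "(\<lambda>x. \<theta> (height x0 x)) \<in> borel_measurable M" by (rule continuous_measurable[OF cont])
  have wd: "weak_deriv G (\<lambda>x. \<theta> (height x0 x) * u x) z"
    unfolding weak_deriv_iff
  proof
    fix e assume e: "e \<in> edges G"
    define a where "a = gdist G x0 (Vert (src G e))"
    define b where "b = slope x0 e"
    have d: "deriv (\<lambda>t. \<theta> (a + b * t)) t = deriv \<theta> (a + b * t) * b" for t
      by (rule DERIV_imp_deriv, rule DERIV_chain2[where f = \<theta> and g = "\<lambda>t. a + b * t", OF smooth_has_deriv[OF \<theta>]])
        (auto intro!: derivative_eq_intros)
    have "weak_derivative_on (edge_int G e) (\<lambda>t. \<theta> (a + b * t) * u (EPt e t))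
        (\<lambda>t. \<theta> (a + b * t) * gderiv G u (EPt e t) + deriv (\<lambda>t. \<theta> (a + b * t)) t * u (EPt e t))"
      using D(2) e by (intro weak_derivative_on_times_smooth smooth_affine[OF \<theta>]) (auto simp: weak_deriv_iff)
    then show "weak_derivative_on (edge_int G e) (\<lambda>t. \<theta> (height x0 (EPt e t)) * u (EPt e t)) (\<lambda>t. z (EPt e t))"
      unfolding d by (simp add: z_def height_def edge_slope_def a_def b_def mult.assoc)
  qed
  show zm [measurable]: "z \<in> borel_measurable M" by (rule weak_deriv_measurable[OF wd])
  show "AE x in M. gderiv G (\<lambda>x. \<theta> (height x0 x) * u x) x = z x" by (rule gderiv_AE[OF cont_u wd])
  have q: "(deriv \<theta> (height x0 x) * edge_slope x0 x * u x)\<^sup>2 \<le> C\<^sup>2 * (u x)\<^sup>2" if "x \<in> points G" for x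
  proof -
    have "\<bar>edge_slope x0 x\<bar> \<le> 1"
      using that slope_le_1[OF x0] by (auto simp: edge_slope_def points_def)
    then have "\<bar>deriv \<theta> (height x0 x)\<bar> * \<bar>edge_slope x0 x\<bar> \<le> C * 1"
      using bound(3)[of "height x0 x"] by (intro mult_mono) auto
    then have "\<bar>deriv \<theta> (height x0 x) * edge_slope x0 x\<bar> \<le> C" by (simp add: abs_mult)
    then have "\<bar>deriv \<theta> (height x0 x) * edge_slope x0 x\<bar>\<^sup>2 \<le> C\<^sup>2" by (intro power_mono) auto
    then have "(deriv \<theta> (height x0 x) * edge_slope x0 x)\<^sup>2 * (u x)\<^sup>2 \<le> C\<^sup>2 * (u x)\<^sup>2"
      by (intro mult_right_mono) auto
    then show ?thesis by (simp only: power_mult_distrib)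
  qed
  have \<theta>2: "(\<theta> h)\<^sup>2 \<le> 1" for h using bound(1,2)[of h] by (simp add: power_le_one)
  have z2: "(z x)\<^sup>2 \<le> 2 * (gderiv G u x)\<^sup>2 + 2 * (C\<^sup>2 * (u x)\<^sup>2)" if "x \<in> points G" for x
  proof -
    have "(p + r)\<^sup>2 \<le> 2 * p\<^sup>2 + 2 * r\<^sup>2" for p r :: real
      using zero_le_power2[of "p - r"] by (simp add: power2_eq_square algebra_simps)
    then have "(z x)\<^sup>2 \<le> 2 * (\<theta> (height x0 x) * gderiv G u x)\<^sup>2 + 2 * (deriv \<theta> (height x0 x) * edge_slope x0 x * u x)\<^sup>2"
      unfolding z_def .
    moreover have "(\<theta> (height x0 x) * gderiv G u x)\<^sup>2 \<le> 1 * (gderiv G u x)\<^sup>2"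
      unfolding power_mult_distrib by (intro mult_right_mono \<theta>2) auto
    ultimately show ?thesis using q[OF that] by linarith
  qed
  show "AE x in M. (deriv \<theta> (height x0 x) * edge_slope x0 x * u x)\<^sup>2 \<le> C\<^sup>2 * (u x)\<^sup>2" by (rule AE_I2) (simp add: q)
  show z2_AE: "AE x in M. (z x)\<^sup>2 \<le> 2 * (gderiv G u x)\<^sup>2 + 2 * (C\<^sup>2 * (u x)\<^sup>2)" by (rule AE_I2) (simp add: z2)
  have [measurable]: "u \<in> borel_measurable M" using D by simp
  show "(\<lambda>x. \<theta> (height x0 x) * u x) \<in> H1 G V"
  proof (rule H1_I[OF cont_u wd])
    have le: "(\<theta> (height x0 x) * u x)\<^sup>2 \<le> 1 * (u x)\<^sup>2" for x
      unfolding power_mult_distrib by (intro mult_right_mono \<theta>2) auto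
    show "integrable M (\<lambda>x. (\<theta> (height x0 x) * u x)\<^sup>2)"
      by (rule Bochner_Integration.integrable_bound[OF D(5)]) (use le in auto)
    show "integrable M (\<lambda>x. V x * (\<theta> (height x0 x) * u x)\<^sup>2)"
    proof (rule Bochner_Integration.integrable_bound[OF D(7)])
      show "AE x in M. norm (V x * (\<theta> (height x0 x) * u x)\<^sup>2) \<le> norm (V x * (u x)\<^sup>2)"
        using V_nonneg by eventually_elim (use le in \<open>auto intro!: mult_left_mono\<close>)
    qed simp
    have "integrable M (\<lambda>x. 2 * (gderiv G u x)\<^sup>2 + 2 * (C\<^sup>2 * (u x)\<^sup>2))" using D by simp
    then show "integrable M (\<lambda>x. (z x)\<^sup>2)"
      by (rule Bochner_Integration.integrable_bound) (use z2_AE in \<open>auto elim!: eventually_mono\<close>)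
  qed
qed

section \<open>The energy of functions that vanish on a bounded set\<close>

lemma height_measurable: "x0 \<in> points G \<Longrightarrow> height x0 \<in> borel_measurable M"
  by (intro continuous_measurable height_continuous)

lemma low_part_sets: "x0 \<in> points G \<Longrightarrow> {x \<in> points G. height x0 x \<le> R} \<in> sets M"
proof -
  assume "x0 \<in> points G"
  then have [measurable]: "height x0 \<in> borel_measurable M" by (rule height_measurable)
  have "{x \<in> space M. height x0 x \<le> R} \<in> sets M" by measurable
  then show ?thesis by simp
qed

text \<open>
  From \<open>(p + q)\<^sup>2 \<le> (1 + \<delta>) p\<^sup>2 + (1 + 1/\<delta>) q\<^sup>2\<close>, where \<open>q\<close> contains the derivative of the
  cutoff and so lives on \<open>B\<close>.
\<close>

theorem cutoff_form_bound:
  assumes x0: "x0 \<in> points G" and u: "u \<in> H1 G V" and \<theta>: "smooth \<theta>"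
    and bound: "\<And>h. 0 \<le> \<theta> h" "\<And>h. \<theta> h \<le> 1" "\<And>h. \<bar>deriv \<theta> h\<bar> \<le> C"
    and "\<delta> > 0" and B: "B \<in> sets M" "\<And>x. x \<in> points G \<Longrightarrow> x \<notin> B \<Longrightarrow> deriv \<theta> (height x0 x) = 0"
  shows "form G V (points G) (\<lambda>x. \<theta> (height x0 x) * u x) (\<lambda>x. \<theta> (height x0 x) * u x)
    \<le> (1 + \<delta>) * form G V (points G) u u + (1 + 1 / \<delta>) * C\<^sup>2 * (LINT x:B|M. (u x)\<^sup>2)"
proof -
  note cut = cutoff_H1[OF x0 u \<theta> bound] and D = H1_D[OF u]
  let ?w = "gderiv G u"
  let ?z = "\<lambda>x. \<theta> (height x0 x) * ?w x + deriv \<theta> (height x0 x) * edge_slope x0 x * u x"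
  have Bi: "integrable M (\<lambda>x. indicator B x *\<^sub>R (u x)\<^sup>2)" by (rule integrable_mult_indicator[OF B(1) D(5)])
  have "form G V (points G) (\<lambda>x. \<theta> (height x0 x) * u x) (\<lambda>x. \<theta> (height x0 x) * u x)
      = (LINT x|M. (?z x)\<^sup>2 + V x * (\<theta> (height x0 x) * u x)\<^sup>2)"
    by (rule form_eq_weak(1)[OF cut(1-3)])
  also have "\<dots> \<le> (LINT x|M. (1 + \<delta>) * ((?w x)\<^sup>2 + V x * (u x)\<^sup>2) + (1 + 1 / \<delta>) * C\<^sup>2 * (indicator B x *\<^sub>R (u x)\<^sup>2))"
  proof (rule integral_mono_AE)
    show "integrable M (\<lambda>x. (?z x)\<^sup>2 + V x * (\<theta> (height x0 x) * u x)\<^sup>2)" by (rule form_eq_weak(2)[OF cut(1-3)])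
    show "integrable M (\<lambda>x. (1 + \<delta>) * ((?w x)\<^sup>2 + V x * (u x)\<^sup>2) + (1 + 1 / \<delta>) * C\<^sup>2 * (indicator B x *\<^sub>R (u x)\<^sup>2))"
      using D Bi by (intro Bochner_Integration.integrable_add integrable_mult_right) auto
    show "AE x in M. (?z x)\<^sup>2 + V x * (\<theta> (height x0 x) * u x)\<^sup>2
        \<le> (1 + \<delta>) * ((?w x)\<^sup>2 + V x * (u x)\<^sup>2) + (1 + 1 / \<delta>) * C\<^sup>2 * (indicator B x *\<^sub>R (u x)\<^sup>2)"
      using V_nonneg cut(4) AE_space
    proof eventually_elim
      case (elim x)
      define p where "p = \<theta> (height x0 x) * ?w x"
      define q where "q = deriv \<theta> (height x0 x) * edge_slope x0 x * u x"
      have \<theta>2: "(\<theta> (height x0 x))\<^sup>2 \<le> 1" using bound(1,2) by (simp add: power_le_one)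
      have p2: "p\<^sup>2 \<le> 1 * (?w x)\<^sup>2" unfolding p_def power_mult_distrib using \<theta>2 by (intro mult_right_mono) auto
      have u2: "(\<theta> (height x0 x) * u x)\<^sup>2 \<le> 1 * (u x)\<^sup>2"
        unfolding power_mult_distrib using \<theta>2 by (intro mult_right_mono) auto
      have q2: "q\<^sup>2 \<le> C\<^sup>2 * (indicator B x * (u x)\<^sup>2)"
        using elim B(2)[of x] by (cases "x \<in> B") (auto simp: q_def)
      have "(p + q)\<^sup>2 \<le> (1 + \<delta>) * p\<^sup>2 + (1 + 1 / \<delta>) * q\<^sup>2"
      proof -
        have "(p + q)\<^sup>2 + (\<delta> * p - q)\<^sup>2 / \<delta> = (1 + \<delta>) * p\<^sup>2 + (1 + 1 / \<delta>) * q\<^sup>2"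
          using \<open>\<delta> > 0\<close> by (simp add: power2_eq_square field_simps)
        moreover have "0 \<le> (\<delta> * p - q)\<^sup>2 / \<delta>" using \<open>\<delta> > 0\<close> by simp
        ultimately show ?thesis by linarith
      qed
      also have "\<dots> \<le> (1 + \<delta>) * (?w x)\<^sup>2 + (1 + 1 / \<delta>) * (C\<^sup>2 * (indicator B x * (u x)\<^sup>2))"
        using p2 q2 \<open>\<delta> > 0\<close> by (intro add_mono mult_left_mono) auto
      finally have "(?z x)\<^sup>2 \<le> (1 + \<delta>) * (?w x)\<^sup>2 + (1 + 1 / \<delta>) * (C\<^sup>2 * (indicator B x * (u x)\<^sup>2))"
        by (simp only: p_def q_def)
      moreover have "V x * (\<theta> (height x0 x) * u x)\<^sup>2 \<le> (1 + \<delta>) * (V x * (u x)\<^sup>2)"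
      proof -
        have "V x * (\<theta> (height x0 x) * u x)\<^sup>2 \<le> V x * (u x)\<^sup>2" using u2 elim by (intro mult_left_mono) auto
        moreover have "0 \<le> \<delta> * (V x * (u x)\<^sup>2)" using elim \<open>\<delta> > 0\<close> by simp
        ultimately show ?thesis by (simp add: distrib_right)
      qed
      ultimately show ?case by (simp only: distrib_left real_scaleR_def mult.assoc)
    qed
  qed
  also have "\<dots> = (1 + \<delta>) * (LINT x|M. (?w x)\<^sup>2 + V x * (u x)\<^sup>2) + (1 + 1 / \<delta>) * C\<^sup>2 * (LINT x:B|M. (u x)\<^sup>2)"
  proof -
    have "integrable M (\<lambda>x. (1 + \<delta>) * ((?w x)\<^sup>2 + V x * (u x)\<^sup>2))" using D by simp
    moreover have "integrable M (\<lambda>x. (1 + 1 / \<delta>) * C\<^sup>2 * (indicator B x *\<^sub>R (u x)\<^sup>2))" using Bi by simp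
    ultimately show ?thesis by (simp add: set_lebesgue_integral_def)
  qed
  also have "(LINT x|M. (?w x)\<^sup>2 + V x * (u x)\<^sup>2) = form G V (points G) u u"
    using form_eq_weak(1)[OF u D(4)] by simp
  finally show ?thesis .
qed

text \<open>
  The part below the height \<open>R\<close> has a finite cover by short intervals, because only finitely
  many edges reach down there (\<open>finite_low_edges\<close>), and each of them on a bounded part of its
  length (\<open>low_part_bounded\<close>).
\<close>

lemma low_part_cover:
  assumes x0: "x0 \<in> points G" and "\<eta> > 0"
  shows "\<exists>(F :: 'e set) (n :: 'e \<Rightarrow> nat) (\<tau> :: 'e \<Rightarrow> real). finite F \<and> F \<subseteq> edges G \<and>
    (\<forall>e\<in>F. 0 < \<tau> e \<and> \<tau> e \<le> \<eta> \<and> {0..real (n e) * \<tau> e} \<subseteq> edge_dom G e) \<and>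
    (\<forall>e\<in>edges G. \<forall>t\<in>edge_dom G e. height x0 (pt G e t) \<le> R \<longrightarrow> e \<in> F \<and> t \<le> real (n e) * \<tau> e)"
proof -
  define F where "F = {e \<in> edges G. \<exists>t\<in>edge_dom G e. height x0 (pt G e t) \<le> R}"
  have F: "finite F" "F \<subseteq> edges G" using finite_low_edges[OF x0] by (auto simp: F_def)
  have "\<forall>e\<in>edges G. \<exists>T>0. {0..T} \<subseteq> edge_dom G e \<and> (\<forall>t\<in>edge_dom G e. height x0 (pt G e t) \<le> R \<longrightarrow> t \<le> T)"
    using low_part_bounded by blast
  from bchoice[OF this] obtain T where T: "\<And>e. e \<in> edges G \<Longrightarrow> T e > 0 \<and> {0..T e} \<subseteq> edge_dom G e"
    "\<And>e t. e \<in> edges G \<Longrightarrow> t \<in> edge_dom G e \<Longrightarrow> height x0 (pt G e t) \<le> R \<Longrightarrow> t \<le> T e" by blast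
  define n where "n e = nat \<lceil>T e / \<eta>\<rceil> + 1" for e
  define \<tau> where "\<tau> e = T e / real (n e)" for e
  have n\<tau>: "real (n e) * \<tau> e = T e" for e by (simp add: \<tau>_def n_def)
  have "0 < \<tau> e \<and> \<tau> e \<le> \<eta> \<and> {0..real (n e) * \<tau> e} \<subseteq> edge_dom G e" if "e \<in> F" for e
  proof -
    have e: "e \<in> edges G" using that F(2) by blast
    have "T e / \<eta> \<le> real (n e)" unfolding n_def by linarith
    then have "T e \<le> \<eta> * real (n e)" using \<open>\<eta> > 0\<close> by (simp add: pos_divide_le_eq mult.commute)
    then have "\<tau> e \<le> \<eta>" by (simp add: \<tau>_def n_def pos_divide_le_eq)
    moreover have "0 < \<tau> e" using T(1)[OF e] by (simp add: \<tau>_def n_def)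
    ultimately show ?thesis using T(1)[OF e] by (simp add: n\<tau>)
  qed
  moreover have "e \<in> F \<and> t \<le> real (n e) * \<tau> e"
    if "e \<in> edges G" "t \<in> edge_dom G e" "height x0 (pt G e t) \<le> R" for e t
    using that T(2)[OF that] by (auto simp: F_def n\<tau>)
  ultimately show ?thesis using F by (intro exI[of _ F] exI[of _ n] exI[of _ \<tau>]) blast
qed

lemma grid_interval:
  fixes t \<tau> :: real
  assumes "0 < \<tau>" "0 < t" "t \<le> real n * \<tau>" "\<And>k. k \<le> n \<Longrightarrow> t \<noteq> real k * \<tau>"
  shows "\<exists>i<n. t \<in> {real i * \<tau><..<real i * \<tau> + \<tau>}"
proof -
  define i where "i = nat \<lfloor>t / \<tau>\<rfloor>"
  have "0 \<le> t / \<tau>" using assms by simp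
  then have i: "real i \<le> t / \<tau>" "t / \<tau> < real i + 1" by (simp_all add: i_def)
  then have 1: "real i * \<tau> \<le> t" "t < real i * \<tau> + \<tau>" using assms(1)
    by (simp_all add: pos_le_divide_eq pos_divide_less_eq distrib_right)
  have "t < real n * \<tau>" using assms(3) assms(4)[of n] by linarith
  then have "real i * \<tau> < real n * \<tau>" using 1 by linarith
  then have "i < n" using assms(1) by simp
  moreover have "real i * \<tau> \<noteq> t" using assms(4)[of i] \<open>i < n\<close> by auto
  ultimately show ?thesis using 1 by (intro exI[of _ i]) auto
qed

text \<open>
  Sum the Poincare estimate over the intervals of the cover; the points are their left end
  points. The factor \<open>\<eta>\<^sup>2\<close> before the form can be made small, at the expense of more points.
\<close>

theorem low_part_Poincare:
  assumes x0: "x0 \<in> points G" and \<eta>: "\<eta> > 0"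
  shows "\<exists>X. (\<forall>x\<in>set X. \<exists>e\<in>edges G. \<exists>t\<in>edge_dom G e. x = pt G e t) \<and>
    (\<forall>u\<in>H1 G V. (LINT x:{x \<in> points G. height x0 x \<le> R}|M. (u x)\<^sup>2)
      \<le> 2 * \<eta> * (\<Sum>j<length X. (u (X ! j))\<^sup>2) + 2 * \<eta>\<^sup>2 * form G V (points G) u u)"
proof -
  define B where "B = {x \<in> points G. height x0 x \<le> R}"
  have B: "B \<in> sets M" unfolding B_def by (rule low_part_sets[OF x0])
  obtain F :: "'e set" and n :: "'e \<Rightarrow> nat" and \<tau> :: "'e \<Rightarrow> real" where F: "finite F" "F \<subseteq> edges G"
    and \<tau>': "\<forall>e\<in>F. 0 < \<tau> e \<and> \<tau> e \<le> \<eta> \<and> {0..real (n e) * \<tau> e} \<subseteq> edge_dom G e"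
    and cover': "\<forall>e\<in>edges G. \<forall>t\<in>edge_dom G e. height x0 (pt G e t) \<le> R \<longrightarrow> e \<in> F \<and> t \<le> real (n e) * \<tau> e"
    using low_part_cover[OF x0 \<eta>, of R] by (elim exE conjE)
  have \<tau>: "0 < \<tau> e \<and> \<tau> e \<le> \<eta> \<and> {0..real (n e) * \<tau> e} \<subseteq> edge_dom G e" if "e \<in> F" for e
    using \<tau>' that by blast
  have cover: "e \<in> F \<and> t \<le> real (n e) * \<tau> e"
    if "e \<in> edges G" "t \<in> edge_dom G e" "height x0 (pt G e t) \<le> R" for e t
    using cover' that by blast
  define P where "P = (SIGMA e:F. {..<n e})"
  have P: "finite P" using F by (simp add: P_def)
  define lo where "lo p = real (snd p) * \<tau> (fst p)" for p :: "'e \<times> nat"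
  define J :: "'e \<times> nat \<Rightarrow> ('v, 'e) gpoint set"
    where "J p = EPt (fst p) ` {lo p<..<lo p + \<tau> (fst p)}" for p
  define y where "y p = pt G (fst p) (lo p)" for p
  have pe: "fst p \<in> edges G" "fst p \<in> F" if "p \<in> P" for p using that F by (auto simp: P_def)
  have \<tau>p: "0 < \<tau> (fst p)" "\<tau> (fst p) \<le> \<eta>" if "p \<in> P" for p using \<tau>[OF pe(2)[OF that]] by auto
  have dom: "{lo p..lo p + \<tau> (fst p)} \<subseteq> edge_dom G (fst p)" if p: "p \<in> P" for p
  proof -
    have "snd p < n (fst p)" using p by (auto simp: P_def)
    then have "real (snd p) + 1 \<le> real (n (fst p))" by linarith
    then have "(real (snd p) + 1) * \<tau> (fst p) \<le> real (n (fst p)) * \<tau> (fst p)"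
      using \<tau>p(1)[OF p] by (intro mult_right_mono) auto
    moreover have "0 \<le> lo p" using \<tau>p(1)[OF p] by (simp add: lo_def)
    ultimately have "{lo p..lo p + \<tau> (fst p)} \<subseteq> {0..real (n (fst p)) * \<tau> (fst p)}"
      by (auto simp: lo_def distrib_right)
    then show ?thesis using \<tau>[OF pe(2)[OF p]] by blast
  qed
  have y: "\<exists>e\<in>edges G. \<exists>t\<in>edge_dom G e. y p = pt G e t" if p: "p \<in> P" for p
    using pe(1)[OF p] dom[OF p] \<tau>p(1)[OF p] unfolding y_def by (intro bexI[of _ "fst p"] bexI[of _ "lo p"]) auto
  have disj: "disjoint_family_on J P"
    unfolding disjoint_family_on_def
  proof (intro ballI impI)
    fix p q assume pq: "p \<in> P" "q \<in> P" "p \<noteq> q"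
    show "J p \<inter> J q = {}"
    proof (rule ccontr)
      assume "J p \<inter> J q \<noteq> {}"
      then obtain t where t: "fst p = fst q" "t \<in> {lo p<..<lo p + \<tau> (fst p)}" "t \<in> {lo q<..<lo q + \<tau> (fst q)}"
        by (auto simp: J_def simp del: greaterThanLessThan_iff)
      have "snd p = snd q"
      proof (rule ccontr)
        assume "snd p \<noteq> snd q"
        then consider "real (snd p) + 1 \<le> real (snd q)" | "real (snd q) + 1 \<le> real (snd p)" by linarith
        then show False
        proof cases
          case 1
          then have "(real (snd p) + 1) * \<tau> (fst p) \<le> real (snd q) * \<tau> (fst p)"
            using \<tau>p(1)[OF pq(1)] by (intro mult_right_mono) auto
          then show False using t by (auto simp: lo_def distrib_right)
        next
          case 2
          then have "(real (snd q) + 1) * \<tau> (fst p) \<le> real (snd p) * \<tau> (fst p)"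
            using \<tau>p(1)[OF pq(1)] by (intro mult_right_mono) auto
          then show False using t by (auto simp: lo_def distrib_right)
        qed
      qed
      with t(1) pq(3) show False by (simp add: prod_eq_iff)
    qed
  qed
  obtain ps where ps: "set ps = P" "distinct ps" using finite_distinct_list[OF P] by blast
  define X where "X = map y ps"
  have X_sum: "(\<Sum>j<length X. g (X ! j)) = (\<Sum>p\<in>P. g (y p))" for g :: "('v, 'e) gpoint \<Rightarrow> real"
  proof -
    have "(\<Sum>p\<in>P. g (y p)) = sum_list (map (\<lambda>p. g (y p)) ps)"
      using sum.distinct_set_conv_list[OF ps(2), of "\<lambda>p. g (y p)"] ps(1) by simp
    also have "\<dots> = (\<Sum>j<length X. g (X ! j))"
      by (simp add: sum_list_sum_nth X_def atLeast0LessThan)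
    finally show ?thesis by simp
  qed
  have "(LINT x:B|M. (u x)\<^sup>2) \<le> 2 * \<eta> * (\<Sum>j<length X. (u (X ! j))\<^sup>2) + 2 * \<eta>\<^sup>2 * form G V (points G) u u"
    if u: "u \<in> H1 G V" for u
  proof -
    note D = H1_D[OF u]
    have int: "weak_derivative_interval (edge_int G (fst p)) (\<lambda>t. u (pt G (fst p) t)) (\<lambda>t. gderiv G u (EPt (fst p) t)) (lo p) (lo p + \<tau> (fst p))"
      "(LINT t:{lo p<..<lo p + \<tau> (fst p)}|lebesgue. (u (pt G (fst p) t))\<^sup>2) = (LINT x:J p|M. (u x)\<^sup>2)"
      "(LINT t:{lo p<..<lo p + \<tau> (fst p)}|lebesgue. (gderiv G u (EPt (fst p) t))\<^sup>2) = (LINT x:J p|M. (gderiv G u x)\<^sup>2)"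
      "J p \<in> sets M" if p: "p \<in> P" for p
      using edge_interval[OF u pe(1)[OF p] _ dom[OF p]] \<tau>p(1)[OF p] by (auto simp: J_def)
    have local: "(LINT x:J p|M. (u x)\<^sup>2) \<le> 2 * \<eta> * (u (y p))\<^sup>2 + 2 * \<eta>\<^sup>2 * (LINT x:J p|M. (gderiv G u x)\<^sup>2)"
      if p: "p \<in> P" for p
    proof -
      interpret weak_derivative_interval "edge_int G (fst p)" "\<lambda>t. u (pt G (fst p) t)"
        "\<lambda>t. gderiv G u (EPt (fst p) t)" "lo p" "lo p + \<tau> (fst p)" by (rule int(1)[OF p])
      have "(LINT x:J p|M. (u x)\<^sup>2) \<le> 2 * \<tau> (fst p) * (u (y p))\<^sup>2 + 2 * (\<tau> (fst p))\<^sup>2 * (LINT x:J p|M. (gderiv G u x)\<^sup>2)"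
        using Poincare_estimate[of "lo p"] \<tau>p(1)[OF p] by (simp add: int(2,3)[OF p] y_def)
      also have "\<dots> \<le> 2 * \<eta> * (u (y p))\<^sup>2 + 2 * \<eta>\<^sup>2 * (LINT x:J p|M. (gderiv G u x)\<^sup>2)"
        using \<tau>p[OF p] W_nonneg int(3)[OF p]
        by (intro add_mono mult_right_mono mult_left_mono power_mono) auto
      finally show ?thesis .
    qed
    have Ji: "integrable M (\<lambda>x. indicator (J p) x * g x)" if "p \<in> P" "integrable M g" for p and g :: "('v, 'e) gpoint \<Rightarrow> real"
      using integrable_mult_indicator[OF int(4)[OF that(1)] that(2)] by simp
    have "(LINT x:B|M. (u x)\<^sup>2) \<le> (LINT x|M. (\<Sum>p\<in>P. indicator (J p) x * (u x)\<^sup>2))"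
      unfolding set_lebesgue_integral_def
    proof (rule integral_mono_AE)
      show "integrable M (\<lambda>x. indicator B x *\<^sub>R (u x)\<^sup>2)" by (rule integrable_mult_indicator[OF B D(5)])
      show "integrable M (\<lambda>x. \<Sum>p\<in>P. indicator (J p) x * (u x)\<^sup>2)"
        by (intro Bochner_Integration.integrable_sum Ji D)
      show "AE x in M. indicator B x *\<^sub>R (u x)\<^sup>2 \<le> (\<Sum>p\<in>P. indicator (J p) x * (u x)\<^sup>2)"
        unfolding AE_graph_measure_iff
      proof
        fix e assume e: "e \<in> edges G"
        \<comment> \<open>The intervals are open and miss the points of the grid.\<close>
        have "AE t in lebesgue. t \<notin> (\<lambda>k. real k * \<tau> e) ` {..n e}"
          by (rule AE_not_in) (auto intro!: finite_imp_null_set_lborel null_sets_completionI)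
        then show "AE t in lebesgue. t \<in> edge_int G e \<longrightarrow>
            indicator B (EPt e t) *\<^sub>R (u (EPt e t))\<^sup>2 \<le> (\<Sum>p\<in>P. indicator (J p) (EPt e t) * (u (EPt e t))\<^sup>2)"
        proof eventually_elim
          case (elim t)
          show ?case
          proof
            assume t: "t \<in> edge_int G e"
            show "indicator B (EPt e t) *\<^sub>R (u (EPt e t))\<^sup>2 \<le> (\<Sum>p\<in>P. indicator (J p) (EPt e t) * (u (EPt e t))\<^sup>2)"
            proof (cases "EPt e t \<in> B")
              case True
              then have "height x0 (pt G e t) \<le> R" using t by (simp add: B_def pt_interior)
              then have eF: "e \<in> F" "t \<le> real (n e) * \<tau> e" using cover[OF e] t edge_int_subset_dom[of e] by auto
              obtain i where i: "i < n e" "t \<in> {real i * \<tau> e<..<real i * \<tau> e + \<tau> e}"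
                using grid_interval[of "\<tau> e" t "n e"] \<tau>[OF eF(1)] eF(2) t elim by (auto simp: edge_int_def)
              have p: "(e, i) \<in> P" "EPt e t \<in> J (e, i)" using eF i by (auto simp: P_def J_def lo_def)
              have "indicator (J (e, i)) (EPt e t) * (u (EPt e t))\<^sup>2 \<le> (\<Sum>p\<in>P. indicator (J p) (EPt e t) * (u (EPt e t))\<^sup>2)"
                by (rule member_le_sum[OF p(1) _ P]) auto
              then show ?thesis using p(2) True by simp
            qed (auto intro!: sum_nonneg)
          qed
        qed
      qed
    qed
    also have "\<dots> = (\<Sum>p\<in>P. (LINT x:J p|M. (u x)\<^sup>2))"
      unfolding set_lebesgue_integral_def by (subst Bochner_Integration.integral_sum) (auto intro!: Ji D)
    also have "\<dots> \<le> (\<Sum>p\<in>P. 2 * \<eta> * (u (y p))\<^sup>2 + 2 * \<eta>\<^sup>2 * (LINT x:J p|M. (gderiv G u x)\<^sup>2))"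
      by (intro sum_mono local)
    also have "\<dots> = 2 * \<eta> * (\<Sum>p\<in>P. (u (y p))\<^sup>2) + 2 * \<eta>\<^sup>2 * (\<Sum>p\<in>P. (LINT x:J p|M. (gderiv G u x)\<^sup>2))"
      by (simp add: sum.distrib sum_distrib_left)
    also have "(\<Sum>p\<in>P. (LINT x:J p|M. (gderiv G u x)\<^sup>2)) = (LINT x|M. (\<Sum>p\<in>P. indicator (J p) x * (gderiv G u x)\<^sup>2))"
      unfolding set_lebesgue_integral_def by (subst Bochner_Integration.integral_sum) (auto intro!: Ji D)
    also have "\<dots> \<le> (LINT x|M. (gderiv G u x)\<^sup>2)"
    proof (rule integral_mono)
      show "integrable M (\<lambda>x. \<Sum>p\<in>P. indicator (J p) x * (gderiv G u x)\<^sup>2)"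
        by (intro Bochner_Integration.integrable_sum Ji D)
      show "integrable M (\<lambda>x. (gderiv G u x)\<^sup>2)" by (rule D)
      show "(\<Sum>p\<in>P. indicator (J p) x * (gderiv G u x)\<^sup>2) \<le> (gderiv G u x)\<^sup>2" for x
      proof -
        have "(\<Sum>p\<in>P. indicator (J p) x * (gderiv G u x)\<^sup>2) = indicator (\<Union>p\<in>P. J p) x * (gderiv G u x)\<^sup>2"
          by (simp add: indicator_UN_disjoint[OF P disj] sum_distrib_right)
        then show ?thesis by (auto simp: indicator_def)
      qed
    qed
    also have "\<dots> \<le> form G V (points G) u u" using form_diag[OF u] by simp
    finally show ?thesis using \<eta> by (simp add: X_sum[of "\<lambda>x. (u x)\<^sup>2"] mult_left_mono)
  qed
  then show ?thesis using y ps(1) unfolding B_def by (intro exI[of _ X]) (auto simp: X_def)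
qed

text \<open>
  Suppose the quotient is at least \<open>\<nu>\<close> for all functions that vanish up to the height \<open>r\<close>.
  Splitting off the part of \<open>u\<close> below \<open>r + 1\<close> by a cutoff and estimating it by
  \<open>low_part_Poincare\<close>, one obtains \<open>\<nu> m(u, u) \<le> (1 + 2 \<delta>) a(u, u)\<close> up to finitely many point
  values. For small \<open>\<delta>\<close> this excludes \<open>\<mu>\<close> from the essential spectrum.
\<close>

theorem ground_energy_outside:
  assumes x0: "x0 \<in> points G"
    and ess: "\<mu> \<in> essential_spectrum (measure_on G (points G)) (schroedinger G V (points G))"
    and "\<mu> < \<nu>"
  shows "\<exists>u\<in>H1 G V. (\<forall>x\<in>points G. height x0 x \<le> r \<longrightarrow> u x = 0) \<and>
    form G V (points G) u u < \<nu> * L2_inner G (points G) u u"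
proof (rule ccontr)
  assume "\<not> ?thesis"
  then have outside: "\<nu> * L2_inner G (points G) u u \<le> form G V (points G) u u"
    if "u \<in> H1 G V" "\<And>x. x \<in> points G \<Longrightarrow> height x0 x \<le> r \<Longrightarrow> u x = 0" for u
    using that by (meson not_le)
  \<comment> \<open>The form is nonnegative, so no functionals are needed to exclude \<open>\<mu> < 0\<close>.\<close>
  have "0 \<le> \<mu>"
  proof (rule ccontr)
    assume "\<not> 0 \<le> \<mu>"
    then have "\<mu> \<notin> essential_spectrum (measure_on G (points G)) (schroedinger G V (points G))"
      by (intro not_essential_if_coercive_modulo_points[of "[]" 0 0]) (auto intro: full.a.nonneg)
    with ess show False by simp
  qed
  then have "\<nu> > 0" using \<open>\<mu> < \<nu>\<close> by simp
  \<comment> \<open>Chosen such that \<open>(1 + 2 \<delta>) \<mu> < \<nu>\<close>: one \<open>\<delta>\<close> for the cutoff, one for the Poincare estimate.\<close>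
  define \<delta> where "\<delta> = (\<nu> - \<mu>) / (4 * (\<mu> + 1))"
  have \<delta>: "\<delta> > 0" using \<open>0 \<le> \<mu>\<close> \<open>\<mu> < \<nu>\<close> by (simp add: \<delta>_def)
  have "2 * \<delta> * \<mu> \<le> 2 * \<delta> * (\<mu> + 1)" using \<delta> by simp
  also have "\<dots> = (\<nu> - \<mu>) / 2" using \<open>0 \<le> \<mu>\<close> by (simp add: \<delta>_def field_simps)
  finally have \<mu>\<delta>: "(1 + 2 * \<delta>) * \<mu> < \<nu>" using \<open>\<mu> < \<nu>\<close> by (simp add: algebra_simps)
  obtain C where C: "C > 0" "\<And>x. \<bar>deriv step x\<bar> \<le> C" using deriv_step_bounded by blast
  define \<theta> where "\<theta> h = step (- r + 1 * h)" for h
  have \<theta>_smooth: "smooth \<theta>" unfolding \<theta>_def[abs_def] by (rule smooth_affine[OF smooth_step])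
  have \<theta>_deriv: "deriv \<theta> h = deriv step (h - r)" for h
    using scaled_step_deriv[of 1 r h] by (intro DERIV_imp_deriv) (simp add: \<theta>_def[abs_def] algebra_simps)
  have bound: "0 \<le> \<theta> h" "\<theta> h \<le> 1" "\<bar>deriv \<theta> h\<bar> \<le> C" for h
    using step_range C(2) by (auto simp: \<theta>_def \<theta>_deriv)
  define B where "B = {x \<in> points G. height x0 x \<le> r + 1}"
  have B: "B \<in> sets M" unfolding B_def by (rule low_part_sets[OF x0])
  have B0: "deriv \<theta> (height x0 x) = 0" if "x \<in> points G" "x \<notin> B" for x
    using that deriv_step_0[of "height x0 x - r"] by (auto simp: B_def \<theta>_deriv)
  define K where "K = (1 + 1 / \<delta>) * C\<^sup>2 + \<nu>"
  have K: "K > 0" using \<delta> \<open>\<nu> > 0\<close> by (auto simp: K_def intro!: add_nonneg_pos mult_nonneg_nonneg)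
  \<comment> \<open>Makes the factor \<open>2 * \<eta>\<^sup>2 * K\<close>, with which the form reappears on the right, at most \<open>\<delta>\<close>.\<close>
  define \<eta> where "\<eta> = min 1 (\<delta> / (2 * K))"
  have \<eta>: "\<eta> > 0" using \<delta> K by (simp add: \<eta>_def)
  have \<eta>K: "2 * \<eta>\<^sup>2 * K \<le> \<delta>"
  proof -
    have "\<eta> * \<eta> \<le> 1 * (\<delta> / (2 * K))" using \<eta> by (intro mult_mono) (auto simp: \<eta>_def)
    then have "2 * K * (\<eta> * \<eta>) \<le> 2 * K * (\<delta> / (2 * K))" using K by (intro mult_left_mono) auto
    then show ?thesis using K by (simp add: power2_eq_square mult_ac)
  qed
  obtain X where X: "\<And>x. x \<in> set X \<Longrightarrow> \<exists>e\<in>edges G. \<exists>t\<in>edge_dom G e. x = pt G e t"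
    "\<And>u. u \<in> H1 G V \<Longrightarrow> (LINT x:B|M. (u x)\<^sup>2)
      \<le> 2 * \<eta> * (\<Sum>j<length X. (u (X ! j))\<^sup>2) + 2 * \<eta>\<^sup>2 * form G V (points G) u u"
    using low_part_Poincare[OF x0 \<eta>, of "r + 1"] unfolding B_def by blast
  have coercive: "\<nu> * L2_inner G (points G) u u
      \<le> (1 + 2 * \<delta>) * form G V (points G) u u + K * (2 * \<eta>) * (\<Sum>j<length X. (u (X ! j))\<^sup>2)"
    if u: "u \<in> H1 G V" for u
  proof -
    define v where "v = (\<lambda>x. \<theta> (height x0 x) * u x)"
    define mB where "mB = (LINT x:B|M. (u x)\<^sup>2)"
    define S where "S = (\<Sum>j<length X. (u (X ! j))\<^sup>2)"
    define A where "A = form G V (points G) u u"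
    have A0: "0 \<le> A" unfolding A_def by (rule full.a.nonneg[OF u])
    note D = H1_D[OF u]
    have v: "v \<in> H1 G V" unfolding v_def by (rule cutoff_H1(1)[OF x0 u \<theta>_smooth bound])
    have "\<theta> h = 0" if "h \<le> r" for h using that step_0[of "h - r"] by (simp add: \<theta>_def)
    then have "\<nu> * L2_inner G (points G) v v \<le> form G V (points G) v v" by (intro outside v) (simp add: v_def)
    also have "\<dots> \<le> (1 + \<delta>) * A + (1 + 1 / \<delta>) * C\<^sup>2 * mB"
      unfolding v_def A_def mB_def using cutoff_form_bound[OF x0 u \<theta>_smooth bound \<delta> B B0] .
    finally have 1: "\<nu> * L2_inner G (points G) v v \<le> (1 + \<delta>) * A + (1 + 1 / \<delta>) * C\<^sup>2 * mB" .
    have "(LINT x|M. (u x)\<^sup>2) \<le> (LINT x|M. (v x)\<^sup>2 + indicator B x *\<^sub>R (u x)\<^sup>2)"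
    proof (rule integral_mono)
      show "(u x)\<^sup>2 \<le> (v x)\<^sup>2 + indicator B x *\<^sub>R (u x)\<^sup>2" if "x \<in> space M" for x
        using that step_1[of "height x0 x - r"] by (cases "x \<in> B") (auto simp: B_def v_def \<theta>_def)
      show "integrable M (\<lambda>x. (v x)\<^sup>2 + indicator B x *\<^sub>R (u x)\<^sup>2)"
        using H1_D(5)[OF v] integrable_mult_indicator[OF B D(5)] by (rule Bochner_Integration.integrable_add)
    qed (rule D)
    also have "\<dots> = (LINT x|M. (v x)\<^sup>2) + mB"
      unfolding mB_def set_lebesgue_integral_def
      using H1_D(5)[OF v] integrable_mult_indicator[OF B D(5)] by (rule Bochner_Integration.integral_add)
    finally have "\<nu> * L2_inner G (points G) u u \<le> \<nu> * (L2_inner G (points G) v v + mB)"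
      using \<open>\<nu> > 0\<close> by (simp add: form_diag(2)[OF u] form_diag(2)[OF v])
    also have "\<dots> \<le> (1 + \<delta>) * A + K * mB" using 1 by (simp add: K_def algebra_simps)
    also have "\<dots> \<le> (1 + \<delta>) * A + K * (2 * \<eta> * S + 2 * \<eta>\<^sup>2 * A)"
      using X(2)[OF u] K by (intro add_left_mono mult_left_mono) (auto simp: mB_def S_def A_def)
    also have "\<dots> = (1 + \<delta>) * A + (2 * \<eta>\<^sup>2 * K) * A + K * (2 * \<eta>) * S" by (simp add: algebra_simps)
    also have "\<dots> \<le> (1 + \<delta>) * A + \<delta> * A + K * (2 * \<eta>) * S"
      using mult_right_mono[OF \<eta>K A0] by linarith
    finally show ?thesis by (simp add: A_def S_def algebra_simps)
  qed
  define q where "q = 1 + 2 * \<delta>"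
  have q: "q > 0" using \<delta> by (simp add: q_def)
  have "\<mu> \<notin> essential_spectrum (measure_on G (points G)) (schroedinger G V (points G))"
  proof (rule not_essential_if_coercive_modulo_points[of X "K * (2 * \<eta>) / q" "\<nu> / q"])
    show "0 \<le> K * (2 * \<eta>) / q" using K \<eta> q by simp
    show "\<mu> < \<nu> / q" using \<mu>\<delta> q by (simp add: q_def pos_less_divide_eq mult.commute)
    show "\<nu> / q * L2_inner G (points G) f f \<le> form G V (points G) f f + K * (2 * \<eta>) / q * (\<Sum>j<length X. (f (X ! j))\<^sup>2)"
      if "f \<in> H1 G V" for f
    proof -
      have "\<nu> * L2_inner G (points G) f f / q \<le> (q * form G V (points G) f f + K * (2 * \<eta>) * (\<Sum>j<length X. (f (X ! j))\<^sup>2)) / q"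
        using coercive[OF that] q by (intro divide_right_mono) (auto simp: q_def)
      then show ?thesis using q by (simp add: add_divide_distrib)
    qed
  qed (rule X)
  with ess show False by simp
qed

text \<open>
  Cutoffs at growing heights \<open>n\<close> with uniformly bounded derivatives change the form and the
  norm of a fixed function by amounts that tend to zero, by dominated convergence.
\<close>

theorem ground_energy_annulus:
  assumes x0: "x0 \<in> points G"
    and ess: "\<mu> \<in> essential_spectrum (measure_on G (points G)) (schroedinger G V (points G))"
    and "\<mu> < \<nu>"
  shows "\<exists>R. \<exists>u\<in>H1 G V. (\<forall>x\<in>points G. height x0 x \<le> r \<or> R \<le> height x0 x \<longrightarrow> u x = 0) \<and>
    form G V (points G) u u < \<nu> * L2_inner G (points G) u u"
proof -
  obtain u where u: "u \<in> H1 G V" "\<And>x. x \<in> points G \<Longrightarrow> height x0 x \<le> r \<Longrightarrow> u x = 0"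
    "form G V (points G) u u < \<nu> * L2_inner G (points G) u u"
    using ground_energy_outside[OF x0 ess \<open>\<mu> < \<nu>\<close>, of r] by blast
  note D = H1_D[OF u(1)]
  have [measurable]: "u \<in> borel_measurable M" "gderiv G u \<in> borel_measurable M" using D by auto
  obtain C where C: "C > 0" "\<And>x. \<bar>deriv step x\<bar> \<le> C" using deriv_step_bounded by blast
  define \<theta> where "\<theta> n h = 1 - step (1 * (h - real n))" for n :: nat and h
  have \<theta>_smooth: "smooth (\<theta> n)" for n
    unfolding \<theta>_def[abs_def] by (intro smooth_diff smooth_const smooth_scaled_step)
  have \<theta>_deriv: "deriv (\<theta> n) h = - deriv step (h - real n)" for n h
    unfolding \<theta>_def[abs_def] using DERIV_diff[OF DERIV_const scaled_step_deriv[of 1 "real n" h], of 1]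
    by (intro DERIV_imp_deriv) simp
  have bound: "0 \<le> \<theta> n h" "\<theta> n h \<le> 1" "\<bar>deriv (\<theta> n) h\<bar> \<le> C" for n h
    using step_range[of "h - real n"] C(2) by (auto simp: \<theta>_def \<theta>_deriv)
  have ev: "\<forall>\<^sub>F n in sequentially. \<theta> n h = 1 \<and> deriv (\<theta> n) h = 0" for h
  proof -
    obtain N where "h < real N" using reals_Archimedean2 by blast
    then have "\<theta> n h = 1 \<and> deriv (\<theta> n) h = 0" if "n \<ge> N" for n
      using that step_0[of "h - real n"] deriv_step_0[of "h - real n"] by (simp add: \<theta>_def \<theta>_deriv)
    then show ?thesis by (auto simp: eventually_sequentially)
  qed
  define v where "v n = (\<lambda>x. \<theta> n (height x0 x) * u x)" for n
  define z where "z n = (\<lambda>x. \<theta> n (height x0 x) * gderiv G u x + deriv (\<theta> n) (height x0 x) * edge_slope x0 x * u x)" for n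
  have cut: "v n \<in> H1 G V" "z n \<in> borel_measurable M" "AE x in M. gderiv G (v n) x = z n x"
    "AE x in M. (z n x)\<^sup>2 \<le> 2 * (gderiv G u x)\<^sup>2 + 2 * (C\<^sup>2 * (u x)\<^sup>2)" for n
    using cutoff_H1[OF x0 u(1) \<theta>_smooth bound, of n] unfolding v_def z_def by blast+
  have vm [measurable]: "v n \<in> borel_measurable M" "z n \<in> borel_measurable M" for n
    using H1_D(3)[OF cut(1)] cut(2) by auto
  have le: "(v n x)\<^sup>2 \<le> (u x)\<^sup>2" for n x
  proof -
    have "(\<theta> n (height x0 x))\<^sup>2 * (u x)\<^sup>2 \<le> 1 * (u x)\<^sup>2"
      using bound(1,2) by (intro mult_right_mono) (auto simp: power_le_one)
    then show ?thesis by (simp add: v_def power_mult_distrib)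
  qed
  have v_ev: "\<forall>\<^sub>F n in sequentially. v n x = u x" and z_ev: "\<forall>\<^sub>F n in sequentially. z n x = gderiv G u x" for x
    by (rule eventually_mono[OF ev[of "height x0 x"]], simp add: v_def z_def)+
  have "(\<lambda>n. LINT x|M. (z n x)\<^sup>2 + V x * (v n x)\<^sup>2) \<longlonglongrightarrow> (LINT x|M. (gderiv G u x)\<^sup>2 + V x * (u x)\<^sup>2)"
  proof (rule integral_dominated_convergence)
    show "integrable M (\<lambda>x. (2 * (gderiv G u x)\<^sup>2 + 2 * (C\<^sup>2 * (u x)\<^sup>2)) + V x * (u x)\<^sup>2)" using D by simp
    show "AE x in M. norm ((z n x)\<^sup>2 + V x * (v n x)\<^sup>2) \<le> (2 * (gderiv G u x)\<^sup>2 + 2 * (C\<^sup>2 * (u x)\<^sup>2)) + V x * (u x)\<^sup>2" for n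
      using cut(4)[of n] V_nonneg
    proof eventually_elim
      case (elim x)
      have "V x * (v n x)\<^sup>2 \<le> V x * (u x)\<^sup>2" using le elim by (intro mult_left_mono) auto
      moreover have "norm ((z n x)\<^sup>2 + V x * (v n x)\<^sup>2) = (z n x)\<^sup>2 + V x * (v n x)\<^sup>2" using elim by simp
      ultimately show ?case using elim by linarith
    qed
    show "AE x in M. (\<lambda>n. (z n x)\<^sup>2 + V x * (v n x)\<^sup>2) \<longlonglongrightarrow> (gderiv G u x)\<^sup>2 + V x * (u x)\<^sup>2"
      by (intro AE_I2 tendsto_intros tendsto_eventually v_ev z_ev)
  qed simp_all
  moreover have "(LINT x|M. (z n x)\<^sup>2 + V x * (v n x)\<^sup>2) = form G V (points G) (v n) (v n)" for n
    by (rule form_eq_weak(1)[OF cut(1-3), symmetric])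
  moreover have "(LINT x|M. (gderiv G u x)\<^sup>2 + V x * (u x)\<^sup>2) = form G V (points G) u u"
    using form_eq_weak(1)[OF u(1) D(4)] by simp
  ultimately have lim_form: "(\<lambda>n. form G V (points G) (v n) (v n)) \<longlonglongrightarrow> form G V (points G) u u" by simp
  have "(\<lambda>n. LINT x|M. (v n x)\<^sup>2) \<longlonglongrightarrow> (LINT x|M. (u x)\<^sup>2)"
  proof (rule integral_dominated_convergence)
    show "integrable M (\<lambda>x. (u x)\<^sup>2)" by (rule D)
    show "AE x in M. norm ((v n x)\<^sup>2) \<le> (u x)\<^sup>2" for n using le by (intro AE_I2) simp
    show "AE x in M. (\<lambda>n. (v n x)\<^sup>2) \<longlonglongrightarrow> (u x)\<^sup>2"
      by (intro AE_I2 tendsto_intros tendsto_eventually v_ev)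
  qed simp_all
  then have lim_L2_inner: "(\<lambda>n. L2_inner G (points G) (v n) (v n)) \<longlonglongrightarrow> L2_inner G (points G) u u"
    by (simp add: form_diag(2)[OF cut(1)] form_diag(2)[OF u(1)])
  have "(\<lambda>n. form G V (points G) (v n) (v n) - \<nu> * L2_inner G (points G) (v n) (v n))
      \<longlonglongrightarrow> form G V (points G) u u - \<nu> * L2_inner G (points G) u u"
    by (intro tendsto_intros lim_form lim_L2_inner)
  then have "\<forall>\<^sub>F n in sequentially. form G V (points G) (v n) (v n) - \<nu> * L2_inner G (points G) (v n) (v n) < 0"
    by (rule order_tendstoD) (use u(3) in simp)
  then obtain n where n: "form G V (points G) (v n) (v n) < \<nu> * L2_inner G (points G) (v n) (v n)"
    by (auto simp: eventually_sequentially)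
  have "v n x = 0" if "x \<in> points G" "height x0 x \<le> r \<or> real n + 1 \<le> height x0 x" for x
    using that u(2)[of x] step_1[of "height x0 x - real n"] by (auto simp: v_def \<theta>_def)
  then show ?thesis using cut(1) n by blast
qed

end

section \<open>Connected pieces and partitions\<close>

context connected_metric_graph begin

lemma continuous_map_pt:
  assumes e: "e \<in> edges G"
  shows "continuous_map (top_of_set (edge_dom G e)) (gtop G) (pt G e)"
  unfolding dist.continuous_map_to_metric
proof (intro ballI allI impI)
  fix s \<epsilon> assume s: "s \<in> topspace (top_of_set (edge_dom G e))" and \<epsilon>: "\<epsilon> > (0::real)"
  show "\<exists>U. openin (top_of_set (edge_dom G e)) U \<and> s \<in> U \<and> (\<forall>t\<in>U. pt G e t \<in> dist.mball (pt G e s) \<epsilon>)"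
  proof (intro exI conjI ballI)
    show "openin (top_of_set (edge_dom G e)) (edge_dom G e \<inter> ball s \<epsilon>)" by (simp add: openin_open_Int)
    show "s \<in> edge_dom G e \<inter> ball s \<epsilon>" using s \<epsilon> by simp
    show "pt G e t \<in> dist.mball (pt G e s) \<epsilon>" if "t \<in> edge_dom G e \<inter> ball s \<epsilon>" for t
      using that s gdist_pt_le[OF e, of s t] pt_in_points[OF metric e] by (auto simp: dist_real_def)
  qed
qed

lemma closedin_sets:
  assumes "closedin (gtop G) H"
  shows "H \<in> sets (graph_measure G)"
proof -
  have "{t \<in> edge_int G e. EPt e t \<in> H} \<in> sets lebesgue" if e: "e \<in> edges G" for e
  proof -
    have "closedin (top_of_set (edge_dom G e)) {t \<in> topspace (top_of_set (edge_dom G e)). pt G e t \<in> H}"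
      by (rule closedin_continuous_map_preimage[OF continuous_map_pt[OF e] assms])
    then obtain T where T: "closed T" "{t \<in> edge_dom G e. pt G e t \<in> H} = edge_dom G e \<inter> T"
      by (auto simp: closedin_closed)
    have "{t \<in> edge_int G e. EPt e t \<in> H} = edge_int G e \<inter> T"
    proof (intro set_eqI)
      fix t
      have "t \<in> {t \<in> edge_dom G e. pt G e t \<in> H} \<longleftrightarrow> t \<in> edge_dom G e \<inter> T" by (simp only: T(2))
      then show "t \<in> {t \<in> edge_int G e. EPt e t \<in> H} \<longleftrightarrow> t \<in> edge_int G e \<inter> T"
        using edge_int_subset_dom[of e] pt_interior[of t e] by auto
    qed
    then show ?thesis using T(1) by auto
  qed
  moreover have "H \<subseteq> points G" using closedin_subset[OF assms] by simp
  ultimately show ?thesis by (simp add: sets_graph_measure)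
qed

text \<open>
  Since the height is affine, the part of an edge between two heights is the image of a single
  interval, hence connected.
\<close>

definition piece :: "('v, 'e) gpoint \<Rightarrow> real \<Rightarrow> real \<Rightarrow> 'e \<Rightarrow> ('v, 'e) gpoint set" where
  "piece x0 r R e = pt G e ` {t \<in> edge_dom G e. r \<le> height x0 (pt G e t) \<and> height x0 (pt G e t) \<le> R}"

lemma piece_compact_connected:
  assumes e: "e \<in> edges G"
  shows "closedin (gtop G) (piece x0 r R e)" "connectedin (gtop G) (piece x0 r R e)"
proof -
  define Q where "Q = {t \<in> edge_dom G e. r \<le> height x0 (pt G e t) \<and> height x0 (pt G e t) \<le> R}"
  define a b where "a = gdist G x0 (Vert (src G e))" and "b = slope x0 e"
  have Q_eq: "Q = edge_dom G e \<inter> {t. r \<le> a + b * t} \<inter> {t. a + b * t \<le> R}"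
    by (auto simp: Q_def height_pt[OF e] a_def b_def)
  have sub: "Q \<subseteq> edge_dom G e" by (auto simp: Q_def)
  have dom: "edge_dom G e = {0..} \<inter> (if elen G e = \<infinity> then UNIV else {..real_of_ereal (elen G e)})"
    using e by (cases rule: elen_cases) (auto simp: edge_dom_def)
  have "closed (edge_dom G e)" unfolding dom by auto
  then have "closed Q" unfolding Q_eq by (intro closed_Int closed_Collect_le continuous_intros)
  obtain T where T: "\<And>t. t \<in> edge_dom G e \<Longrightarrow> height x0 (pt G e t) \<le> R \<Longrightarrow> t \<le> T"
    using low_part_bounded[OF e, of x0 R] by blast
  have "Q \<subseteq> {0..T}" using T by (auto simp: Q_def edge_dom_def)
  then have "compact Q" using \<open>closed Q\<close> compact_Icc compact_Int_closed by (metis inf.absorb_iff2)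
  then have "compactin (top_of_set (edge_dom G e)) Q" using sub by (simp add: compactin_subtopology)
  then have "compactin (gtop G) (pt G e ` Q)" by (rule image_compactin[OF _ continuous_map_pt[OF e]])
  then show "closedin (gtop G) (piece x0 r R e)"
    unfolding piece_def Q_def[symmetric] by (rule compactin_imp_closedin[OF dist.Hausdorff_space_mtopology])
  have "convex (edge_dom G e)" unfolding dom by (intro convex_Int) auto
  moreover have "convex {t. r \<le> a + b * t}" "convex {t. a + b * t \<le> R}"
    using convex_halfspace_ge[of "r - a" b] convex_halfspace_le[of b "R - a"] by (simp_all add: algebra_simps)
  ultimately have "connected Q" unfolding Q_eq by (intro convex_connected convex_Int)
  then have "connectedin (top_of_set (edge_dom G e)) Q" using sub by (simp add: connectedin_subtopology)
  then show "connectedin (gtop G) (piece x0 r R e)"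
    unfolding piece_def Q_def[symmetric] by (rule connectedin_continuous_map_image[OF continuous_map_pt[OF e]])
qed

lemma EPt_in_piece: "EPt e t \<in> piece x0 r R e' \<Longrightarrow> e' = e"
  by (auto simp: piece_def pt_def split: if_splits)

end

context schroedinger_graph begin

text \<open>
  No edge has interior points in both \<open>A\<close> and \<open>B\<close>, so that the restriction to \<open>A\<close> coincides on
  each edge either with \<open>u\<close> or with zero. Continuity at the vertices follows since \<open>A\<close> and \<open>B\<close>
  are closed and disjoint.
\<close>

lemma restrict_H1:
  assumes u: "u \<in> H1 G V" and A: "closedin (gtop G) A" and B: "closedin (gtop G) B" "A \<inter> B = {}"
    and off: "\<And>x. x \<in> points G \<Longrightarrow> x \<notin> A \<union> B \<Longrightarrow> u x = 0"
    and edges: "\<And>e s t. e \<in> edges G \<Longrightarrow> s \<in> edge_int G e \<Longrightarrow> t \<in> edge_int G e \<Longrightarrow> EPt e s \<in> A \<Longrightarrow> EPt e t \<notin> B"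
  defines "v \<equiv> \<lambda>x. if x \<in> A then u x else 0"
    and "z \<equiv> \<lambda>x. case x of Vert _ \<Rightarrow> 0 | EPt e t \<Rightarrow> if \<exists>s\<in>edge_int G e. EPt e s \<in> A then gderiv G u x else 0"
  shows "v \<in> H1 G V" "z \<in> borel_measurable M" "AE x in M. gderiv G v x = z x"
proof -
  note D = H1_D[OF u]
  have cont: "continuous_map (gtop G) euclideanreal v"
    unfolding continuous_map_closedin
  proof (intro conjI ballI allI impI)
    fix T :: "real set" assume "closedin euclideanreal T"
    then have uT: "closedin (gtop G) {x \<in> points G. u x \<in> T}" and u0: "closedin (gtop G) {x \<in> points G. u x \<in> {0}}"
      using D(1) closedin_continuous_map_preimage[OF D(1)] by force+
    have Asub: "A \<subseteq> points G" "B \<subseteq> points G" using closedin_subset[OF A] closedin_subset[OF B(1)] by auto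
    have "{x \<in> points G. v x \<in> T} = (if 0 \<in> T then (A \<inter> {x \<in> points G. u x \<in> T}) \<union> B \<union> {x \<in> points G. u x \<in> {0}}
        else A \<inter> {x \<in> points G. u x \<in> T})"
      using Asub B(2) off by (auto simp: v_def)
    then show "closedin (gtop G) {x \<in> topspace (gtop G). v x \<in> T}"
      using A B(1) uT u0 by (auto intro!: closedin_Un closedin_Int)
  qed auto
  have wd: "weak_deriv G v z"
    unfolding weak_deriv_iff
  proof
    fix e assume e: "e \<in> edges G"
    show "weak_derivative_on (edge_int G e) (\<lambda>t. v (EPt e t)) (\<lambda>t. z (EPt e t))"
    proof (cases "\<exists>s\<in>edge_int G e. EPt e s \<in> A")
      case True
      then obtain s where s: "s \<in> edge_int G e" "EPt e s \<in> A" by blast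
      have "u (EPt e t) = v (EPt e t)" if "t \<in> edge_int G e" for t
        using edges[OF e s(1) that s(2)] off[OF EPt_in_points[OF e that]] by (auto simp: v_def)
      moreover have "weak_derivative_on (edge_int G e) (\<lambda>t. u (EPt e t)) (\<lambda>t. gderiv G u (EPt e t))"
        using D(2) e by (simp add: weak_deriv_iff)
      ultimately show ?thesis using True
        by (subst weak_derivative_on_cong[where u' = "\<lambda>t. u (EPt e t)" and w' = "\<lambda>t. gderiv G u (EPt e t)"]) (auto simp: z_def)
    next
      case False
      have "weak_derivative_on (edge_int G e) (\<lambda>t. 0) (\<lambda>t. 0)"
        by (auto simp: weak_derivative_on_def set_integrable_def)
      then show ?thesis using False
        by (subst weak_derivative_on_cong[where u' = "\<lambda>t. 0" and w' = "\<lambda>t. 0"]) (auto simp: z_def v_def)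
    qed
  qed
  show [measurable]: "z \<in> borel_measurable M" by (rule weak_deriv_measurable[OF wd])
  show "AE x in M. gderiv G v x = z x" by (rule gderiv_AE[OF cont wd])
  have [measurable]: "v \<in> borel_measurable M" by (rule continuous_measurable[OF cont])
  have vle: "\<bar>v x\<bar> \<le> \<bar>u x\<bar>" and zle: "\<bar>z x\<bar> \<le> \<bar>gderiv G u x\<bar>" for x
    by (auto simp: v_def z_def split: gpoint.split)
  have v2: "(v x)\<^sup>2 \<le> (u x)\<^sup>2" and z2: "(z x)\<^sup>2 \<le> (gderiv G u x)\<^sup>2" for x
    using vle[of x] zle[of x] by (simp_all add: abs_le_square_iff)
  show "v \<in> H1 G V"
  proof (rule H1_I[OF cont wd])
    show "integrable M (\<lambda>x. (v x)\<^sup>2)" by (rule Bochner_Integration.integrable_bound[OF D(5)]) (use v2 in auto)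
    show "integrable M (\<lambda>x. (z x)\<^sup>2)" by (rule Bochner_Integration.integrable_bound[OF D(6)]) (use z2 in auto)
    show "integrable M (\<lambda>x. V x * (v x)\<^sup>2)"
    proof (rule Bochner_Integration.integrable_bound[OF D(7)])
      show "AE x in M. norm (V x * (v x)\<^sup>2) \<le> norm (V x * (u x)\<^sup>2)"
        using V_nonneg by eventually_elim (use v2 in \<open>auto intro!: mult_left_mono\<close>)
    qed simp
  qed
qed

text \<open>
  The squared norm of \<open>u\<close> is the sum, and the form at least the sum, of those of its
  restrictions to \<open>A\<close> and \<open>B\<close>; so not both restrictions can have a quotient of \<open>\<nu>\<close> or more.
\<close>

lemma split_quotient:
  assumes u: "u \<in> H1 G V" and A: "closedin (gtop G) A" and B: "closedin (gtop G) B" "A \<inter> B = {}"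
    and off: "\<And>x. x \<in> points G \<Longrightarrow> x \<notin> A \<union> B \<Longrightarrow> u x = 0"
    and edges: "\<And>e s t. e \<in> edges G \<Longrightarrow> s \<in> edge_int G e \<Longrightarrow> t \<in> edge_int G e \<Longrightarrow> EPt e s \<in> A \<Longrightarrow> EPt e t \<notin> B"
    and low: "form G V (points G) u u < \<nu> * L2_inner G (points G) u u"
  shows "\<exists>H\<in>{A, B}. \<exists>v\<in>H1 G V. (\<forall>x\<in>points G. x \<notin> H \<longrightarrow> v x = 0) \<and>
    form G V (points G) v v < \<nu> * L2_inner G (points G) v v"
proof -
  define v where "v H x = (if x \<in> H then u x else 0)" for H :: "('v, 'e) gpoint set" and x
  define z where "z H x = (case x of Vert _ \<Rightarrow> 0 | EPt e t \<Rightarrow> if \<exists>s\<in>edge_int G e. EPt e s \<in> H then gderiv G u x else 0)"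
    for H :: "('v, 'e) gpoint set" and x
  note D = H1_D[OF u]
  have "B \<inter> A = {}" using B(2) by blast
  have offB: "u x = 0" if "x \<in> points G" "x \<notin> B \<union> A" for x using off that by blast
  have "v A \<in> H1 G V \<and> z A \<in> borel_measurable M \<and> (AE x in M. gderiv G (v A) x = z A x)"
    unfolding v_def[abs_def] z_def[abs_def]
    by (intro conjI; rule restrict_H1[OF u A B off]; use edges in blast)
  then have rA: "v A \<in> H1 G V" "z A \<in> borel_measurable M" "AE x in M. gderiv G (v A) x = z A x" by auto
  have "v B \<in> H1 G V \<and> z B \<in> borel_measurable M \<and> (AE x in M. gderiv G (v B) x = z B x)"
    unfolding v_def[abs_def] z_def[abs_def]
    by (intro conjI; rule restrict_H1[OF u B(1) A \<open>B \<inter> A = {}\<close> offB]; use edges in blast)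
  then have rB: "v B \<in> H1 G V" "z B \<in> borel_measurable M" "AE x in M. gderiv G (v B) x = z B x" by auto
  have L2_inner: "L2_inner G (points G) u u = L2_inner G (points G) (v A) (v A) + L2_inner G (points G) (v B) (v B)"
  proof -
    have "(LINT x|M. (u x)\<^sup>2) = (LINT x|M. (v A x)\<^sup>2 + (v B x)\<^sup>2)"
    proof (rule Bochner_Integration.integral_cong)
      fix x assume "x \<in> space M"
      then show "(u x)\<^sup>2 = (v A x)\<^sup>2 + (v B x)\<^sup>2" using off[of x] B(2) by (auto simp: v_def)
    qed simp
    then show ?thesis using H1_D(5)[OF rA(1)] H1_D(5)[OF rB(1)]
      by (simp add: form_diag(2)[OF u] form_diag(2)[OF rA(1)] form_diag(2)[OF rB(1)])
  qed
  have form: "form G V (points G) (v A) (v A) + form G V (points G) (v B) (v B) \<le> form G V (points G) u u"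
  proof -
    have "form G V (points G) (v A) (v A) + form G V (points G) (v B) (v B)
        = (LINT x|M. ((z A x)\<^sup>2 + V x * (v A x)\<^sup>2) + ((z B x)\<^sup>2 + V x * (v B x)\<^sup>2))"
      using form_eq_weak[OF rA] form_eq_weak[OF rB] by simp
    also have "\<dots> \<le> (LINT x|M. (gderiv G u x)\<^sup>2 + V x * (u x)\<^sup>2)"
    proof (rule integral_mono)
      show "integrable M (\<lambda>x. ((z A x)\<^sup>2 + V x * (v A x)\<^sup>2) + ((z B x)\<^sup>2 + V x * (v B x)\<^sup>2))"
        using form_eq_weak(2)[OF rA] form_eq_weak(2)[OF rB] by (rule Bochner_Integration.integrable_add)
      show "integrable M (\<lambda>x. (gderiv G u x)\<^sup>2 + V x * (u x)\<^sup>2)" using D by simp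
      fix x assume x: "x \<in> space M"
      have "V x * (v A x)\<^sup>2 + V x * (v B x)\<^sup>2 = V x * (u x)\<^sup>2"
        using off[of x] B(2) x by (auto simp: v_def)
      moreover have "(z A x)\<^sup>2 + (z B x)\<^sup>2 \<le> (gderiv G u x)\<^sup>2"
      proof (cases x)
        case (EPt e t)
        then have "e \<in> edges G" using x by (auto simp: points_def)
        then show ?thesis using EPt edges[of e] by (auto simp: z_def)
      qed (simp add: z_def)
      ultimately show "((z A x)\<^sup>2 + V x * (v A x)\<^sup>2) + ((z B x)\<^sup>2 + V x * (v B x)\<^sup>2) \<le> (gderiv G u x)\<^sup>2 + V x * (u x)\<^sup>2"
        by linarith
    qed
    also have "\<dots> = form G V (points G) u u" using form_eq_weak(1)[OF u D(4)] by simp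
    finally show ?thesis .
  qed
  have "form G V (points G) (v A) (v A) < \<nu> * L2_inner G (points G) (v A) (v A) \<or>
      form G V (points G) (v B) (v B) < \<nu> * L2_inner G (points G) (v B) (v B)"
    using low form unfolding L2_inner distrib_left by linarith
  moreover have "v H x = 0" if "x \<notin> H" for H x using that by (simp add: v_def)
  ultimately show ?thesis using rA(1) rB(1) by blast
qed

text \<open>
  Induction on the number of edges. If the union of the pieces is disconnected, each piece,
  being connected, lies on one of the two sides, and each side consists of fewer pieces.
\<close>

lemma connected_support:
  assumes "finite S" "S \<subseteq> edges G" "u \<in> H1 G V"
    and "\<And>x. x \<in> points G \<Longrightarrow> x \<notin> (\<Union>e\<in>S. piece x0 r R e) \<Longrightarrow> u x = 0"
    and "form G V (points G) u u < \<nu> * L2_inner G (points G) u u"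
  shows "\<exists>H. \<exists>v\<in>H1 G V. H \<subseteq> (\<Union>e\<in>S. piece x0 r R e) \<and> closedin (gtop G) H \<and> connectedin (gtop G) H \<and>
    (\<forall>x\<in>points G. x \<notin> H \<longrightarrow> v x = 0) \<and> form G V (points G) v v < \<nu> * L2_inner G (points G) v v"
  using assms
proof (induction S arbitrary: u rule: finite_psubset_induct)
  case (psubset S)
  define U where "U S = (\<Union>e\<in>S. piece x0 r R e)" for S
  have closed: "closedin (gtop G) (U T)" if "T \<subseteq> S" for T
    unfolding U_def using that psubset.hyps psubset.prems(1) finite_subset[OF that]
    by (intro closedin_Union) (auto intro: piece_compact_connected)
  have off: "u x = 0" if "x \<in> points G" "x \<notin> U S" for x using psubset.prems(3) that by (auto simp: U_def)
  show ?case
  proof (cases "connectedin (gtop G) (U S)")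
    case True
    then show ?thesis using psubset.prems closed[of S] off unfolding U_def by blast
  next
    case False
    have "U S \<subseteq> points G" using closedin_subset[OF closed[of S]] by simp
    with False obtain E1 E2 where E: "closedin (gtop G) E1" "closedin (gtop G) E2" "U S \<subseteq> E1 \<union> E2"
      "E1 \<inter> E2 \<inter> U S = {}" "E1 \<inter> U S \<noteq> {}" "E2 \<inter> U S \<noteq> {}"
      unfolding connectedin_closedin by auto
    define S1 where "S1 = {e \<in> S. piece x0 r R e \<inter> E2 = {}}"
    define S2 where "S2 = {e \<in> S. piece x0 r R e \<inter> E1 = {}}"
    have side: "e \<in> S1 \<or> e \<in> S2" if e: "e \<in> S" for e
    proof -
      have "piece x0 r R e \<subseteq> U S" using e by (auto simp: U_def)
      moreover have "connectedin (gtop G) (piece x0 r R e)"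
        using e psubset.prems(1) by (intro piece_compact_connected) auto
      ultimately show ?thesis
        using E e unfolding connectedin_closedin S1_def S2_def by blast
    qed
    have psub: "S1 \<subset> S" "S2 \<subset> S"
      using E(5,6) by (auto simp: S1_def S2_def U_def)
    have U12: "U S = U S1 \<union> U S2" using side psub unfolding U_def by blast
    have in1: "U S1 \<subseteq> E1" "U S2 \<subseteq> E2" using E(3) by (auto simp: U_def S1_def S2_def)
    have disj: "U S1 \<inter> U S2 = {}" using in1 E(4) U12 by blast
    have edge: "EPt e t \<notin> U S2" if "e \<in> edges G" "EPt e s \<in> U S1" for e s t
    proof
      assume "EPt e t \<in> U S2"
      then have "e \<in> S2" "EPt e t \<in> piece x0 r R e" using EPt_in_piece[of e t] by (auto simp: U_def)
      moreover have "e \<in> S1" "EPt e s \<in> piece x0 r R e" using that(2) EPt_in_piece[of e s] by (auto simp: U_def)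
      ultimately show False using in1 by (auto simp: S1_def S2_def U_def)
    qed
    have "\<exists>H\<in>{U S1, U S2}. \<exists>v\<in>H1 G V. (\<forall>x\<in>points G. x \<notin> H \<longrightarrow> v x = 0) \<and>
        form G V (points G) v v < \<nu> * L2_inner G (points G) v v"
    proof (rule split_quotient[OF psubset.prems(2)])
      show "closedin (gtop G) (U S1)" "closedin (gtop G) (U S2)" using psub by (auto intro!: closed)
      show "u x = 0" if "x \<in> points G" "x \<notin> U S1 \<union> U S2" for x using off that U12 by blast
    qed (use disj edge psubset.prems(4) in auto)
    then obtain H v where H: "H \<in> {U S1, U S2}" and v: "v \<in> H1 G V" "\<forall>x\<in>points G. x \<notin> H \<longrightarrow> v x = 0"
      "form G V (points G) v v < \<nu> * L2_inner G (points G) v v" by blast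
    obtain T where "T \<subset> S" "H = U T" using H psub by blast
    with v have T: "T \<subset> S" "v \<in> H1 G V" "\<And>x. x \<in> points G \<Longrightarrow> x \<notin> U T \<Longrightarrow> v x = 0"
      "form G V (points G) v v < \<nu> * L2_inner G (points G) v v" by auto
    have rest: "\<exists>H. \<exists>v\<in>H1 G V. H \<subseteq> U T \<and> closedin (gtop G) H \<and> connectedin (gtop G) H \<and>
      (\<forall>x\<in>points G. x \<notin> H \<longrightarrow> v x = 0) \<and> form G V (points G) v v < \<nu> * L2_inner G (points G) v v"
      unfolding U_def
    proof (rule psubset.IH[OF T(1) _ T(2) _ T(4)])
      show "T \<subseteq> edges G" using T(1) psubset.prems(1) by blast
      show "v x = 0" if "x \<in> points G" "x \<notin> (\<Union>e\<in>T. piece x0 r R e)" for x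
        using T(3)[OF that(1)] that(2) by (simp add: U_def)
    qed
    have "U T \<subseteq> U S" using T(1) by (auto simp: U_def)
    from rest obtain K w where K: "w \<in> H1 G V" "K \<subseteq> U T" "closedin (gtop G) K" "connectedin (gtop G) K"
      "\<forall>x\<in>points G. x \<notin> K \<longrightarrow> w x = 0" "form G V (points G) w w < \<nu> * L2_inner G (points G) w w"
      by (elim exE bexE conjE)
    have "K \<subseteq> (\<Union>e\<in>S. piece x0 r R e)"
      using order_trans[OF K(2) \<open>U T \<subseteq> U S\<close>] by (simp only: U_def)
    with K show ?thesis by (intro exI[of _ K] bexI[of _ w] conjI)
  qed
qed

lemma edges_nonempty_if_positive_L2_inner: "L2_inner G (points G) u u \<noteq> 0 \<Longrightarrow> edges G \<noteq> {}"
  using L2_inner_AE_zero[of u] by (auto simp: AE_graph_measure_iff)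

lemma spec_bottom_le_if_supported:
  assumes v: "v \<in> H1 G V" and H: "closedin (gtop G) H" and off: "\<And>x. x \<in> points G \<Longrightarrow> x \<notin> H \<Longrightarrow> v x = 0"
    and low: "form G V (points G) v v < \<nu> * L2_inner G (points G) v v"
  shows "spec_bottom G V H \<le> ereal \<nu>"
proof (rule spec_bottom_le)
  show HM: "H \<in> sets M" by (rule closedin_sets[OF H])
  note D = H1_D[OF v]
  have "supp G v \<subseteq> H"
    unfolding supp_def by (rule closure_of_minimal[OF _ H]) (use off in blast)
  then show "v \<in> H10 G V H" using v by (simp add: H10_def)
  have "form G V H v v \<le> form G V (points G) v v"
  proof -
    have int: "integrable M (\<lambda>x. gderiv G v x * gderiv G v x + V x * v x * v x)" by (rule integrable_products[OF v v])
    show ?thesis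
      unfolding form_eq_set_integral[OF HM] form_points set_lebesgue_integral_def
    proof (rule integral_mono_AE[OF integrable_mult_indicator[OF HM int] int])
      show "AE x in M. indicator H x *\<^sub>R (gderiv G v x * gderiv G v x + V x * v x * v x)
          \<le> gderiv G v x * gderiv G v x + V x * v x * v x"
        using V_nonneg by eventually_elim (auto simp: indicator_def mult.assoc)
    qed
  qed
  moreover have "L2_inner G H v v = L2_inner G (points G) v v"
    unfolding L2_inner_eq_set_integral[OF HM] L2_inner_points set_lebesgue_integral_def
    using off by (intro Bochner_Integration.integral_cong) (auto simp: indicator_def)
  ultimately show "form G V H v v < \<nu> * L2_inner G H v v" using low by simp
qed

lemma connected_piece_with_low_energy:
  assumes x0: "x0 \<in> points G"
    and ess: "\<mu> \<in> essential_spectrum (measure_on G (points G)) (schroedinger G V (points G))"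
    and "\<mu> < \<nu>"
  shows "\<exists>H R. closedin (gtop G) H \<and> connectedin (gtop G) H \<and> H \<noteq> {} \<and> spec_bottom G V H \<le> ereal \<nu> \<and>
    (\<forall>x\<in>H. r \<le> height x0 x \<and> height x0 x \<le> R)"
proof -
  obtain R u where u: "u \<in> H1 G V" "\<And>x. x \<in> points G \<Longrightarrow> height x0 x \<le> r \<or> R \<le> height x0 x \<Longrightarrow> u x = 0"
    "form G V (points G) u u < \<nu> * L2_inner G (points G) u u"
    using ground_energy_annulus[OF x0 ess \<open>\<mu> < \<nu>\<close>, of r] by blast
  have pos: "L2_inner G (points G) v v \<noteq> 0" if "v \<in> H1 G V" "form G V (points G) v v < \<nu> * L2_inner G (points G) v v" for v
    using full.a.nonneg[OF that(1)] that(2) by auto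
  have ne: "edges G \<noteq> {}" using edges_nonempty_if_positive_L2_inner pos[OF u(1,3)] by blast
  define S where "S = {e \<in> edges G. \<exists>t\<in>edge_dom G e. height x0 (pt G e t) \<le> R}"
  have S: "finite S" "S \<subseteq> edges G" using finite_low_edges[OF x0] by (auto simp: S_def)
  have off: "u x = 0" if x: "x \<in> points G" "x \<notin> (\<Union>e\<in>S. piece x0 r R e)" for x
  proof (rule ccontr)
    assume "u x \<noteq> 0"
    then have "\<not> (height x0 x \<le> r \<or> R \<le> height x0 x)" using u(2)[OF x(1)] by blast
    then have h: "r \<le> height x0 x" "height x0 x \<le> R" by auto
    obtain e t where e: "e \<in> edges G" "t \<in> edge_dom G e" "x = pt G e t" using point_on_edge[OF ne x(1)] by blast
    then have "e \<in> S" "x \<in> piece x0 r R e" using h by (auto simp: S_def piece_def)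
    with x(2) show False by blast
  qed
  have "\<exists>H. \<exists>v\<in>H1 G V. H \<subseteq> (\<Union>e\<in>S. piece x0 r R e) \<and> closedin (gtop G) H \<and> connectedin (gtop G) H \<and>
    (\<forall>x\<in>points G. x \<notin> H \<longrightarrow> v x = 0) \<and> form G V (points G) v v < \<nu> * L2_inner G (points G) v v"
    by (rule connected_support[OF S u(1) _ u(3)], rule off)
  then obtain H v where v: "v \<in> H1 G V" "H \<subseteq> (\<Union>e\<in>S. piece x0 r R e)" "closedin (gtop G) H" "connectedin (gtop G) H"
    "\<forall>x\<in>points G. x \<notin> H \<longrightarrow> v x = 0" "form G V (points G) v v < \<nu> * L2_inner G (points G) v v"
    by (elim exE bexE conjE)
  have off_H: "v x = 0" if "x \<in> points G" "x \<notin> H" for x using v(5) that by simp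
  have "H \<noteq> {}"
  proof
    assume "H = {}"
    then have "AE x in M. v x = 0" using off_H by (intro AE_I2) auto
    then show False using pos[OF v(1,6)] L2_inner_AE_zero by blast
  qed
  moreover have "spec_bottom G V H \<le> ereal \<nu>" by (rule spec_bottom_le_if_supported[OF v(1,3) off_H v(6)])
  moreover have "\<forall>x\<in>H. r \<le> height x0 x \<and> height x0 x \<le> R" using v(2) by (force simp: piece_def)
  ultimately show ?thesis using v(3,4) by blast
qed

text \<open>Each new piece lies above the height of all previous ones.\<close>

lemma disjoint_pieces_with_low_energy:
  assumes x0: "x0 \<in> points G"
    and ess: "\<mu> \<in> essential_spectrum (measure_on G (points G)) (schroedinger G V (points G))"
    and "\<mu> < \<nu>"
  shows "\<exists>P R. length P = k \<and> (\<forall>H\<in>set P. closedin (gtop G) H \<and> connectedin (gtop G) H \<and> H \<noteq> {} \<and>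
      spec_bottom G V H \<le> ereal \<nu> \<and> (\<forall>x\<in>H. height x0 x \<le> R)) \<and>
    (\<forall>i<k. \<forall>j<k. i \<noteq> j \<longrightarrow> P ! i \<inter> P ! j = {})"
proof (induction k)
  case 0
  then show ?case by (intro exI[of _ "[]"]) auto
next
  case (Suc k)
  then obtain P R where P': "length P = k"
    "\<forall>H\<in>set P. closedin (gtop G) H \<and> connectedin (gtop G) H \<and> H \<noteq> {} \<and>
      spec_bottom G V H \<le> ereal \<nu> \<and> (\<forall>x\<in>H. height x0 x \<le> R)"
    "\<forall>i<k. \<forall>j<k. i \<noteq> j \<longrightarrow> P ! i \<inter> P ! j = {}" by (elim exE conjE)
  have P: "length P = k"
    "\<And>H. H \<in> set P \<Longrightarrow> closedin (gtop G) H \<and> connectedin (gtop G) H \<and> H \<noteq> {} \<and>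
      spec_bottom G V H \<le> ereal \<nu> \<and> (\<forall>x\<in>H. height x0 x \<le> R)"
    "\<And>i j. i < k \<Longrightarrow> j < k \<Longrightarrow> i \<noteq> j \<Longrightarrow> P ! i \<inter> P ! j = {}"
    using P' by simp_all
  obtain H R' where H: "closedin (gtop G) H" "connectedin (gtop G) H" "H \<noteq> {}" "spec_bottom G V H \<le> ereal \<nu>"
    "\<And>x. x \<in> H \<Longrightarrow> R + 1 \<le> height x0 x \<and> height x0 x \<le> R'"
    using connected_piece_with_low_energy[OF x0 ess \<open>\<mu> < \<nu>\<close>, of "R + 1"] by auto
  have disj: "H \<inter> P ! i = {}" if "i < k" for i
  proof (rule ccontr)
    assume "H \<inter> P ! i \<noteq> {}"
    then obtain x where x: "x \<in> H" "x \<in> P ! i" by blast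
    have "P ! i \<in> set P" using that P(1) by simp
    then have "height x0 x \<le> R" using P(2) x(2) by blast
    then show False using H(5)[OF x(1)] by linarith
  qed
  have "(H # P) ! i \<inter> (H # P) ! j = {}" if "i < Suc k" "j < Suc k" "i \<noteq> j" for i j
    using that P(3)[of "i - 1" "j - 1"] disj[of "i - 1"] disj[of "j - 1"] by (cases i; cases j) auto
  moreover have "\<forall>x\<in>K. height x0 x \<le> max R R'" if "K \<in> set (H # P)" for K
  proof
    fix x assume x: "x \<in> K"
    show "height x0 x \<le> max R R'"
    proof (cases "K = H")
      case True
      then show ?thesis using H(5)[of x] x by (simp add: max.coboundedI2)
    next
      case False
      then have "height x0 x \<le> R" using P(2)[of K] that x by simp
      then show ?thesis by (rule max.coboundedI1)
    qed
  qed
  moreover have "closedin (gtop G) K \<and> connectedin (gtop G) K \<and> K \<noteq> {} \<and> spec_bottom G V K \<le> ereal \<nu>"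
    if "K \<in> set (H # P)" for K
    using that P(2)[of K] H(1-4) by auto
  moreover have "length (H # P) = Suc k" using P(1) by simp
  ultimately show ?case by (intro exI[of _ "H # P"] exI[of _ "max R R'"]) blast
qed

theorem min_energy_le:
  assumes "1 \<le> k" and ess: "\<mu> \<in> essential_spectrum (measure_on G (points G)) (schroedinger G V (points G))"
    and "\<mu> < \<nu>"
  shows "min_energy G V k \<le> ereal \<nu>"
proof -
  have "edges G \<noteq> {}"
  proof
    assume "edges G = {}"
    then have "L2_inner G (points G) f f = 0" for f using edges_nonempty_if_positive_L2_inner by blast
    then have "\<mu> \<notin> essential_spectrum (measure_on G (points G)) (schroedinger G V (points G))"
      by (intro not_essential_if_coercive_modulo_points[of "[]" 0 "\<mu> + 1"]) (auto intro: full.a.nonneg)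
    with ess show False by simp
  qed
  then obtain x0 where x0: "x0 \<in> points G" using src_in_points by blast
  obtain P where P: "length P = k" "\<And>H. H \<in> set P \<Longrightarrow> closedin (gtop G) H \<and> connectedin (gtop G) H \<and> H \<noteq> {} \<and>
      spec_bottom G V H \<le> ereal \<nu>" "\<And>i j. i < k \<Longrightarrow> j < k \<Longrightarrow> i \<noteq> j \<Longrightarrow> P ! i \<inter> P ! j = {}"
    using disjoint_pieces_with_low_energy[OF x0 ess \<open>\<mu> < \<nu>\<close>, of k] by force
  have "subgraph G H" if "H \<in> set P" for H
  proof -
    have H: "closedin (gtop G) H" "connectedin (gtop G) H" using P(2)[OF that] by auto
    then have "connected_components_of (subtopology (gtop G) H) \<subseteq> {topspace (subtopology (gtop G) H)}"
      by (subst connected_components_of_subset_sing) (auto simp: connectedin_def)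
    then show ?thesis using H(1) finite_subset unfolding subgraph_def by blast
  qed
  then have "k_partition G k P"
    unfolding k_partition_def using P(1,2,3) by auto
  then have "min_energy G V k \<le> energy G V P"
    unfolding min_energy_def by (intro Inf_lower) auto
  also have "energy G V P \<le> ereal \<nu>"
  proof -
    have "P \<noteq> []" using P(1) \<open>1 \<le> k\<close> by auto
    then show ?thesis unfolding energy_def using P(2) by (subst Max_le_iff) auto
  qed
  finally show ?thesis .
qed

end

text \<open>The balls with integer radii around a point exhaust the graph.\<close>

lemma locally_L1_measurable:
  assumes "locally_L1 G V"
  shows "V \<in> borel_measurable (graph_measure G)"
proof (cases "points G = {}")
  case True
  then show ?thesis by (intro measurableI) auto
next
  case False
  then obtain x where x: "x \<in> points G" by blast
  have "(\<lambda>y. indicator (gball G x (real n)) y *\<^sub>R V y) \<in> borel_measurable (graph_measure G)" for n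
    using assms x unfolding locally_L1_def set_integrable_def by (auto intro: borel_measurable_integrable)
  moreover have "(\<lambda>n. indicator (gball G x (real n)) y *\<^sub>R V y) \<longlonglongrightarrow> V y" if "y \<in> space (graph_measure G)" for y
  proof (rule tendsto_eventually)
    obtain N where "gdist G x y < real N" using reals_Archimedean2 by blast
    then have "y \<in> gball G x (real n)" if "n \<ge> N" for n
      using that \<open>y \<in> space (graph_measure G)\<close> by (auto simp: gball_def)
    then show "\<forall>\<^sub>F n in sequentially. indicator (gball G x (real n)) y *\<^sub>R V y = V y"
      unfolding eventually_sequentially by (intro exI[of _ N] allI impI) simp
  qed
  ultimately show ?thesis by (rule borel_measurable_LIMSEQ_real[rotated])
qed

theorem theorem1p2:
  fixes G :: "('v, 'e) mgraph" and V :: "('v, 'e) gpoint \<Rightarrow> real" and k :: nat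
  assumes "metric_graph G" and "graph_connected G" and "finite_ball_condition G"
    and "locally_L1 G V" and "AE x in graph_measure G. 0 \<le> V x"
    and "1 \<le> k"
  shows "min_energy G V k \<le> ess_bottom G V (points G)"
proof -
  interpret schroedinger_graph G V
    using assms locally_L1_measurable[OF assms(4)] by unfold_locales
  show ?thesis
    unfolding ess_bottom_def
  proof (rule Inf_greatest)
    fix b assume "b \<in> ereal ` essential_spectrum (measure_on G (points G)) (schroedinger G V (points G))"
    then obtain \<mu> where \<mu>: "b = ereal \<mu>" "\<mu> \<in> essential_spectrum (measure_on G (points G)) (schroedinger G V (points G))"
      by blast
    have "min_energy G V k \<le> ereal \<mu> + ereal \<epsilon>" if "0 < \<epsilon>" for \<epsilon>
      using min_energy_le[OF assms(6) \<mu>(2), of "\<mu> + \<epsilon>"] that by simp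
    then show "min_energy G V k \<le> b" unfolding \<mu>(1) by (rule ereal_le_epsilon2)
  qed
qed

end
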